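(* In the setting and notation of the context, let $\tilde{\mathfrak{A}}$ be a basic algebra of the twisted group algebra $k_\alpha(P\rtimes L)$. Then $k_\alpha(P\rtimes L)$ is a matrix algebra over $\tilde{\mathfrak{A}}$, and $\tilde{\mathfrak{A}}$ has an explicit presentation as a quantised version of the group algebra $k(P\rtimes Z(H)/Z)$. The explicit presentation is as follows: $\tilde{\mathfrak A}$ can be taken to be the subalgebra of $kGe\cong k_\alpha(P\rtimes L)$ generated by the elements $e_\phi$ and $\tilde{\mathsf w}_{i,\phi}$, and it is given as a quiver with relations $kQ/\tilde I$, where $Q$ has vertices $[\phi]$ for $\phi\in\mathrm{Irr}(Z(H)|\chi)$ (corresponding to $e_\phi$) and arrows $[\phi]\xrightarrow{\ i\ }[\phi\psi_i]$ (corresponding to $\tilde{\mathsf w}_{i,\phi}$) for those $i$ with $\deg(w_i)=1$. The relations are those that follow from $$\tilde{\mathsf w}_{j,\phi\psi_i}\tilde{\mathsf w}_{i,\phi}-q_{i,j,\phi}\tilde{\mathsf w}_{i,\phi\psi_j}\tilde{\mathsf w}_{j,\phi}=\sum_k c_{i,j,k}\,q'_{i,j,k,\phi}\tilde{\mathsf w}_{k,\phi}+\psi_j(g_{i,\phi})^{-1}\sum_{\tilde w\in\tilde{\mathcal B}}q'_{i,j,\tilde w,\phi}\,c_{i,j,\tilde w}\tilde{\mathsf w}_\phi,$$ $$\tilde{\mathsf w}_{i,\phi\psi_i^{p-1}}\cdots \tilde{\mathsf w}_{i,\phi\psi_i}\tilde{\mathsf w}_{i,\phi}=\sum_k d_{i,k}\,q''_{i,k,\phi}\tilde{\mathsf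 w}_{k,\phi}+\kappa_{i,\phi}\sum_{\tilde w\in\tilde{\mathcal B}}q''_{i,\tilde w,\phi}\,d_{i,\tilde w}\tilde{\mathsf w}_\phi$$ (with each $\tilde{\mathsf w}_{k,\zeta}$ for $\deg(w_k)\ge2$ replaced by an element of $kQ$ corresponding to an expression for it in terms of the arrows), together with the relations saying that every composite of at least $s$ arrows is zero, where $s$ is the radical length of $kP$.
   Context: Setup. $p$ is a prime, $k$ an algebraically closed field of characteristic $p$; in groups $[g,h]=ghg^{-1}h^{-1}$, in associative algebras $[a,b]=ab-ba$. $P$ is a finite $p$-group, $L$ an abelian $p'$-subgroup of $\mathrm{Aut}(P)$, and $\alpha\in H^2(L,k^\times)$, represented by a $2$-cocycle of the same order, also denoted $\alpha$, and inflated to $P\rtimes L$. (By a theorem of Külshammer, every block of a finite group algebra over $k$ with normal defect group $P$ and abelian $p'$ inertial quotient $L$ is isomorphic to a matrix algebra over such a twisted group algebra $k_\alpha(P\rtimes L)$.) Associated to $\alpha$ is a central extension $1\to Z\to H\to L\to1$ of finite $p'$-groups and a faithful character $\chi\colon Z\to k^\times$ with $Z=[H,H]$ and $\alpha(x,y)=\chi(\hat x\hat y\,\widehat{xy}^{\,-1})$ for some choice of inverse images $\hat x\in H$ of $x\in L$. Put $G=P\rtimes H$ with $H$ acting via $H\to L$ (so $Z=C_H(P)$), and $e=\frac1{|Z|}\sum_{z\in Z}\chi(z^{-1})z$. Then $kGe\cong k_\alpha(P\rtimes L)$. The group $Z(H)/Z$ acts on $P$ by restriction of the action of $H/Z=L$.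 Meaning of "quantised version". If the same computations are performed with the group algebra of the semidirect product $P\rtimes Z(H)/Z$ instead of $kGe$, the resulting relations look similar, except with different scalars; it is in this sense that $\tilde{\mathfrak A}$ is a quantised version (quantum deformation) of $k(P\rtimes Z(H)/Z)$. Characters. $\mathrm{Irr}(Z(H)|\chi)$ is the set of homomorphisms $\phi\colon Z(H)\to k^\times$ extending $\chi$, and $e_\phi=\frac1{|Z(H)|}\sum_{h\in Z(H)}\phi(h^{-1})h$. Fix $\phi_0\in \mathrm{Irr}(Z(H)|\chi)$ and for each $\phi$ a $\xi_\phi\in\mathrm{Hom}(H/Z,k^\times)$ (inflated to $H$) restricting to $\phi\phi_0^{-1}$ on $Z(H)$, with $\xi_{\phi_0}=1$. For $\psi\in\mathrm{Hom}(H/Z,k^\times)$ write $\phi\psi$ for $\phi\cdot\psi|_{Z(H)}$. The map $\rho\colon H\to\mathrm{Hom}(H,k^\times)$, $\rho(g)(h)=\chi([h,g])$, has kernel $Z(H)$ and image $\mathrm{Hom}(H/Z(H),k^\times)$. For each $\psi,\phi$ choose $g_{\psi,\phi}\in H$ with $\rho(g_{\psi,\phi})=\xi_{\phi\psi}\xi_\phi^{-1}\psi^{-1}$. Jennings Lie algebra. $F_r(P)=\{g\in P\mid g-1\in J^r(kP)\}$ and $\mathrm{Jen}_*(P)=\bigoplus_{r\ge1}k\otimes_{\mathbb F_p}F_r(P)/F_{r+1}(P)$, a $p$-restricted Lie algebra with bracket induced by commutators and $p$-map by $p$-th powers in $P$; $H$ acts on it. By the Jennings–Quillen theorem its restricted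 universal enveloping algebra is isomorphic to $\mathrm{gr}_*(kP)=\bigoplus_n J^n(kP)/J^{n+1}(kP)$, the class of $g\in F_r(P)$ going to the class of $g-1$. Choose a basis $w_1,\dots,w_n$ ($p^n=|P|$) of $\mathrm{Jen}_*(P)$ of homogeneous $H$-eigenvectors with $\deg w_i\le\deg w_j$ for $i\le j$, ${}^gw_i=\psi_i(g)w_i$ with $\psi_i\in\mathrm{Hom}(H/Z,k^\times)$, and write $[w_i,w_j]=\sum_kc_{i,j,k}w_k$, $w_i^{[p]}=\sum_kd_{i,k}w_k$. Put $g_{i,\phi}=g_{\psi_i,\phi}$. Lifts. Using $H$-invariant complements of $J^{r+1}(kP)$ in $J^r(kP)$, choose representatives $\tilde w_i\in kP$ of the $w_i$ with $g\tilde w_ig^{-1}=\psi_i(g)\tilde w_i$ for $g\in H$. $\tilde{\mathcal B}$ is the PBW basis of $kP$ of monomials $\tilde w_{i_1}\cdots\tilde w_{i_r}$, $i_1\le\dots\le i_r$, each index repeated at most $p-1$ times. Write $[\tilde w_i,\tilde w_j]=\sum_kc_{i,j,k}\tilde w_k+y_{i,j}$ and $\tilde w_i^p=\sum_kd_{i,k}\tilde w_k+y''_i$, where $y_{i,j}=\sum_{\tilde w\in\tilde{\mathcal B}}c_{i,j,\tilde w}\tilde w$ lies in a higher power of the radical than $\deg w_i+\deg w_j$ and $y''_i=\sum_{\tilde w\in\tilde{\mathcal B}}d_{i,\tilde w}\tilde w$ in a higher power than $p\deg w_i$. Put $\tilde{\mathsf w}_{i,\phi}=g_{i,\phi}\tilde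 w_ie_\phi\in kGe$ and, for $\tilde w=\tilde w_{i_1}\cdots\tilde w_{i_r}\in\tilde{\mathcal B}$, $\tilde{\mathsf w}_\phi=\tilde{\mathsf w}_{i_1,\phi\psi_{i_2}\cdots\psi_{i_r}}\cdots\tilde{\mathsf w}_{i_{r-1},\phi\psi_{i_r}}\tilde{\mathsf w}_{i_r,\phi}$. Scalars. There are elements of $Z(H)$ with $g_{j,\phi\psi_i}g_{i,\phi}=g_{i,\phi\psi_j}g_{j,\phi}z_{i,j,\phi}$; if $c_{i,j,k}\ne0$, $g_{j,\phi\psi_i}g_{i,\phi}=g_{k,\phi}z'_{i,j,k,\phi}$; if $d_{i,k}\neq0$, $g_{i,\phi\psi_i^{p-1}}\cdots g_{i,\phi\psi_i}g_{i,\phi}=g_{k,\phi}z''_{i,k,\phi}$. Put $\kappa_{i,\phi}=\prod_{a=0}^{p-2}\psi_i(g_{i,\phi\psi_i^a})^{-(p-1-a)}$ and $q_{i,j,\phi}=\psi_i(g_{j,\phi}z_{i,j,\phi})\psi_j(g_{i,\phi}^{-1}z_{i,j,\phi})\phi(z_{i,j,\phi})$, $q'_{i,j,k,\phi}=\psi_j(g_{i,\phi})^{-1}\psi_k(z'_{i,j,k,\phi})\phi(z'_{i,j,k,\phi})$, $q''_{i,k,\phi}=\kappa_{i,\phi}\psi_k(z''_{i,k,\phi})\phi(z''_{i,k,\phi})$. When $c_{i,j,\tilde w}\ne0$, $q'_{i,j,\tilde w,\phi}\in k^\times$ is the scalar with $g_{j,\phi\psi_i}g_{i,\phi}\tilde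 we_\phi=q'_{i,j,\tilde w,\phi}\tilde{\mathsf w}_\phi$; when $d_{i,\tilde w}\neq0$, $q''_{i,\tilde w,\phi}\in k^\times$ is the scalar with $g_{i,\phi\psi_i^{p-1}}\cdots g_{i,\phi\psi_i}g_{i,\phi}\tilde we_\phi=q''_{i,\tilde w,\phi}\tilde{\mathsf w}_\phi$. Terms with zero coefficient $c$ or $d$ are omitted. Products of arrows are read right to left.
   Formalization: The right-hand side of the first (commutator) relation is taken with a minus sign, since the constants c are those of [w̃_i,w̃_j], not [w̃_j,w̃_i]; with the printed sign the claim fails, e.g. for L=1, p odd and P extraspecial of order p³ and exponent p. *)

theory Defs
  imports
    "Graph_Theory.Arc_Walk"
    "HOL-Algebra.Algebraic_Closure_Type"
    "HOL-Algebra.Algebra"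
begin

section \<open>Algebras over a field\<close>

text \<open>
  The ground field is a type \<open>'k\<close>; \<^const>\<open>ring_of_type_algebra\<close> is the same field as a record.
  Algebras are records of type \<open>('k, 'a) module\<close>. The library locale \<^locale>\<open>algebra\<close>
  is about commutative algebras only, hence the following predicate.
\<close>

definition k_algebra :: "('k::field, 'a) module \<Rightarrow> bool" where
  "k_algebra A \<longleftrightarrow> module ring_of_type_algebra A \<and> ring A \<and>
    (\<forall>c. \<forall>x\<in>carrier A. \<forall>y\<in>carrier A.
       (c \<odot>\<^bsub>A\<^esub> x) \<otimes>\<^bsub>A\<^esub> y = c \<odot>\<^bsub>A\<^esub> (x \<otimes>\<^bsub>A\<^esub> y) \<and> x \<otimes>\<^bsub>A\<^esub> (c \<odot>\<^bsub>A\<^esub> y) = c \<odot>\<^bsub>A\<^esub> (x \<otimes>\<^bsub>A\<^esub> y))"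

definition alg_iso :: "('k, 'a) module \<Rightarrow> ('k, 'b) module \<Rightarrow> ('a \<Rightarrow> 'b) set" where
  "alg_iso A B = {f \<in> ring_iso A B. \<forall>c. \<forall>x\<in>carrier A. f (c \<odot>\<^bsub>A\<^esub> x) = c \<odot>\<^bsub>B\<^esub> f x}"

definition alg_isomorphic :: "('k, 'a) module \<Rightarrow> ('k, 'b) module \<Rightarrow> bool" where
  "alg_isomorphic A B \<longleftrightarrow> alg_iso A B \<noteq> {}"

text \<open>Quotient of an algebra by an ideal, or of a module by a submodule.\<close>

definition quot_alg :: "('k, 'a) module \<Rightarrow> 'a set \<Rightarrow> ('k, 'a set) module" where
  "quot_alg A N = \<lparr>carrier = a_rcosets\<^bsub>A\<^esub> N, monoid.mult = rcoset_mult A N,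
     one = N +>\<^bsub>A\<^esub> \<one>\<^bsub>A\<^esub>, ring.zero = N, ring.add = set_add A,
     module.smult = (\<lambda>c T. \<Union>x\<in>T. N +>\<^bsub>A\<^esub> (c \<odot>\<^bsub>A\<^esub> x))\<rparr>"

definition gen_subalg :: "('k, 'a) module \<Rightarrow> 'a set \<Rightarrow> ('k, 'a) module" where
  "gen_subalg A T = A\<lparr>carrier := \<Inter>{B. subring B A \<and> (\<forall>c. \<forall>x\<in>B. c \<odot>\<^bsub>A\<^esub> x \<in> B) \<and> T \<subseteq> B}\<rparr>"

definition corner_alg :: "('k, 'a) module \<Rightarrow> 'a \<Rightarrow> ('k, 'a) module" where
  "corner_alg A i = A\<lparr>carrier := (\<lambda>x. i \<otimes>\<^bsub>A\<^esub> x \<otimes>\<^bsub>A\<^esub> i) ` carrier A, one := i\<rparr>"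

definition mat_alg :: "nat \<Rightarrow> ('k, 'a) module \<Rightarrow> ('k, nat \<times> nat \<Rightarrow> 'a) module" where
  "mat_alg m B = (let I = {..<m} \<times> {..<m} in
     \<lparr>carrier = I \<rightarrow>\<^sub>E carrier B,
      monoid.mult = (\<lambda>T Y. \<lambda>v\<in>I. \<Oplus>\<^bsub>B\<^esub>l\<in>{..<m}. T (fst v, l) \<otimes>\<^bsub>B\<^esub> Y (l, snd v)),
      one = (\<lambda>v\<in>I. if fst v = snd v then \<one>\<^bsub>B\<^esub> else \<zero>\<^bsub>B\<^esub>),
      ring.zero = (\<lambda>v\<in>I. \<zero>\<^bsub>B\<^esub>),
      ring.add = (\<lambda>T Y. \<lambda>v\<in>I. T v \<oplus>\<^bsub>B\<^esub> Y v),
      module.smult = (\<lambda>c T. \<lambda>v\<in>I. c \<odot>\<^bsub>B\<^esub> T v)\<rparr>)"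

definition left_ideal :: "('k, 'a) module \<Rightarrow> 'a set \<Rightarrow> bool" where
  "left_ideal A M \<longleftrightarrow> additive_subgroup M A \<and> (\<forall>a\<in>carrier A. \<forall>x\<in>M. a \<otimes>\<^bsub>A\<^esub> x \<in> M)"

definition max_left_ideal :: "('k, 'a) module \<Rightarrow> 'a set \<Rightarrow> bool" where
  "max_left_ideal A M \<longleftrightarrow> left_ideal A M \<and> M \<noteq> carrier A \<and>
     (\<forall>N. left_ideal A N \<and> M \<subseteq> N \<longrightarrow> N = M \<or> N = carrier A)"

definition jacobson_rad :: "('k, 'a) module \<Rightarrow> 'a set" where
  "jacobson_rad A = {x \<in> carrier A. \<forall>M. max_left_ideal A M \<longrightarrow> x \<in> M}"

definition rad_pow :: "('k, 'a) module \<Rightarrow> nat \<Rightarrow> 'a set" where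
  "rad_pow A r = ((ideal_prod A (jacobson_rad A)) ^^ r) (carrier A)"

definition rad_length :: "('k, 'a) module \<Rightarrow> nat" where
  "rad_length A = (LEAST s. rad_pow A s = {\<zero>\<^bsub>A\<^esub>})"

definition idem :: "('k, 'a) module \<Rightarrow> 'a \<Rightarrow> bool" where
  "idem A i \<longleftrightarrow> i \<in> carrier A \<and> i \<otimes>\<^bsub>A\<^esub> i = i"

definition primitive_idem :: "('k, 'a) module \<Rightarrow> 'a \<Rightarrow> bool" where
  "primitive_idem A i \<longleftrightarrow> idem A i \<and> i \<noteq> \<zero>\<^bsub>A\<^esub> \<and>
     (\<forall>a b. idem A a \<and> idem A b \<and> a \<otimes>\<^bsub>A\<^esub> b = \<zero>\<^bsub>A\<^esub> \<and> b \<otimes>\<^bsub>A\<^esub> a = \<zero>\<^bsub>A\<^esub> \<and> i = a \<oplus>\<^bsub>A\<^esub> b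
        \<longrightarrow> a = \<zero>\<^bsub>A\<^esub> \<or> b = \<zero>\<^bsub>A\<^esub>)"

text \<open>The isomorphism of the projective modules \<open>A i\<close> and \<open>A j\<close>, given by right multiplication
  with \<open>a \<in> i A j\<close> and \<open>b \<in> j A i\<close>.\<close>

definition iso_idem :: "('k, 'a) module \<Rightarrow> 'a \<Rightarrow> 'a \<Rightarrow> bool" where
  "iso_idem A i j \<longleftrightarrow> (\<exists>a\<in>carrier A. \<exists>b\<in>carrier A.
     a = i \<otimes>\<^bsub>A\<^esub> a \<otimes>\<^bsub>A\<^esub> j \<and> b = j \<otimes>\<^bsub>A\<^esub> b \<otimes>\<^bsub>A\<^esub> i \<and> a \<otimes>\<^bsub>A\<^esub> b = i \<and> b \<otimes>\<^bsub>A\<^esub> a = j)"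

text \<open>\<open>B\<close> is isomorphic to \<open>i A i\<close>, where \<open>i\<close> is a sum of orthogonal primitive idempotents
  that represent the isomorphism classes of projective indecomposable modules, once each.\<close>

definition basic_algebra_of :: "('k::field, 'b) module \<Rightarrow> ('k, 'a) module \<Rightarrow> bool" where
  "basic_algebra_of B A \<longleftrightarrow> k_algebra B \<and>
     (\<exists>I. finite I \<and> (\<forall>i\<in>I. primitive_idem A i) \<and>
        (\<forall>i\<in>I. \<forall>j\<in>I. i \<noteq> j \<longrightarrow> i \<otimes>\<^bsub>A\<^esub> j = \<zero>\<^bsub>A\<^esub>) \<and>
        (\<forall>i. primitive_idem A i \<longrightarrow> (\<exists>!j. j \<in> I \<and> iso_idem A i j)) \<and>
        alg_isomorphic B (corner_alg A (\<Oplus>\<^bsub>A\<^esub>i\<in>I. i)))"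


section \<open>Group algebras and path algebras\<close>

definition delta :: "'x \<Rightarrow> 'x \<Rightarrow> 'k::field" where
  "delta x = (\<lambda>y. if y = x then 1 else 0)"

definition free_mod :: "'x set \<Rightarrow> ('k::field, 'x \<Rightarrow> 'k) module" where
  "free_mod T = \<lparr>carrier = {f. finite {x. f x \<noteq> 0} \<and> {x. f x \<noteq> 0} \<subseteq> T},
     monoid.mult = undefined, one = undefined,
     ring.zero = (\<lambda>_. 0), ring.add = (\<lambda>f g x. f x + g x), module.smult = (\<lambda>c f x. c * f x)\<rparr>"

text \<open>\<open>k\<^sub>\<alpha> T\<close> for a finite group \<open>T\<close>, where \<open>x \<cdot> y = \<alpha>(x,y) xy\<close>. The cocycle need not be
  normalised, so the identity is \<open>\<alpha>(1,1)\<^sup>-\<^sup>1\<close> times the basis element of \<open>1\<close>.\<close>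

definition twisted_group_algebra :: "('g, 'm) monoid_scheme \<Rightarrow> ('g \<times> 'g \<Rightarrow> 'k) \<Rightarrow> ('k::field, 'g \<Rightarrow> 'k) module" where
  "twisted_group_algebra T \<alpha> = (free_mod (carrier T))
     \<lparr>monoid.mult := (\<lambda>f g x. \<Sum>(y, z) | y \<in> carrier T \<and> z \<in> carrier T \<and> y \<otimes>\<^bsub>T\<^esub> z = x. \<alpha> (y, z) * (f y * g z)),
      one := (\<lambda>x. inverse (\<alpha> (\<one>\<^bsub>T\<^esub>, \<one>\<^bsub>T\<^esub>)) * delta \<one>\<^bsub>T\<^esub> x)\<rparr>"

definition group_algebra :: "('g, 'm) monoid_scheme \<Rightarrow> ('k::field, 'g \<Rightarrow> 'k) module" where
  "group_algebra T = twisted_group_algebra T (\<lambda>_. 1)"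

definition semidirect :: "('a, 'm) monoid_scheme \<Rightarrow> ('b, 'n) monoid_scheme \<Rightarrow> ('b \<Rightarrow> 'a \<Rightarrow> 'a) \<Rightarrow> ('a \<times> 'b) monoid" where
  "semidirect P K \<theta> = \<lparr>carrier = carrier P \<times> carrier K,
     monoid.mult = (\<lambda>v w. (fst v \<otimes>\<^bsub>P\<^esub> \<theta> (snd v) (fst w), snd v \<otimes>\<^bsub>K\<^esub> snd w)),
     one = (\<one>\<^bsub>P\<^esub>, \<one>\<^bsub>K\<^esub>)\<rparr>"

text \<open>Inside \<open>k(P \<rtimes> K)\<close>: an element of \<open>kP\<close>, and the idempotent
  \<open>1/|N| \<Sum>\<^sub>h \<nu>(h\<^sup>-\<^sup>1) h\<close> of a linear character \<open>\<nu>\<close> of a subgroup \<open>N\<close> of \<open>K\<close>.\<close>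

definition embP :: "('b, 'n) monoid_scheme \<Rightarrow> ('a \<Rightarrow> 'k) \<Rightarrow> ('a \<times> 'b \<Rightarrow> 'k::field)" where
  "embP K f = (\<lambda>v. if snd v = \<one>\<^bsub>K\<^esub> then f (fst v) else 0)"

definition char_idem :: "('a, 'm) monoid_scheme \<Rightarrow> ('b, 'n) monoid_scheme \<Rightarrow> 'b set \<Rightarrow> ('b \<Rightarrow> 'k) \<Rightarrow> ('a \<times> 'b \<Rightarrow> 'k::field)" where
  "char_idem P K N \<nu> = (\<lambda>v. inverse (of_nat (card N)) * (\<Sum>h\<in>N. \<nu> (inv\<^bsub>K\<^esub> h) * delta (\<one>\<^bsub>P\<^esub>, h) v))"

text \<open>Quivers are multidigraphs. A path is a pair of a start vertex and the list of its arrows in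
  the order of travel, so in the path \<open>f \<otimes> g\<close> the path \<open>g\<close> is travelled first.\<close>

definition paths :: "('v, 'e) pre_digraph \<Rightarrow> ('v \<times> 'e list) set" where
  "paths Q = {(u, es). \<exists>v. pre_digraph.awalk Q u es v}"

definition path_algebra :: "('v, 'e) pre_digraph \<Rightarrow> ('k::field, 'v \<times> 'e list \<Rightarrow> 'k) module" where
  "path_algebra Q = (free_mod (paths Q))
     \<lparr>monoid.mult := (\<lambda>f g (u, es). \<Sum>m\<le>length es.
         f (pre_digraph.awlast Q u (take m es), drop m es) * g (u, take m es)),
      one := (\<lambda>(u, es). if u \<in> verts Q \<and> es = [] then 1 else 0)\<rparr>"

text \<open>Evaluation in \<open>A\<close> of a combination of paths, with \<open>E\<close> and \<open>U\<close> the values of the vertices and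
  arrows.\<close>

definition path_eval :: "('k::field, 'a) module \<Rightarrow> ('v \<Rightarrow> 'a) \<Rightarrow> ('e \<Rightarrow> 'a) \<Rightarrow> ('v \<times> 'e list \<Rightarrow> 'k) \<Rightarrow> 'a" where
  "path_eval A E U f =
     (\<Oplus>\<^bsub>A\<^esub>x\<in>{x. f x \<noteq> 0}. f x \<odot>\<^bsub>A\<^esub> foldl (\<lambda>a e. U e \<otimes>\<^bsub>A\<^esub> a) (E (fst x)) (snd x))"


section \<open>Second cohomology with trivial coefficients\<close>

abbreviation kx :: "'k::field monoid" where
  "kx \<equiv> mult_of (ring_of_type_algebra :: 'k ring)"

definition cocycles2 :: "('g, 'm) monoid_scheme \<Rightarrow> ('g \<times> 'g \<Rightarrow> 'k::field) monoid" where
  "cocycles2 T = \<lparr>carrier = {\<alpha> \<in> carrier T \<times> carrier T \<rightarrow>\<^sub>E carrier kx.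
       \<forall>x\<in>carrier T. \<forall>y\<in>carrier T. \<forall>z\<in>carrier T.
         \<alpha> (x, y) * \<alpha> (x \<otimes>\<^bsub>T\<^esub> y, z) = \<alpha> (x, y \<otimes>\<^bsub>T\<^esub> z) * \<alpha> (y, z)},
     monoid.mult = (\<lambda>\<alpha> \<beta>. \<lambda>v\<in>carrier T \<times> carrier T. \<alpha> v * \<beta> v),
     one = (\<lambda>v\<in>carrier T \<times> carrier T. 1)\<rparr>"

definition coboundaries2 :: "('g, 'm) monoid_scheme \<Rightarrow> ('g \<times> 'g \<Rightarrow> 'k::field) set" where
  "coboundaries2 T = {\<lambda>v\<in>carrier T \<times> carrier T. f (fst v) * f (snd v) / f (fst v \<otimes>\<^bsub>T\<^esub> snd v)
     | f. f \<in> carrier T \<rightarrow> carrier kx}"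

definition H2 :: "('g, 'm) monoid_scheme \<Rightarrow> ('g \<times> 'g \<Rightarrow> 'k::field) set monoid" where
  "H2 T = cocycles2 T Mod coboundaries2 T"


section \<open>The Jennings Lie algebra\<close>

text \<open>\<open>F\<^sub>r(P)\<close>; the first argument only carries the field.\<close>

definition jfilt :: "'k::field itself \<Rightarrow> ('p, 'm) monoid_scheme \<Rightarrow> nat \<Rightarrow> 'p set" where
  "jfilt _ P r = {g \<in> carrier P.
     (\<lambda>x. delta g x - delta \<one>\<^bsub>P\<^esub> x) \<in> rad_pow (group_algebra P :: ('k, 'p \<Rightarrow> 'k) module) r}"

definition jlayer :: "'k::field itself \<Rightarrow> ('p, 'm) monoid_scheme \<Rightarrow> nat \<Rightarrow> 'p set monoid" where
  "jlayer k P r = (P\<lparr>carrier := jfilt k P r\<rparr>) Mod jfilt k P (Suc r)"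

text \<open>\<open>k \<otimes>\<^bsub>\<bbbF>\<^sub>p\<^esub> V\<close> for an elementary abelian \<open>p\<close>-group \<open>V\<close>, written multiplicatively: the free
  \<open>k\<close>-module on \<open>V\<close> modulo additivity in \<open>V\<close> and \<open>\<bbbF>\<^sub>p\<close>-balancedness.\<close>

definition span_of :: "('k::field, 'a) module \<Rightarrow> 'a set \<Rightarrow> 'a set" where
  "span_of M T = \<Inter>{N. submodule N ring_of_type_algebra M \<and> T \<subseteq> N}"

definition tensor_rels :: "('v, 'm) monoid_scheme \<Rightarrow> ('v \<Rightarrow> 'k::field) set" where
  "tensor_rels V = span_of (free_mod (carrier V))
     ({\<lambda>u. delta (x \<otimes>\<^bsub>V\<^esub> y) u - delta x u - delta y u | x y. x \<in> carrier V \<and> y \<in> carrier V} \<union>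
      {\<lambda>u. delta (x [^]\<^bsub>V\<^esub> (a::nat)) u - of_nat a * delta x u | x a. x \<in> carrier V})"

definition tensor_k :: "('v, 'm) monoid_scheme \<Rightarrow> ('k::field, ('v \<Rightarrow> 'k) set) module" where
  "tensor_k V = quot_alg (free_mod (carrier V)) (tensor_rels V)"

definition tensor_elt :: "('v, 'm) monoid_scheme \<Rightarrow> ('v \<Rightarrow> 'k::field) \<Rightarrow> ('v \<Rightarrow> 'k) set" where
  "tensor_elt V f = tensor_rels V +>\<^bsub>free_mod (carrier V)\<^esub> f"

text \<open>\<open>id \<otimes> h\<close> for an endomorphism \<open>h\<close> of \<open>V\<close>.\<close>

definition tensor_map :: "('v, 'm) monoid_scheme \<Rightarrow> ('v \<Rightarrow> 'v) \<Rightarrow> ('v \<Rightarrow> 'k::field) set \<Rightarrow> ('v \<Rightarrow> 'k) set" where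
  "tensor_map V h T = (\<Union>f\<in>T. tensor_elt V (\<lambda>u. \<Sum>v | v \<in> carrier V \<and> h v = u. f v))"

definition direct_sum :: "'i set \<Rightarrow> ('i \<Rightarrow> ('k, 'a) module) \<Rightarrow> ('k, 'i \<Rightarrow> 'a) module" where
  "direct_sum I M =
     \<lparr>carrier = {x \<in> (\<Pi>\<^sub>E r\<in>I. carrier (M r)). finite {r \<in> I. x r \<noteq> \<zero>\<^bsub>M r\<^esub>}},
      monoid.mult = undefined, one = undefined,
      ring.zero = (\<lambda>r\<in>I. \<zero>\<^bsub>M r\<^esub>), ring.add = (\<lambda>x y. \<lambda>r\<in>I. x r \<oplus>\<^bsub>M r\<^esub> y r),
      module.smult = (\<lambda>c x. \<lambda>r\<in>I. c \<odot>\<^bsub>M r\<^esub> x r)\<rparr>"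

type_synonym ('p, 'k) jen_elt = "nat \<Rightarrow> ('p set \<Rightarrow> 'k) set"

definition jennings :: "('p, 'm) monoid_scheme \<Rightarrow> ('k::field, ('p, 'k) jen_elt) module" where
  "jennings P = direct_sum {1..} (\<lambda>r. tensor_k (jlayer TYPE('k) P r))"

definition jen_homogeneous :: "('p, 'm) monoid_scheme \<Rightarrow> nat \<Rightarrow> ('p, 'k::field) jen_elt set" where
  "jen_homogeneous P r = {x \<in> carrier (jennings P).
     \<forall>t\<in>{1..}. t \<noteq> r \<longrightarrow> x t = \<zero>\<^bsub>tensor_k (jlayer TYPE('k) P t) :: ('k, _) module\<^esub>}"

text \<open>\<open>1 \<otimes> g F\<^sub>r\<^sub>+\<^sub>1(P)\<close>, for \<open>g \<in> F\<^sub>r(P)\<close>.\<close>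

definition jen_class :: "('p, 'm) monoid_scheme \<Rightarrow> nat \<Rightarrow> 'p \<Rightarrow> ('p, 'k::field) jen_elt" where
  "jen_class P r g = (\<lambda>t\<in>{1..}. if t = r
     then tensor_elt (jlayer TYPE('k) P r) (delta (jfilt TYPE('k) P (Suc r) #>\<^bsub>P\<^esub> g))
     else \<zero>\<^bsub>tensor_k (jlayer TYPE('k) P t) :: ('k, _) module\<^esub>)"

definition jen_act :: "('p, 'm) monoid_scheme \<Rightarrow> ('p \<Rightarrow> 'p) \<Rightarrow> ('p, 'k::field) jen_elt \<Rightarrow> ('p, 'k) jen_elt" where
  "jen_act P \<sigma> x = (\<lambda>r\<in>{1..}. tensor_map (jlayer TYPE('k) P r) ((`) \<sigma>) (x r))"

text \<open>
  Restricted Lie algebras in characteristic \<open>p\<close>. In the last axiom, which is Jacobson's formula,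
  \<open>i s\<^sub>i(x,y)\<close> is the coefficient of \<open>t\<^sup>i\<^sup>-\<^sup>1\<close> in \<open>(ad(t x + y))\<^sup>p\<^sup>-\<^sup>1(x)\<close>: the words
  are the ways to expand the power, and \<open>True\<close> stands for \<open>ad(x)\<close>.
\<close>

definition jacobson_s :: "('k::field, 'a) module \<Rightarrow> ('a \<Rightarrow> 'a \<Rightarrow> 'a) \<Rightarrow> nat \<Rightarrow> 'a \<Rightarrow> 'a \<Rightarrow> 'a" where
  "jacobson_s M br i x y = inverse (of_nat i) \<odot>\<^bsub>M\<^esub>
     (\<Oplus>\<^bsub>M\<^esub>us\<in>{us :: bool list. length us = CHAR('k) - 1 \<and> count_list us True = i - 1}.
        foldr (\<lambda>b. br (if b then x else y)) us x)"

locale restricted_lie_algebra = module ring_of_type_algebra M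
  for M :: "('k::field, 'a) module" +
  fixes br :: "'a \<Rightarrow> 'a \<Rightarrow> 'a" and pmap :: "'a \<Rightarrow> 'a"
  assumes br_closed: "\<lbrakk>x \<in> carrier M; y \<in> carrier M\<rbrakk> \<Longrightarrow> br x y \<in> carrier M"
    and br_add_left: "\<lbrakk>x \<in> carrier M; x' \<in> carrier M; y \<in> carrier M\<rbrakk>
      \<Longrightarrow> br (x \<oplus>\<^bsub>M\<^esub> x') y = br x y \<oplus>\<^bsub>M\<^esub> br x' y"
    and br_add_right: "\<lbrakk>x \<in> carrier M; y \<in> carrier M; y' \<in> carrier M\<rbrakk>
      \<Longrightarrow> br x (y \<oplus>\<^bsub>M\<^esub> y') = br x y \<oplus>\<^bsub>M\<^esub> br x y'"
    and br_smult_left: "\<lbrakk>x \<in> carrier M; y \<in> carrier M\<rbrakk> \<Longrightarrow> br (c \<odot>\<^bsub>M\<^esub> x) y = c \<odot>\<^bsub>M\<^esub> br x y"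
    and br_smult_right: "\<lbrakk>x \<in> carrier M; y \<in> carrier M\<rbrakk> \<Longrightarrow> br x (c \<odot>\<^bsub>M\<^esub> y) = c \<odot>\<^bsub>M\<^esub> br x y"
    and br_self: "x \<in> carrier M \<Longrightarrow> br x x = \<zero>\<^bsub>M\<^esub>"
    and jacobi: "\<lbrakk>x \<in> carrier M; y \<in> carrier M; z \<in> carrier M\<rbrakk>
      \<Longrightarrow> br x (br y z) \<oplus>\<^bsub>M\<^esub> br y (br z x) \<oplus>\<^bsub>M\<^esub> br z (br x y) = \<zero>\<^bsub>M\<^esub>"
    and pmap_closed: "x \<in> carrier M \<Longrightarrow> pmap x \<in> carrier M"
    and pmap_smult: "x \<in> carrier M \<Longrightarrow> pmap (c \<odot>\<^bsub>M\<^esub> x) = c ^ CHAR('k) \<odot>\<^bsub>M\<^esub> pmap x"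
    and br_pmap: "\<lbrakk>x \<in> carrier M; y \<in> carrier M\<rbrakk> \<Longrightarrow> br (pmap x) y = (br x ^^ CHAR('k)) y"
    and pmap_add: "\<lbrakk>x \<in> carrier M; y \<in> carrier M\<rbrakk> \<Longrightarrow>
      pmap (x \<oplus>\<^bsub>M\<^esub> y) = pmap x \<oplus>\<^bsub>M\<^esub> pmap y \<oplus>\<^bsub>M\<^esub> (\<Oplus>\<^bsub>M\<^esub>i\<in>{1..CHAR('k) - 1}. jacobson_s M br i x y)"

definition commutator :: "('g, 'm) monoid_scheme \<Rightarrow> 'g \<Rightarrow> 'g \<Rightarrow> 'g" where
  "commutator T g h = g \<otimes>\<^bsub>T\<^esub> h \<otimes>\<^bsub>T\<^esub> inv\<^bsub>T\<^esub> g \<otimes>\<^bsub>T\<^esub> inv\<^bsub>T\<^esub> h"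

text \<open>These conditions determine \<open>br\<close> and \<open>pmap\<close> on the Jennings Lie algebra, which is spanned by
  the classes of group elements.\<close>

definition jennings_structure ::
  "('p, 'm) monoid_scheme \<Rightarrow> (('p, 'k::field) jen_elt \<Rightarrow> ('p, 'k) jen_elt \<Rightarrow> ('p, 'k) jen_elt)
     \<Rightarrow> (('p, 'k) jen_elt \<Rightarrow> ('p, 'k) jen_elt) \<Rightarrow> bool" where
  "jennings_structure P br pmap \<longleftrightarrow> restricted_lie_algebra (jennings P) br pmap \<and>
     (\<forall>r\<ge>1. \<forall>t\<ge>1. \<forall>g\<in>jfilt TYPE('k) P r. \<forall>h\<in>jfilt TYPE('k) P t.
        br (jen_class P r g) (jen_class P t h) = jen_class P (r + t) (commutator P g h)) \<and>
     (\<forall>r\<ge>1. \<forall>g\<in>jfilt TYPE('k) P r.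
        pmap (jen_class P r g) = jen_class P (CHAR('k) * r) (g [^]\<^bsub>P\<^esub> CHAR('k)))"

text \<open>The elements of \<open>J\<^sup>r(kP)\<close> whose class in \<open>J\<^sup>r(kP)/J\<^sup>r\<^sup>+\<^sup>1(kP)\<close> is the image of
  \<open>T \<in> k \<otimes> F\<^sub>r(P)/F\<^sub>r\<^sub>+\<^sub>1(P)\<close> under the Jennings--Quillen map \<open>1 \<otimes> g F\<^sub>r\<^sub>+\<^sub>1(P) \<mapsto> g - 1\<close>.
  Here \<open>s\<close> selects an element of each coset.\<close>

definition jq_representatives :: "('p, 'm) monoid_scheme \<Rightarrow> nat \<Rightarrow> ('p set \<Rightarrow> 'k::field) set \<Rightarrow> ('p \<Rightarrow> 'k) set" where
  "jq_representatives P r T = {y \<in> rad_pow (group_algebra P) r.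
     \<exists>f\<in>T. \<exists>s. (\<forall>C\<in>carrier (jlayer TYPE('k) P r). s C \<in> C) \<and>
       (\<lambda>x. y x - (\<Sum>C\<in>carrier (jlayer TYPE('k) P r). f C * (delta (s C) x - delta \<one>\<^bsub>P\<^esub> x)))
         \<in> rad_pow (group_algebra P) (Suc r)}"


section \<open>The data\<close>

record ('p, 'h, 'k) block_data =
  grpP :: "'p monoid"
  autL :: "('p \<Rightarrow> 'p) set"
  coc :: "('p \<Rightarrow> 'p) \<times> ('p \<Rightarrow> 'p) \<Rightarrow> 'k"
  grpH :: "'h monoid"
  actH :: "'h \<Rightarrow> 'p \<Rightarrow> 'p"  \<comment> \<open>the epimorphism \<open>H \<rightarrow> L\<close>\<close>
  chi :: "'h \<Rightarrow> 'k"
  hat :: "('p \<Rightarrow> 'p) \<Rightarrow> 'h"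
  phi0 :: "'h \<Rightarrow> 'k"
  xi :: "('h \<Rightarrow> 'k) \<Rightarrow> 'h \<Rightarrow> 'k"
  gel :: "('h \<Rightarrow> 'k) \<Rightarrow> ('h \<Rightarrow> 'k) \<Rightarrow> 'h"  \<comment> \<open>\<open>g\<^bsub>\<psi>,\<phi>\<^esub>\<close>\<close>
  lie :: "('p, 'k) jen_elt \<Rightarrow> ('p, 'k) jen_elt \<Rightarrow> ('p, 'k) jen_elt"
  ppow :: "('p, 'k) jen_elt \<Rightarrow> ('p, 'k) jen_elt"
  num :: nat  \<comment> \<open>\<open>n\<close>, where \<open>|P| = p\<^sup>n\<close>\<close>
  wdeg :: "nat \<Rightarrow> nat"
  wel :: "nat \<Rightarrow> ('p, 'k) jen_elt"
  psi :: "nat \<Rightarrow> 'h \<Rightarrow> 'k"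
  wlift :: "nat \<Rightarrow> 'p \<Rightarrow> 'k"
  cLie :: "nat \<Rightarrow> nat \<Rightarrow> nat \<Rightarrow> 'k"  \<comment> \<open>\<open>c\<^bsub>i,j,k\<^esub>\<close>\<close>
  dLie :: "nat \<Rightarrow> nat \<Rightarrow> 'k"  \<comment> \<open>\<open>d\<^bsub>i,k\<^esub>\<close>\<close>
  cErr :: "nat \<Rightarrow> nat \<Rightarrow> nat list \<Rightarrow> 'k"  \<comment> \<open>\<open>c\<^bsub>i,j,w\<^esub>\<close> for \<open>w\<close> in the PBW basis\<close>
  dErr :: "nat \<Rightarrow> nat list \<Rightarrow> 'k"  \<comment> \<open>\<open>d\<^bsub>i,w\<^esub>\<close> for \<open>w\<close> in the PBW basis\<close>

definition grpL :: "('p, 'h, 'k) block_data \<Rightarrow> ('p \<Rightarrow> 'p) monoid" where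
  "grpL S = (AutoGroup (grpP S))\<lparr>carrier := autL S\<rparr>"

definition subZ :: "('p, 'h, 'k) block_data \<Rightarrow> 'h set" where
  "subZ S = kernel (grpH S) (grpL S) (actH S)"

definition centH :: "('p, 'h, 'k) block_data \<Rightarrow> 'h set" where
  "centH S = {z \<in> carrier (grpH S). \<forall>h\<in>carrier (grpH S). z \<otimes>\<^bsub>grpH S\<^esub> h = h \<otimes>\<^bsub>grpH S\<^esub> z}"

definition kP :: "('p, 'h, 'k::field) block_data \<Rightarrow> ('k, 'p \<Rightarrow> 'k) module" where
  "kP S = group_algebra (grpP S)"

definition kG :: "('p, 'h, 'k::field) block_data \<Rightarrow> ('k, 'p \<times> 'h \<Rightarrow> 'k) module" where
  "kG S = group_algebra (semidirect (grpP S) (grpH S) (actH S))"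

text \<open>\<open>kGe\<close>; note that \<open>e\<close> is a central idempotent of \<open>kG\<close>.\<close>

definition kGe :: "('p, 'h, 'k::field) block_data \<Rightarrow> ('k, 'p \<times> 'h \<Rightarrow> 'k) module" where
  "kGe S = corner_alg (kG S) (char_idem (grpP S) (grpH S) (subZ S) (chi S))"

definition k_alpha_PL :: "('p, 'h, 'k::field) block_data \<Rightarrow> ('k, 'p \<times> ('p \<Rightarrow> 'p) \<Rightarrow> 'k) module" where
  "k_alpha_PL S = twisted_group_algebra (semidirect (grpP S) (grpL S) (\<lambda>\<sigma>. \<sigma>))
     (\<lambda>(v, w). coc S (snd v, snd w))"

text \<open>\<open>k(P \<rtimes> Z(H)/Z)\<close>, where the coset \<open>zZ\<close> acts on \<open>P\<close> as \<open>z\<close>.\<close>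

definition grpM :: "('p, 'h, 'k) block_data \<Rightarrow> 'h set monoid" where
  "grpM S = ((grpH S)\<lparr>carrier := centH S\<rparr>) Mod subZ S"

definition kPM :: "('p, 'h, 'k::field) block_data \<Rightarrow> ('k, 'p \<times> 'h set \<Rightarrow> 'k) module" where
  "kPM S = group_algebra (semidirect (grpP S) (grpM S) (\<lambda>C. the_elem (actH S ` C)))"

text \<open>\<open>Hom(H/Z, k\<^sup>\<times>)\<close>, inflated to \<open>H\<close>.\<close>

definition HomHZ :: "('p, 'h, 'k::field) block_data \<Rightarrow> ('h \<Rightarrow> 'k) set" where
  "HomHZ S = {\<psi> \<in> hom (grpH S) kx \<inter> extensional (carrier (grpH S)). \<forall>z\<in>subZ S. \<psi> z = 1}"

definition IrrZ :: "('p, 'h, 'k::field) block_data \<Rightarrow> ('h \<Rightarrow> 'k) set" where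
  "IrrZ S = {\<phi> \<in> hom ((grpH S)\<lparr>carrier := centH S\<rparr>) kx \<inter> extensional (centH S). \<forall>z\<in>subZ S. \<phi> z = chi S z}"

definition tw :: "('p, 'h, 'k::field) block_data \<Rightarrow> ('h \<Rightarrow> 'k) \<Rightarrow> ('h \<Rightarrow> 'k) \<Rightarrow> ('h \<Rightarrow> 'k)" where
  "tw S \<phi> \<psi> = (\<lambda>h\<in>centH S. \<phi> h * \<psi> h)"

text \<open>\<open>\<phi>\<psi>\<^bsub>i\<^sub>1\<^esub>\<cdots>\<psi>\<^bsub>i\<^sub>r\<^esub>\<close>\<close>

definition tws :: "('p, 'h, 'k::field) block_data \<Rightarrow> ('h \<Rightarrow> 'k) \<Rightarrow> nat list \<Rightarrow> ('h \<Rightarrow> 'k)" where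
  "tws S \<phi> is = foldr (\<lambda>i \<zeta>. tw S \<zeta> (psi S i)) is \<phi>"

definition gi :: "('p, 'h, 'k::field) block_data \<Rightarrow> nat \<Rightarrow> ('h \<Rightarrow> 'k) \<Rightarrow> 'h" where
  "gi S i \<phi> = gel S (psi S i) \<phi>"

text \<open>\<open>g\<^bsub>i\<^sub>1,\<phi>\<psi>\<^bsub>i\<^sub>2\<^esub>\<cdots>\<psi>\<^bsub>i\<^sub>r\<^esub>\<^esub> \<cdots> g\<^bsub>i\<^sub>r,\<phi>\<^esub>\<close>\<close>

primrec gword :: "('p, 'h, 'k::field) block_data \<Rightarrow> ('h \<Rightarrow> 'k) \<Rightarrow> nat list \<Rightarrow> 'h" where
  "gword S \<phi> [] = \<one>\<^bsub>grpH S\<^esub>"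
| "gword S \<phi> (i # is) = gi S i (tws S \<phi> is) \<otimes>\<^bsub>grpH S\<^esub> gword S \<phi> is"

text \<open>The same pattern for elements \<open>U\<^bsub>i,\<phi>\<^esub>\<close> and vertex idempotents \<open>E\<^sub>\<phi>\<close> of an algebra; the
  trailing factor \<open>E\<^sub>\<phi>\<close> only matters for the empty word.\<close>

primrec uword :: "('p, 'h, 'k::field) block_data \<Rightarrow> ('k, 'a) module \<Rightarrow> (('h \<Rightarrow> 'k) \<Rightarrow> 'a)
    \<Rightarrow> (nat \<Rightarrow> ('h \<Rightarrow> 'k) \<Rightarrow> 'a) \<Rightarrow> ('h \<Rightarrow> 'k) \<Rightarrow> nat list \<Rightarrow> 'a" where
  "uword S A E U \<phi> [] = E \<phi>"
| "uword S A E U \<phi> (i # is) = U i (tws S \<phi> is) \<otimes>\<^bsub>A\<^esub> uword S A E U \<phi> is"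

text \<open>The PBW basis of \<open>kP\<close> is indexed by the sorted words \<open>PBW S\<close>.\<close>

definition PBW :: "('p, 'h, 'k::field) block_data \<Rightarrow> nat list set" where
  "PBW S = {xs. sorted xs \<and> set xs \<subseteq> {1..num S} \<and> (\<forall>i. count_list xs i \<le> CHAR('k) - 1)}"

definition wmon :: "('p, 'h, 'k::field) block_data \<Rightarrow> nat list \<Rightarrow> 'p \<Rightarrow> 'k" where
  "wmon S xs = foldr (\<lambda>i y. wlift S i \<otimes>\<^bsub>kP S\<^esub> y) xs \<one>\<^bsub>kP S\<^esub>"

definition yComm :: "('p, 'h, 'k::field) block_data \<Rightarrow> nat \<Rightarrow> nat \<Rightarrow> 'p \<Rightarrow> 'k" where
  "yComm S i j = (\<Oplus>\<^bsub>kP S\<^esub>xs\<in>PBW S. cErr S i j xs \<odot>\<^bsub>kP S\<^esub> wmon S xs)"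

definition yPow :: "('p, 'h, 'k::field) block_data \<Rightarrow> nat \<Rightarrow> 'p \<Rightarrow> 'k" where
  "yPow S i = (\<Oplus>\<^bsub>kP S\<^esub>xs\<in>PBW S. dErr S i xs \<odot>\<^bsub>kP S\<^esub> wmon S xs)"

locale block_setting =
  fixes S :: "('p, 'h, 'k::alg_closed_field) block_data"
  assumes prime_char: "prime CHAR('k)"
    and P_group: "group (grpP S)"
    and P_order: "Coset.order (grpP S) = CHAR('k) ^ num S"
    and L_subgroup: "subgroup (autL S) (AutoGroup (grpP S))"
    and L_abelian: "comm_group (grpL S)"
    and L_p': "coprime (Coset.order (grpL S)) CHAR('k)"
    and coc_cocycle: "coc S \<in> carrier (cocycles2 (grpL S))"
    and coc_order: "group.ord (cocycles2 (grpL S)) (coc S)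
       = group.ord (H2 (grpL S)) (coboundaries2 (grpL S) #>\<^bsub>cocycles2 (grpL S)\<^esub> coc S)"
    and H_group: "group (grpH S)"
    and H_finite: "finite (carrier (grpH S))"
    and H_p': "coprime (Coset.order (grpH S)) CHAR('k)"
    and H_onto_L: "actH S \<in> epi (grpH S) (grpL S)"
    and Z_central: "subZ S \<subseteq> centH S"
    and Z_derived: "subZ S = derived (grpH S) (carrier (grpH S))"
    and chi_hom: "chi S \<in> hom ((grpH S)\<lparr>carrier := subZ S\<rparr>) kx"
    and chi_faithful: "inj_on (chi S) (subZ S)"
    and hat_preimage: "x \<in> autL S \<Longrightarrow> hat S x \<in> carrier (grpH S) \<and> actH S (hat S x) = x"
    and coc_chi: "\<lbrakk>x \<in> autL S; y \<in> autL S\<rbrakk> \<Longrightarrow>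
       coc S (x, y) = chi S (hat S x \<otimes>\<^bsub>grpH S\<^esub> hat S y \<otimes>\<^bsub>grpH S\<^esub> inv\<^bsub>grpH S\<^esub> hat S (x \<otimes>\<^bsub>grpL S\<^esub> y))"
    and phi0: "phi0 S \<in> IrrZ S"
    and xi_hom: "\<phi> \<in> IrrZ S \<Longrightarrow> xi S \<phi> \<in> HomHZ S"
    and xi_restrict: "\<lbrakk>\<phi> \<in> IrrZ S; h \<in> centH S\<rbrakk> \<Longrightarrow> xi S \<phi> h = \<phi> h / phi0 S h"
    and xi_phi0: "h \<in> carrier (grpH S) \<Longrightarrow> xi S (phi0 S) h = 1"
    and gel_closed: "\<lbrakk>\<psi> \<in> HomHZ S; \<phi> \<in> IrrZ S\<rbrakk> \<Longrightarrow> gel S \<psi> \<phi> \<in> carrier (grpH S)"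
    and gel_rho: "\<lbrakk>\<psi> \<in> HomHZ S; \<phi> \<in> IrrZ S; h \<in> carrier (grpH S)\<rbrakk> \<Longrightarrow>
       chi S (commutator (grpH S) h (gel S \<psi> \<phi>)) = xi S (tw S \<phi> \<psi>) h / xi S \<phi> h / \<psi> h"
    and jennings: "jennings_structure (grpP S) (lie S) (ppow S)"
    and wdeg_pos: "i \<in> {1..num S} \<Longrightarrow> 1 \<le> wdeg S i"
    and wdeg_mono: "\<lbrakk>i \<in> {1..num S}; j \<in> {1..num S}; i \<le> j\<rbrakk> \<Longrightarrow> wdeg S i \<le> wdeg S j"
    and wel_homogeneous: "i \<in> {1..num S} \<Longrightarrow> wel S i \<in> jen_homogeneous (grpP S) (wdeg S i)"
    and wel_basis: "v \<in> carrier (jennings (grpP S) :: ('k, _) module) \<Longrightarrow>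
       \<exists>!c. c \<in> {1..num S} \<rightarrow>\<^sub>E UNIV \<and>
            v = (\<Oplus>\<^bsub>jennings (grpP S)\<^esub>i\<in>{1..num S}. c i \<odot>\<^bsub>jennings (grpP S)\<^esub> wel S i)"
    and psi_hom: "i \<in> {1..num S} \<Longrightarrow> psi S i \<in> HomHZ S"
    and wel_eigen: "\<lbrakk>i \<in> {1..num S}; h \<in> carrier (grpH S)\<rbrakk> \<Longrightarrow>
       jen_act (grpP S) (actH S h) (wel S i) = psi S i h \<odot>\<^bsub>jennings (grpP S)\<^esub> wel S i"
    and lie_coeffs: "\<lbrakk>i \<in> {1..num S}; j \<in> {1..num S}\<rbrakk> \<Longrightarrow> lie S (wel S i) (wel S j) =
       (\<Oplus>\<^bsub>jennings (grpP S)\<^esub>k\<in>{1..num S}. cLie S i j k \<odot>\<^bsub>jennings (grpP S)\<^esub> wel S k)"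
    and ppow_coeffs: "i \<in> {1..num S} \<Longrightarrow> ppow S (wel S i) =
       (\<Oplus>\<^bsub>jennings (grpP S)\<^esub>k\<in>{1..num S}. dLie S i k \<odot>\<^bsub>jennings (grpP S)\<^esub> wel S k)"
    and wlift_represents: "i \<in> {1..num S} \<Longrightarrow>
       wlift S i \<in> jq_representatives (grpP S) (wdeg S i) (wel S i (wdeg S i))"
    and wlift_eigen: "\<lbrakk>i \<in> {1..num S}; h \<in> carrier (grpH S)\<rbrakk> \<Longrightarrow>
       delta (\<one>\<^bsub>grpP S\<^esub>, h) \<otimes>\<^bsub>kG S\<^esub> embP (grpH S) (wlift S i) \<otimes>\<^bsub>kG S\<^esub> delta (\<one>\<^bsub>grpP S\<^esub>, inv\<^bsub>grpH S\<^esub> h)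
         = psi S i h \<odot>\<^bsub>kG S\<^esub> embP (grpH S) (wlift S i)"
    and wlift_comm: "\<lbrakk>i \<in> {1..num S}; j \<in> {1..num S}\<rbrakk> \<Longrightarrow>
       wlift S i \<otimes>\<^bsub>kP S\<^esub> wlift S j \<ominus>\<^bsub>kP S\<^esub> wlift S j \<otimes>\<^bsub>kP S\<^esub> wlift S i =
         (\<Oplus>\<^bsub>kP S\<^esub>k\<in>{1..num S}. cLie S i j k \<odot>\<^bsub>kP S\<^esub> wlift S k) \<oplus>\<^bsub>kP S\<^esub> yComm S i j"
    and yComm_deep: "\<lbrakk>i \<in> {1..num S}; j \<in> {1..num S}\<rbrakk> \<Longrightarrow>
       yComm S i j \<in> rad_pow (kP S) (Suc (wdeg S i + wdeg S j))"
    and wlift_pow: "i \<in> {1..num S} \<Longrightarrow> wlift S i [^]\<^bsub>kP S\<^esub> CHAR('k) =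
         (\<Oplus>\<^bsub>kP S\<^esub>k\<in>{1..num S}. dLie S i k \<odot>\<^bsub>kP S\<^esub> wlift S k) \<oplus>\<^bsub>kP S\<^esub> yPow S i"
    and yPow_deep: "i \<in> {1..num S} \<Longrightarrow> yPow S i \<in> rad_pow (kP S) (Suc (CHAR('k) * wdeg S i))"


section \<open>The basic algebra, and its generators\<close>

definition ePhi :: "('p, 'h, 'k::field) block_data \<Rightarrow> ('h \<Rightarrow> 'k) \<Rightarrow> 'p \<times> 'h \<Rightarrow> 'k" where
  "ePhi S \<phi> = char_idem (grpP S) (grpH S) (centH S) \<phi>"

definition wPhi :: "('p, 'h, 'k::field) block_data \<Rightarrow> nat \<Rightarrow> ('h \<Rightarrow> 'k) \<Rightarrow> 'p \<times> 'h \<Rightarrow> 'k" where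
  "wPhi S i \<phi> = delta (\<one>\<^bsub>grpP S\<^esub>, gi S i \<phi>) \<otimes>\<^bsub>kG S\<^esub> embP (grpH S) (wlift S i) \<otimes>\<^bsub>kG S\<^esub> ePhi S \<phi>"

definition frakA :: "('p, 'h, 'k::field) block_data \<Rightarrow> ('k, 'p \<times> 'h \<Rightarrow> 'k) module" where
  "frakA S = gen_subalg (kGe S)
     (ePhi S ` IrrZ S \<union> {wPhi S i \<phi> | i \<phi>. i \<in> {1..num S} \<and> \<phi> \<in> IrrZ S})"

text \<open>The corresponding elements of \<open>k(P \<rtimes> Z(H)/Z)\<close>: here \<open>\<phi>\<close> is replaced by the character
  \<open>\<phi>\<phi>\<^sub>0\<^sup>-\<^sup>1\<close> of \<open>Z(H)/Z\<close>, and all \<open>g\<^bsub>i,\<phi>\<^esub>\<close> by \<open>1\<close>.\<close>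

definition ePhiM :: "('p, 'h, 'k::field) block_data \<Rightarrow> ('h \<Rightarrow> 'k) \<Rightarrow> 'p \<times> 'h set \<Rightarrow> 'k" where
  "ePhiM S \<phi> = char_idem (grpP S) (grpM S) (carrier (grpM S)) (\<lambda>C. the_elem ((\<lambda>h. \<phi> h / phi0 S h) ` C))"

definition wPhiM :: "('p, 'h, 'k::field) block_data \<Rightarrow> nat \<Rightarrow> ('h \<Rightarrow> 'k) \<Rightarrow> 'p \<times> 'h set \<Rightarrow> 'k" where
  "wPhiM S i \<phi> = embP (grpM S) (wlift S i) \<otimes>\<^bsub>kPM S\<^esub> ePhiM S \<phi>"


section \<open>Scalars\<close>

definition zSwap :: "('p, 'h, 'k::field) block_data \<Rightarrow> nat \<Rightarrow> nat \<Rightarrow> ('h \<Rightarrow> 'k) \<Rightarrow> 'h" where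
  "zSwap S i j \<phi> = inv\<^bsub>grpH S\<^esub> (gword S \<phi> [i, j]) \<otimes>\<^bsub>grpH S\<^esub> gword S \<phi> [j, i]"

definition zLie :: "('p, 'h, 'k::field) block_data \<Rightarrow> nat \<Rightarrow> nat \<Rightarrow> nat \<Rightarrow> ('h \<Rightarrow> 'k) \<Rightarrow> 'h" where
  "zLie S i j k \<phi> = inv\<^bsub>grpH S\<^esub> (gi S k \<phi>) \<otimes>\<^bsub>grpH S\<^esub> gword S \<phi> [j, i]"

definition zPow :: "('p, 'h, 'k::field) block_data \<Rightarrow> nat \<Rightarrow> nat \<Rightarrow> ('h \<Rightarrow> 'k) \<Rightarrow> 'h" where
  "zPow S i k \<phi> = inv\<^bsub>grpH S\<^esub> (gi S k \<phi>) \<otimes>\<^bsub>grpH S\<^esub> gword S \<phi> (replicate CHAR('k) i)"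

definition kappa :: "('p, 'h, 'k::field) block_data \<Rightarrow> nat \<Rightarrow> ('h \<Rightarrow> 'k) \<Rightarrow> 'k" where
  "kappa S i \<phi> = (\<Prod>a<CHAR('k) - 1.
     inverse (psi S i (gi S i (tws S \<phi> (replicate a i)))) ^ (CHAR('k) - 1 - a))"

definition qSwap :: "('p, 'h, 'k::field) block_data \<Rightarrow> nat \<Rightarrow> nat \<Rightarrow> ('h \<Rightarrow> 'k) \<Rightarrow> 'k" where
  "qSwap S i j \<phi> = psi S i (gi S j \<phi> \<otimes>\<^bsub>grpH S\<^esub> zSwap S i j \<phi>)
     * psi S j (inv\<^bsub>grpH S\<^esub> (gi S i \<phi>) \<otimes>\<^bsub>grpH S\<^esub> zSwap S i j \<phi>) * \<phi> (zSwap S i j \<phi>)"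

definition qLie :: "('p, 'h, 'k::field) block_data \<Rightarrow> nat \<Rightarrow> nat \<Rightarrow> nat \<Rightarrow> ('h \<Rightarrow> 'k) \<Rightarrow> 'k" where
  "qLie S i j k \<phi> = inverse (psi S j (gi S i \<phi>)) * psi S k (zLie S i j k \<phi>) * \<phi> (zLie S i j k \<phi>)"

definition qPow :: "('p, 'h, 'k::field) block_data \<Rightarrow> nat \<Rightarrow> nat \<Rightarrow> ('h \<Rightarrow> 'k) \<Rightarrow> 'k" where
  "qPow S i k \<phi> = kappa S i \<phi> * psi S k (zPow S i k \<phi>) * \<phi> (zPow S i k \<phi>)"

text \<open>The nonzero scalar \<open>q\<close> with \<open>g\<^bsub>i\<^sub>1,\<dots>\<^esub> \<cdots> g\<^bsub>i\<^sub>r,\<phi>\<^esub> w e\<^sub>\<phi> = q w\<^sub>\<phi>\<close>, for the PBW basis element \<open>w\<close> with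
  index \<open>xs\<close>.\<close>

definition qWord :: "('p, 'h, 'k::field) block_data \<Rightarrow> nat list \<Rightarrow> nat list \<Rightarrow> ('h \<Rightarrow> 'k) \<Rightarrow> 'k" where
  "qWord S is xs \<phi> = (THE q. q \<noteq> 0 \<and>
     delta (\<one>\<^bsub>grpP S\<^esub>, gword S \<phi> is) \<otimes>\<^bsub>kG S\<^esub> embP (grpH S) (wmon S xs) \<otimes>\<^bsub>kG S\<^esub> ePhi S \<phi>
       = q \<odot>\<^bsub>kG S\<^esub> uword S (kG S) (ePhi S) (wPhi S) \<phi> xs)"

text \<open>A family of scalars for the relations below.\<close>

record ('h, 'k) rel_scalars =
  sSwap :: "nat \<Rightarrow> nat \<Rightarrow> ('h \<Rightarrow> 'k) \<Rightarrow> 'k"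
  sLie :: "nat \<Rightarrow> nat \<Rightarrow> nat \<Rightarrow> ('h \<Rightarrow> 'k) \<Rightarrow> 'k"
  sErr :: "nat \<Rightarrow> nat \<Rightarrow> nat list \<Rightarrow> ('h \<Rightarrow> 'k) \<Rightarrow> 'k"
  sPow :: "nat \<Rightarrow> nat \<Rightarrow> ('h \<Rightarrow> 'k) \<Rightarrow> 'k"
  sPowErr :: "nat \<Rightarrow> nat list \<Rightarrow> ('h \<Rightarrow> 'k) \<Rightarrow> 'k"

definition quantum_scalars :: "('p, 'h, 'k::field) block_data \<Rightarrow> ('h, 'k) rel_scalars" where
  "quantum_scalars S = \<lparr>sSwap = qSwap S, sLie = qLie S,
     sErr = (\<lambda>i j xs \<phi>. inverse (psi S j (gi S i \<phi>)) * qWord S [j, i] xs \<phi>),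
     sPow = qPow S,
     sPowErr = (\<lambda>i xs \<phi>. kappa S i \<phi> * qWord S (replicate CHAR('k) i) xs \<phi>)\<rparr>"

definition classical_scalars :: "('h, 'k::field) rel_scalars" where
  "classical_scalars = \<lparr>sSwap = (\<lambda>i j \<phi>. 1), sLie = (\<lambda>i j k \<phi>. 1), sErr = (\<lambda>i j xs \<phi>. 1),
     sPow = (\<lambda>i k \<phi>. 1), sPowErr = (\<lambda>i xs \<phi>. 1)\<rparr>"


section \<open>Quiver and relations\<close>

text \<open>The arrow \<open>[\<phi>] \<rightarrow> [\<phi>\<psi>\<^sub>i]\<close> is \<open>(\<phi>, i)\<close>.\<close>

definition quiv :: "('p, 'h, 'k::field) block_data \<Rightarrow> ('h \<Rightarrow> 'k, ('h \<Rightarrow> 'k) \<times> nat) pre_digraph" where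
  "quiv S = \<lparr>verts = IrrZ S, arcs = IrrZ S \<times> {i \<in> {1..num S}. wdeg S i = 1},
     tail = fst, head = (\<lambda>a. tw S (fst a) (psi S (snd a)))\<rparr>"

type_synonym ('h, 'k) path_elt = "('h \<Rightarrow> 'k) \<times> (('h \<Rightarrow> 'k) \<times> nat) list \<Rightarrow> 'k"

definition kQ :: "('p, 'h, 'k::field) block_data \<Rightarrow> ('k, ('h, 'k) path_elt) module" where
  "kQ S = path_algebra (quiv S)"

definition vertex :: "('h \<Rightarrow> 'k) \<Rightarrow> ('h, 'k::field) path_elt" where
  "vertex \<phi> = delta (\<phi>, [])"

definition arrow :: "nat \<Rightarrow> ('h \<Rightarrow> 'k) \<Rightarrow> ('h, 'k::field) path_elt" where
  "arrow i \<phi> = delta (\<phi>, [(\<phi>, i)])"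

text \<open>\<open>W\<^bsub>i,\<phi>\<^esub>\<close> is a combination of paths from \<open>[\<phi>]\<close> to \<open>[\<phi>\<psi>\<^sub>i]\<close> that expresses \<open>U\<^bsub>i,\<phi>\<^esub>\<close> in terms of
  the arrows; if \<open>deg w\<^sub>i = 1\<close>, it is the arrow itself.\<close>

definition arrow_expressions :: "('p, 'h, 'k::field) block_data \<Rightarrow> ('k, 'a) module \<Rightarrow> (('h \<Rightarrow> 'k) \<Rightarrow> 'a)
    \<Rightarrow> (nat \<Rightarrow> ('h \<Rightarrow> 'k) \<Rightarrow> 'a) \<Rightarrow> (nat \<Rightarrow> ('h \<Rightarrow> 'k) \<Rightarrow> ('h, 'k) path_elt) \<Rightarrow> bool" where
  "arrow_expressions S A E U W \<longleftrightarrow> (\<forall>i\<in>{1..num S}. \<forall>\<phi>\<in>IrrZ S.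
     W i \<phi> \<in> carrier (kQ S) \<and>
     (\<forall>u es. W i \<phi> (u, es) \<noteq> 0 \<longrightarrow> u = \<phi> \<and> pre_digraph.awalk (quiv S) \<phi> es (tw S \<phi> (psi S i))) \<and>
     path_eval A E (\<lambda>a. U (snd a) (fst a)) (W i \<phi>) = U i \<phi> \<and>
     (wdeg S i = 1 \<longrightarrow> W i \<phi> = arrow i \<phi>))"

text \<open>
  The sign of the structure constants in the commutator relations is forced by
  \<open>w\<^sub>j w\<^sub>i - w\<^sub>i w\<^sub>j = -[w\<^sub>i, w\<^sub>j]\<close>, where the constants \<open>c\<^bsub>i,j,k\<^esub>\<close> and \<open>c\<^bsub>i,j,w\<^esub>\<close> are those
  of \<open>[w\<^sub>i, w\<^sub>j]\<close>. Accordingly the sums are added to, not subtracted from, the left hand side.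
\<close>

definition comm_rel :: "('p, 'h, 'k::field) block_data \<Rightarrow> ('h, 'k) rel_scalars
    \<Rightarrow> (nat \<Rightarrow> ('h \<Rightarrow> 'k) \<Rightarrow> ('h, 'k) path_elt) \<Rightarrow> nat \<Rightarrow> nat \<Rightarrow> ('h \<Rightarrow> 'k) \<Rightarrow> ('h, 'k) path_elt" where
  "comm_rel S q W i j \<phi> =
     (W j (tw S \<phi> (psi S i)) \<otimes>\<^bsub>kQ S\<^esub> W i \<phi>
        \<ominus>\<^bsub>kQ S\<^esub> sSwap q i j \<phi> \<odot>\<^bsub>kQ S\<^esub> (W i (tw S \<phi> (psi S j)) \<otimes>\<^bsub>kQ S\<^esub> W j \<phi>))
     \<oplus>\<^bsub>kQ S\<^esub> ((\<Oplus>\<^bsub>kQ S\<^esub>k\<in>{1..num S}. (cLie S i j k * sLie q i j k \<phi>) \<odot>\<^bsub>kQ S\<^esub> W k \<phi>)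
        \<oplus>\<^bsub>kQ S\<^esub> (\<Oplus>\<^bsub>kQ S\<^esub>xs\<in>PBW S. (sErr q i j xs \<phi> * cErr S i j xs) \<odot>\<^bsub>kQ S\<^esub> uword S (kQ S) vertex W \<phi> xs))"

definition pow_rel :: "('p, 'h, 'k::field) block_data \<Rightarrow> ('h, 'k) rel_scalars
    \<Rightarrow> (nat \<Rightarrow> ('h \<Rightarrow> 'k) \<Rightarrow> ('h, 'k) path_elt) \<Rightarrow> nat \<Rightarrow> ('h \<Rightarrow> 'k) \<Rightarrow> ('h, 'k) path_elt" where
  "pow_rel S q W i \<phi> =
     uword S (kQ S) vertex W \<phi> (replicate CHAR('k) i)
     \<ominus>\<^bsub>kQ S\<^esub> ((\<Oplus>\<^bsub>kQ S\<^esub>k\<in>{1..num S}. (dLie S i k * sPow q i k \<phi>) \<odot>\<^bsub>kQ S\<^esub> W k \<phi>)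
        \<oplus>\<^bsub>kQ S\<^esub> (\<Oplus>\<^bsub>kQ S\<^esub>xs\<in>PBW S. (sPowErr q i xs \<phi> * dErr S i xs) \<odot>\<^bsub>kQ S\<^esub> uword S (kQ S) vertex W \<phi> xs))"

definition rel_ideal :: "('p, 'h, 'k::field) block_data \<Rightarrow> ('h, 'k) rel_scalars
    \<Rightarrow> (nat \<Rightarrow> ('h \<Rightarrow> 'k) \<Rightarrow> ('h, 'k) path_elt) \<Rightarrow> ('h, 'k) path_elt set" where
  "rel_ideal S q W = Idl\<^bsub>kQ S\<^esub>
     ({comm_rel S q W i j \<phi> | i j \<phi>. i \<in> {1..num S} \<and> j \<in> {1..num S} \<and> \<phi> \<in> IrrZ S} \<union>
      {pow_rel S q W i \<phi> | i \<phi>. i \<in> {1..num S} \<and> \<phi> \<in> IrrZ S} \<union>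
      {delta x | x. x \<in> paths (quiv S) \<and> rad_length (kP S) \<le> length (snd x)})"

text \<open>
  \<open>A\<close> is the quiver algebra with the relations given by the scalars \<open>q\<close>, with vertices and arrows
  corresponding to the given elements \<open>E\<^sub>\<phi>\<close> and \<open>U\<^bsub>i,\<phi>\<^esub>\<close>, whichever expressions of the \<open>U\<^bsub>i,\<phi>\<^esub>\<close> in
  terms of the arrows are chosen.
\<close>

definition presented_by :: "('p, 'h, 'k::field) block_data \<Rightarrow> ('h, 'k) rel_scalars \<Rightarrow> ('k, 'a) module
    \<Rightarrow> (('h \<Rightarrow> 'k) \<Rightarrow> 'a) \<Rightarrow> (nat \<Rightarrow> ('h \<Rightarrow> 'k) \<Rightarrow> 'a) \<Rightarrow> bool" where
  "presented_by S q A E U \<longleftrightarrow>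
     (\<exists>W. arrow_expressions S A E U W) \<and>
     (\<forall>W. arrow_expressions S A E U W \<longrightarrow>
        (\<exists>\<Psi>\<in>alg_iso (quot_alg (kQ S) (rel_ideal S q W)) A.
           (\<forall>\<phi>\<in>IrrZ S. \<Psi> (rel_ideal S q W +>\<^bsub>kQ S\<^esub> vertex \<phi>) = E \<phi>) \<and>
           (\<forall>\<phi>\<in>IrrZ S. \<forall>i\<in>{1..num S}. wdeg S i = 1 \<longrightarrow>
              \<Psi> (rel_ideal S q W +>\<^bsub>kQ S\<^esub> arrow i \<phi>) = U i \<phi>)))"

end

theory Submission
 imports Defs "HOL-Library.Function_Algebras" "HOL-Library.Multiset" "HOL-Number_Theory.Cong"
begin

text \<open>
  Presentation: words in the generators can be straightened into PBW words modulo the relations,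
  because a commutator or a \<open>p\<close>-th power is replaced by shorter words of the same weight and by
  words of larger weight, and words of large weight vanish. The PBW monomials are a basis of \<open>kP\<close>,
  since they span it and their number is at most \<open>|P|\<close>; hence the PBW words are linearly independent
  in the algebra, and the relations suffice. The scalars appear when the group elements
  \<open>g\<^bsub>i,\<phi>\<^esub>\<close> in a word are collected on the left: two such products with the same \<open>H\<close>-eigenvalue
  have the same image under \<open>\<rho>\<close>, so they differ by an element of \<open>Z(H)\<close>, which acts as a scalar.

  Morita equivalence: \<open>h \<mapsto> \<Sum>\<^sub>\<phi> \<xi>\<^sub>\<phi>(h)\<^sup>-\<^sup>1 h e\<^sub>\<phi>\<close> is a homomorphism from \<open>H\<close> to the units of \<open>kGe\<close>
  that commutes with the generators. An extension of \<open>\<phi>\<^sub>0\<close> to a maximal isotropic subgroup of \<open>H\<close>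
  gives an idempotent in the span of its image, whose conjugates are the diagonal of a system of matrix
  units, and the corner at this idempotent is isomorphic to the algebra of the generators.
\<close>

text \<open>Both algebras, \<open>frakA S\<close> and \<open>kPM S\<close>, are treated by one
  criterion, the locale \<open>quiver_presentation\<close>; the relations of the two cases differ in
  the scalars alone. The field may be infinite, so the fixed point count behind the nilpotency of
  the augmentation ideal is made on the functions with values in the prime field. The bracket and
  the p-map are given by their effect on classes of group elements; the degrees of the structure
  constants are derived from these classes and from Jacobson's formula, and these degrees make
  straightening terminate. The Jennings map enters in degree one: the lifts of degree one generate
  the augmentation ideal modulo its square, and all deeper powers are then spanned by words in these
  lifts. The scalar in the sum of the conjugates of the isotropic idempotent is determined by
  idempotency: the sum is an idempotent and a nonzero multiple of the identity of
  \<open>kGe S\<close>.\<close>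

abbreviation mult_in ("_ *[_] _" [70, 0, 71] 70) where "x *[A] y \<equiv> x \<otimes>\<^bsub>A\<^esub> y"
abbreviation smult_in ("_ *.[_] _" [70, 0, 71] 70) where "c *.[A] x \<equiv> c \<odot>\<^bsub>A\<^esub> x"
abbreviation add_in ("_ +[_] _" [65, 0, 66] 65) where "x +[A] y \<equiv> x \<oplus>\<^bsub>A\<^esub> y"
abbreviation one_in ("#1[_]") where "#1[A] \<equiv> \<one>\<^bsub>A\<^esub>"
abbreviation zero_in ("#0[_]") where "#0[A] \<equiv> \<zero>\<^bsub>A\<^esub>"
abbreviation inv_in ("inv[_] _" [0, 81] 80) where "inv[A] x \<equiv> inv\<^bsub>A\<^esub> x"

section \<open>Algebras of functions\<close>

text \<open>Pointwise scaling gets a name so that span, subspace and independence from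
  \<open>vector_space\<close> apply to the function spaces on which the group and path algebras
  live.\<close>

definition scl :: "'k::field => ('x => 'k) => 'x => 'k" where
 "scl c f = (%x. c * f x)"

lemma scl_apply: "scl c f x = c * f x"
 by (simp add: scl_def)

text \<open>The induction method produces eta-expanded functions, in which these rules would fire.\<close>

declare plus_fun_apply [simp del] zero_fun_apply [simp del] minus_apply [simp del] uminus_apply [simp del]

lemmas pointwise = plus_fun_apply zero_fun_apply minus_apply uminus_apply scl_apply

global_interpretation fv: vector_space scl
 by unfold_locales (auto simp: fun_eq_iff algebra_simps pointwise)

lemma sum_apply: "(SUM i:I. f i) x = (SUM i:I. f i x)" for f :: "'i => 'x => 'k::comm_monoid_add"
 by (induction I rule: infinite_finite_induct) (auto simp: pointwise)

lemma delta_apply: "delta x y = (if y = x then 1 else 0)"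
 by (simp add: delta_def)

lemma supp_expand:
 fixes f :: "'x => 'k::field"
 assumes "finite U" "!!x. f x ~= 0 ==> x : U"
 shows "f = (SUM x:U. scl (f x) (delta x))"
proof
 fix y
 show "f y = (SUM x:U. scl (f x) (delta x)) y"
  using assms by (auto simp: sum_apply delta_apply pointwise if_distrib sum.delta cong: if_cong)
qed

lemma span_sumI:
 "(!!i. i : I ==> f i : fv.span B) ==> (SUM i:I. scl (c i) (f i)) : fv.span B"
 by (intro fv.span_sum fv.span_scale)

text \<open>Multiplications such as convolution are defined for all functions; only the unit law needs
  the carrier.\<close>

locale pmul =
 fixes mul :: "('x => 'k::field) => ('x => 'k) => 'x => 'k" (infixl \<open>\<star>\<close> 70)
 assumes add_l: "(f + g) \<star> h = f \<star> h + g \<star> h"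
  and add_r: "h \<star> (f + g) = h \<star> f + h \<star> g"
  and scl_l: "scl c f \<star> g = scl c (f \<star> g)"
  and scl_r: "f \<star> scl c g = scl c (f \<star> g)"
  and assoc: "(f \<star> g) \<star> h = f \<star> (g \<star> h)"
begin

lemma zero_l [simp]: "0 \<star> f = 0"
 using add_l[of 0 0 f] by simp

lemma zero_r [simp]: "f \<star> 0 = 0"
 using add_r[of f 0 0] by simp

lemma neg_l: "(- f) \<star> g = - (f \<star> g)"
 using add_l[of "- f" f g] by (simp add: eq_neg_iff_add_eq_0)

lemma neg_r: "f \<star> (- g) = - (f \<star> g)"
 using add_r[of f "- g" g] by (simp add: eq_neg_iff_add_eq_0)

lemma diff_l: "(f - g) \<star> h = f \<star> h - g \<star> h"
 using add_l[of f "- g" h] by (simp add: neg_l)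

lemma diff_r: "h \<star> (f - g) = h \<star> f - h \<star> g"
 using add_r[of h f "- g"] by (simp add: neg_r)

lemma sum_l: "(SUM i:I. f i) \<star> g = (SUM i:I. f i \<star> g)"
 using sum_comp_morphism[of "%x. x \<star> g" f I] by (simp add: add_l o_def)

lemma sum_r: "g \<star> (SUM i:I. f i) = (SUM i:I. g \<star> f i)"
 using sum_comp_morphism[of "%x. g \<star> x" f I] by (simp add: add_r o_def)

lemmas distribs = add_l add_r diff_l diff_r sum_l sum_r scl_l scl_r neg_l neg_r

text \<open>Bilinearity reduces membership of a product to generators of the two factors. The target
  \<open>U\<close> is any subspace, so one rule serves carriers, powers of ideals and spans of
  words.\<close>

lemma span_mul:
 assumes "x : fv.span B" "y : fv.span C" "fv.subspace U"
  and "!!b c. b : B ==> c : C ==> b \<star> c : U"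
 shows "x \<star> y : U"
proof -
 have 1: "b \<star> y : U" if "b : B" for b
  using assms(2)
 proof (induction rule: fv.span_induct_alt)
  case base show ?case unfolding zero_r using assms(3) by (rule fv.subspace_0)
 next
  case (step c x y)
  thus ?case using assms(3,4) that by (auto simp: distribs intro: fv.subspace_add fv.subspace_scale)
 qed
 show ?thesis
  using assms(1)
 proof (induction rule: fv.span_induct_alt)
  case base show ?case unfolding zero_l using assms(3) by (rule fv.subspace_0)
 next
  case (step c x y)
  thus ?case using assms(3) 1 by (auto simp: distribs intro: fv.subspace_add fv.subspace_scale)
 qed
qed

end

lemma module_scalarI:
 fixes A :: "('k::field, 'a) module"
 assumes "abelian_group A"
  and "!!c x. x : carrier A ==> c *.[A] x : carrier A"
  and "!!c d x. x : carrier A ==> (c + d) *.[A] x = c *.[A] x +[A] d *.[A] x"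
  and "!!c x y. x : carrier A ==> y : carrier A ==> c *.[A] (x +[A] y) = c *.[A] x +[A] c *.[A] y"
  and "!!c d x. x : carrier A ==> (c * d) *.[A] x = c *.[A] (d *.[A] x)"
  and "!!x. x : carrier A ==> 1 *.[A] x = x"
 shows "module ring_of_type_algebra A"
proof (rule moduleI)
 show "cring (ring_of_type_algebra :: 'k ring)" by blast
qed (use assms in \<open>auto simp: ring_of_type_algebra_def\<close>)

lemma module_scalarD:
 fixes A :: "('k::field, 'a) module"
 assumes "module ring_of_type_algebra A"
 shows "abelian_group A"
  "x : carrier A ==> c *.[A] x : carrier A"
  "x : carrier A ==> (c + d) *.[A] x = c *.[A] x +[A] d *.[A] x"
  "x : carrier A ==> y : carrier A ==> c *.[A] (x +[A] y) = c *.[A] x +[A] c *.[A] y"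
  "x : carrier A ==> (c * d) *.[A] x = c *.[A] (d *.[A] x)"
  "x : carrier A ==> 1 *.[A] x = x"
proof -
 interpret module "ring_of_type_algebra :: 'k ring" A by fact
 show "abelian_group A" by (rule M.abelian_group_axioms)
 show "x : carrier A ==> c *.[A] x : carrier A"
  "x : carrier A ==> (c + d) *.[A] x = c *.[A] x +[A] d *.[A] x"
  "x : carrier A ==> y : carrier A ==> c *.[A] (x +[A] y) = c *.[A] x +[A] c *.[A] y"
  "x : carrier A ==> (c * d) *.[A] x = c *.[A] (d *.[A] x)"
  "x : carrier A ==> 1 *.[A] x = x"
  using smult_closed[of c x] smult_l_distr[of c d x] smult_r_distr[of c x y] smult_assoc1[of c d x]
   smult_one[of x]
  by (auto simp: ring_of_type_algebra_def)
qed

text \<open>The group algebras, the path algebra and their subalgebras all consist of functions with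
  pointwise addition and scaling. Stating this once lets sums, negatives and scalars of the record
  be replaced by those of the function type, so that only the product still refers to
  \<open>A\<close>.\<close>

locale fun_alg = pmul "monoid.mult A"
 for A :: "('k::field, 'x => 'k) module" +
 assumes add_A: "ring.add A = (+)"
  and zero_A: "ring.zero A = 0"
  and smult_A: "module.smult A = scl"
  and sub_A: "fv.subspace (carrier A)"
  and mul_closed: "x : carrier A ==> y : carrier A ==> x *[A] y : carrier A"
  and one_closed: "#1[A] : carrier A"
  and one_l: "x : carrier A ==> #1[A] *[A] x = x"
  and one_r: "x : carrier A ==> x *[A] #1[A] = x"
begin

lemmas closed = mul_closed one_closed fv.subspace_add[OF sub_A] fv.subspace_scale[OF sub_A]
 fv.subspace_0[OF sub_A] fv.subspace_diff[OF sub_A] fv.subspace_sum[OF sub_A] fv.subspace_neg[OF sub_A]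

lemma abelian_group_A: "abelian_group A"
proof (rule abelian_groupI)
 fix x assume "x : carrier A"
 thus "EX y:carrier A. y +[A] x = #0[A]"
  by (intro bexI[of _ "- x"]) (auto simp: add_A zero_A closed)
qed (auto simp: add_A zero_A closed add.assoc add.commute)

lemma ring_A: "ring A"
proof (rule ringI)
 show "abelian_group A" by (rule abelian_group_A)
 show "Group.monoid A"
  by (rule monoidI) (auto simp: closed one_l one_r assoc)
qed (auto simp: add_A distribs)

lemma module_A: "module ring_of_type_algebra A"
 by (rule module_scalarI) (auto simp: abelian_group_A smult_A add_A closed fun_eq_iff algebra_simps pointwise)

lemma k_algebra_A: "k_algebra A"
 by (auto simp: k_algebra_def module_A ring_A smult_A distribs)

lemma finsum_A: "f : S \<rightarrow> carrier A ==> finsum A f S = sum f S"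
proof (induction S rule: infinite_finite_induct)
 case (insert x S)
 interpret abelian_group A by (rule abelian_group_A)
 from insert show ?case by (simp add: add_A finsum_insert)
next
 case empty
 thus ?case using abelian_monoid.finsum_empty[OF abelian_group.axioms(1)[OF abelian_group_A]] by (simp only: zero_A sum.empty)
next
 case (infinite B)
 thus ?case by (simp only: finsum_def finprod_def sum.infinite) (simp add: zero_A)
qed

lemma a_inv_A: "x : carrier A ==> \<ominus>\<^bsub>A\<^esub> x = - x"
proof -
 interpret abelian_group A by (rule abelian_group_A)
 assume "x : carrier A"
 thus ?thesis
  by (intro minus_equality) (auto simp: add_A zero_A closed)
qed

lemma minus_A: "y : carrier A ==> x \<ominus>\<^bsub>A\<^esub> y = x - y"
 by (simp add: a_minus_def a_inv_A add_A)

lemma sub_algebra: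
 assumes "fv.subspace B" "B <= carrier A" "i : B"
  and "!!x y. x : B ==> y : B ==> x *[A] y : B"
  and "!!x. x : B ==> i *[A] x = x" "!!x. x : B ==> x *[A] i = x"
 shows "fun_alg (A\<lparr>carrier := B, one := i\<rparr>)"
proof -
 have "pmul (monoid.mult (A\<lparr>carrier := B, one := i\<rparr>))"
  by (simp add: pmul_axioms)
 thus ?thesis
  unfolding fun_alg_def fun_alg_axioms_def using assms by (simp add: add_A zero_A smult_A)
qed

lemma corner_carrier:
 assumes "i : carrier A" "i *[A] i = i"
 shows "x : carrier (corner_alg A i) \<longleftrightarrow> x : carrier A & i *[A] x = x & x *[A] i = x"
proof
 assume "x : carrier (corner_alg A i)"
 then obtain y where y: "y : carrier A" "x = i *[A] y *[A] i" by (auto simp: corner_alg_def)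
 thus "x : carrier A & i *[A] x = x & x *[A] i = x"
  using assms by (simp add: closed assoc) (simp add: assms(2) flip: assoc)
next
 assume "x : carrier A & i *[A] x = x & x *[A] i = x"
 thus "x : carrier (corner_alg A i)"
  by (auto simp: corner_alg_def image_iff intro!: bexI[of _ x])
qed

lemma corner_fun_alg:
 assumes "i : carrier A" "i *[A] i = i"
 shows "fun_alg (corner_alg A i)"
proof -
 let ?B = "(%x. i *[A] x *[A] i) ` carrier A"
 define B where "B = ?B"
 have B: "x : B \<longleftrightarrow> x : carrier A & i *[A] x = x & x *[A] i = x" for x
  using corner_carrier[OF assms, of x] by (simp add: corner_alg_def B_def)
 have 1: "fv.subspace B"
  unfolding fv.subspace_def using closed B by (auto simp: distribs)
 have "fun_alg (A\<lparr>carrier := B, one := i\<rparr>)"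
 proof (rule sub_algebra[OF 1])
  fix x y assume "x : B" "y : B"
  thus "x *[A] y : B" unfolding B by (simp add: closed assoc) (simp flip: assoc)
 qed (use B assms in auto)
 thus ?thesis unfolding corner_alg_def B_def .
qed

end

section \<open>Twisted group algebras\<close>

locale tga = group T for T :: "('g, 'm) monoid_scheme" (structure) +
 fixes al :: "'g \<times> 'g => 'k::field"
 assumes fin: "finite (carrier T)"
  and coc_nz: "x : carrier T ==> y : carrier T ==> al (x, y) ~= 0"
  and coc: "[|x : carrier T; y : carrier T; z : carrier T|] ==>
   al (x, y) * al (x \<otimes> y, z) = al (x, y \<otimes> z) * al (y, z)"
begin

abbreviation kT :: "('k, 'g => 'k) module" where "kT \<equiv> twisted_group_algebra T al"

lemma carrier_kT: "carrier kT = {f. \<forall>x. f x ~= 0 --> x : carrier T}"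
 using fin by (auto simp: twisted_group_algebra_def free_mod_def intro: finite_subset)

lemma mult_kT: "f *[kT] g = (SUM s:carrier T. SUM t:carrier T. scl (al (s, t) * (f s * g t)) (delta (s \<otimes> t)))"
proof
 fix x
 have eq: "{(y, z). y : carrier T & z : carrier T & y \<otimes> z = x} = {v : carrier T \<times> carrier T. fst v \<otimes> snd v = x}"
  by auto
 have "(f *[kT] g) x = (SUM v:carrier T \<times> carrier T. if fst v \<otimes> snd v = x then al (fst v, snd v) * (f (fst v) * g (snd v)) else 0)"
 proof -
  have "(f *[kT] g) x = (SUM v:{v : carrier T \<times> carrier T. fst v \<otimes> snd v = x}. al (fst v, snd v) * (f (fst v) * g (snd v)))"
   unfolding twisted_group_algebra_def by (simp add: eq case_prod_beta)
  thus ?thesis using fin by (subst (asm) sum.inter_filter) auto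
 qed
 also have "... = (SUM s:carrier T. SUM t:carrier T. if s \<otimes> t = x then al (s, t) * (f s * g t) else 0)"
  by (simp add: sum.cartesian_product case_prod_beta)
 also have "... = (SUM s:carrier T. SUM t:carrier T. scl (al (s, t) * (f s * g t)) (delta (s \<otimes> t))) x"
  by (auto simp: sum_apply delta_apply pointwise intro!: sum.cong)
 finally show "(f *[kT] g) x = (SUM s:carrier T. SUM t:carrier T. scl (al (s, t) * (f s * g t)) (delta (s \<otimes> t))) x" .
qed

lemma mult_kT_delta:
 assumes "s : carrier T" "t : carrier T"
 shows "delta s *[kT] delta t = scl (al (s, t)) (delta (s \<otimes> t))"
proof -
 have "delta s *[kT] delta t = (SUM s':carrier T. SUM t':carrier T. if t' = t then (if s' = s then scl (al (s, t)) (delta (s \<otimes> t)) else 0) else 0)"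
  unfolding mult_kT by (intro sum.cong refl) (auto simp: delta_apply fun_eq_iff pointwise)
 thus ?thesis using assms fin by simp
qed

lemma mult_kT_add_l: "(f + g) *[kT] h = f *[kT] h + g *[kT] h"
 by (simp add: mult_kT pointwise distrib_left distrib_right fv.scale_left_distrib sum.distrib)

lemma mult_kT_add_r: "h *[kT] (f + g) = h *[kT] f + h *[kT] g"
 by (simp add: mult_kT pointwise distrib_left distrib_right fv.scale_left_distrib sum.distrib)

lemma mult_kT_scl_l: "scl c f *[kT] g = scl c (f *[kT] g)"
 by (simp add: mult_kT pointwise fv.scale_sum_right algebra_simps)

lemma mult_kT_scl_r: "f *[kT] scl c g = scl c (f *[kT] g)"
 by (simp add: mult_kT pointwise fv.scale_sum_right algebra_simps)

lemma mult_kT_sum_l: "(SUM i:I. f i) *[kT] g = (SUM i:I. f i *[kT] g)"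
proof -
 have "(%x. x *[kT] g) 0 = 0" by (simp add: mult_kT pointwise)
 thus ?thesis using sum_comp_morphism[of "%x. x *[kT] g" f I] by (simp add: mult_kT_add_l o_def)
qed

lemma mult_kT_sum_r: "g *[kT] (SUM i:I. f i) = (SUM i:I. g *[kT] f i)"
proof -
 have "(%x. g *[kT] x) 0 = 0" by (simp add: mult_kT pointwise)
 thus ?thesis using sum_comp_morphism[of "%x. g *[kT] x" f I] by (simp add: mult_kT_add_r o_def)
qed

lemma mult_kT_assoc: "(f *[kT] g) *[kT] h = f *[kT] (g *[kT] h)"
proof -
 \<comment> \<open>The three functions are arbitrary, but the product sees only their values on
   \<open>carrier T\<close>. Replacing them by \<open>F\<close>, \<open>K\<close> and
   \<open>H\<close>, which are combinations of basis elements, reduces associativity to the cocycle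
   identity.\<close>
 define F where "F = (SUM s:carrier T. scl (f s) (delta s))"
 define H where "H = (SUM s:carrier T. scl (h s) (delta s))"
 define K where "K = (SUM s:carrier T. scl (g s) (delta s))"
 have e: "(SUM s:carrier T. scl (y s) (delta s)) t = y t" if "t : carrier T" for y :: "'g => 'k" and t
 proof -
  have "(SUM s:carrier T. scl (y s) (delta s)) t = (SUM s:carrier T. if s = t then y s else 0)"
   unfolding sum_apply scl_apply delta_apply by (intro sum.cong) auto
  thus ?thesis using that fin by simp
 qed
 have F: "f *[kT] x = F *[kT] x" and H: "x *[kT] h = x *[kT] H" and K: "g *[kT] x = K *[kT] x" for x
  unfolding mult_kT F_def H_def K_def by (simp_all add: e cong: sum.cong)
 have K': "f *[kT] g = f *[kT] K"
  unfolding mult_kT K_def by (simp add: e cong: sum.cong)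
 have d: "(delta x *[kT] delta y) *[kT] delta z = delta x *[kT] (delta y *[kT] delta z)"
  if "x : carrier T" "y : carrier T" "z : carrier T" for x y z
 proof -
  have c: "al (x, y) * al (x \<otimes> y, z) = al (y, z) * al (x, y \<otimes> z)"
   using coc[OF that] by (metis mult.commute)
  show ?thesis using that by (simp add: mult_kT_delta mult_kT_scl_l mult_kT_scl_r m_assoc c)
 qed
 have 1: "(F *[kT] delta y) *[kT] delta z = F *[kT] (delta y *[kT] delta z)"
  if "y : carrier T" "z : carrier T" for y z
  unfolding F_def mult_kT_sum_l mult_kT_scl_l using d that by (intro sum.cong arg_cong2[where f=scl]) auto
 have 2: "(F *[kT] K) *[kT] delta z = F *[kT] (K *[kT] delta z)"
  if "z : carrier T" for z
  unfolding K_def mult_kT_sum_l mult_kT_scl_l mult_kT_sum_r mult_kT_scl_r using 1 that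
  by (intro sum.cong arg_cong2[where f=scl]) auto
 have 3: "(F *[kT] K) *[kT] H = F *[kT] (K *[kT] H)"
  unfolding H_def mult_kT_sum_l mult_kT_scl_l mult_kT_sum_r mult_kT_scl_r using 2
  by (intro sum.cong arg_cong2[where f=scl]) auto
 have "(f *[kT] g) *[kT] h = (f *[kT] K) *[kT] h" by (simp only: K')
 also have "... = (F *[kT] K) *[kT] H" by (simp only: F H)
 also have "... = F *[kT] (K *[kT] H)" by (rule 3)
 also have "... = f *[kT] (g *[kT] h)" by (simp only: K F H)
 finally show ?thesis .
qed

text \<open>The cocycle identity at (1, 1, x), with the nonzero factor al(1, x) cancelled. For a
  cocycle that is not normalised this constancy is what makes a multiple of the basis element of 1 a
  unit element.\<close>

lemma coc_one_l: "x : carrier T ==> al (\<one>, x) = al (\<one>, \<one>)"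
proof -
 assume x: "x : carrier T"
 have "al (\<one>, \<one>) * al (\<one>, x) = al (\<one>, x) * al (\<one>, x)" using coc[OF one_closed one_closed x] unfolding l_one[OF one_closed] l_one[OF x] .
 thus ?thesis using coc_nz[OF one_closed x] by simp
qed

lemma coc_one_r: "x : carrier T ==> al (x, \<one>) = al (\<one>, \<one>)"
proof -
 assume x: "x : carrier T"
 have "al (x, \<one>) * al (x, \<one>) = al (x, \<one>) * al (\<one>, \<one>)" using coc[OF x one_closed one_closed] unfolding r_one[OF one_closed] r_one[OF x] .
 thus ?thesis using coc_nz[OF x one_closed] by simp
qed

lemma one_kT: "#1[kT] = scl (inverse (al (\<one>, \<one>))) (delta \<one>)"
 by (simp add: twisted_group_algebra_def fun_eq_iff pointwise)

lemma expand: "f : carrier kT ==> f = (SUM t:carrier T. scl (f t) (delta t))"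
 by (rule supp_expand) (auto simp: fin carrier_kT)

lemma delta_in: "t : carrier T ==> delta t : carrier kT"
 by (auto simp: carrier_kT delta_apply)

lemma subspace_kT: "fv.subspace (carrier kT)"
 unfolding carrier_kT fv.subspace_def by (auto simp: pointwise) (metis add.right_neutral)

lemma carrier_span: "carrier kT = fv.span (delta ` carrier T)"
proof
 show "carrier kT <= fv.span (delta ` carrier T)"
 proof
  fix f assume "f : carrier kT"
  hence "f = (SUM t:carrier T. scl (f t) (delta t))" by (rule expand)
  also have "... : fv.span (delta ` carrier T)" by (intro span_sumI fv.span_base imageI)
  finally show "f : fv.span (delta ` carrier T)" .
 qed
 show "fv.span (delta ` carrier T) <= carrier kT"
  by (rule fv.span_minimal) (auto simp: delta_in subspace_kT)
qed

sublocale kT: fun_alg kT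
proof
 show "x *[kT] y : carrier kT" for x y
  unfolding mult_kT
  by (intro fv.subspace_sum fv.subspace_scale subspace_kT delta_in m_closed)
 show "#1[kT] : carrier kT"
  unfolding one_kT by (intro fv.subspace_scale subspace_kT delta_in one_closed)
 fix x assume x: "x : carrier kT"
 have nz: "al (\<one>, \<one>) ~= 0" by (simp add: coc_nz)
 have l: "#1[kT] *[kT] delta t = delta t" if "t : carrier T" for t
  using that nz by (simp add: one_kT mult_kT_scl_l mult_kT_delta coc_one_l[OF that])
 have r: "delta t *[kT] #1[kT] = delta t" if "t : carrier T" for t
  using that nz by (simp add: one_kT mult_kT_scl_r mult_kT_delta coc_one_r[OF that])
 have "#1[kT] *[kT] (SUM t:carrier T. scl (x t) (delta t)) = (SUM t:carrier T. scl (x t) (delta t))"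
  by (simp only: mult_kT_sum_r mult_kT_scl_r l cong: sum.cong)
 thus "#1[kT] *[kT] x = x" unfolding expand[OF x, symmetric] .
 have "(SUM t:carrier T. scl (x t) (delta t)) *[kT] #1[kT] = (SUM t:carrier T. scl (x t) (delta t))"
  by (simp only: mult_kT_sum_l mult_kT_scl_l r cong: sum.cong)
 thus "x *[kT] #1[kT] = x" unfolding expand[OF x, symmetric] .
next
 show "ring.add kT = (+)" "#0[kT] = 0" "module.smult kT = scl"
  by (auto simp: twisted_group_algebra_def free_mod_def fun_eq_iff pointwise)
qed (rule mult_kT_add_l mult_kT_add_r mult_kT_scl_l mult_kT_scl_r mult_kT_assoc subspace_kT)+

end

locale group_alg = group T for T :: "('g, 'm) monoid_scheme" (structure) +
 fixes kT :: "('k::field, 'g => 'k) module"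
 assumes finite_T: "finite (carrier T)"
  and kT_def: "kT = group_algebra T"
begin

sublocale tw: tga T "%_. 1 :: 'k"
 by unfold_locales (auto simp: finite_T)

lemma kT_tw: "kT = twisted_group_algebra T (%_. 1)"
 by (simp add: kT_def group_algebra_def)

sublocale fun_alg kT
 unfolding kT_tw by (rule tw.kT.fun_alg_axioms)

lemmas carrier_kT = tw.carrier_kT[folded kT_tw]
 and expand = tw.expand[folded kT_tw]
 and delta_in = tw.delta_in[folded kT_tw]
 and carrier_span = tw.carrier_span[folded kT_tw]

lemma mul_delta: "s : carrier T ==> t : carrier T ==> delta s *[kT] delta t = delta (s \<otimes> t)"
 using tw.mult_kT_delta[of s t] by (simp add: kT_tw)

lemma mult_def: "f *[kT] g = (SUM s:carrier T. SUM t:carrier T. scl (f s * g t) (delta (s \<otimes> t)))"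
 using tw.mult_kT[of f g] by (simp add: kT_tw)

lemma one_delta: "#1[kT] = delta \<one>"
 using tw.one_kT by (simp add: kT_tw)

end

section \<open>Linear characters\<close>

text \<open>The values on \<open>B\<close> are all that is recorded, so a character can be
  restricted, extended or multiplied without adjusting its domain; \<open>HomHZ\<close> and
  \<open>IrrZ\<close> add extensionality, on which equality of vertices rests.\<close>

definition lchar :: "('g, 'm) monoid_scheme => 'g set => ('g => 'k::field) => bool" where
 "lchar G B l \<longleftrightarrow> (ALL x:B. l x ~= 0) & (ALL x:B. ALL y:B. l (x *[G] y) = l x * l y)"

lemma lchar_nz: "lchar G B l ==> x : B ==> l x ~= 0"
 by (simp add: lchar_def)

lemma lchar_mult: "lchar G B l ==> x : B ==> y : B ==> l (x *[G] y) = l x * l y"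
 by (simp add: lchar_def)

lemma lchar_subset: "lchar G B l ==> A <= B ==> lchar G A l"
 by (auto simp: lchar_def)

lemma lchar_hom:
 "l : hom (G\<lparr>carrier := B\<rparr>) kx \<longleftrightarrow> lchar G B l"
 by (auto simp: hom_def lchar_def ring_of_type_algebra_def)

context group
begin

lemma lchar_one: "lchar G B l ==> \<one> : B ==> l \<one> = 1"
 using lchar_mult[of G B l \<one> \<one>] lchar_nz[of G B l \<one>] by simp

lemma lchar_inv: "lchar G B l ==> subgroup B G ==> x : B ==> l (inv x) = inverse (l x)"
 using lchar_mult[of G B l x "inv x"] lchar_one[of B l] lchar_nz[of G B l x]
 by (simp add: subgroup.m_inv_closed subgroup.one_closed subgroup.mem_carrier field_simps)

lemma lchar_pow:
 assumes "lchar G B l" "subgroup B G" "x : B" shows "x [^] (n::nat) : B" "l (x [^] n) = l x ^ n"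
proof -
 show *: "x [^] n : B" for n :: nat
  by (induction n) (use assms in \<open>auto simp: subgroup.one_closed subgroup.m_closed\<close>)
 show "l (x [^] n) = l x ^ n"
  by (induction n) (use assms * in \<open>auto simp: lchar_one lchar_mult subgroup.one_closed\<close>)
qed

text \<open>Translation by \<open>a\<close> permutes \<open>B\<close> and multiplies the sum by
  \<open>l a\<close>, a scalar different from 1.\<close>

lemma sum_lchar:
 fixes l :: "'a => 'k::field"
 assumes "subgroup B G" "lchar G B l" "a : B" "l a ~= 1"
 shows "(SUM b:B. l b) = 0"
proof -
 have "bij_betw (%b. a \<otimes> b) B B"
  by (rule bij_betw_byWitness[where f' = "%b. inv a \<otimes> b"])
   (use assms in \<open>auto simp: subgroup.m_closed subgroup.m_inv_closed subgroup.mem_carrier m_assoc[symmetric]\<close>)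
 hence "(SUM b:B. l b) = (SUM b:B. l (a \<otimes> b))" by (rule sum.reindex_bij_betw[symmetric])
 also have "... = l a * (SUM b:B. l b)" using assms by (simp add: lchar_mult sum_distrib_left)
 finally have "(1 - l a) * (SUM b:B. l b) = 0" by (simp add: algebra_simps)
 thus ?thesis using assms(4) by simp
qed

text \<open>The order of \<open>h\<close> modulo \<open>B\<close>, phrased with powers so that it
  makes sense for subgroups that are not normal.\<close>

definition rel_ord :: "'a set => 'a => nat" where
 "rel_ord B h = (LEAST d. d > 0 & h [^] d : B)"

lemma rel_ord:
 assumes "finite (carrier G)" "subgroup B G" "h : carrier G"
 shows "rel_ord B h > 0" "h [^] rel_ord B h : B" "h [^] (n::nat) : B ==> rel_ord B h dvd n"
  "rel_ord B h dvd Coset.order G"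
proof -
 let ?P = "\<lambda>d::nat. d > 0 & h [^] d : B"
 have "?P (Coset.order G)"
  using assms by (auto simp: pow_order_eq_1 subgroup.one_closed order_gt_0_iff_finite)
 hence P: "?P (rel_ord B h)" unfolding rel_ord_def by (rule LeastI)
 thus 1: "rel_ord B h > 0" "h [^] rel_ord B h : B" by auto
 show d: "rel_ord B h dvd n" if n: "h [^] n : B" for n :: nat
 proof -
  let ?r = "n mod rel_ord B h" and ?q = "n div rel_ord B h"
  have "n = rel_ord B h * ?q + ?r" by simp
  hence "h [^] n = h [^] (rel_ord B h * ?q + ?r)" by (rule arg_cong)
  hence "h [^] n = (h [^] rel_ord B h) [^] ?q \<otimes> h [^] ?r"
   using assms(3) by (simp add: nat_pow_pow nat_pow_mult)
  hence "h [^] ?r = inv ((h [^] rel_ord B h) [^] ?q) \<otimes> h [^] n"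
   using assms(3) by (simp add: m_assoc[symmetric])
  moreover have "(h [^] rel_ord B h) [^] ?q : B"
  proof -
   have "(h [^] rel_ord B h) [^] (q::nat) : B" for q
    by (induction q) (use P assms in \<open>auto simp: subgroup.one_closed subgroup.m_closed\<close>)
   thus ?thesis .
  qed
  ultimately have "h [^] ?r : B" using assms n by (simp add: subgroup.m_closed subgroup.m_inv_closed)
  moreover have "?r < rel_ord B h" using 1 by simp
  ultimately have "?r = 0"
   using not_less_Least[of ?r ?P, folded rel_ord_def] by auto
  thus ?thesis by auto
 qed
 show "rel_ord B h dvd Coset.order G" by (rule d) (use assms in \<open>auto simp: pow_order_eq_1 subgroup.one_closed\<close>)
qed

text \<open>As \<open>h\<close> commutes with \<open>B\<close>, the subgroup generated by both
  consists of the products b h^i. The value l(b) m^i does not depend on the chosen expression: the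
  exponents i for which h^i lies in \<open>B\<close> are the multiples of the relative order, and
  there the condition on \<open>m\<close> applies.\<close>

lemma lchar_extend:
 fixes l :: "'a => 'k::field"
 assumes fin: "finite (carrier G)" and B: "subgroup B G" and l: "lchar G B l"
  and h: "h : carrier G" and com: "!!b. b : B ==> b \<otimes> h = h \<otimes> b"
  and mu: "m ^ rel_ord B h = l (h [^] rel_ord B h)"
 shows "\<exists>B' l'. subgroup B' G & B <= B' & h : B' & lchar G B' l' & (ALL b:B. l' b = l b) & l' h = m"
proof -
 let ?d = "rel_ord B h"
 note d = rel_ord[OF fin B h]
 have mnz: "m ~= 0"
 proof
  assume "m = 0"
  hence "l (h [^] ?d) = 0" using mu d(1) by (simp add: power_0_left)
  thus False using lchar_nz[OF l d(2)] by simp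
 qed
 have Bc: "b : B ==> b : carrier G" for b using B by (rule subgroup.mem_carrier)
 have comp: "b \<otimes> h [^] i = h [^] i \<otimes> b" if "b : B" for b and i :: nat
 proof (induction i)
  case (Suc i)
  have "b \<otimes> h [^] Suc i = (b \<otimes> h [^] i) \<otimes> h" using h Bc[OF that] by (simp add: m_assoc)
  also have "... = h [^] i \<otimes> (b \<otimes> h)" unfolding Suc using h Bc[OF that] by (simp add: m_assoc)
  also have "... = h [^] Suc i \<otimes> b" unfolding com[OF that] using h Bc[OF that] by (simp add: m_assoc)
  finally show ?case .
 qed (use Bc[OF that] in simp)
 define B' where "B' = {b \<otimes> h [^] i | b (i::nat). b : B}"
 \<comment> \<open>Cancelling in b h^i = b' h^j shows that h^(j - i) lies in \<open>B\<close>, so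
   the relative order divides j - i. The order i <= j keeps the exponent natural; the proof about
   \<open>l'\<close> below treats both cases.\<close>
 have wd: "l b * m ^ i = l b' * m ^ j" if "b : B" "b' : B" "b \<otimes> h [^] i = b' \<otimes> h [^] j" "i <= j" for b b' and i j :: nat
 proof -
  have "b \<otimes> h [^] i = b' \<otimes> h [^] (j - i) \<otimes> h [^] i"
   using that h Bc by (simp add: m_assoc nat_pow_mult)
  hence e: "b = b' \<otimes> h [^] (j - i)" using that h Bc by simp
  hence e2: "h [^] (j - i) = inv b' \<otimes> b" using that h Bc by (simp add: m_assoc[symmetric])
  have "h [^] (j - i) : B" unfolding e2 using that B by (simp add: subgroup.m_closed subgroup.m_inv_closed)
  then obtain q where q: "j - i = ?d * q" using d(3) by blast
  have "l (h [^] (j - i)) = l ((h [^] ?d) [^] q)" unfolding q using h by (simp add: nat_pow_pow)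
  also have "... = m ^ (j - i)" unfolding q using lchar_pow(2)[OF l B d(2)] by (simp add: mu power_mult)
  finally have lm: "l (h [^] (j - i)) = m ^ (j - i)" .
  have "l b = l (b' \<otimes> h [^] (j - i))" by (rule arg_cong[OF e])
  hence "l b = l b' * m ^ (j - i)"
   unfolding lchar_mult[OF l that(2) \<open>h [^] (j - i) : B\<close>] lm .
  thus ?thesis using that(4) by (simp add: power_add[symmetric])
 qed
 define l' where "l' x = (SOME v. EX b:B. \<exists>i::nat. x = b \<otimes> h [^] i & v = l b * m ^ i)" for x
 have l': "l' (b \<otimes> h [^] i) = l b * m ^ i" if "b : B" for b and i :: nat
  unfolding l'_def
 proof (rule some_equality)
  show "EX b':B. \<exists>i'::nat. b \<otimes> h [^] i = b' \<otimes> h [^] i' & l b * m ^ i = l b' * m ^ i'" using that by blast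
  fix v assume "EX b':B. \<exists>i'::nat. b \<otimes> h [^] i = b' \<otimes> h [^] i' & v = l b' * m ^ i'"
  then obtain b' i' where *: "b' : B" "b \<otimes> h [^] i = b' \<otimes> h [^] (i'::nat)" "v = l b' * m ^ i'" by blast
  show "v = l b * m ^ i"
  proof (cases "i <= i'")
   case True
   thus ?thesis using wd[OF that *(1,2)] *(3) by simp
  next
   case False
   thus ?thesis using wd[OF *(1) that *(2)[symmetric]] *(3) by simp
  qed
 qed
 have BB: "b : B ==> b : B'" for b using Bc[of b] unfolding B'_def by (auto intro!: exI[of _ b] exI[of _ "0::nat"])
 have hB: "h : B'" unfolding B'_def using h B
  by (auto intro!: exI[of _ \<one>] exI[of _ "1::nat"] simp: subgroup.one_closed)
 have mul: "(b \<otimes> h [^] i) \<otimes> (b' \<otimes> h [^] j) = (b \<otimes> b') \<otimes> h [^] (i + j)" if "b : B" "b' : B" for b b' and i j :: nat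
 proof -
  have "(b \<otimes> h [^] i) \<otimes> (b' \<otimes> h [^] j) = b \<otimes> (h [^] i \<otimes> b') \<otimes> h [^] j" using Bc that h by (simp add: m_assoc)
  also have "... = b \<otimes> (b' \<otimes> h [^] i) \<otimes> h [^] j" by (simp add: comp[OF that(2)])
  finally show ?thesis using Bc that h by (simp add: m_assoc nat_pow_mult)
 qed
 have sub: "subgroup B' G"
 proof (rule subgroupI)
  show "B' <= carrier G" using Bc h by (auto simp: B'_def)
  show "B' ~= {}" using hB by auto
 next
  fix x assume "x : B'"
  then obtain b i where x: "b : B" "x = b \<otimes> h [^] (i::nat)" by (auto simp: B'_def)
  \<comment> \<open>Exponents are natural numbers, so h^(-i) is written as h^((|G| - 1) i).\<close>
  define y where "y = inv b \<otimes> h [^] ((Coset.order G - 1) * i)"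
  have "Coset.order G > 0" using fin by (simp add: order_gt_0_iff_finite)
  hence "i + (Coset.order G - 1) * i = Coset.order G * i" by (cases "Coset.order G") auto
  hence "h [^] (i + (Coset.order G - 1) * i) = (h [^] Coset.order G) [^] i" using h by (simp add: nat_pow_pow)
  also have "... = \<one>" using h fin by (simp add: pow_order_eq_1)
  finally have xy: "x \<otimes> y = \<one>"
   unfolding x(2) y_def using mul[OF x(1) subgroup.m_inv_closed[OF B x(1)], of i "(Coset.order G - 1) * i"] Bc[OF x(1)] by simp
  have xc: "x : carrier G" "y : carrier G" unfolding x(2) y_def using Bc[OF x(1)] h by auto
  have "inv x = inv x \<otimes> (x \<otimes> y)" using xc xy by simp
  also have "... = y" using xc by (simp add: m_assoc[symmetric])
  finally have "inv x = inv b \<otimes> h [^] ((Coset.order G - 1) * i)" unfolding y_def .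
  thus "inv x : B'" using x B by (auto simp: B'_def subgroup.m_inv_closed)
 next
  fix x y assume "x : B'" "y : B'"
  thus "x \<otimes> y : B'" using mul B by (fastforce simp: B'_def subgroup.m_closed)
 qed
 have "lchar G B' l'"
  unfolding lchar_def
 proof (intro conjI ballI)
  fix x assume "x : B'"
  thus "l' x ~= 0" using lchar_nz[OF l] mnz by (auto simp: B'_def l')
  fix y assume "y : B'"
  thus "l' (x \<otimes> y) = l' x * l' y" using \<open>x : B'\<close> B
   by (auto simp: B'_def l' mul subgroup.m_closed lchar_mult[OF l] power_add)
 qed
 moreover have "l' b = l b" if "b : B" for b using l'[OF that, of 0] Bc[OF that] by simp
 moreover have "l' h = m" using l'[of \<one> 1] B h lchar_one[OF l] by (simp add: subgroup.one_closed)
 ultimately show ?thesis using sub BB hB by blast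
qed

text \<open>An element outside \<open>B\<close> that commutes with \<open>B\<close> permits a
  further extension, for which the algebraically closed field provides the root \<open>m\<close>.
  The process ends at a subgroup containing its own centraliser. In an abelian group that is the
  whole group; in \<open>H\<close> it gives the isotropic subgroup behind
  \<open>eps\<close>.\<close>

lemma lchar_maximal:
 fixes l :: "'a => 'k::alg_closed_field"
 assumes fin: "finite (carrier G)" and "subgroup B G" and "lchar G B l"
 shows "\<exists>A l'. subgroup A G & B <= A & lchar G A l' & (ALL b:B. l' b = l b) &
  (ALL h:carrier G. (ALL a:A. a \<otimes> h = h \<otimes> a) --> h : A)"
 using assms(2,3)
proof (induction "card (carrier G) - card B" arbitrary: B l rule: less_induct)
 case less
 show ?case
 proof (cases "ALL h:carrier G. (ALL a:B. a \<otimes> h = h \<otimes> a) --> h : B")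
  case True
  with less.prems show ?thesis by blast
 next
  case False
  then obtain h where h: "h : carrier G" "!!a. a : B ==> a \<otimes> h = h \<otimes> a" "h \<notin> B" by blast
  obtain m where m: "m ^ rel_ord B h = l (h [^] rel_ord B h)"
   using nth_root_exists rel_ord(1)[OF fin less.prems(1) h(1)] by blast
  obtain B' l' where B': "subgroup B' G" "B <= B'" "h : B'" "lchar G B' l'" "ALL b:B. l' b = l b"
   using lchar_extend[OF fin less.prems h(1,2) m] by blast
  have "B' <= carrier G" using B'(1) by (rule subgroup.subset)
  hence "card B < card B'" "card B' <= card (carrier G)"
   using B' h fin by (auto intro!: psubset_card_mono card_mono dest: finite_subset)
  hence "card (carrier G) - card B' < card (carrier G) - card B" by simp
  from less.hyps[OF this B'(1,4)] obtain A l2 where A: "subgroup A G" "B' <= A" "lchar G A l2"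
   "ALL b:B'. l2 b = l' b" "ALL h:carrier G. (ALL a:A. a \<otimes> h = h \<otimes> a) --> h : A" by blast
  have "ALL b:B. l2 b = l b" using A(4) B'(2,5) by auto
  thus ?thesis using A B'(2) by (intro exI[of _ A] exI[of _ l2]) auto
 qed
qed

text \<open>The value of \<open>l\<close> at \<open>h\<close> can be multiplied by a nontrivial root
  of unity of order dividing the relative order of \<open>h\<close>, without disturbing the values
  on \<open>B\<close>. As the group is abelian, \<open>lchar_maximal\<close> then extends this
  second character to all of it.\<close>

lemma lchar_separates:
 fixes l :: "'a => 'k::alg_closed_field"
 assumes fin: "finite (carrier G)" and ab: "!!x y. x : carrier G ==> y : carrier G ==> x \<otimes> y = y \<otimes> x"
  and ord: "of_nat (Coset.order G) ~= (0 :: 'k)"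
  and B: "subgroup B G" and l: "lchar G (carrier G) l" and h: "h : carrier G" "h \<notin> B"
 shows "\<exists>l'. lchar G (carrier G) l' & (ALL b:B. l' b = l b) & l' h ~= l h"
proof -
 let ?d = "rel_ord B h"
 note d = rel_ord[OF fin B h(1)]
 have lB: "lchar G B l" by (rule lchar_subset[OF l]) (rule subgroup.subset[OF B])
 have "?d ~= 1" using d(2) h by auto
 hence "?d - 1 > 0" using d(1) by simp
 \<comment> \<open>A root of 1 + X + ... + X^(d-1) is a d-th root of unity. It is not 1, since the
   value of the polynomial at 1 is d, which is nonzero in the field because d divides the group
   order.\<close>
 then obtain z :: 'k where z: "(\<Sum>k\<le>?d - 1. 1 * z ^ k) = 0" using alg_closed[of "?d - 1" "%_. 1"] by auto
 obtain q where "Coset.order G = ?d * q" using d(4) by blast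
 hence nz: "of_nat ?d ~= (0 :: 'k)" using ord by auto
 have z1: "z ~= 1"
 proof
  assume "z = 1"
  hence "of_nat (Suc (?d - 1)) = (0 :: 'k)" using z by simp
  thus False using nz d(1) by simp
 qed
 have "(1 - z) * (\<Sum>k\<le>?d - 1. z ^ k) = 1 - z ^ Suc (?d - 1)" by (rule sum_gp_basic)
 hence zd: "z ^ ?d = 1" using z d(1) by simp
 have "(l h * z) ^ ?d = l (h [^] ?d)"
  using zd lchar_pow(2)[OF l subgroup_self h(1)] by (simp add: power_mult_distrib)
 from lchar_extend[OF fin B lB h(1) _ this] obtain B' l1 where
  1: "subgroup B' G" "B <= B'" "h : B'" "lchar G B' l1" "ALL b:B. l1 b = l b" "l1 h = l h * z"
  using ab h(1) subgroup.mem_carrier[OF B] by blast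
 obtain A l2 where 2: "subgroup A G" "B' <= A" "lchar G A l2" "ALL b:B'. l2 b = l1 b"
   "ALL h:carrier G. (ALL a:A. a \<otimes> h = h \<otimes> a) --> h : A"
  using lchar_maximal[OF fin 1(1,4)] by blast
 have "A = carrier G" using 2(1,5) ab subgroup.mem_carrier[OF 2(1)] by blast
 moreover have "l2 h ~= l h" using 1 2(4) z1 lchar_nz[OF l h(1)] by simp
 moreover have "ALL b:B. l2 b = l b" using 1 2(4) by auto
 ultimately show ?thesis using 2(3) by blast
qed

end

section \<open>Isomorphisms and basic algebras\<close>

lemma alg_isoI:
 assumes "!!x. x : carrier A ==> f x : carrier B" "!!y. y : carrier B ==> g y : carrier A"
  and "!!x. x : carrier A ==> g (f x) = x" "!!y. y : carrier B ==> f (g y) = y"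
  and "!!x y. x : carrier A ==> y : carrier A ==> f (x *[A] y) = f x *[B] f y"
  and "!!x y. x : carrier A ==> y : carrier A ==> f (x +[A] y) = f x +[B] f y"
  and "f #1[A] = #1[B]"
  and "!!c x. x : carrier A ==> f (c *.[A] x) = c *.[B] f x"
 shows "f : alg_iso A B"
proof -
 have "bij_betw f (carrier A) (carrier B)"
  by (rule bij_betw_byWitness[where f' = g]) (use assms in auto)
 thus ?thesis unfolding alg_iso_def ring_iso_def ring_hom_def using assms by auto
qed

lemma alg_isoD:
 assumes "f : alg_iso A B"
 shows "x : carrier A ==> f x : carrier B" "bij_betw f (carrier A) (carrier B)"
  "x : carrier A ==> y : carrier A ==> f (x *[A] y) = f x *[B] f y"
  "x : carrier A ==> y : carrier A ==> f (x +[A] y) = f x +[B] f y"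
  "f #1[A] = #1[B]" "x : carrier A ==> f (c *.[A] x) = c *.[B] f x"
 using assms unfolding alg_iso_def ring_iso_def ring_hom_def by auto

lemma k_algebraD:
 assumes "k_algebra A"
 shows "ring A" "x : carrier A ==> c *.[A] x : carrier A"
 using assms module_scalarD(2)[of A x c] by (auto simp: k_algebra_def)

lemma alg_iso_inv:
 assumes f: "f : alg_iso A B" and A: "k_algebra A"
 shows "inv_into (carrier A) f : alg_iso B A"
proof -
 interpret ring A using A by (rule k_algebraD)
 note fD = alg_isoD[OF f]
 note bij = fD(2)
 have g1: "y : carrier B ==> inv_into (carrier A) f y : carrier A" for y
  using bij by (metis bij_betw_def inv_into_into)
 have g2: "y : carrier B ==> f (inv_into (carrier A) f y) = y" for y
  using bij by (metis bij_betw_def f_inv_into_f)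
 have g3: "x : carrier A ==> inv_into (carrier A) f (f x) = x" for x
  using bij by (metis bij_betw_def inv_into_f_f)
 show ?thesis
 proof (rule alg_isoI[where g = f])
  fix x y assume xy: "x : carrier B" "y : carrier B"
  have "f (inv_into (carrier A) f x *[A] inv_into (carrier A) f y) = x *[B] y"
   using xy by (simp add: fD g1 g2)
  thus "inv_into (carrier A) f (x *[B] y) = inv_into (carrier A) f x *[A] inv_into (carrier A) f y"
   using g3 g1 xy by (metis m_closed)
  have "f (inv_into (carrier A) f x +[A] inv_into (carrier A) f y) = x +[B] y"
   using xy by (simp add: fD g1 g2)
  thus "inv_into (carrier A) f (x +[B] y) = inv_into (carrier A) f x +[A] inv_into (carrier A) f y"
   using g3 g1 xy by (metis add.m_closed)
 next
  fix c x assume x: "x : carrier B"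
  have "f (c *.[A] inv_into (carrier A) f x) = c *.[B] x" using x by (simp add: fD g1 g2)
  thus "inv_into (carrier A) f (c *.[B] x) = c *.[A] inv_into (carrier A) f x"
   using g3 g1 x k_algebraD(2)[OF A] by metis
 next
  show "inv_into (carrier A) f #1[B] = #1[A]" using g3[of "#1[A]"] fD(5) by simp
 qed (use g1 g2 g3 fD in auto)
qed

lemma alg_iso_comp: "f : alg_iso A B ==> g : alg_iso B C ==> g \<circ> f : alg_iso A C"
 unfolding alg_iso_def ring_iso_def ring_hom_def
 by (auto intro: bij_betw_trans simp: Pi_iff)

lemma alg_isomorphic_sym: "alg_isomorphic A B ==> k_algebra A ==> alg_isomorphic B A"
 unfolding alg_isomorphic_def using alg_iso_inv by blast

lemma alg_isomorphic_trans: "alg_isomorphic A B ==> alg_isomorphic B C ==> alg_isomorphic A C"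
 unfolding alg_isomorphic_def using alg_iso_comp by blast

lemma alg_iso_finsum:
 assumes "f : alg_iso A B" "ring A" "ring B" "x : I \<rightarrow> carrier A" "finite I"
 shows "f (\<Oplus>\<^bsub>A\<^esub>i\<in>I. x i) = (\<Oplus>\<^bsub>B\<^esub>i\<in>I. f (x i))"
proof -
 interpret A: ring A by fact
 interpret B: ring B by fact
 note fD = alg_isoD[OF assms(1)]
 have z: "f #0[A] = #0[B]"
  using fD(4)[of "#0[A]" "#0[A]"] fD(1)[of "#0[A]"] by (simp add: B.add.l_cancel_one')
 show ?thesis
  using assms(5,4)
 proof (induction I rule: finite_induct)
  case (insert i I)
  hence "x : I \<rightarrow> carrier A" "x i : carrier A" "(%i. f (x i)) : I \<rightarrow> carrier B" by (auto intro: fD)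
  with insert show ?case by (simp add: A.finsum_insert B.finsum_insert fD)
 qed (simp add: z)
qed

lemma mat_alg_iso:
 assumes f: "f : alg_iso B B'" and B: "k_algebra B" and B': "k_algebra B'"
 shows "alg_isomorphic (mat_alg m B) (mat_alg m B')"
proof -
 interpret B: ring B using B by (rule k_algebraD)
 interpret B': ring B' using B' by (rule k_algebraD)
 let ?I = "{..<m} \<times> {..<m}"
 let ?g = "inv_into (carrier B) f"
 note fD = alg_isoD[OF f] and gD = alg_isoD[OF alg_iso_inv[OF f B]]
 have g2: "y : carrier B' ==> f (?g y) = y" for y using fD(2) by (metis bij_betw_def f_inv_into_f)
 have g3: "x : carrier B ==> ?g (f x) = x" for x using fD(2) by (metis bij_betw_def inv_into_f_f)
 have f0: "f #0[B] = #0[B']" using alg_iso_finsum[OF f B.ring_axioms B'.ring_axioms, of _ "{}"] by simp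
 have "(%T. \<lambda>v\<in>?I. f (T v)) : alg_iso (mat_alg m B) (mat_alg m B')"
 proof (rule alg_isoI[where g = "%T. \<lambda>v\<in>?I. ?g (T v)"])
  fix T U assume T: "T : carrier (mat_alg m B)" and U: "U : carrier (mat_alg m B)"
  have c: "T v : carrier B" "U v : carrier B" if "v : ?I" for v
   using T U that by (auto simp: mat_alg_def Let_def PiE_iff)
  show "(\<lambda>v\<in>?I. f ((T *[mat_alg m B] U) v)) = (\<lambda>v\<in>?I. f (T v)) *[mat_alg m B'] (\<lambda>v\<in>?I. f (U v))"
   unfolding mat_alg_def Let_def monoid.simps
  proof (rule restrict_ext)
   fix v assume v: "v : ?I"
   have "f (\<Oplus>\<^bsub>B\<^esub>l\<in>{..<m}. T (fst v, l) *[B] U (l, snd v)) = (\<Oplus>\<^bsub>B'\<^esub>l\<in>{..<m}. f (T (fst v, l) *[B] U (l, snd v)))"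
    using v c by (intro alg_iso_finsum[OF f] B.ring_axioms B'.ring_axioms) (auto simp: mem_Times_iff)
   also have "... = (\<Oplus>\<^bsub>B'\<^esub>l\<in>{..<m}. (\<lambda>v\<in>?I. f (T v)) (fst v, l) *[B'] (\<lambda>v\<in>?I. f (U v)) (l, snd v))"
    using v c by (intro B'.finsum_cong') (auto simp: fD mem_Times_iff)
   finally show "f ((\<lambda>v\<in>?I. \<Oplus>\<^bsub>B\<^esub>l\<in>{..<m}. T (fst v, l) *[B] U (l, snd v)) v) =
    (\<Oplus>\<^bsub>B'\<^esub>l\<in>{..<m}. (\<lambda>v\<in>?I. f (T v)) (fst v, l) *[B'] (\<lambda>v\<in>?I. f (U v)) (l, snd v))" using v by simp
  qed
  show "(\<lambda>v\<in>?I. f ((T +[mat_alg m B] U) v)) = (\<lambda>v\<in>?I. f (T v)) +[mat_alg m B'] (\<lambda>v\<in>?I. f (U v))"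
   using c by (auto simp: mat_alg_def Let_def fun_eq_iff fD)
 next
  fix d T assume T: "T : carrier (mat_alg m B)"
  hence "T v : carrier B" if "v : ?I" for v
   using that by (auto simp: mat_alg_def Let_def PiE_iff)
  thus "(\<lambda>v\<in>?I. f ((d *.[mat_alg m B] T) v)) = d *.[mat_alg m B'] (\<lambda>v\<in>?I. f (T v))"
   by (auto simp: mat_alg_def Let_def fun_eq_iff fD)
 next
  show "(\<lambda>v\<in>?I. f (#1[mat_alg m B] v)) = #1[mat_alg m B']"
   by (auto simp: mat_alg_def Let_def fun_eq_iff fD f0)
 qed (auto simp: mat_alg_def Let_def PiE_iff fD gD g2 g3 fun_eq_iff extensional_def)
 thus ?thesis unfolding alg_isomorphic_def by blast
qed

text \<open>The conditions that \<open>basic_algebra_of\<close> puts on its set of idempotents,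
  isolated in order to transport such sets along isomorphisms and to compare two of them.\<close>

definition basic_set :: "('k::field, 'a) module => 'a set => bool" where
 "basic_set A I \<longleftrightarrow> finite I & (ALL i:I. primitive_idem A i) &
  (ALL i:I. ALL j:I. i ~= j --> i *[A] j = #0[A]) &
  (\<forall>i. primitive_idem A i --> (\<exists>!j. j : I & iso_idem A i j))"

lemma basic_algebra_of_set:
 "basic_algebra_of B A \<longleftrightarrow> k_algebra B & (\<exists>I. basic_set A I & alg_isomorphic B (corner_alg A (\<Oplus>\<^bsub>A\<^esub>i\<in>I. i)))"
 by (simp only: basic_algebra_of_def basic_set_def conj_assoc)

lemma idem_iso:
 assumes f: "f : alg_iso A B" "ring A" "i : carrier A"
 shows "idem B (f i) \<longleftrightarrow> idem A i"
 using alg_isoD[OF f(1)] f(2,3) unfolding idem_def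
 by (metis bij_betw_def inj_onD monoid.m_closed ring.is_monoid)

lemma primitive_idem_iso:
 assumes f: "f : alg_iso A B" and A: "ring A" and B: "ring B" and i: "primitive_idem A i"
 shows "primitive_idem B (f i)"
proof -
 interpret A: ring A by fact
 note fD = alg_isoD[OF f]
 have f0: "f #0[A] = #0[B]" using alg_iso_finsum[OF f A B, of _ "{}"] by (simp add: A B ring.is_abelian_group abelian_group.axioms(1) abelian_monoid.finsum_empty)
 have ic: "i : carrier A" and ii: "idem A i" "i ~= #0[A]" using i by (auto simp: primitive_idem_def idem_def)
 have inj: "f x = f y ==> x : carrier A ==> y : carrier A ==> x = y" for x y
  using fD(2) by (metis bij_betw_def inj_onD)
 show ?thesis
  unfolding primitive_idem_def
 proof (intro conjI allI impI)
  show "idem B (f i)" using idem_iso[OF f A ic] ii by simp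
  show "f i ~= #0[B]" using ii ic inj f0 by (metis A.zero_closed)
  fix a b assume *: "idem B a & idem B b & a *[B] b = #0[B] & b *[B] a = #0[B] & f i = a +[B] b"
  then obtain a' b' where ab: "a' : carrier A" "b' : carrier A" "a = f a'" "b = f b'"
   using fD(2) unfolding idem_def bij_betw_def by (metis imageE)
  have "idem A a'" "idem A b'" using * ab idem_iso[OF f A] by auto
  moreover have "f (a' *[A] b') = f #0[A]" "f (b' *[A] a') = f #0[A]" "f i = f (a' +[A] b')"
   using * ab by (auto simp: fD f0)
  hence "a' *[A] b' = #0[A]" "b' *[A] a' = #0[A]" "i = a' +[A] b'"
   using ab ic by (auto intro: inj)
  ultimately have "a' = #0[A] \<or> b' = #0[A]" using i by (auto simp: primitive_idem_def)
  thus "a = #0[B] \<or> b = #0[B]" using ab f0 by auto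
 qed
qed

lemma iso_idem_iso:
 assumes f: "f : alg_iso A B" and A: "ring A" and i: "i : carrier A" "j : carrier A" and ij: "iso_idem A i j"
 shows "iso_idem B (f i) (f j)"
proof -
 interpret ring A by fact
 note fD = alg_isoD[OF f]
 obtain a b where ab: "a : carrier A" "b : carrier A" "a = i *[A] a *[A] j" "b = j *[A] b *[A] i"
   "a *[A] b = i" "b *[A] a = j" using ij unfolding iso_idem_def by blast
 have "f (i *[A] a *[A] j) = f i *[B] f a *[B] f j" "f (j *[A] b *[A] i) = f j *[B] f b *[B] f i"
  using ab(1,2) i by (simp_all add: fD)
 hence "f a = f i *[B] f a *[B] f j" "f b = f j *[B] f b *[B] f i" using ab(3,4) by simp_all
 moreover have "f a *[B] f b = f i" "f b *[B] f a = f j" using ab by (auto simp: fD(3)[symmetric])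
 ultimately show ?thesis unfolding iso_idem_def using fD(1)[OF ab(1)] fD(1)[OF ab(2)] by blast
qed

text \<open>The idempotents are constructed in \<open>kGe S\<close>, whereas the claim concerns the
  isomorphic algebra \<open>k_alpha_PL S\<close>; primitivity, isomorphism of idempotents and the
  corner all go across.\<close>

lemma basic_set_iso:
 assumes f: "f : alg_iso A B" and A: "k_algebra A" and B: "k_algebra B" and I: "basic_set A I"
 shows "basic_set B (f ` I)" "alg_isomorphic (corner_alg A (\<Oplus>\<^bsub>A\<^esub>i\<in>I. i)) (corner_alg B (\<Oplus>\<^bsub>B\<^esub>i\<in>f ` I. i))"
proof -
 interpret A: ring A using A by (rule k_algebraD)
 interpret B: ring B using B by (rule k_algebraD)
 let ?g = "inv_into (carrier A) f"
 note fD = alg_isoD[OF f]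
 note g = alg_iso_inv[OF f A]
 note gD = alg_isoD[OF g]
 have g2: "y : carrier B ==> f (?g y) = y" for y using fD(2) by (metis bij_betw_def f_inv_into_f)
 have g3: "x : carrier A ==> ?g (f x) = x" for x using fD(2) by (metis bij_betw_def inv_into_f_f)
 have f0: "f #0[A] = #0[B]" using alg_iso_finsum[OF f A.ring_axioms B.ring_axioms, of _ "{}"] by simp
 have Ic: "I <= carrier A" and fin: "finite I" using I by (auto simp: basic_set_def primitive_idem_def idem_def)
 have inj: "inj_on f I" using fD(2) Ic by (metis bij_betw_def inj_on_subset)
 show "basic_set B (f ` I)"
  unfolding basic_set_def
 proof (intro conjI ballI allI impI)
  show "finite (f ` I)" using fin by simp
  show "primitive_idem B i" if "i : f ` I" for i
   using that I primitive_idem_iso[OF f A.ring_axioms B.ring_axioms] by (auto simp: basic_set_def)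
  show "i *[B] j = #0[B]" if "i : f ` I" "j : f ` I" "i ~= j" for i j
  proof -
   obtain i' j' where ij: "i' : I" "j' : I" "i = f i'" "j = f j'" using \<open>i : f ` I\<close> \<open>j : f ` I\<close> by blast
   hence "i' *[A] j' = #0[A]" using that(3) I by (auto simp: basic_set_def)
   thus ?thesis using ij Ic f0 fD(3)[of i' j'] by (simp add: subsetD)
  qed
 next
  fix i assume i: "primitive_idem B i"
  hence ic: "i : carrier B" by (simp add: primitive_idem_def idem_def)
  have "primitive_idem A (?g i)" by (rule primitive_idem_iso[OF g B.ring_axioms A.ring_axioms i])
  then obtain j where j: "j : I" "iso_idem A (?g i) j" "!!j'. j' : I ==> iso_idem A (?g i) j' ==> j' = j"
   using I unfolding basic_set_def by metis
  show "\<exists>!j. j : f ` I & iso_idem B i j"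
  proof (rule ex1I[of _ "f j"], intro conjI)
   show "iso_idem B i (f j)"
    using iso_idem_iso[OF f A.ring_axioms _ _ j(2)] gD(1)[OF ic] j(1) Ic g2[OF ic] by auto
   fix j' assume j': "j' : f ` I & iso_idem B i j'"
   then obtain j'' where j'': "j'' : I" "j' = f j''" by blast
   have "iso_idem A (?g i) (?g j')"
    using iso_idem_iso[OF g B.ring_axioms ic _ conjunct2[OF j']] j'' Ic fD(1) by auto
   thus "j' = f j" using j(3)[OF j''(1)] j'' g3 Ic by auto
  next
   show "f j : f ` I" using j(1) by (rule imageI)
  qed
 qed
 define e where "e = (\<Oplus>\<^bsub>A\<^esub>i\<in>I. i)"
 have ec: "e : carrier A" unfolding e_def using Ic by (intro A.finsum_closed) auto
 have "f e = (\<Oplus>\<^bsub>B\<^esub>i\<in>I. f i)" unfolding e_def by (rule alg_iso_finsum[OF f A.ring_axioms B.ring_axioms]) (use Ic fin in auto)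
 also have "... = (\<Oplus>\<^bsub>B\<^esub>i\<in>f ` I. i)" using B.finsum_reindex[OF _ inj, of "%i. i"] Ic fD(1) by (simp add: Pi_iff subsetD)
 finally have fe: "f e = (\<Oplus>\<^bsub>B\<^esub>i\<in>f ` I. i)" .
 have "f : alg_iso (corner_alg A e) (corner_alg B (f e))"
 proof (rule alg_isoI[where g = ?g])
  show "f x : carrier (corner_alg B (f e))" if "x : carrier (corner_alg A e)" for x
   using that ec fD by (auto simp: corner_alg_def)
  show "?g y : carrier (corner_alg A e)" if y: "y : carrier (corner_alg B (f e))" for y
  proof -
   obtain z where z: "z : carrier B" "y = f e *[B] z *[B] f e" using y by (auto simp: corner_alg_def)
   hence "?g y = e *[A] ?g z *[A] e" using ec by (simp add: gD fD g3)
   thus ?thesis using gD(1)[OF z(1)] by (auto simp: corner_alg_def)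
  qed
 next
  have cA: "x : carrier A" if "x : carrier (corner_alg A e)" for x using that ec by (auto simp: corner_alg_def)
  have cB: "y : carrier B" if "y : carrier (corner_alg B (f e))" for y using that ec fD by (auto simp: corner_alg_def)
  have ops: "monoid.mult (corner_alg A e) = monoid.mult A" "monoid.mult (corner_alg B (f e)) = monoid.mult B"
   "ring.add (corner_alg A e) = ring.add A" "ring.add (corner_alg B (f e)) = ring.add B"
   "module.smult (corner_alg A e) = module.smult A" "module.smult (corner_alg B (f e)) = module.smult B"
   "#1[corner_alg A e] = e" "#1[corner_alg B (f e)] = f e"
   by (simp_all add: corner_alg_def)
  show "f #1[corner_alg A e] = #1[corner_alg B (f e)]" unfolding ops ..
  fix x assume x: "x : carrier (corner_alg A e)"
  show "?g (f x) = x" by (rule g3[OF cA[OF x]])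
  show "f (c *.[corner_alg A e] x) = c *.[corner_alg B (f e)] f x" for c unfolding ops by (rule fD(6)[OF cA[OF x]])
  fix y assume y: "y : carrier (corner_alg A e)"
  show "f (x *[corner_alg A e] y) = f x *[corner_alg B (f e)] f y" unfolding ops by (rule fD(3)[OF cA[OF x] cA[OF y]])
  show "f (x +[corner_alg A e] y) = f x +[corner_alg B (f e)] f y" unfolding ops by (rule fD(4)[OF cA[OF x] cA[OF y]])
 next
  fix y assume "y : carrier (corner_alg B (f e))"
  hence "y : carrier B" using ec fD by (auto simp: corner_alg_def)
  thus "f (?g y) = y" by (rule g2)
 qed
 thus "alg_isomorphic (corner_alg A (\<Oplus>\<^bsub>A\<^esub>i\<in>I. i)) (corner_alg B (\<Oplus>\<^bsub>B\<^esub>i\<in>f ` I. i))"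
  unfolding alg_isomorphic_def fe e_def[symmetric] by blast
qed

section \<open>Uniqueness of basic algebras, matrix units, and a criterion for basic sets\<close>

context fun_alg
begin

lemma assoc_cong: "x *[A] y = z ==> x *[A] (y *[A] w) = z *[A] w"
 by (metis assoc)

lemma iso_idem_sym: "iso_idem A i j ==> iso_idem A j i"
 unfolding iso_idem_def by metis

lemma iso_idem_refl: "idem A i ==> iso_idem A i i"
 unfolding iso_idem_def idem_def by (intro bexI[of _ i]) auto

lemma iso_idemE:
 assumes "iso_idem A i j" "idem A i" "idem A j"
 obtains a b where "a : carrier A" "b : carrier A" "i *[A] a = a" "a *[A] j = a" "j *[A] b = b" "b *[A] i = b"
  "a *[A] b = i" "b *[A] a = j"
proof -
 obtain a b where ab: "a : carrier A" "b : carrier A" "a = i *[A] a *[A] j" "b = j *[A] b *[A] i"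
   "a *[A] b = i" "b *[A] a = j" using assms(1) unfolding iso_idem_def by blast
 have i: "i *[A] i = i" "j *[A] j = j" using assms by (auto simp: idem_def)
 have "i *[A] a = a" "a *[A] j = a" "j *[A] b = b" "b *[A] i = b"
  using ab(3,4) i by (metis assoc)+
 thus ?thesis using that ab by blast
qed

lemma iso_idemI:
 assumes "a : carrier A" "b : carrier A" "i *[A] a = a" "a *[A] j = a" "j *[A] b = b" "b *[A] i = b"
  "a *[A] b = i" "b *[A] a = j"
 shows "iso_idem A i j"
 unfolding iso_idem_def using assms by (intro bexI[of _ a] bexI[of _ b]) auto

lemma iso_idem_trans:
 assumes "iso_idem A i j" "iso_idem A j l" "idem A i" "idem A j" "idem A l" shows "iso_idem A i l"
proof -
 obtain a b where ab: "a : carrier A" "b : carrier A" "i *[A] a = a" "a *[A] j = a" "j *[A] b = b" "b *[A] i = b"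
  "a *[A] b = i" "b *[A] a = j" using iso_idemE[OF assms(1,3,4)] by blast
 obtain c d where cd: "c : carrier A" "d : carrier A" "j *[A] c = c" "c *[A] l = c" "l *[A] d = d" "d *[A] j = d"
  "c *[A] d = j" "d *[A] c = l" using iso_idemE[OF assms(2,4,5)] by blast
 show ?thesis
  by (rule iso_idemI[of "a *[A] c" "d *[A] b"])
   (use ab cd in \<open>simp_all add: mul_closed assoc assoc_cong[OF ab(3)] assoc_cong[OF cd(5)]
     assoc_cong[OF cd(7)] assoc_cong[OF ab(8)]\<close>)
qed

text \<open>Each \<open>i\<close> in \<open>I\<close> is isomorphic to one \<open>si i\<close> in
  \<open>J\<close>, and uniqueness on both sides makes \<open>si\<close> a bijection. The witnesses
  add up to \<open>u\<close> and \<open>v\<close> with u v = e and v u = e', the sums of the two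
  sets, so x -> v x u identifies the corners.\<close>

lemma basic_set_unique:
 assumes I: "basic_set A I" and J: "basic_set A J"
 shows "alg_isomorphic (corner_alg A (\<Oplus>\<^bsub>A\<^esub>i\<in>I. i)) (corner_alg A (\<Oplus>\<^bsub>A\<^esub>i\<in>J. i))"
proof -
 have idI: "idem A i" "primitive_idem A i" if "i : I" for i using I that by (auto simp: basic_set_def primitive_idem_def)
 have idJ: "idem A i" "primitive_idem A i" if "i : J" for i using J that by (auto simp: basic_set_def primitive_idem_def)
 have fin: "finite I" "finite J" using I J by (auto simp: basic_set_def)
 have orI: "i *[A] i' = (if i = i' then i else 0)" if "i : I" "i' : I" for i i'
  using I that idI(1) by (auto simp: basic_set_def idem_def zero_A)
 have orJ: "i *[A] i' = (if i = i' then i else 0)" if "i : J" "i' : J" for i i'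
  using J that idJ(1) by (auto simp: basic_set_def idem_def zero_A)
 have "\<exists>j. j : J & iso_idem A i j" if "i : I" for i using J idI[OF that] unfolding basic_set_def by blast
 then obtain si where si: "!!i. i : I ==> si i : J" "!!i. i : I ==> iso_idem A i (si i)" by metis
 have inj: "inj_on si I"
 proof (rule inj_onI)
  fix i i' assume *: "i : I" "i' : I" "si i = si i'"
  have "iso_idem A i i'"
   using iso_idem_trans[OF si(2)[OF *(1)], of i'] iso_idem_sym[OF si(2)[OF *(2)]] * idI idJ si(1) by auto
  thus "i = i'" using I * idI iso_idem_refl[OF idI(1)[OF *(1)]] unfolding basic_set_def by metis
 qed
 have surj: "si ` I = J"
 proof
  show "J <= si ` I"
  proof
   fix j assume j: "j : J"
   then obtain i where i: "i : I" "iso_idem A j i" using I idJ(2) unfolding basic_set_def by blast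
   hence "si i = j"
    using J idI(2)[OF i(1)] si[OF i(1)] iso_idem_sym[OF i(2)] j unfolding basic_set_def by metis
   thus "j : si ` I" using i by blast
  qed
 qed (use si in auto)
 \<comment> \<open>The two witnesses of an isomorphism are tied to each other, so they are chosen
   jointly, as a pair.\<close>
 define R where "R i w \<longleftrightarrow> fst w : carrier A & snd w : carrier A & i *[A] fst w = fst w & fst w *[A] si i = fst w &
  si i *[A] snd w = snd w & snd w *[A] i = snd w & fst w *[A] snd w = i & snd w *[A] fst w = si i" for i w
 have "\<exists>w. R i w" if iI: "i : I" for i
 proof -
  obtain a b where "a : carrier A" "b : carrier A" "i *[A] a = a" "a *[A] si i = a" "si i *[A] b = b" "b *[A] i = b"
   "a *[A] b = i" "b *[A] a = si i"
   using iso_idemE[OF si(2)[OF iI] idI(1)[OF iI] idJ(1)[OF si(1)[OF iI]]] by blast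
  hence "R i (a, b)" by (simp add: R_def)
  thus ?thesis ..
 qed
 hence "ALL i:I. \<exists>w. R i w" by blast
 from bchoice[OF this] obtain w where w: "ALL i:I. R i (w i)" by blast
 define a where "a i = fst (w i)" for i
 define b where "b i = snd (w i)" for i
 have ab: "a i : carrier A" "b i : carrier A" "i *[A] a i = a i" "a i *[A] si i = a i"
   "si i *[A] b i = b i" "b i *[A] i = b i" "a i *[A] b i = i" "b i *[A] a i = si i" if "i : I" for i
  using bspec[OF w that] unfolding R_def a_def b_def by simp_all
 have Ic: "i : I ==> i : carrier A" and Jc: "i : J ==> i : carrier A" for i using idI idJ by (auto simp: idem_def)
 define e where "e = (SUM i:I. i)"
 define e' where "e' = (SUM i:J. i)"
 define u where "u = (SUM i:I. a i)"
 define v where "v = (SUM i:I. b i)"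
 have e'si: "e' = (SUM i:I. si i)" unfolding e'_def surj[symmetric] using inj by (simp add: sum.reindex)
 have E: "(\<Oplus>\<^bsub>A\<^esub>i\<in>I. i) = e" "(\<Oplus>\<^bsub>A\<^esub>i\<in>J. i) = e'" unfolding e_def e'_def using Ic Jc by (auto intro!: finsum_A)
 have c: "e : carrier A" "e' : carrier A" "u : carrier A" "v : carrier A"
  unfolding e_def e'_def u_def v_def using Ic Jc ab by (auto intro: closed)
 have ab0: "a i *[A] b i' = (if i = i' then i else 0)" if "i : I" "i' : I" for i i'
 proof (cases "i = i'")
  case False
  hence "si i *[A] si i' = 0" using orJ[of "si i" "si i'"] si that inj by (auto dest: inj_onD)
  have "a i *[A] b i' = (a i *[A] si i) *[A] (si i' *[A] b i')" using ab that by simp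
  also have "... = a i *[A] ((si i *[A] si i') *[A] b i')" by (simp only: assoc)
  finally show ?thesis using False \<open>si i *[A] si i' = 0\<close> by simp
 qed (use ab that in simp)
 have ba0: "b i *[A] a i' = (if i = i' then si i else 0)" if "i : I" "i' : I" for i i'
 proof (cases "i = i'")
  case False
  hence "i *[A] i' = 0" using orI that by auto
  have "b i *[A] a i' = (b i *[A] i) *[A] (i' *[A] a i')" using ab that by simp
  also have "... = b i *[A] ((i *[A] i') *[A] a i')" by (simp only: assoc)
  finally show ?thesis using False \<open>i *[A] i' = 0\<close> by simp
 qed (use ab that in simp)
 have uv: "u *[A] v = e" unfolding u_def v_def e_def sum_l sum_r using fin by (intro sum.cong) (simp_all add: ab0 cong: sum.cong)
 have vu: "v *[A] u = e'" unfolding u_def v_def e'si sum_l sum_r using fin by (intro sum.cong) (simp_all add: ba0 cong: sum.cong)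
 have ee: "e *[A] e = e" unfolding e_def sum_l sum_r using fin by (intro sum.cong) (simp_all add: orI cong: sum.cong)
 have ee': "e' *[A] e' = e'" unfolding e'_def sum_l sum_r using fin by (intro sum.cong) (simp_all add: orJ cong: sum.cong)
 have ea: "i *[A] a i' = (if i = i' then a i' else 0)" if "i : I" "i' : I" for i i'
  using ab(3)[OF that(2)] orI[OF that] by (metis assoc zero_l)
 have be: "b i' *[A] i = (if i = i' then b i' else 0)" if "i : I" "i' : I" for i i'
  using ab(6)[OF that(2)] orI[OF that(2,1)] by (metis assoc zero_r)
 have eu: "e *[A] u = u"
  unfolding e_def u_def sum_l sum_r
  by (subst sum.swap) (use fin in \<open>intro sum.cong; simp add: ea cong: sum.cong\<close>)
 have ve: "v *[A] e = v"
  unfolding e_def v_def sum_l sum_r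
  by (use fin in \<open>intro sum.cong; simp add: be cong: sum.cong\<close>)
 have ue': "u *[A] e' = u" using eu by (simp add: vu[symmetric] uv assoc[symmetric])
 have e'v: "e' *[A] v = v" using ve by (simp add: vu[symmetric] uv assoc)
 have "(%x. v *[A] x *[A] u) : alg_iso (corner_alg A e) (corner_alg A e')"
 proof (rule alg_isoI[where g = "%y. u *[A] y *[A] v"])
  note cc = corner_carrier[OF c(1) ee] corner_carrier[OF c(2) ee']
  note ac = assoc_cong[OF uv] assoc_cong[OF vu] assoc_cong[OF ve] assoc_cong[OF e'v] assoc_cong[OF eu] assoc_cong[OF ue']
  fix x assume "x : carrier (corner_alg A e)"
  hence x: "x : carrier A" "e *[A] x = x" "x *[A] e = x" by (auto simp: cc)
  show "v *[A] x *[A] u : carrier (corner_alg A e')"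
   using x c by (simp add: cc closed assoc ac ue' assoc_cong[OF e'v])
  show "u *[A] (v *[A] x *[A] u) *[A] v = x"
   using x by (simp add: assoc ac uv)
  fix y assume "y : carrier (corner_alg A e)"
  hence y: "y : carrier A" "e *[A] y = y" "y *[A] e = y" by (auto simp: cc)
  show "v *[A] (x *[corner_alg A e] y) *[A] u = v *[A] x *[A] u *[corner_alg A e'] (v *[A] y *[A] u)"
   using x y by (simp add: corner_alg_def assoc ac assoc_cong[OF y(2)])
  show "v *[A] (x +[corner_alg A e] y) *[A] u = v *[A] x *[A] u +[corner_alg A e'] v *[A] y *[A] u"
   by (simp add: corner_alg_def add_A distribs)
 next
  note cc = corner_carrier[OF c(1) ee] corner_carrier[OF c(2) ee']
  note ac = assoc_cong[OF uv] assoc_cong[OF vu] assoc_cong[OF ve] assoc_cong[OF e'v] assoc_cong[OF eu] assoc_cong[OF ue']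
  fix y assume "y : carrier (corner_alg A e')"
  hence y: "y : carrier A" "e' *[A] y = y" "y *[A] e' = y" by (auto simp: cc)
  show "u *[A] y *[A] v : carrier (corner_alg A e)"
   using y c by (simp add: cc closed assoc ac ve)
  show "v *[A] (u *[A] y *[A] v) *[A] u = y"
   using y by (simp add: assoc ac vu)
 next
  show "v *[A] #1[corner_alg A e] *[A] u = #1[corner_alg A e']" by (simp add: corner_alg_def ve vu)
  show "v *[A] (c *.[corner_alg A e] x) *[A] u = c *.[corner_alg A e'] (v *[A] x *[A] u)" for c x
   by (simp add: corner_alg_def smult_A distribs)
 qed
 thus ?thesis unfolding E alg_isomorphic_def by blast
qed

text \<open>The products t_l e s_l' behave as matrix units: their diagonal sums to 1, and e s_l t_l'
  e is e or 0. Hence the entry of x at (l, l') is e s_l x t_l' e, and x is recovered by summing t_l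
  T(l, l') s_l'.\<close>

lemma matrix_units_iso:
 fixes m :: nat
 assumes e: "e : carrier A" "e *[A] e = e"
  and t: "!!l. l < m ==> t l : carrier A" and s: "!!l. l < m ==> s l : carrier A"
  and st: "!!l l'. l < m ==> l' < m ==> e *[A] (s l *[A] (t l' *[A] e)) = (if l = l' then e else 0)"
  and ts: "(\<Sum>l<m. t l *[A] (e *[A] s l)) = #1[A]"
 shows "alg_isomorphic A (mat_alg m (corner_alg A e))"
proof -
 let ?I = "{..<m} \<times> {..<m}" and ?C = "corner_alg A e"
 interpret C: fun_alg ?C by (rule corner_fun_alg[OF e])
 have Cs: "monoid.mult ?C = monoid.mult A" "ring.add ?C = (+)" "ring.zero ?C = 0" "module.smult ?C = scl" "#1[?C] = e"
  by (simp_all add: corner_alg_def add_A zero_A smult_A)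
 note cc = corner_carrier[OF e]
 let ?f = "%x. \<lambda>v\<in>?I. e *[A] (s (fst v) *[A] (x *[A] (t (snd v) *[A] e)))"
 let ?g = "%T. \<Sum>l<m. \<Sum>l'<m. t l *[A] (T (l, l') *[A] s l')"
 have fc: "e *[A] (s l *[A] (x *[A] (t l' *[A] e))) : carrier ?C" if "x : carrier A" "l < m" "l' < m" for x l l'
  unfolding cc using that e s t by (simp add: closed assoc assoc_cong[OF e(2)])
 have "?f : alg_iso A (mat_alg m ?C)"
 proof (rule alg_isoI[where g = ?g])
  fix x assume x: "x : carrier A"
  show "?f x : carrier (mat_alg m ?C)" using fc[OF x] by (auto simp: mat_alg_def Let_def)
  have "?g (?f x) = (\<Sum>l<m. \<Sum>l'<m. (t l *[A] (e *[A] s l)) *[A] (x *[A] (t l' *[A] (e *[A] s l'))))"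
   by (intro sum.cong refl) (simp add: assoc)
  also have "... = (\<Sum>l<m. t l *[A] (e *[A] s l)) *[A] (x *[A] (\<Sum>l<m. t l *[A] (e *[A] s l)))"
   unfolding sum_l sum_r by (rule sum.swap)
  also have "... = x" unfolding ts using x by (simp add: one_l one_r)
  finally show "?g (?f x) = x" .
  fix y assume y: "y : carrier A"
  show "?f (x *[A] y) = ?f x *[mat_alg m ?C] ?f y"
   unfolding mat_alg_def Let_def monoid.simps
  proof (rule restrict_ext)
   fix v assume v: "v : ?I"
   hence v': "fst v < m" "snd v < m" by auto
   have "(\<Oplus>\<^bsub>?C\<^esub>l\<in>{..<m}. ?f x (fst v, l) *[?C] ?f y (l, snd v)) = (\<Sum>l<m. ?f x (fst v, l) *[A] ?f y (l, snd v))"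
   proof -
    have "(%l. ?f x (fst v, l) *[?C] ?f y (l, snd v)) : {..<m} \<rightarrow> carrier ?C"
     using v' fc[OF x] fc[OF y] by (intro Pi_I C.mul_closed) simp_all
    from C.finsum_A[OF this] show ?thesis by (simp only: Cs(1))
   qed
   also have "... = (\<Sum>l<m. e *[A] (s (fst v) *[A] (x *[A] ((t l *[A] (e *[A] s l)) *[A] (y *[A] (t (snd v) *[A] e))))))"
    using v' by (intro sum.cong refl) (simp add: assoc assoc_cong[OF e(2)])
   also have "... = e *[A] (s (fst v) *[A] (x *[A] ((\<Sum>l<m. t l *[A] (e *[A] s l)) *[A] (y *[A] (t (snd v) *[A] e)))))"
    by (simp only: sum_l sum_r)
   also have "... = e *[A] (s (fst v) *[A] ((x *[A] y) *[A] (t (snd v) *[A] e)))"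
    unfolding ts using y t v' e by (simp add: assoc one_l closed)
   finally show "e *[A] (s (fst v) *[A] (x *[A] y *[A] (t (snd v) *[A] e))) =
    (\<Oplus>\<^bsub>?C\<^esub>l\<in>{..<m}. ?f x (fst v, l) *[?C] ?f y (l, snd v))" by simp
  qed
  show "?f (x +[A] y) = ?f x +[mat_alg m ?C] ?f y"
   by (auto simp: mat_alg_def Let_def Cs add_A distribs fun_eq_iff pointwise)
 next
  fix T assume "T : carrier (mat_alg m ?C)"
  hence T: "T v : carrier ?C" "T : extensional ?I" if "v : ?I" for v
   using that by (auto simp: mat_alg_def Let_def PiE_iff)
  have T': "T (l, l') : carrier A" "e *[A] T (l, l') = T (l, l')" "T (l, l') *[A] e = T (l, l')" if "l < m" "l' < m" for l l'
   using T(1)[of "(l, l')"] that by (auto simp: cc)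
  show "?g T : carrier A" using s t T' by (intro closed) auto
  have "?f (?g T) v = T v" for v
  proof (cases "v : ?I")
   case True
   then obtain i j where v: "v = (i, j)" "i < m" "j < m" by auto
   have "?f (?g T) v = (\<Sum>l<m. \<Sum>l'<m. e *[A] (s i *[A] (t l *[A] (T (l, l') *[A] (s l' *[A] (t j *[A] e))))))"
    using v by (simp add: sum_l sum_r assoc)
   also have "... = (\<Sum>l<m. \<Sum>l'<m. (e *[A] (s i *[A] (t l *[A] e))) *[A] (T (l, l') *[A] (e *[A] (s l' *[A] (t j *[A] e)))))"
    by (intro sum.cong refl) (simp add: assoc assoc_cong[OF T'(2)] assoc_cong[OF T'(3)])
   also have "... = (\<Sum>l<m. \<Sum>l'<m. if l' = j then (if l = i then T (i, j) else 0) else 0)"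
    using v T' st by (intro sum.cong refl) (auto simp: assoc)
   also have "... = T v" using v by simp
   finally show ?thesis .
  next
   case False
   have "T : extensional ?I" using \<open>T : carrier (mat_alg m ?C)\<close> by (auto simp: mat_alg_def Let_def PiE_iff)
   hence "T v = undefined" using False by (rule extensional_arb)
   thus ?thesis using False by simp
  qed
  thus "?f (?g T) = T" by blast
 next
  show "?f #1[A] = #1[mat_alg m ?C]"
   using st t e by (auto simp: mat_alg_def Let_def Cs fun_eq_iff one_l closed)
  show "?f (c *.[A] x) = c *.[mat_alg m ?C] ?f x" for c x
   by (auto simp: mat_alg_def Let_def Cs smult_A distribs fun_eq_iff pointwise)
 qed
 thus ?thesis unfolding alg_isomorphic_def by blast
qed

text \<open>A finite geometric series with alternating signs inverts e + n in the corner at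
  \<open>e\<close>. The powers of \<open>n\<close> are written as iterates applied to
  \<open>e\<close>, which makes the zeroth power the identity of the corner.\<close>

lemma local_inverse:
 assumes e: "e : carrier A" "e *[A] e = e" and n: "n : carrier A" "e *[A] n = n" "n *[A] e = n"
  and nil: "((%y. n *[A] y) ^^ r) e = 0"
 shows "EX y:carrier A. e *[A] y = y & y *[A] e = y & (e + n) *[A] y = e"
proof -
 define z where "z i = scl ((-1) ^ i) (((%y. n *[A] y) ^^ i) e)" for i
 have p: "((%y. n *[A] y) ^^ i) e : carrier A" "e *[A] ((%y. n *[A] y) ^^ i) e = ((%y. n *[A] y) ^^ i) e"
  "((%y. n *[A] y) ^^ i) e *[A] e = ((%y. n *[A] y) ^^ i) e" for i
  by (induction i) (use e n in \<open>auto simp: closed assoc assoc_cong[OF n(2)]\<close>)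
 have *: "(e + n) *[A] (\<Sum>i<r. z i) = e - z r" for r
 proof (induction r)
  case 0
  thus ?case by (simp add: z_def)
 next
  case (Suc r)
  have "(e + n) *[A] z r = z r - z (Suc r)"
   by (simp add: z_def distribs p fv.scale_right_distrib)
  thus ?case using Suc by (simp add: add_r)
 qed
 have "z r = 0" using nil by (simp add: z_def)
 thus ?thesis
  by (intro bexI[of _ "\<Sum>i<r. z i"]) (use * p in \<open>auto simp: z_def sum_r sum_l scl_r scl_l intro!: closed\<close>)
qed

text \<open>Modulo the nil ideal \<open>N\<close> the corners at the \<open>ep ph\<close> become
  one-dimensional and the mixed corners vanish, so the \<open>ep ph\<close> are primitive and
  pairwise not isomorphic. By \<open>full\<close> they generate the unit ideal, hence every
  primitive idempotent meets one of them outside \<open>N\<close> and is isomorphic to it.\<close>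

lemma basic_setI:
 assumes fin: "finite \<Phi>"
  and e: "!!ph. ph : \<Phi> ==> ep ph : carrier A" "!!ph. ph : \<Phi> ==> ep ph ~= 0"
  and orth: "!!ph ph'. ph : \<Phi> ==> ph' : \<Phi> ==> ep ph *[A] ep ph' = (if ph = ph' then ep ph else 0)"
  and N: "fv.subspace N" "N <= carrier A"
   "!!x n. x : carrier A ==> n : N ==> x *[A] n : N" "!!x n. x : carrier A ==> n : N ==> n *[A] x : N"
  and nil: "!!n x. n : N ==> x : carrier A ==> ((%y. n *[A] y) ^^ r) x = 0"
  and loc: "!!ph x. ph : \<Phi> ==> x : carrier A ==> \<exists>c. ep ph *[A] x *[A] ep ph - scl c (ep ph) : N"
  and off: "!!ph ph' x. ph : \<Phi> ==> ph' : \<Phi> ==> ph ~= ph' ==> x : carrier A ==> ep ph *[A] x *[A] ep ph' : N"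
  and t: "!!l. l : \<Lambda> ==> t l : carrier A" "!!l. l : \<Lambda> ==> s l : carrier A"
  and full: "(SUM l:\<Lambda>. SUM ph:\<Phi>. t l *[A] (ep ph *[A] s l)) = #1[A]"
 shows "basic_set A (ep ` \<Phi>)" "(\<Oplus>\<^bsub>A\<^esub>i\<in>ep ` \<Phi>. i) = (SUM ph:\<Phi>. ep ph)"
proof -
 have inj: "inj_on ep \<Phi>"
  by (rule inj_onI) (metis e(2) orth)
 \<comment> \<open>An idempotent equals all its iterated powers, and the \<open>r\<close>-fold one
   vanishes in \<open>N\<close>.\<close>
 have idN: "n = 0" if "n : N" "n *[A] n = n" for n
 proof -
  have "((%y. n *[A] y) ^^ i) n = n" for i by (induction i) (auto simp: that)
  thus ?thesis using nil[of n n] that N(2) by auto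
 qed
 have ee: "ep ph *[A] ep ph = ep ph" if "ph : \<Phi>" for ph using orth[OF that that] by simp
 have enN: "ep ph \<notin> N" if "ph : \<Phi>" for ph using idN ee[OF that] e(2)[OF that] by blast
 have ide: "idem A (ep ph)" if "ph : \<Phi>" for ph using that by (simp add: idem_def e ee)
 have prim: "primitive_idem A (ep ph)" if ph: "ph : \<Phi>" for ph
  unfolding primitive_idem_def
 proof (intro conjI allI impI)
  fix a b assume *: "idem A a & idem A b & a *[A] b = #0[A] & b *[A] a = #0[A] & ep ph = a +[A] b"
  hence a: "a : carrier A" "b : carrier A" "a *[A] a = a" "b *[A] b = b" "a *[A] b = 0" "b *[A] a = 0" "ep ph = a + b"
   by (auto simp: idem_def zero_A add_A)
  have "ep ph *[A] a *[A] ep ph = a" using a by (simp add: distribs)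
  then obtain c where c: "a - scl c (ep ph) : N" using loc[OF ph a(1)] by auto
  \<comment> \<open>Write a = c ep + n with n in \<open>N\<close>. Comparing with a a = a leaves
    (c^2 - c) ep in \<open>N\<close>, so c is 0 or 1, and accordingly a or its complement b lies in
    \<open>N\<close> and vanishes.\<close>
  define n where "n = a - scl c (ep ph)"
  have n: "n : N" "a = scl c (ep ph) + n" using c by (auto simp: n_def)
  have "ep ph *[A] n = n" "n *[A] ep ph = n" using a by (simp_all add: n_def distribs ee[OF ph], simp_all add: a(7) distribs a fv.scale_right_distrib)
  hence "(scl c (ep ph) + n) *[A] (scl c (ep ph) + n) = scl (c * c) (ep ph) + (scl c n + scl c n + n *[A] n)"
   by (simp add: distribs ee[OF ph] fv.scale_right_distrib add.assoc)
  hence "a *[A] a = scl (c * c) (ep ph) + (scl c n + scl c n + n *[A] n)"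
   unfolding n(2)[symmetric] .
  hence "scl (c * c - c) (ep ph) = n - (scl c n + scl c n + n *[A] n)"
  proof -
   assume *: "a *[A] a = scl (c * c) (ep ph) + (scl c n + scl c n + n *[A] n)"
   have "scl (c * c) (ep ph) + (scl c n + scl c n + n *[A] n) = scl c (ep ph) + n"
    using * a(3) n(2) by simp
   thus ?thesis by (simp add: fv.scale_left_diff_distrib algebra_simps)
  qed
  moreover have "n - (scl c n + scl c n + n *[A] n) : N"
   using n(1) N by (intro fv.subspace_diff fv.subspace_add fv.subspace_scale) auto
  ultimately have m: "scl (c * c - c) (ep ph) : N" by simp
  have "c * c - c = 0"
  proof (rule ccontr)
   assume "c * c - c ~= 0"
   hence "ep ph = scl (inverse (c * c - c)) (scl (c * c - c) (ep ph))" by simp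
   hence "ep ph : N" using fv.subspace_scale[OF N(1) m] by metis
   thus False using enN ph by blast
  qed
  hence "c * (c - 1) = 0" by (simp add: algebra_simps)
  then consider "c = 0" | "c = 1" by auto
  thus "a = #0[A] \<or> b = #0[A]"
  proof cases
   case 1
   hence "a : N" using n by simp
   thus ?thesis using idN a by (simp add: zero_A)
  next
   case 2
   hence "a = (a + b) + n" using n(2) a(7) by simp
   hence "b = - n" by (simp add: eq_neg_iff_add_eq_0 add.assoc)
   hence "b : N" using n(1) fv.subspace_neg[OF N(1)] by simp
   thus ?thesis using idN a by (simp add: zero_A)
  qed
 qed (use ide e ph in \<open>auto simp: zero_A\<close>)
 have ex: "EX ph:\<Phi>. iso_idem A i (ep ph)" if i: "primitive_idem A i" for i
 proof -
  have ic: "i : carrier A" "i *[A] i = i" "i ~= 0" using i by (auto simp: primitive_idem_def idem_def zero_A)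
  \<comment> \<open>Writing 1 on both sides of \<open>i\<close> by means of \<open>full\<close>
    expresses \<open>i\<close> through these elements; if all of them were in \<open>N\<close>, so
    would be the nonzero idempotent \<open>i\<close>.\<close>
  have "EX l:\<Lambda>. EX l':\<Lambda>. EX ph:\<Phi>. EX ph':\<Phi>. ep ph *[A] (s l *[A] (i *[A] (t l' *[A] ep ph'))) \<notin> N"
  proof (rule ccontr)
   assume neg: "\<not> ?thesis"
   have "i = #1[A] *[A] (i *[A] #1[A])" using ic by (simp add: one_l one_r)
   also have "... = (SUM l':\<Lambda>. SUM ph':\<Phi>. SUM l:\<Lambda>. SUM ph:\<Phi>. t l *[A] ((ep ph *[A] (s l *[A] (i *[A] (t l' *[A] ep ph')))) *[A] s l'))"
    unfolding full[symmetric] sum_l sum_r assoc ..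
   also have "... : N" using neg by (intro fv.subspace_sum[OF N(1)] N(3)[OF t(1)] N(4)[OF t(2)]) auto
   finally show False using idN ic by blast
  qed
  then obtain l l' ph ph' where l: "l : \<Lambda>" "l' : \<Lambda>" "ph : \<Phi>" "ph' : \<Phi>"
   and nN: "ep ph *[A] (s l *[A] (i *[A] (t l' *[A] ep ph'))) \<notin> N" by blast
  have xc: "s l *[A] (i *[A] t l') : carrier A" using l t ic by (simp add: mul_closed)
  have "ph' = ph" using off[OF l(3,4) _ xc] nN by (auto simp: assoc)
  obtain c where "ep ph *[A] (s l *[A] (i *[A] t l')) *[A] ep ph - scl c (ep ph) : N" using loc[OF l(3) xc] by blast
  define a where "a = ep ph *[A] (s l *[A] i)"
  define b where "b = i *[A] (t l' *[A] ep ph)"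
  have abN: "a *[A] b \<notin> N" "a *[A] b - scl c (ep ph) : N"
   using nN \<open>ph' = ph\<close> \<open>_ - scl c (ep ph) : N\<close> by (simp_all add: a_def b_def assoc assoc_cong[OF ic(2)])
  have c0: "c ~= 0" using abN by auto
  have ac: "a : carrier A" "b : carrier A" unfolding a_def b_def using l t ic e by (simp_all add: mul_closed)
  have ab1: "ep ph *[A] a = a" "a *[A] i = a" "i *[A] b = b" "b *[A] ep ph = b"
   by (simp_all add: a_def b_def assoc assoc_cong[OF ic(2)] ic ee[OF l(3)] assoc_cong[OF ee[OF l(3)]])
  define n where "n = scl (inverse c) (a *[A] b) - ep ph"
  have "n = scl (inverse c) (a *[A] b - scl c (ep ph))" using c0 by (simp add: n_def fv.scale_right_diff_distrib)
  hence nN: "n : N" using abN(2) fv.subspace_scale[OF N(1)] by simp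
  have "EX y:carrier A. ep ph *[A] y = y & y *[A] ep ph = y & (ep ph + n) *[A] y = ep ph"
  proof (rule local_inverse)
   show "ep ph *[A] n = n" "n *[A] ep ph = n"
    by (simp_all add: n_def distribs assoc ab1 assoc_cong[OF ab1(1)] ee[OF l(3)])
   show "((%y. n *[A] y) ^^ r) (ep ph) = 0" using nil nN e l by blast
  qed (use e ee l nN N in auto)
  then obtain y where y: "y : carrier A" "ep ph *[A] y = y" "y *[A] ep ph = y" "(ep ph + n) *[A] y = ep ph" by blast
  \<comment> \<open>The product a b is c times ep + n, which is invertible in the corner, so
    \<open>b\<close> can be corrected to make a b' equal to ep. Then b' a is a nonzero idempotent
    below \<open>i\<close>, and primitivity makes it equal to \<open>i\<close>.\<close>
  define b' where "b' = b *[A] scl (inverse c) y"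
  have b'c: "b' : carrier A" unfolding b'_def using ac y by (intro closed)
  have ab': "a *[A] b' = ep ph" using y(4) by (simp add: b'_def n_def scl_l scl_r assoc)
  have b'1: "i *[A] b' = b'" "b' *[A] ep ph = b'"
   by (simp_all add: b'_def scl_r scl_l assoc assoc_cong[OF ab1(3)] y)
  define w where "w = b' *[A] a"
  have w: "w : carrier A" "w *[A] w = w" "i *[A] w = w" "w *[A] i = w"
   using ac b'c by (simp_all add: w_def closed assoc assoc_cong[OF ab'] ab1 assoc_cong[OF b'1(1)])
  have "w ~= 0"
  proof
   assume "w = 0"
   have "ep ph = a *[A] (w *[A] b')" by (simp add: w_def assoc ab' assoc_cong[OF ab'] ee[OF l(3)])
   thus False using e(2)[OF l(3)] \<open>w = 0\<close> by simp
  qed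
  have "w = #0[A] \<or> i - w = #0[A]"
  proof -
   have "idem A w" "idem A (i - w)" "w *[A] (i - w) = #0[A]" "(i - w) *[A] w = #0[A]" "i = w +[A] (i - w)"
    using w ic by (auto simp: idem_def distribs zero_A add_A closed)
   thus ?thesis using i unfolding primitive_idem_def by blast
  qed
  hence "w = i" using \<open>w ~= 0\<close> by (simp add: zero_A)
  hence "iso_idem A i (ep ph)"
   by (intro iso_idemI[of b' a]) (use ac b'c b'1 ab1 ab' in \<open>auto simp: w_def\<close>)
  thus ?thesis using l by blast
 qed
 have uniq: "ph = ph'" if iso: "iso_idem A (ep ph) (ep ph')" and \<Phi>: "ph : \<Phi>" "ph' : \<Phi>" for ph ph'
 proof (rule ccontr)
  assume "ph ~= ph'"
  obtain a b where ab: "a : carrier A" "b : carrier A" "ep ph *[A] a = a" "a *[A] ep ph' = a" "a *[A] b = ep ph"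
   using iso_idemE[OF iso ide[OF \<Phi>(1)] ide[OF \<Phi>(2)]] by blast
  hence "a : N" using off[OF \<Phi> \<open>ph ~= ph'\<close> ab(1)] by simp
  hence "ep ph : N" using N(4)[OF ab(2)] ab(5) by metis
  thus False using enN[OF \<Phi>(1)] by blast
 qed
 show "basic_set A (ep ` \<Phi>)"
  unfolding basic_set_def
 proof (intro conjI ballI impI allI)
  show "finite (ep ` \<Phi>)" using fin by simp
  show "i : ep ` \<Phi> ==> primitive_idem A i" for i using prim by auto
  show "i : ep ` \<Phi> ==> j : ep ` \<Phi> ==> i ~= j ==> i *[A] j = #0[A]" for i j using orth by (auto simp: zero_A)
  fix i assume i: "primitive_idem A i"
  then obtain ph where ph: "ph : \<Phi>" "iso_idem A i (ep ph)" using ex by blast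
  have ii: "idem A i" using i by (simp add: primitive_idem_def)
  show "\<exists>!j. j : ep ` \<Phi> & iso_idem A i j"
  proof (rule ex1I[of _ "ep ph"])
   fix j assume "j : ep ` \<Phi> & iso_idem A i j"
   then obtain ph' where ph': "ph' : \<Phi>" "j = ep ph'" "iso_idem A i (ep ph')" by blast
   have "iso_idem A (ep ph) (ep ph')"
    by (rule iso_idem_trans[OF iso_idem_sym[OF ph(2)] ph'(3)]) (use ide ii ph ph' in auto)
   thus "j = ep ph" using uniq ph ph' by auto
  qed (use ph in auto)
 qed
 have "(\<Oplus>\<^bsub>A\<^esub>i\<in>ep ` \<Phi>. i) = (SUM i:ep ` \<Phi>. i)" by (rule finsum_A) (use e in auto)
 also have "... = (SUM ph:\<Phi>. ep ph)" using inj by (simp add: sum.reindex)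
 finally show "(\<Oplus>\<^bsub>A\<^esub>i\<in>ep ` \<Phi>. i) = (SUM ph:\<Phi>. ep ph)" .
qed

end

section \<open>Straightening\<close>

text \<open>A letter is counted as many times as there are letters from it to the end. Moving the
  larger letter of a descent to the right therefore lowers the sum while the length stays the same;
  this is the inner measure of \<open>straighten\<close>.\<close>

primrec pos_weight :: "nat list => nat" where
 "pos_weight [] = 0"
| "pos_weight (x # xs) = Suc (length xs) * x + pos_weight xs"

lemma pos_weight_swap: "i < j ==> pos_weight (u @ [i, j] @ v) < pos_weight (u @ [j, i] @ v)"
 by (induction u) auto

lemma not_sorted_split:
 "\<not> sorted xs ==> \<exists>u i j v. xs = u @ [j, i] @ v & i < (j::nat)"
proof (induction xs)
 case (Cons x xs)
 show ?case
 proof (cases "sorted xs")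
  case False
  then obtain u i j v where "xs = u @ [j, i] @ v" "i < j" using Cons.IH by blast
  thus ?thesis by (intro exI[of _ "x # u"]) auto
 next
  case True
  then obtain y ys where "xs = y # ys" "y < x" using Cons.prems
   by (cases xs) (auto simp: not_le dest: order_less_le_trans)
  thus ?thesis by (intro exI[of _ "[]"]) auto
 qed
qed simp

lemma sorted_split:
 "sorted xs ==> xs = filter (%x. x < i) xs @ replicate (count_list xs i) i @ filter (%x. i < x) xs"
 for i :: nat
proof (induction xs)
 case (Cons x xs)
 hence IH: "xs = filter (%x. x < i) xs @ replicate (count_list xs i) i @ filter (%x. i < x) xs" by simp
 consider "x < i" | "x = i" | "x > i" by linarith
 thus ?case
 proof cases
  case 1 thus ?thesis using IH by simp
 next
  case 2
  hence "filter (%x. x < i) xs = []" using Cons.prems by (auto simp: filter_empty_conv)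
  thus ?thesis using IH 2 by simp
 next
  case 3
  hence "filter (%x. x < i) xs = []" "count_list xs i = 0" "filter (%x. i < x) xs = xs"
   using Cons.prems by (auto simp: filter_empty_conv count_list_0_iff filter_id_conv)
  thus ?thesis using 3 by simp
 qed
qed simp

text \<open>Serves both the monomials in kP and the words in the path algebra. The outer induction
  is on the length, which commutators and p-th powers reduce; the inner one on
  \<open>pos_weight\<close>, which a swap reduces. Terms that are to be discarded are put into
  \<open>U\<close>, and \<open>Q\<close> fixes the letters and the weight. The factor
  \<open>q\<close> of a swap is left free to allow for quantum commutation.\<close>

lemma straighten:
 fixes wd :: "nat list => 'x => 'k::field"
 assumes U: "fv.subspace U"
  and Q: "!!xs ys. Q xs ==> mset xs = mset ys ==> Q ys"
  and swap: "!!u i j v. [|Q (u @ [j, i] @ v); i < j;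
   !!ys. Q ys ==> length ys < length (u @ [j, i] @ v) ==> wd ys : U|]
   ==> \<exists>q. wd (u @ [j, i] @ v) - scl q (wd (u @ [i, j] @ v)) : U"
  and pow: "!!u i v. [|Q (u @ replicate p i @ v);
   !!ys. Q ys ==> length ys < length (u @ replicate p i @ v) ==> wd ys : U|]
   ==> wd (u @ replicate p i @ v) : U"
  and pbw: "!!xs. Q xs ==> sorted xs ==> (!!i. count_list xs i < p) ==> wd xs : U"
  and xs: "Q xs"
 shows "wd xs : U"
 using xs
proof (induction "length xs" arbitrary: xs rule: less_induct)
 case less
 note IH = less.hyps
 show ?case
  using IH less.prems
 proof (induction "pos_weight xs" arbitrary: xs rule: less_induct)
  case less
  note short = less.prems(1) and Qx = less.prems(2)
  show ?case
  proof (cases "sorted xs")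
   case False
   then obtain u i j v where x: "xs = u @ [j, i] @ v" and ij: "i < j" using not_sorted_split by blast
   have "Q (u @ [i, j] @ v)" by (rule Q[OF Qx]) (simp add: x)
   hence "wd (u @ [i, j] @ v) : U"
    using less.hyps[of "u @ [i, j] @ v"] pos_weight_swap[OF ij] short by (simp add: x)
   moreover obtain q where "wd (u @ [j, i] @ v) - scl q (wd (u @ [i, j] @ v)) : U"
    using swap[OF Qx[unfolded x] ij] short x by blast
   ultimately have "(wd (u @ [j, i] @ v) - scl q (wd (u @ [i, j] @ v))) + scl q (wd (u @ [i, j] @ v)) : U"
    using U by (intro fv.subspace_add fv.subspace_scale)
   thus ?thesis by (simp add: x)
  next
   case True
   show ?thesis
   proof (cases "\<forall>i. count_list xs i < p")
    case True
    thus ?thesis using pbw[OF Qx \<open>sorted xs\<close>] by blast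
   next
    case False
    then obtain i where i: "p <= count_list xs i" by (auto simp: not_less)
    have "replicate (count_list xs i) i = replicate p i @ replicate (count_list xs i - p) i"
     using i by (simp add: replicate_add[symmetric])
    then obtain u v where x: "xs = u @ replicate p i @ v"
     using sorted_split[OF \<open>sorted xs\<close>, of i] by (metis append.assoc)
    show ?thesis using pow[OF Qx[unfolded x]] short x by blast
   qed
  qed
 qed
qed

section \<open>The radical of the group algebra of a p-group\<close>

locale pgroup_alg = group_alg P kP for P :: "('p, 'm) monoid_scheme" (structure)
  and kP :: "('k::field, 'p => 'k) module" +
 fixes n p :: nat
 assumes char_p: "CHAR('k) = p" and prime_p: "prime p" and order_P: "card (carrier P) = p ^ n"
begin

definition aug :: "('p => 'k) set" where
 "aug = {f : carrier kP. (SUM g:carrier P. f g) = 0}"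

definition dl :: "'p => 'p => 'k" where
 "dl g = delta g - delta \<one>"

lemma sum_delta: "g : carrier P ==> (SUM x:carrier P. delta g x) = (1::'k)"
 using finite_T by (simp add: delta_apply)

lemma dl_aug: "g : carrier P ==> dl g : aug"
 by (simp add: aug_def dl_def closed delta_in sum_subtractf sum_delta pointwise)

lemma aug_sub: "fv.subspace aug"
 unfolding fv.subspace_def aug_def
 by (auto simp: closed sum.distrib sum_distrib_left[symmetric] pointwise)

lemma aug_carrier: "aug <= carrier kP"
 by (auto simp: aug_def)

lemma sum_mult: "(SUM g:carrier P. (x *[kP] y) g) = (SUM g:carrier P. x g) * (SUM g:carrier P. y g)"
proof -
 have "(SUM g:carrier P. (x *[kP] y) g) = (SUM g:carrier P. SUM s:carrier P. SUM t:carrier P. x s * y t * delta (s \<otimes> t) g)"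
  by (simp add: mult_def sum_apply pointwise)
 also have "... = (SUM s:carrier P. SUM t:carrier P. SUM g:carrier P. x s * y t * delta (s \<otimes> t) g)"
  by (subst sum.swap) (intro sum.cong refl sum.swap)
 also have "... = (SUM s:carrier P. SUM t:carrier P. x s * y t)"
  by (intro sum.cong refl) (simp add: sum_distrib_left[symmetric] sum_delta)
 finally show ?thesis by (simp add: sum_product)
qed

lemma aug_mul: "x : carrier kP ==> y : aug ==> x *[kP] y : aug" "x : aug ==> y : carrier kP ==> x *[kP] y : aug"
 by (auto simp: aug_def closed sum_mult)

lemma aug_span: "f : aug ==> f = (SUM g:carrier P. scl (f g) (dl g))"
proof -
 assume f: "f : aug"
 have "(SUM g:carrier P. scl (f g) (dl g)) = (SUM g:carrier P. scl (f g) (delta g)) - scl (SUM g:carrier P. f g) (delta \<one>)"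
  by (simp add: dl_def fv.scale_right_diff_distrib sum_subtractf fv.scale_sum_left)
 also have "... = f" using f expand[of f] by (simp add: aug_def)
 finally show ?thesis by simp
qed

text \<open>The form of kP over the prime field, given as the functions with values in the image of
  the natural numbers. It is finite, which makes orbit counting possible even when the field is
  infinite.\<close>

definition prim :: "('p => 'k) set" where
 "prim = {f : carrier kP. \<forall>g. f g : range of_nat}"

lemma range_of_nat: "range (of_nat :: nat => 'k) = of_nat ` {..<p}"
proof
 show "range (of_nat :: nat => 'k) <= of_nat ` {..<p}"
 proof
  fix x :: 'k assume "x : range of_nat"
  then obtain i where "x = of_nat i" by blast
  hence "x = of_nat (i mod p)" by (simp add: of_nat_eq_iff_cong_CHAR char_p cong_def)
  thus "x : of_nat ` {..<p}" using prime_p by (auto simp: prime_gt_0_nat)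
 qed
qed auto

lemma card_range: "card (range (of_nat :: nat => 'k)) = p"
 unfolding range_of_nat
 by (subst card_image) (auto simp: inj_on_def of_nat_eq_iff_cong_CHAR char_p cong_def)

lemma finite_range: "finite (range (of_nat :: nat => 'k))"
 unfolding range_of_nat by simp

lemma range_neg: "x : range (of_nat :: nat => 'k) ==> - x : range (of_nat :: nat => 'k)"
proof -
 assume "x : range (of_nat :: nat => 'k)"
 then obtain i where i: "x = of_nat i" by blast
 have "of_nat ((p - 1) * i) = of_nat (p - 1) * (of_nat i :: 'k)" by simp
 also have "of_nat (p - 1) = (- 1 :: 'k)"
 proof -
  have "of_nat (p - 1) + 1 = (of_nat (p - 1 + 1) :: 'k)" by simp
  also have "p - 1 + 1 = p" using prime_gt_0_nat[OF prime_p] by simp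
  also have "of_nat p = (0 :: 'k)" using of_nat_CHAR[where 'a='k] by (simp only: char_p)
  finally show ?thesis by (simp add: eq_neg_iff_add_eq_0)
 qed
 finally have "- x = of_nat ((p - 1) * i)" by (simp add: i)
 thus ?thesis by blast
qed

lemma range_add: "x : range (of_nat :: nat => 'k) ==> y : range (of_nat :: nat => 'k) ==> x + y : range (of_nat :: nat => 'k)"
 by (metis (no_types, lifting) image_iff of_nat_add rangeI)

lemma zero_range: "0 : range (of_nat :: nat => 'k)"
 by (rule range_eqI[of _ _ 0]) simp

lemma card_prim: "finite prim" "card prim = p ^ card (carrier P)"
proof -
 have "bij_betw (%f. restrict f (carrier P)) prim (carrier P \<rightarrow>\<^sub>E range (of_nat :: nat => 'k))"
 proof (rule bij_betw_byWitness[where f' = "%f g. if g : carrier P then f g else 0"])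
  show "(%f g. if g : carrier P then f g else 0) ` (carrier P \<rightarrow>\<^sub>E range (of_nat :: nat => 'k)) <= prim"
   by (auto simp: prim_def carrier_kT simp: PiE_iff zero_range)
 qed (auto simp: prim_def carrier_kT fun_eq_iff PiE_iff extensional_def)
 hence *: "finite prim = finite (carrier P \<rightarrow>\<^sub>E range (of_nat :: nat => 'k))"
  "card prim = card (carrier P \<rightarrow>\<^sub>E range (of_nat :: nat => 'k))"
  by (rule bij_betw_finite, rule bij_betw_same_card)
 show "finite prim" unfolding * by (rule finite_PiE) (auto intro: finite_T finite_range)
 show "card prim = p ^ card (carrier P)" unfolding * using finite_T by (simp add: card_funcsetE card_range)
qed

lemma prim_add: "f : prim ==> g : prim ==> f + g : prim"
 by (auto simp: prim_def closed pointwise intro!: range_add)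

lemma prim_diff: "f : prim ==> g : prim ==> f - g : prim"
 using range_add[OF _ range_neg] by (auto simp: prim_def closed pointwise)

lemma delta_mul_apply: "g : carrier P ==> x : carrier P ==> (delta g *[kP] f) x = f (inv g \<otimes> x)"
proof -
 assume g: "g : carrier P" and x: "x : carrier P"
 have "(delta g *[kP] f) x = (SUM s:carrier P. SUM t:carrier P. if s = g then (if t = inv g \<otimes> x then f t else 0) else 0)"
  unfolding mult_def sum_apply scl_apply delta_apply
  using g x by (intro sum.cong refl) (auto simp: m_assoc[symmetric] inv_solve_left)
 also have "... = (SUM s:carrier P. if s = g then f (inv g \<otimes> x) else 0)"
  using finite_T g x by (intro sum.cong refl) auto
 also have "... = f (inv g \<otimes> x)" using finite_T g by simp
 finally show ?thesis .
qed

lemma prim_act: "g : carrier P ==> f : prim ==> delta g *[kP] f : prim"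
proof -
 assume g: "g : carrier P" and f: "f : prim"
 have c: "delta g *[kP] f : carrier kP" using g f by (auto simp: prim_def closed delta_in)
 have "(delta g *[kP] f) x : range of_nat" for x
 proof (cases "x : carrier P")
  case True
  thus ?thesis using f g by (auto simp: prim_def delta_mul_apply)
 next
  case False
  hence "(delta g *[kP] f) x = of_nat 0" using c by (auto simp: carrier_kT)
  thus ?thesis by blast
 qed
 thus ?thesis using c by (simp add: prim_def)
qed

text \<open>Orbit counting: if only the elements of \<^term>\<open>S\<close> were fixed modulo \<^term>\<open>S\<close>, then
  \<open>p |S|\<close> would divide \<open>|prim| - |S|\<close> and hence \<open>|S|\<close>.\<close>

lemma fixed_modulo:
 assumes S: "S \<subset> prim" "0 : S" "!!x y. x : S ==> y : S ==> x + y : S" "!!x y. x : S ==> y : S ==> x - y : S"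
  and act: "!!g x. g : carrier P ==> x : S ==> delta g *[kP] x : S"
 shows "EX x:prim - S. ALL g:carrier P. delta g *[kP] x - x : S"
proof (rule ccontr)
 assume neg: "\<not> ?thesis"
 let ?a = "%g x. delta g *[kP] x"
 have aa: "?a g (?a h x) = ?a (g \<otimes> h) x" if "g : carrier P" "h : carrier P" for g h x
  using mul_delta[OF that] by (metis assoc)
 have a1: "?a \<one> x = x" if "x : prim" for x using one_l[of x] that by (simp add: one_delta prim_def)
 have ai: "?a (inv g) (?a g x) = x" if "g : carrier P" "x : prim" for g x
  using that by (simp add: aa a1)
 define r where "r = {(x, y). x : prim - S & y : prim - S & (EX g:carrier P. y - ?a g x : S)}"
 have inS: "?a g x : S ==> x : prim ==> g : carrier P ==> x : S" for g x
  using act[of "inv g" "?a g x"] ai[of g x] by simp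
 have finS: "finite S" using S card_prim by (meson finite_subset psubset_imp_subset)
 have cardS: "card S > 0" using S finS by (auto simp: card_gt_0_iff)
 have equiv: "equiv (prim - S) r"
 proof (rule equivI)
  show "refl_on (prim - S) r"
   unfolding refl_on_def r_def using S a1 by (auto intro!: bexI[of _ \<one>])
  show "sym r"
  proof (rule symI)
   fix x y assume "(x, y) : r"
   then obtain g where g: "x : prim - S" "y : prim - S" "g : carrier P" "y - ?a g x : S" by (auto simp: r_def)
   have "x - ?a (inv g) y = 0 - ?a (inv g) (y - ?a g x)" using g ai[of g x] by (simp add: diff_r)
   also have "... : S" by (rule S(4)[OF S(2) act[OF inv_closed[OF g(3)] g(4)]])
   finally show "(y, x) : r" using g by (auto simp: r_def intro!: bexI[of _ "inv g"])
  qed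
  show "trans r"
  proof (rule transI)
   fix x y z assume "(x, y) : r" "(y, z) : r"
   then obtain g h where g: "x : prim - S" "y : prim - S" "z : prim - S" "g : carrier P" "y - ?a g x : S"
    "h : carrier P" "z - ?a h y : S" by (auto simp: r_def)
   have "z - ?a (h \<otimes> g) x = (z - ?a h y) + ?a h (y - ?a g x)" using g by (simp add: diff_r aa)
   also have "... : S" by (rule S(3)[OF g(7) act[OF g(6,5)]])
   finally show "(x, z) : r" using g by (auto simp: r_def intro!: bexI[of _ "h \<otimes> g"])
  qed
 qed (auto simp: r_def)
 have "p * card S dvd card C" if C: "C : (prim - S) // r" for C
 proof -
  obtain x where x: "x : prim - S" "C = r `` {x}" using C by (rule quotientE)
  hence xp: "x : prim" by blast
  \<comment> \<open>Fibre of the map (g, s) -> g x + s from P x \<open>S\<close> onto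
    \<open>C\<close>. All fibres have the size of the stabiliser \<open>H\<close> of
    \<open>x\<close> modulo \<open>S\<close>, so the class has |P : H| |S| elements, and
    \<open>neg\<close> makes the index a proper power of p.\<close>
  define F where "F y = {(g, s). g : carrier P & s : S & ?a g x + s = y}" for y
  define H where "H = {g : carrier P. ?a g x - x : S}"
  have H: "subgroup H P"
  proof (rule subgroupI)
   show "H <= carrier P" by (auto simp: H_def)
   show "H ~= {}" using S a1[OF xp] by (auto simp: H_def intro!: exI[of _ \<one>])
  next
   fix g assume g: "g : H"
   hence gP: "g : carrier P" "?a g x - x : S" by (simp_all add: H_def)
   have "?a (inv g) x - x = 0 - ?a (inv g) (?a g x - x)" using g ai[of g x] xp by (auto simp: H_def diff_r)
   also have "... : S" by (rule S(4)[OF S(2) act[OF inv_closed[OF gP(1)] gP(2)]])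
   finally show "inv g : H" using g by (auto simp: H_def)
  next
   fix g h assume g: "g : H" and h: "h : H"
   hence gP: "g : carrier P" "?a g x - x : S" "h : carrier P" "?a h x - x : S" by (simp_all add: H_def)
   have "?a (g \<otimes> h) x - x = ?a g (?a h x - x) + (?a g x - x)" using g h by (auto simp: H_def diff_r aa)
   also have "... : S" by (rule S(3)[OF act[OF gP(1,4)] gP(2)])
   finally show "g \<otimes> h : H" using g h by (auto simp: H_def)
  qed
  have fib: "card (F y) = card H" if y: "y : C" for y
  proof -
   obtain g0 where g0: "g0 : carrier P" "y - ?a g0 x : S" using y x by (auto simp: r_def)
   have "bij_betw (%h. (g0 \<otimes> h, y - ?a (g0 \<otimes> h) x)) H (F y)"
   proof (rule bij_betw_byWitness[where f' = "%(g, s). inv g0 \<otimes> g"])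
    show "ALL h:H. (case (g0 \<otimes> h, y - ?a (g0 \<otimes> h) x) of (g, s) => inv g0 \<otimes> g) = h"
     using g0 by (auto simp: H_def m_assoc[symmetric])
    show "ALL v:F y. (g0 \<otimes> (case v of (g, s) => inv g0 \<otimes> g), y - ?a (g0 \<otimes> (case v of (g, s) => inv g0 \<otimes> g)) x) = v"
     using g0 by (auto simp: F_def m_assoc[symmetric])
    show "(%h. (g0 \<otimes> h, y - ?a (g0 \<otimes> h) x)) ` H <= F y"
    proof (clarsimp simp: F_def g0)
     fix h assume h: "h : H"
     hence hP: "h : carrier P" by (simp add: H_def)
     have "y - ?a (g0 \<otimes> h) x = (y - ?a g0 x) - ?a g0 (?a h x - x)" using g0 hP by (simp add: diff_r aa)
     also have "... : S" using S(4)[OF g0(2) act[OF g0(1)]] h by (simp add: H_def)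
     finally show "g0 \<otimes> h : carrier P & y - ?a (g0 \<otimes> h) x : S" using g0 hP by simp
    qed
    show "(%(g, s). inv g0 \<otimes> g) ` F y <= H"
    proof (clarsimp simp: F_def)
     fix g s assume g: "g : carrier P" and s: "s : S" and ys: "y = ?a g x + s"
     have "?a (inv g0 \<otimes> g) x - x = ?a (inv g0) ((y - ?a g0 x) - s)"
      using g g0 xp ys by (simp add: diff_r aa[symmetric] ai add_r)
     also have "... : S" by (rule act[OF inv_closed[OF g0(1)] S(4)[OF g0(2) s]])
     finally show "inv g0 \<otimes> g : H" using g g0 by (simp add: H_def)
    qed
   qed
   thus ?thesis by (rule bij_betw_same_card[symmetric])
  qed
  have CF: "carrier P \<times> S = (\<Union>y\<in>C. F y)"
  proof
   show "carrier P \<times> S <= (\<Union>y\<in>C. F y)"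
   proof clarify
    fix g s assume g: "g : carrier P" and s: "s : S"
    let ?y = "?a g x + s"
    have "?y : prim" using prim_add prim_act[OF g xp] s S by blast
    moreover have "?y \<notin> S"
    proof
     assume "?y : S"
     hence "?y - s : S" using S s by blast
     thus False using inS[of g x] g xp x by simp
    qed
    ultimately have "?y : C" using x g s by (auto simp: r_def intro!: bexI[of _ g])
    thus "(g, s) : (\<Union>y\<in>C. F y)" using g s by (auto simp: F_def)
   qed
  qed (auto simp: F_def)
  have finC: "finite C" using x card_prim(1) by (auto simp: r_def intro: finite_subset[of _ prim])
  have "card (carrier P) * card S = card (\<Union>y\<in>C. F y)" by (simp add: CF[symmetric] card_cartesian_product)
  also have "... = (SUM y:C. card (F y))"
   using finC finS finite_T by (intro card_UN_disjoint) (auto simp: F_def intro: finite_subset[of _ "carrier P \<times> S"])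
  also have "... = card C * card H" by (simp add: fib)
  finally have e: "p ^ n * card S = card C * card H" by (simp add: order_P)
  have "card H dvd p ^ n" using lagrange[OF H] order_P by (metis Coset.order_def dvd_triv_right)
  then obtain j where j: "j <= n" "card H = p ^ j" using prime_p divides_primepow_nat by blast
  have "H ~= carrier P" using neg x unfolding H_def by blast
  hence "card H < card (carrier P)" using finite_T by (intro psubset_card_mono) (auto simp: H_def)
  hence "j < n" using j order_P by (cases "j = n") auto
  hence "p ^ n = p ^ j * p ^ (n - j)" by (simp add: power_add[symmetric])
  hence "p ^ j * (p ^ (n - j) * card S) = p ^ j * card C" using e j by (simp add: mult_ac)
  hence "p ^ (n - j) * card S = card C" using prime_p by (auto simp: prime_gt_0_nat)
  moreover have "p dvd p ^ (n - j)" using \<open>j < n\<close> by (simp add: dvd_power)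
  ultimately show ?thesis by (metis mult_dvd_mono dvd_refl)
 qed
 hence "p * card S dvd card (prim - S)"
  using card_prim(1) by (intro equiv_imp_dvd_card[OF _ equiv]) auto
 moreover have "p * card S dvd card prim"
 proof -
  \<comment> \<open>The cosets of \<open>S\<close> show that |S| divides |prim|, a power of p; being
    smaller, it leaves a factor p over, so that p |S| divides |prim| as well.\<close>
  define r' where "r' = {(x, y). x : prim & y : prim & y - x : S}"
  have e': "equiv prim r'"
  proof (rule equivI)
   show "refl_on prim r'" using S by (auto simp: refl_on_def r'_def)
   show "sym r'"
   proof (rule symI)
    fix x y assume "(x, y) : r'"
    hence "x : prim" "y : prim" "0 - (y - x) : S" using S(4)[OF S(2), of "y - x"] by (simp_all add: r'_def)
    thus "(y, x) : r'" by (simp add: r'_def)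
   qed
   show "trans r'"
   proof (rule transI)
    fix x y z assume "(x, y) : r'" "(y, z) : r'"
    hence "(z - y) + (y - x) : S" "x : prim" "z : prim" using S(3)[of "z - y" "y - x"] by (auto simp: r'_def)
    thus "(x, z) : r'" by (simp add: r'_def)
   qed
  qed (auto simp: r'_def)
  have "card S dvd card C" if "C : prim // r'" for C
  proof -
   obtain x where x: "x : prim" "C = r' `` {x}" using \<open>C : prim // r'\<close> by (rule quotientE)
   have "C = (%s. x + s) ` S"
   proof
    show "C <= (%s. x + s) ` S"
    proof
     fix y assume "y : C"
     hence "y - x : S" "y = x + (y - x)" using x by (auto simp: r'_def)
     thus "y : (%s. x + s) ` S" by blast
    qed
    show "(%s. x + s) ` S <= C" using x S prim_add by (auto simp: r'_def)
   qed
   hence "card C = card S" by (simp add: card_image inj_on_def)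
   thus ?thesis by simp
  qed
  hence "card S dvd card prim" by (intro equiv_imp_dvd_card[OF card_prim(1) e'])
  hence "card S dvd p ^ card (carrier P)" by (simp only: card_prim(2))
  then obtain j where j: "j <= card (carrier P)" "card S = p ^ j" using prime_p divides_primepow_nat by blast
  have "card S < card prim" using S(1) card_prim(1) by (rule psubset_card_mono[rotated])
  hence "j ~= card (carrier P)" using j card_prim by auto
  hence "p ^ Suc j dvd p ^ card (carrier P)" using j by (intro le_imp_power_dvd) auto
  thus ?thesis using j card_prim by simp
 qed
 moreover have "card prim = card (prim - S) + card S"
  using S(1) finS card_prim(1) card_mono[of prim S] by (simp add: card_Diff_subset psubset_imp_subset)
 ultimately have "p * card S dvd card S" by (metis dvd_add_right_iff)
 hence "p * card S <= card S" using cardS by (rule dvd_imp_le)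
 thus False using cardS prime_gt_1_nat[OF prime_p] by simp
qed

text \<open>The ascending socle series of the prime field form of kP. It climbs to
  \<open>prim\<close> by fixed points, and its length bounds the nilpotency of the augmentation
  ideal.\<close>

primrec layer :: "nat => ('p => 'k) set" where
 "layer 0 = {0}"
| "layer (Suc r) = {x : prim. ALL g:carrier P. dl g *[kP] x : layer r}"

lemma dl_mul: "x : carrier kP ==> dl g *[kP] x = delta g *[kP] x - x"
 using one_l[of x] by (simp add: dl_def diff_l one_delta)

lemma prim_carrier: "x : prim ==> x : carrier kP"
 by (simp add: prim_def)

lemma zero_prim: "0 : prim"
 by (auto simp: prim_def closed pointwise intro: range_eqI[of _ _ 0])

lemma layer_props:
 "layer r <= prim & 0 : layer r & (ALL x:layer r. ALL y:layer r. x + y : layer r & x - y : layer r) &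
 (ALL g:carrier P. ALL x:layer r. delta g *[kP] x : layer r)"
proof (induction r)
 case 0
 thus ?case by (simp add: zero_prim)
next
 case (Suc r)
 have "delta g *[kP] x : layer (Suc r)" if g: "g : carrier P" and x: "x : layer (Suc r)" for g x
 proof -
  have xp: "x : prim" using x by simp
  have "dl h *[kP] (delta g *[kP] x) : layer r" if h: "h : carrier P" for h
  proof -
   \<comment> \<open>Conjugation turns (h - 1) g into g times another element of the same kind, so P
     permutes the conditions that define a layer.\<close>
   let ?h = "inv g \<otimes> h \<otimes> g"
   have "dl h *[kP] delta g = delta g *[kP] dl ?h"
    using g h by (simp add: dl_def diff_l diff_r mul_delta m_assoc[symmetric])
   hence "dl h *[kP] (delta g *[kP] x) = delta g *[kP] (dl ?h *[kP] x)" by (metis assoc)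
   thus ?thesis using Suc x g h by simp
  qed
  thus ?thesis using prim_act[OF g xp] by simp
 qed
 moreover have "x + y : layer (Suc r) & x - y : layer (Suc r)" if "x : layer (Suc r)" "y : layer (Suc r)" for x y
  using that conjunct1[OF conjunct2[OF conjunct2[OF Suc]]] prim_add[of x y] prim_diff[of x y]
  unfolding layer.simps mem_Collect_eq add_r diff_r by blast
 moreover have "layer (Suc r) <= prim" "0 : layer (Suc r)" using Suc zero_prim by auto
 ultimately show ?case by blast
qed

text \<open>By \<open>fixed_modulo\<close> every proper layer grows strictly at the next step, which
  a finite set permits only finitely often.\<close>

lemma layer_full: "\<exists>r. layer r = prim"
proof (rule ccontr)
 assume neg: "\<not> ?thesis"
 have "layer r <= layer (Suc r)" for r
 proof (induction r)
  case 0
  show ?case by (simp add: zero_prim)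
 qed auto
 have "card (layer r) >= r" for r
 proof (induction r)
  case (Suc r)
  have sub: "layer r \<subset> prim" using layer_props[of r] neg by blast
  obtain x where x: "x : prim - layer r" "ALL g:carrier P. delta g *[kP] x - x : layer r"
   using fixed_modulo[OF sub] layer_props[of r] by blast
  hence "x : layer (Suc r)" by (simp add: dl_mul prim_carrier)
  hence "layer r \<subset> layer (Suc r)" using x \<open>layer r <= layer (Suc r)\<close> by blast
  moreover have "finite (layer (Suc r))" using layer_props[of "Suc r"] card_prim(1) finite_subset by blast
  ultimately have "card (layer r) < card (layer (Suc r))" by (metis psubset_card_mono)
  thus ?case using Suc by simp
 qed simp
 moreover have "card (layer r) <= card prim" for r
  using layer_props[of r] card_prim(1) by (intro card_mono) auto
 ultimately show False using Suc_n_not_le_n by (metis le_trans)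
qed

section \<open>Powers of the augmentation ideal and the Jacobson radical\<close>

definition augpow :: "nat => ('p => 'k) set" where
 "augpow r = (ideal_prod kP aug ^^ r) (carrier kP)"

lemma augpow_0: "augpow 0 = carrier kP" and augpow_Suc: "augpow (Suc r) = ideal_prod kP aug (augpow r)"
 by (simp_all add: augpow_def)

lemma augpow_carrier: "augpow r <= carrier kP"
proof (induction r)
 case (Suc r)
 have "x : carrier kP" if "x : ideal_prod kP aug (augpow r)" for x
  using that
 proof induction
  case (prod i j)
  thus ?case using Suc aug_carrier by (intro mul_closed) auto
 next
  case (sum s1 s2)
  thus ?case by (simp add: add_A closed)
 qed
 thus ?case by (auto simp: augpow_Suc)
qed (simp add: augpow_0)

lemma augpow_sub: "fv.subspace (augpow r)"
proof (induction r)
 case (Suc r)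
 have "scl c x : ideal_prod kP aug (augpow r)" if "x : ideal_prod kP aug (augpow r)" for c x
  using that
 proof induction
  case (prod i j)
  hence "scl c i *[kP] j : ideal_prod kP aug (augpow r)"
   using aug_sub by (intro ideal_prod.prod fv.subspace_scale)
  thus ?case by (simp add: scl_l)
 next
  case (sum s1 s2)
  hence "scl c s1 +[kP] scl c s2 : ideal_prod kP aug (augpow r)" by (intro ideal_prod.sum)
  thus ?case by (simp add: add_A fv.scale_right_distrib)
 qed
 moreover have "x + y : ideal_prod kP aug (augpow r)" if "x : ideal_prod kP aug (augpow r)" "y : ideal_prod kP aug (augpow r)" for x y
  using ideal_prod.sum[OF that] by (simp add: add_A)
 moreover have "0 : ideal_prod kP aug (augpow r)"
  using ideal_prod.prod[of 0 aug 0 "augpow r" kP] aug_sub Suc by (simp add: fv.subspace_0)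
 ultimately show ?case unfolding augpow_Suc fv.subspace_def by blast
qed (simp add: augpow_0 sub_A)

lemma augpow_SucI: "i : aug ==> j : augpow r ==> i *[kP] j : augpow (Suc r)"
 unfolding augpow_Suc by (rule ideal_prod.prod)

lemma augpow_Suc_induct [consumes 1, case_names prod sum]:
 assumes "x : augpow (Suc r)" "!!i j. i : aug ==> j : augpow r ==> Q (i *[kP] j)"
  "!!x y. Q x ==> Q y ==> Q (x + y)"
 shows "Q x"
 using assms(1) unfolding augpow_Suc
 by induction (use assms(2,3) in \<open>auto simp: add_A\<close>)

lemma augpow_mul: "x : augpow a ==> y : augpow b ==> x *[kP] y : augpow (a + b)"
proof (induction a arbitrary: x)
 case 0
 have *: "x *[kP] y : augpow b" if "x : carrier kP" "y : augpow b" for x y b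
 proof (cases b)
  case (Suc c)
  have "x *[kP] y : augpow (Suc c)" if "y : augpow (Suc c)" for y
   using that
  proof (induction rule: augpow_Suc_induct)
   case (prod i j)
   thus ?case using augpow_SucI[OF aug_mul(1)[OF \<open>x : carrier kP\<close> prod(1)] prod(2)] by (simp add: assoc)
  next
   case (sum s1 s2)
   thus ?case using augpow_sub by (simp add: add_r fv.subspace_add)
  qed
  thus ?thesis using that Suc by blast
 qed (use that in \<open>simp add: augpow_0 closed\<close>)
 show ?case using 0 * by (simp add: augpow_0)
next
 case (Suc a)
 from Suc.prems(1) show ?case
 proof (induction rule: augpow_Suc_induct)
  case (prod i j)
  thus ?case using augpow_SucI[OF prod(1) Suc.IH[OF prod(2) Suc.prems(2)]] by (simp add: assoc)
 next
  case (sum s1 s2)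
  thus ?case using augpow_sub by (simp add: add_l fv.subspace_add)
 qed
qed

lemma augpow_1: "augpow (Suc 0) = aug"
proof
 show "augpow (Suc 0) <= aug"
 proof
  fix x assume "x : augpow (Suc 0)"
  thus "x : aug"
   by (induction rule: augpow_Suc_induct) (use aug_mul aug_sub in \<open>auto simp: augpow_0 intro: fv.subspace_add\<close>)
 qed
 show "aug <= augpow (Suc 0)"
  using augpow_SucI[of _ "#1[kP]" 0] one_r one_closed aug_carrier by (force simp: augpow_0)
qed

lemma augpow_decr: "augpow (Suc r) <= augpow r"
proof (induction r)
 case 0
 thus ?case using augpow_carrier by (simp add: augpow_0)
next
 case (Suc r)
 show ?case
 proof
  fix x assume "x : augpow (Suc (Suc r))"
  thus "x : augpow (Suc r)"
   by (induction rule: augpow_Suc_induct) (use Suc augpow_SucI augpow_sub in \<open>auto intro: fv.subspace_add\<close>)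
 qed
qed

lemma augpow_mono: "a <= b ==> augpow b <= augpow a"
 by (rule lift_Suc_antimono_le[of augpow]) (rule augpow_decr)

text \<open>Each factor from the augmentation ideal is a combination of elements g - 1 and so lowers
  the layer by one. The span passes from coefficients in the prime field to
  \<open>k\<close>.\<close>

lemma augpow_layer: "y : augpow r ==> x : layer (r + t) ==> y *[kP] x : fv.span (layer t)"
proof (induction r arbitrary: y t)
 case 0
 have "delta g *[kP] x : fv.span (layer t)" if "g : carrier P" for g
  using layer_props[of t] 0 that by (intro fv.span_base) auto
 moreover have "y *[kP] x = (SUM g:carrier P. scl (y g) (delta g *[kP] x))"
  using 0 expand[of y] sum_l[of "%g. scl (y g) (delta g)" "carrier P" x] by (simp add: augpow_0 scl_l)
 ultimately show ?case by (simp add: span_sumI)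
next
 case (Suc r)
 from Suc.prems(1) show ?case
 proof (induction rule: augpow_Suc_induct)
  case (prod i j)
  have "j *[kP] x : fv.span (layer (Suc t))" using Suc.IH[OF prod(2), of "Suc t"] Suc.prems by simp
  moreover have "dl g *[kP] z : fv.span (layer t)" if "g : carrier P" "z : layer (Suc t)" for g z
   using that by (intro fv.span_base) simp
  moreover have "i : fv.span (dl ` carrier P)"
   by (subst aug_span[OF prod(1)]) (intro span_sumI fv.span_base imageI)
  ultimately have "i *[kP] (j *[kP] x) : fv.span (layer t)"
   by (intro span_mul[of i "dl ` carrier P" "j *[kP] x" "layer (Suc t)"]) auto
  thus ?case by (simp add: assoc)
 next
  case (sum s1 s2)
  thus ?case by (simp add: add_l fv.span_add)
 qed
qed

text \<open>The identity has coefficients in the prime field and hence lies in the layer that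
  exhausts \<open>prim\<close>; so x = x 1 ends in layer 0.\<close>

lemma augpow_nilpotent: "\<exists>r. augpow r = {0}"
proof -
 obtain r where r: "layer r = prim" using layer_full by blast
 have "#1[kP] : prim" using one_closed
  by (auto simp: prim_def one_delta delta_apply intro: range_eqI[of _ _ 0] range_eqI[of _ _ 1])
 hence "x = 0" if "x : augpow r" for x
  using augpow_layer[OF that, of "#1[kP]" 0] r that augpow_carrier[of r] by (auto simp: one_r)
 hence "augpow r = {0}" using augpow_sub[of r] fv.subspace_0 by blast
 thus ?thesis ..
qed

lemma left_idealD:
 assumes "left_ideal kP M"
 shows "M <= carrier kP" "0 : M" "x : M ==> y : M ==> x + y : M" "x : M ==> - x : M"
  "x : M ==> y : M ==> x - y : M" "a : carrier kP ==> x : M ==> a *[kP] x : M"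
proof -
 interpret M: additive_subgroup M kP using assms by (simp add: left_ideal_def)
 show c: "M <= carrier kP" by (rule M.a_subset)
 show "0 : M" using M.zero_closed by (simp add: zero_A)
 show a: "x : M ==> y : M ==> x + y : M" for x y using M.a_closed by (simp add: add_A)
 show i: "x : M ==> - x : M" for x
  using M.a_inv_closed[of x] c a_inv_A[of x] by auto
 show "x : M ==> y : M ==> x - y : M" using a[of x "- y"] i[of y] by simp
 show "a : carrier kP ==> x : M ==> a *[kP] x : M" using assms by (simp add: left_ideal_def)
qed

lemma left_idealI:
 assumes "M <= carrier kP" "0 : M" "!!x y. x : M ==> y : M ==> x + y : M" "!!x. x : M ==> - x : M"
  "!!a x. a : carrier kP ==> x : M ==> a *[kP] x : M"
 shows "left_ideal kP M"
 unfolding left_ideal_def additive_subgroup_def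
proof (intro conjI ballI)
 interpret abelian_group kP by (rule abelian_group_A)
 show "subgroup M (add_monoid kP)"
 proof (rule add.subgroupI)
  show "\<ominus>\<^bsub>kP\<^esub> a : M" if "a : M" for a using that assms by (simp add: a_inv_A subsetD)
 qed (use assms in \<open>auto simp: add_A\<close>)
qed (use assms in auto)

text \<open>The augmentation ideal has codimension one, hence is a maximal left ideal. Conversely a
  nilpotent ideal lies in every maximal left ideal \<open>M\<close>: otherwise 1 = m + a x with x in
  the ideal, and multiplying by ever deeper powers forces \<open>M\<close> to be everything.\<close>

lemma jacobson_rad_aug: "jacobson_rad kP = aug"
proof
 have "left_ideal kP aug"
  by (rule left_idealI) (use aug_sub aug_carrier aug_mul in \<open>auto intro: fv.subspace_0 fv.subspace_add fv.subspace_neg\<close>)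
 moreover have "delta \<one> \<notin> aug" by (simp add: aug_def sum_delta)
 moreover have "N = aug \<or> N = carrier kP" if N: "left_ideal kP N" "aug <= N" for N
 proof (cases "N = aug")
  case False
  note ND = left_idealD[OF N(1)]
  obtain x where x: "x : N" "x \<notin> aug" using False N by blast
  have xc: "x : carrier kP" using x ND by blast
  define c where "c = (SUM g:carrier P. x g)"
  have c: "c ~= 0" using x xc by (auto simp: aug_def c_def)
  have "x - scl c (delta \<one>) : aug"
   using xc by (simp add: aug_def closed delta_in sum_subtractf sum_delta pointwise c_def sum_distrib_left[symmetric])
  hence "x - (x - scl c (delta \<one>)) : N" using ND(5) x N(2) by blast
  hence "scl (inverse c) (delta \<one>) *[kP] scl c (delta \<one>) : N"
   using ND(6) by (simp add: closed delta_in)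
  hence 1: "#1[kP] : N" using c by (simp add: scl_l scl_r mul_delta one_delta)
  have "y : N" if "y : carrier kP" for y using ND(6)[OF that 1] one_r[OF that] by simp
  thus ?thesis using ND(1) by blast
 qed simp
 ultimately have "max_left_ideal kP aug"
  unfolding max_left_ideal_def using delta_in[OF monoid.one_closed[OF is_monoid]] by blast
 thus "jacobson_rad kP <= aug" by (auto simp: jacobson_rad_def)
 show "aug <= jacobson_rad kP"
 proof
  fix x assume x: "x : aug"
  have "x : M" if M: "max_left_ideal kP M" for M
  proof (rule ccontr)
   assume xM: "x \<notin> M"
   have Ml: "left_ideal kP M" using M by (simp add: max_left_ideal_def)
   note MD = left_idealD[OF Ml]
   have xc: "x : carrier kP" using x aug_carrier by blast
   define N where "N = {m + a *[kP] x | m a. m : M & a : carrier kP}"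
   have "left_ideal kP N"
   proof (rule left_idealI)
    show "N <= carrier kP" using MD(1) xc by (auto simp: N_def closed subsetD)
    show "0 : N" unfolding N_def using MD(2) closed(5) by (auto intro!: exI[of _ 0])
    fix y assume "y : N"
    then obtain m a where y: "m : M" "a : carrier kP" "y = m + a *[kP] x" by (auto simp: N_def)
    have "- y = - m + (- a) *[kP] x" by (simp add: y neg_l)
    thus "- y : N" using y MD(4) unfolding N_def by (blast intro: closed)
    {
     fix b assume b: "b : carrier kP"
     have "b *[kP] y = b *[kP] m + (b *[kP] a) *[kP] x" by (simp add: y add_r assoc)
     thus "b *[kP] y : N" using y b MD(6) unfolding N_def by (blast intro: closed)
    }
    fix z assume "z : N"
    then obtain m' a' where z: "m' : M" "a' : carrier kP" "z = m' + a' *[kP] x" by (auto simp: N_def)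
    have "y + z = (m + m') + (a + a') *[kP] x" by (simp add: y z add_l)
    thus "y + z : N" using y z MD(3) unfolding N_def by (blast intro: closed)
   qed
   moreover have "M <= N"
   proof
    fix m assume m: "m : M"
    have "m = m + 0 *[kP] x" by simp
    thus "m : N" unfolding N_def using m closed(5) by blast
   qed
   moreover have "x : N"
   proof -
    have "x = 0 + #1[kP] *[kP] x" using xc by (simp add: one_l)
    thus ?thesis unfolding N_def using MD(2) one_closed by blast
   qed
   ultimately have "N = carrier kP" using M xM unfolding max_left_ideal_def by blast
   hence "#1[kP] : N" using one_closed by simp
   then obtain m a where ma: "m : M" "a : carrier kP" "#1[kP] = m + a *[kP] x" by (auto simp: N_def)
   have ax: "a *[kP] x : augpow (Suc 0)" using aug_mul(1)[OF ma(2) x] by (simp add: augpow_1)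
   obtain r where r: "augpow r = {0}" using augpow_nilpotent by blast
   \<comment> \<open>Multiplying 1 = m + a x on the left by \<open>w\<close> leaves one term in
     \<open>M\<close> and one in the next power. Starting at the vanishing power, this descends to
     power 0, the whole algebra.\<close>
   have step: "w : M" if "augpow (Suc i) <= M" "w : augpow i" for w i
   proof -
    have wc: "w : carrier kP" using that augpow_carrier by blast
    have "w = w *[kP] m + w *[kP] (a *[kP] x)" using one_r[OF wc] ma(3) by (metis add_r)
    moreover have "w *[kP] (a *[kP] x) : M" using augpow_mul[OF that(2) ax] that(1) by auto
    ultimately show ?thesis using MD(3)[OF MD(6)[OF wc ma(1)]] by metis
   qed
   have "augpow (r - i) <= M" for i
   proof (induction i)
    case 0
    show ?case using r MD(2) by simp
   next
    case (Suc i)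
    show ?case
    proof (cases "r - i")
     case (Suc j)
     hence "r - Suc i = j" by simp
     thus ?thesis using step Suc.IH Suc by auto
    next
     case 0
     thus ?thesis using Suc.IH by simp
    qed
   qed
   from this[of r] have "carrier kP <= M" by (simp add: augpow_0)
   thus False using M MD(1) unfolding max_left_ideal_def by blast
  qed
  thus "x : jacobson_rad kP" using x aug_carrier by (auto simp: jacobson_rad_def)
 qed
qed

lemma rad_pow_augpow: "rad_pow kP r = augpow r"
 by (simp add: rad_pow_def augpow_def jacobson_rad_aug)

lemma rad_length_zero: "augpow (rad_length kP) = {0}"
 unfolding rad_length_def rad_pow_augpow zero_A using augpow_nilpotent by (rule LeastI_ex)

end

section \<open>The Jennings Lie algebra\<close>

lemma free_mod_ops [simp]:
 "ring.add (free_mod T) = (+)" "ring.zero (free_mod T) = 0" "module.smult (free_mod T) = scl"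
 by (auto simp: free_mod_def fun_eq_iff pointwise)

lemma free_mod_sub: "fv.subspace (carrier (free_mod T) :: ('x => 'k::field) set)"
 unfolding fv.subspace_def
proof (intro conjI ballI allI)
 fix f g :: "'x => 'k" and c
 assume f: "f : carrier (free_mod T)"
 thus "scl c f : carrier (free_mod T)"
  by (cases "c = 0") (auto simp: free_mod_def pointwise)
 assume g: "g : carrier (free_mod T)"
 have sub: "{x. (f + g) x ~= 0} <= {x. f x ~= 0} \<union> {x. g x ~= 0}" by (auto simp: pointwise)
 have fg: "finite ({x. f x ~= 0} \<union> {x. g x ~= 0})" "{x. f x ~= 0} \<union> {x. g x ~= 0} <= T"
  using f g by (auto simp: free_mod_def)
 show "f + g : carrier (free_mod T)"
  using finite_subset[OF sub fg(1)] order_trans[OF sub fg(2)] by (simp add: free_mod_def)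
qed (simp add: free_mod_def pointwise)

lemma free_mod_abelian: "abelian_group (free_mod T)"
proof (rule abelian_groupI)
 fix x assume "x : carrier (free_mod T)"
 thus "EX y:carrier (free_mod T). y +[free_mod T] x = #0[free_mod T]"
  using fv.subspace_neg[OF free_mod_sub] by (intro bexI[of _ "- x"]) auto
qed (auto simp: fv.subspace_add[OF free_mod_sub] fv.subspace_0[OF free_mod_sub] add.assoc add.commute)

lemma free_mod_inv: "x : carrier (free_mod T) ==> inv[add_monoid (free_mod T)] x = - x"
proof -
 interpret abelian_group "free_mod T" by (rule free_mod_abelian)
 assume "x : carrier (free_mod T)"
 thus ?thesis
  using fv.subspace_neg[OF free_mod_sub, of x T]
  by (intro minus_equality[of "- x" x, unfolded a_inv_def]) auto
qed

lemma submodule_free_mod: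
 "submodule N ring_of_type_algebra (free_mod T) \<longleftrightarrow> fv.subspace N & N <= carrier (free_mod T)"
proof
 assume "submodule N ring_of_type_algebra (free_mod T)"
 then interpret submodule N ring_of_type_algebra "free_mod T" .
 have "N <= carrier (free_mod T)" using subset by simp
 moreover have "fv.subspace N"
  unfolding fv.subspace_def
  using m_closed one_closed smult_closed by (auto simp: ring_of_type_algebra_def)
 ultimately show "fv.subspace N & N <= carrier (free_mod T)" by simp
next
 interpret abelian_group "free_mod T" by (rule free_mod_abelian)
 assume N: "fv.subspace N & N <= carrier (free_mod T)"
 show "submodule N ring_of_type_algebra (free_mod T)"
  unfolding submodule_def submodule_axioms_def
 proof (intro conjI allI impI)
  show "subgroup N (add_monoid (free_mod T))"
  proof (rule add.subgroupI)
   show "N ~= {}" using N fv.subspace_0 by blast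
   show "\<ominus>\<^bsub>free_mod T\<^esub> a : N" if "a : N" for a
    using that N fv.subspace_neg[of N a] free_mod_inv[of a T] unfolding a_inv_def by auto
  qed (use N in \<open>auto simp: fv.subspace_add\<close>)
  show "a *.[free_mod T] x : N" if "a : carrier ring_of_type_algebra" "x : N" for a x
   using that N by (simp add: fv.subspace_scale)
 qed
qed

definition tensor_gens :: "('v, 'm) monoid_scheme => ('v => 'k::field) set" where
 "tensor_gens V = {delta (x *[V] y) - delta x - delta y | x y. x : carrier V & y : carrier V} \<union>
   {delta (x [^]\<^bsub>V\<^esub> (a::nat)) - scl (of_nat a) (delta x) | x a. x : carrier V}"

lemma delta_free_mod: "x : T ==> delta x : carrier (free_mod T)"
 by (auto simp: free_mod_def delta_apply)

text \<open>\<open>span_of\<close> intersects submodules of \<open>free_mod\<close>, whereas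
  \<open>fv.span\<close> ranges over subspaces of all functions; they agree because the generators
  lie in the carrier, itself a subspace.\<close>

lemma tensor_rels_span:
 assumes "Group.monoid V"
 shows "tensor_rels V = (fv.span (tensor_gens V) :: ('v => 'k::field) set)"
  "(tensor_rels V :: ('v => 'k) set) <= carrier (free_mod (carrier V))"
proof -
 interpret Group.monoid V by fact
 have g: "tensor_gens V <= (carrier (free_mod (carrier V)) :: ('v => 'k) set)"
  unfolding tensor_gens_def
  by (auto intro!: fv.subspace_diff fv.subspace_scale free_mod_sub delta_free_mod)
 have e: "tensor_gens V = {%u. delta (x *[V] y) u - delta x u - delta y u | x y. x : carrier V & y : carrier V} \<union>
   {%u. delta (x [^]\<^bsub>V\<^esub> (a::nat)) u - of_nat a * delta x u | x a. x : carrier V}"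
  unfolding tensor_gens_def fun_diff_def scl_def ..
 let ?g = "tensor_gens V :: ('v => 'k) set"
 have "(tensor_rels V :: ('v => 'k) set) = \<Inter>{N. (fv.subspace N & N <= carrier (free_mod (carrier V))) & ?g <= N}"
  unfolding tensor_rels_def span_of_def submodule_free_mod e ..
 also have "... = fv.span ?g"
 proof
  have "fv.span ?g : {N. (fv.subspace N & N <= carrier (free_mod (carrier V))) & ?g <= N}"
   using fv.span_minimal[OF g free_mod_sub] fv.span_superset[of ?g] fv.subspace_span[of ?g] by blast
  thus "\<Inter>{N. (fv.subspace N & N <= carrier (free_mod (carrier V))) & ?g <= N} <= fv.span ?g"
   by (rule Inter_lower)
  show "fv.span ?g <= \<Inter>{N. (fv.subspace N & N <= carrier (free_mod (carrier V))) & ?g <= N}"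
   by (intro Inter_greatest fv.span_minimal) blast+
 qed
 finally show "tensor_rels V = fv.span ?g" .
 thus "(tensor_rels V :: ('v => 'k) set) <= carrier (free_mod (carrier V))"
  using fv.span_minimal[OF g free_mod_sub] by blast
qed

lemma tensor_rels_sub: "Group.monoid V ==> fv.subspace (tensor_rels V :: ('v => 'k::field) set)"
 by (simp add: tensor_rels_span)

lemma tensor_elt_mem: "g : tensor_elt V f \<longleftrightarrow> g - f : tensor_rels V" for f g :: "'v => 'k::field"
 unfolding tensor_elt_def a_r_coset_def r_coset_def
 by (auto intro!: bexI[of _ "g - f"])

lemma tensor_elt_eq:
 fixes f g :: "'v => 'k::field"
 assumes "Group.monoid V"
 shows "tensor_elt V f = tensor_elt V g \<longleftrightarrow> f - g : tensor_rels V"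
proof
 note sub = tensor_rels_sub[OF assms]
 assume "tensor_elt V f = tensor_elt V g"
 moreover have "f : tensor_elt V f" using fv.subspace_0[OF sub] by (simp add: tensor_elt_mem)
 ultimately show "f - g : tensor_rels V" by (simp add: tensor_elt_mem[symmetric])
next
 note sub = tensor_rels_sub[OF assms]
 assume fg: "f - g : tensor_rels V"
 have "x - f : tensor_rels V \<longleftrightarrow> x - g : tensor_rels V" for x
  using fv.subspace_add[OF sub, of "x - f" "f - g"] fv.subspace_diff[OF sub, of "x - g" "f - g"] fg by auto
 thus "tensor_elt V f = tensor_elt V g" by (auto simp: tensor_elt_mem)
qed

lemma tensor_k_carrier: "T : carrier (tensor_k V) \<longleftrightarrow> (EX f:carrier (free_mod (carrier V)). T = tensor_elt V f)"
 by (auto simp: tensor_k_def quot_alg_def A_RCOSETS_def RCOSETS_def tensor_elt_def a_r_coset_def)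

lemma tensor_k_zero: "Group.monoid V ==> #0[tensor_k V] = tensor_elt V (0 :: 'v => 'k::field)"
 using tensor_elt_mem[of _ V 0] by (auto simp: tensor_k_def quot_alg_def)

lemma tensor_k_add:
 fixes f g :: "'v => 'k::field"
 assumes "Group.monoid V"
 shows "tensor_elt V f +[tensor_k V] tensor_elt V g = tensor_elt V (f + g)"
proof -
 note sub = tensor_rels_sub[OF assms]
 have "tensor_elt V f +[tensor_k V] tensor_elt V g = {a + b | a b. a : tensor_elt V f & b : tensor_elt V g}"
  by (auto simp: tensor_k_def quot_alg_def set_add_def set_mult_def)
 also have "... = tensor_elt V (f + g)"
 proof
  show "{a + b | a b. a : tensor_elt V f & b : tensor_elt V g} <= tensor_elt V (f + g)"
  proof clarify
   fix a b assume "a : tensor_elt V f" "b : tensor_elt V g"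
   hence "(a - f) + (b - g) : tensor_rels V" using fv.subspace_add[OF sub] by (simp add: tensor_elt_mem)
   moreover have "(a - f) + (b - g) = (a + b) - (f + g)" by simp
   ultimately show "a + b : tensor_elt V (f + g)" by (simp add: tensor_elt_mem)
  qed
  show "tensor_elt V (f + g) <= {a + b | a b. a : tensor_elt V f & b : tensor_elt V g}"
  proof
   fix x assume "x : tensor_elt V (f + g)"
   hence "x - g : tensor_elt V f" "g : tensor_elt V g" "x = (x - g) + g"
    using fv.subspace_0[OF sub] by (simp_all add: tensor_elt_mem diff_diff_eq add.commute)
   thus "x : {a + b | a b. a : tensor_elt V f & b : tensor_elt V g}" by blast
  qed
 qed
 finally show ?thesis .
qed

lemma tensor_k_smult:
 fixes f :: "'v => 'k::field"
 assumes "Group.monoid V"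
 shows "c *.[tensor_k V] tensor_elt V f = tensor_elt V (scl c f)"
proof -
 note sub = tensor_rels_sub[OF assms]
 have "tensor_elt V (scl c x) = tensor_elt V (scl c f)" if "x : tensor_elt V f" for x
  using fv.subspace_scale[OF sub, of "x - f" c] that
  by (simp add: tensor_elt_eq[OF assms] tensor_elt_mem fv.scale_right_diff_distrib)
 moreover have "f : tensor_elt V f" using fv.subspace_0[OF sub] by (simp add: tensor_elt_mem)
 moreover have "c *.[tensor_k V] tensor_elt V f = (\<Union>x\<in>tensor_elt V f. tensor_elt V (scl c x))"
  by (simp add: tensor_k_def quot_alg_def tensor_elt_def)
 ultimately show ?thesis by blast
qed

section \<open>The filtration of P and homogeneous elements of the Jennings Lie algebra\<close>

context block_setting
begin

lemma finite_P: "finite (carrier (grpP S))"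
 using P_order prime_char by (auto simp: Coset.order_def prime_gt_0_nat intro: card_ge_0_finite)

sublocale kP: pgroup_alg "grpP S" "kP S" "num S" "CHAR('k)"
 unfolding pgroup_alg_def pgroup_alg_axioms_def group_alg_def group_alg_axioms_def
 using P_group P_order prime_char finite_P by (auto simp: kP_def Coset.order_def)

abbreviation PP (\<open>P\<close>) where "P \<equiv> grpP S"
abbreviation Pc where "Pc \<equiv> carrier (kP S)"
abbreviation F where "F r \<equiv> jfilt TYPE('k) P r"
abbreviation V where "V r \<equiv> jlayer TYPE('k) P r"
abbreviation Jen where "Jen \<equiv> jennings P :: ('k, ('p, 'k) jen_elt) module"
abbreviation J where "J r \<equiv> kP.augpow r"
abbreviation pmulP (infixl \<open>\<star>\<close> 70) where "x \<star> y \<equiv> x *[kP S] y"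

lemma jfilt_iff: "g : F r \<longleftrightarrow> g : carrier P & kP.dl g : J r"
 by (simp add: jfilt_def kP.dl_def fun_diff_def kP.rad_pow_augpow[unfolded kP_def] kP_def[symmetric] kP.rad_pow_augpow)

text \<open>Modulo deeper powers of the augmentation ideal the last term disappears and g - 1
  becomes additive in g; this gives the subgroups \<open>F r\<close> and, in degree one, the
  additivity behind \<open>jq1_mult\<close>.\<close>

lemma dl_mult: "g : carrier P ==> h : carrier P ==>
  kP.dl (g *[P] h) = kP.dl g + kP.dl h + kP.dl g \<star> kP.dl h"
 using kP.mul_delta[of g h] kP.mul_delta[of g "#1[P]"] kP.mul_delta[of "#1[P]" h] kP.mul_delta[of "#1[P]" "#1[P]"]
 by (simp add: kP.dl_def kP.diff_l kP.diff_r)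

lemma F_subgroup: "subgroup (F r) P"
proof (rule kP.subgroupI)
 show "F r <= carrier P" by (auto simp: jfilt_iff)
 have "#1[P] : F r" by (simp add: jfilt_iff kP.dl_def fv.subspace_0[OF kP.augpow_sub])
 thus "F r ~= {}" by blast
next
 fix g assume g: "g : F r"
 hence gc: "g : carrier P" by (simp add: jfilt_iff)
 have "kP.dl (inv[P] g) = - (delta (inv[P] g) \<star> kP.dl g)"
  using gc kP.mul_delta[of "inv[P] g" g] kP.mul_delta[of "inv[P] g" "#1[P]"] by (simp add: kP.dl_def kP.diff_r)
 moreover have "delta (inv[P] g) \<star> kP.dl g : J (0 + r)"
  using g gc by (intro kP.augpow_mul) (auto simp: kP.augpow_0 kP.delta_in jfilt_iff)
 ultimately show "inv[P] g : F r" using gc fv.subspace_neg[OF kP.augpow_sub] by (simp add: jfilt_iff)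
next
 fix g h assume g: "g : F r" and h: "h : F r"
 hence c: "g : carrier P" "h : carrier P" "kP.dl g : J r" "kP.dl h : J r" by (auto simp: jfilt_iff)
 have "kP.dl g \<star> kP.dl h : J (0 + r)"
  using c kP.augpow_carrier by (intro kP.augpow_mul) (auto simp: kP.augpow_0)
 thus "g *[P] h : F r" using c
  by (simp add: jfilt_iff dl_mult fv.subspace_add[OF kP.augpow_sub])
qed

lemma F_normal: "F r \<lhd> P"
 unfolding kP.normal_inv_iff
proof (intro conjI ballI)
 show "subgroup (F r) P" by (rule F_subgroup)
 fix g h assume g: "g : carrier P" and h: "h : F r"
 hence hc: "h : carrier P" "kP.dl h : J r" by (auto simp: jfilt_iff)
 have "kP.dl (g *[P] h *[P] inv[P] g) = delta g \<star> kP.dl h \<star> delta (inv[P] g)"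
  using g hc by (simp add: kP.dl_def kP.diff_l kP.diff_r kP.mul_delta)
 moreover have "delta g \<star> kP.dl h \<star> delta (inv[P] g) : J (0 + r + 0)"
  using g hc by (intro kP.augpow_mul) (auto simp: kP.augpow_0 kP.delta_in)
 ultimately show "g *[P] h *[P] inv[P] g : F r" using g hc by (simp add: jfilt_iff)
qed

lemma F_mono: "F (Suc r) <= F r"
 using subsetD[OF kP.augpow_decr] by (auto simp: jfilt_iff)

lemma F_1: "F (Suc 0) = carrier P"
 using kP.dl_aug by (auto simp: jfilt_iff kP.augpow_1)

lemma V_group: "group (V r)"
 unfolding jlayer_def
 using normal.factorgroup_is_group[OF kP.normal_restrict_supergroup[OF F_subgroup F_normal F_mono]] .

lemma V_monoid: "Group.monoid (V r)"
 using V_group by (rule group.is_monoid)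

lemma V_carrier: "C : carrier (V r) \<longleftrightarrow> (EX g:F r. C = F (Suc r) #>\<^bsub>P\<^esub> g)"
 by (auto simp: jlayer_def FactGroup_def RCOSETS_def r_coset_def)

lemma V_finite: "finite (carrier (V r))"
proof -
 have "carrier (V r) = (%g. F (Suc r) #>\<^bsub>P\<^esub> g) ` F r" by (auto simp: V_carrier)
 thus ?thesis using finite_subset[OF subgroup.subset[OF F_subgroup] finite_P] by simp
qed

lemma free_V: "f : carrier (free_mod (carrier (V r))) \<longleftrightarrow> (\<forall>C. f C ~= 0 --> C : carrier (V r))"
 using V_finite by (auto simp: free_mod_def intro: finite_subset)

lemma coset_dl: "g : carrier P ==> c : F (Suc r) #>\<^bsub>P\<^esub> g ==> c : carrier P & kP.dl c - kP.dl g : J (Suc r)"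
proof -
 assume g: "g : carrier P" and "c : F (Suc r) #>\<^bsub>P\<^esub> g"
 then obtain h where h: "h : F (Suc r)" "c = h *[P] g" by (auto simp: r_coset_def)
 hence hc: "h : carrier P" "kP.dl h : J (Suc r)" by (auto simp: jfilt_iff)
 have "kP.dl h \<star> kP.dl g : J (Suc r + 0)"
  using hc kP.dl_aug[OF g] kP.aug_carrier by (intro kP.augpow_mul) (auto simp: kP.augpow_0)
 thus ?thesis using h hc g by (simp add: dl_mult fv.subspace_add[OF kP.augpow_sub])
qed

lemma jen_module: "module ring_of_type_algebra Jen"
 using jennings by (simp add: jennings_structure_def restricted_lie_algebra_def)

lemma lie_alg: "restricted_lie_algebra Jen (lie S) (ppow S)"
 using jennings by (simp add: jennings_structure_def)

sublocale jen: restricted_lie_algebra Jen "lie S" "ppow S"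
 by (rule lie_alg)

lemmas jenD = module_scalarD[OF jen_module]

text \<open>\<open>comp x r f\<close>: the function \<open>f\<close> represents the component of degree \<open>r\<close> of \<open>x\<close>.\<close>

definition comp :: "('p, 'k) jen_elt => nat => ('p set => 'k) => bool" where
 "comp x r f \<longleftrightarrow> x r = tensor_elt (V r) f"

lemma jen_carrier: "x : carrier Jen \<longleftrightarrow> x : extensional {1..} &
  (\<forall>r\<ge>1. EX f:carrier (free_mod (carrier (V r))). x r = tensor_elt (V r) f) &
  finite {r : {1..}. x r ~= tensor_elt (V r) (0 :: 'p set => 'k)}"
 by (auto simp: jennings_def direct_sum_def PiE_iff tensor_k_carrier tensor_k_zero[OF V_monoid])

lemma comp_add: "comp x r f ==> comp y r g ==> r >= 1 ==> comp (x +[Jen] y) r (f + g)"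
 by (simp add: comp_def jennings_def direct_sum_def tensor_k_add[OF V_monoid])

lemma comp_smult: "comp x r f ==> r >= 1 ==> comp (c *.[Jen] x) r (scl c f)"
 by (simp add: comp_def jennings_def direct_sum_def tensor_k_smult[OF V_monoid])

lemma comp_zero: "r >= 1 ==> comp #0[Jen] r 0"
 by (simp add: comp_def jennings_def direct_sum_def tensor_k_zero[OF V_monoid])

lemma comp_sum:
 assumes "finite I" "!!i. i : I ==> x i : carrier Jen" "!!i. i : I ==> comp (x i) r (f i)" "r >= 1"
 shows "comp (\<Oplus>\<^bsub>Jen\<^esub>i\<in>I. c i *.[Jen] x i) r (SUM i:I. scl (c i) (f i))"
 using assms(1-3)
proof (induction I rule: finite_induct)
 case empty
 thus ?case using comp_zero[OF assms(4)] by simp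
next
 case (insert i I)
 have "(\<Oplus>\<^bsub>Jen\<^esub>j\<in>insert i I. c j *.[Jen] x j) = c i *.[Jen] x i +[Jen] (\<Oplus>\<^bsub>Jen\<^esub>j\<in>I. c j *.[Jen] x j)"
  using insert jenD(2) by (intro jen.M.finsum_insert) auto
 moreover have "comp (\<Oplus>\<^bsub>Jen\<^esub>j\<in>I. c j *.[Jen] x j) r (SUM j:I. scl (c j) (f j))" using insert by auto
 ultimately show ?case using insert comp_add comp_smult assms(4) by simp
qed

lemma comp_ext:
 assumes "x : carrier Jen" "y : carrier Jen" "!!r. r >= 1 ==> \<exists>f. comp x r f & comp y r f"
 shows "x = y"
proof
 fix r show "x r = y r"
 proof (cases "r >= 1")
  case True
  thus ?thesis using assms(3)[OF True] by (auto simp: comp_def)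
 next
  case False
  thus ?thesis using assms(1,2) by (auto simp: jen_carrier extensional_def)
 qed
qed

lemma comp_ex: "x : carrier Jen ==> r >= 1 ==> EX f:carrier (free_mod (carrier (V r))). comp x r f"
 by (auto simp: jen_carrier comp_def)

lemma hom_iff: "x : jen_homogeneous P r \<longleftrightarrow> x : carrier Jen & (\<forall>t\<ge>1. t ~= r --> comp x t 0)"
 by (auto simp: jen_homogeneous_def comp_def tensor_k_zero[OF V_monoid])

lemma hom_add: "x : jen_homogeneous P r ==> y : jen_homogeneous P r ==> x +[Jen] y : jen_homogeneous P r"
 using comp_add[of x _ 0 y 0] by (auto simp: hom_iff)

lemma hom_smult: "x : jen_homogeneous P r ==> c *.[Jen] x : jen_homogeneous P r"
 using comp_smult[of x _ 0 c] jenD(2) by (auto simp: hom_iff)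

lemma hom_zero: "#0[Jen] : jen_homogeneous P r"
 using comp_zero by (auto simp: hom_iff)

lemma sum_closed_under:
 assumes "Z <= carrier Jen" "#0[Jen] : Z" "!!x y. x : Z ==> y : Z ==> x +[Jen] y : Z" "finite I" "!!i. i : I ==> x i : Z"
 shows "(\<Oplus>\<^bsub>Jen\<^esub>i\<in>I. x i) : Z"
 using assms(4,5)
proof (induction I rule: finite_induct)
 case (insert i I)
 hence "(\<Oplus>\<^bsub>Jen\<^esub>j\<in>insert i I. x j) = x i +[Jen] (\<Oplus>\<^bsub>Jen\<^esub>j\<in>I. x j)"
  using assms(1) by (intro jen.M.finsum_insert) auto
 thus ?case using insert assms(3) by auto
qed (use assms(2) in simp)

lemma class_comp: "r >= 1 ==> comp (jen_class P r g) r (delta (F (Suc r) #>\<^bsub>P\<^esub> g))"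
 by (simp add: comp_def jen_class_def)

lemma class_hom: "r >= 1 ==> g : F r ==> (jen_class P r g :: ('p, 'k) jen_elt) : jen_homogeneous P r"
proof -
 assume r: "r >= 1" and g: "g : F r"
 have V: "F (Suc r) #>\<^bsub>P\<^esub> g : carrier (V r)" using g by (auto simp: V_carrier)
 have "finite {t : {1..}. (jen_class P r g :: ('p, 'k) jen_elt) t ~= tensor_elt (V t) (0 :: 'p set => 'k)}"
  by (rule finite_subset[of _ "{r}"]) (auto simp: jen_class_def tensor_k_zero[OF V_monoid])
 moreover have "EX f:carrier (free_mod (carrier (V t))). (jen_class P r g :: ('p, 'k) jen_elt) t = tensor_elt (V t) f" if "t >= 1" for t
  using that delta_free_mod[OF V] fv.subspace_0[OF free_mod_sub]
  by (cases "t = r") (auto simp: jen_class_def tensor_k_zero[OF V_monoid])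
 ultimately have "(jen_class P r g :: ('p, 'k) jen_elt) : carrier Jen"
  by (simp add: jen_carrier) (simp add: jen_class_def)
 moreover have "comp (jen_class P r g) t 0" if "t >= 1" "t ~= r" for t
  using that by (simp add: comp_def jen_class_def tensor_k_zero[OF V_monoid])
 ultimately show ?thesis by (simp add: hom_iff)
qed

text \<open>The bracket and the p-map are specified on classes of group elements. Since these span
  each homogeneous component, closure of \<open>Z\<close> under the linear operations carries a
  property from the classes to the component.\<close>

lemma hom_induct:
 assumes x: "x : jen_homogeneous P r" and r: "r >= 1"
  and Z: "Z <= carrier Jen" "#0[Jen] : Z" "!!x y. x : Z ==> y : Z ==> x +[Jen] y : Z"
   "!!c x. x : Z ==> c *.[Jen] x : Z" "!!g. g : F r ==> jen_class P r g : Z"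
 shows "x : Z"
proof -
 have xc: "x : carrier Jen" using x by (simp add: hom_iff)
 obtain f where f: "f : carrier (free_mod (carrier (V r)))" "comp x r f" using comp_ex[OF xc r] by blast
 have "\<exists>g. g : F r & C = F (Suc r) #>\<^bsub>P\<^esub> g" if "C : carrier (V r)" for C
  using that by (auto simp: V_carrier)
 then obtain g where g: "!!C. C : carrier (V r) ==> g C : F r & C = F (Suc r) #>\<^bsub>P\<^esub> g C" by metis
 let ?y = "\<Oplus>\<^bsub>Jen\<^esub>C\<in>carrier (V r). f C *.[Jen] jen_class P r (g C)"
 have cl: "(jen_class P r (g C) :: ('p, 'k) jen_elt) : jen_homogeneous P r" if "C : carrier (V r)" for C
  using class_hom[OF r] g[OF that] by blast
 have "?y : Z" using V_finite g Z by (intro sum_closed_under) auto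
 moreover have "x = ?y"
 proof (rule comp_ext[OF xc])
  show "?y : carrier Jen" using \<open>?y : Z\<close> Z by blast
  fix t :: nat assume t: "t >= 1"
  show "\<exists>f. comp x t f & comp ?y t f"
  proof (cases "t = r")
   case True
   have "comp ?y r (SUM C:carrier (V r). scl (f C) (delta C))"
   proof (rule comp_sum[OF V_finite _ _ r])
    fix C assume C: "C : carrier (V r)"
    show "jen_class P r (g C) : carrier Jen" using cl[OF C] by (simp add: hom_iff)
    show "comp (jen_class P r (g C)) r (delta C)" using class_comp[OF r, of "g C"] g[OF C] by metis
   qed
   moreover have "f = (SUM C:carrier (V r). scl (f C) (delta C))"
    using f(1) V_finite by (intro supp_expand) (auto simp: free_V)
   ultimately show ?thesis using f(2) True by auto
  next
   case False
   have "comp ?y t (SUM C:carrier (V r). scl (f C) 0)"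
    by (rule comp_sum[OF V_finite _ _ t]) (use cl False t in \<open>auto simp: hom_iff\<close>)
   thus ?thesis using x False t by (auto simp: hom_iff)
  qed
 qed
 ultimately show ?thesis by simp
qed

lemma lie_class: "[|r >= 1; t >= 1; g : F r; h : F t|] ==>
  lie S (jen_class P r g) (jen_class P t h) = jen_class P (r + t) (commutator P g h)"
 using jennings unfolding jennings_structure_def by blast

lemma ppow_class: "[|r >= 1; g : F r|] ==> ppow S (jen_class P r g) = jen_class P (CHAR('k) * r) (g [^]\<^bsub>P\<^esub> CHAR('k))"
 using jennings unfolding jennings_structure_def by blast

text \<open>Applied to commutators and p-th powers. That their classes lie in the carrier follows
  from closure of the bracket and of the p-map; outside degree \<open>r\<close> such a class is zero
  by construction.\<close>

lemma class_hom':
 assumes "(jen_class P r g :: ('p, 'k) jen_elt) : carrier Jen" "r >= 1"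
 shows "(jen_class P r g :: ('p, 'k) jen_elt) : jen_homogeneous P r"
 using assms by (simp add: hom_iff) (simp add: comp_def jen_class_def tensor_k_zero[OF V_monoid])

lemma hom_carrier: "x : jen_homogeneous P r ==> x : carrier Jen"
 by (simp add: hom_iff)

lemma lie_hom:
 assumes x: "x : jen_homogeneous P r" and y: "y : jen_homogeneous P t" and r: "r >= 1" "t >= 1"
 shows "lie S x y : jen_homogeneous P (r + t)"
proof -
 have 1: "lie S (jen_class P r g) y : jen_homogeneous P (r + t)" if g: "g : F r" for g
 proof -
  have gc: "jen_class P r g : carrier Jen" using class_hom[OF r(1) g] by (rule hom_carrier)
  let ?Z = "{y : carrier Jen. lie S (jen_class P r g) y : jen_homogeneous P (r + t)}"
  have "y : ?Z"
  proof (rule hom_induct[OF y r(2)])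
   show "#0[Jen] : ?Z"
    using jen.br_smult_right[OF gc, of "#0[Jen]" 0] hom_smult[of _ "r + t" 0] jen.br_closed[OF gc, of "#0[Jen]"] hom_zero
    by (metis (mono_tags, lifting) gc jen.M.zero_closed jen.br_add_right jen.M.r_zero jen.M.add.r_cancel_one' mem_Collect_eq)
   fix x' y' assume "x' : ?Z" "y' : ?Z"
   thus "x' +[Jen] y' : ?Z" using gc by (simp add: jen.br_add_right hom_add)
  next
   fix c x' assume "x' : ?Z"
   thus "c *.[Jen] x' : ?Z" using gc jenD(2) by (simp add: jen.br_smult_right hom_smult)
  next
   fix h assume h: "h : F t"
   have hc: "jen_class P t h : carrier Jen" using class_hom[OF r(2) h] by (rule hom_carrier)
   thus "jen_class P t h : ?Z"
    using jen.br_closed[OF gc hc] lie_class[OF r g h] class_hom'[of "r + t"] r by simp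
  qed auto
  thus ?thesis by simp
 qed
 have yc: "y : carrier Jen" using y by (rule hom_carrier)
 let ?Z = "{x : carrier Jen. lie S x y : jen_homogeneous P (r + t)}"
 have "x : ?Z"
 proof (rule hom_induct[OF x r(1)])
  show "#0[Jen] : ?Z"
   using jen.br_add_left[of "#0[Jen]" "#0[Jen]" y] jen.br_closed[of "#0[Jen]" y] hom_zero yc
   by (metis (mono_tags, lifting) jen.M.zero_closed jen.M.r_zero jen.M.add.r_cancel_one' mem_Collect_eq)
  fix x' y' assume "x' : ?Z" "y' : ?Z"
  thus "x' +[Jen] y' : ?Z" using yc by (simp add: jen.br_add_left hom_add)
 next
  fix c x' assume "x' : ?Z"
  thus "c *.[Jen] x' : ?Z" using yc jenD(2) by (simp add: jen.br_smult_left hom_smult)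
 next
  fix g assume g: "g : F r"
  thus "jen_class P r g : ?Z" using 1[OF g] class_hom[OF r(1) g] by (simp add: hom_carrier)
 qed auto
 thus ?thesis by simp
qed

text \<open>The p-map is not additive, but the correction terms of Jacobson's formula are brackets
  of p elements of degree \<open>r\<close>, hence of degree p r, and the induction over sums goes
  through.\<close>

lemma ppow_hom:
 assumes x: "x : jen_homogeneous P r" and r: "r >= 1"
 shows "ppow S x : jen_homogeneous P (CHAR('k) * r)"
proof -
 have p: "CHAR('k) > 0" using prime_char by (rule prime_gt_0_nat)
 have fold: "foldr (%b. lie S (if b then x else y)) us x : jen_homogeneous P (Suc (length us) * r)"
  if "x : jen_homogeneous P r" "y : jen_homogeneous P r" for x y us
 proof (induction us)
  case (Cons b us)
  have "lie S (if b then x else y) (foldr (%b. lie S (if b then x else y)) us x) : jen_homogeneous P (r + Suc (length us) * r)"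
   using that r by (intro lie_hom Cons.IH) auto
  thus ?case by (simp add: add.assoc)
 qed (use that in simp)
 have finw: "finite {us :: bool list. length us = n & count_list us True = i}" for n i
  by (rule finite_subset[OF _ finite_lists_length_eq[of "UNIV :: bool set" n]]) auto
 have jac: "jacobson_s Jen (lie S) i x y : jen_homogeneous P (CHAR('k) * r)"
  if "x : jen_homogeneous P r" "y : jen_homogeneous P r" for x y i
  unfolding jacobson_s_def
 proof (intro hom_smult sum_closed_under)
  show "jen_homogeneous P (CHAR('k) * r) <= carrier Jen" by (auto simp: hom_iff)
  fix us assume "us : {us :: bool list. length us = CHAR('k) - 1 & count_list us True = i - 1}"
  hence "Suc (length us) = CHAR('k)" using p by simp
  thus "foldr (%b. lie S (if b then x else y)) us x : jen_homogeneous P (CHAR('k) * r)"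
   using fold[OF that, of us] by simp
 qed (auto simp: hom_zero hom_add finw)
 let ?Z = "{x : jen_homogeneous P r. ppow S x : jen_homogeneous P (CHAR('k) * r)}"
 have "x : ?Z"
 proof (rule hom_induct[OF x r])
  have "ppow S (0 *.[Jen] #0[Jen]) = 0 ^ CHAR('k) *.[Jen] ppow S #0[Jen]" by (rule jen.pmap_smult) simp
  moreover have zz: "0 *.[Jen] z = #0[Jen]" if "z : carrier Jen" for z
   using jenD(3)[OF that, of 0 0] jenD(2)[OF that, of 0] by (simp add: jen.M.add.l_cancel_one')
  ultimately have "ppow S #0[Jen] = #0[Jen]" using p jen.pmap_closed[of "#0[Jen]"] by (simp add: zz power_0_left)
  thus "#0[Jen] : ?Z" by (simp add: hom_zero)
  fix x y assume xy: "x : ?Z" "y : ?Z"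
  have "(\<Oplus>\<^bsub>Jen\<^esub>i\<in>{1..CHAR('k) - 1}. jacobson_s Jen (lie S) i x y) : jen_homogeneous P (CHAR('k) * r)"
  proof (rule sum_closed_under)
   show "jen_homogeneous P (CHAR('k) * r) <= carrier Jen" using hom_carrier by blast
   show "jacobson_s Jen (lie S) i x y : jen_homogeneous P (CHAR('k) * r)" for i using xy by (intro jac) auto
  qed (simp_all add: hom_zero hom_add)
  moreover have "x : carrier Jen" "y : carrier Jen" using xy hom_carrier by blast+
  ultimately show "x +[Jen] y : ?Z" using xy by (simp add: jen.pmap_add hom_add)
 next
  fix c x assume "x : ?Z"
  moreover from this have "x : carrier Jen" using hom_carrier by blast
  ultimately show "c *.[Jen] x : ?Z" by (simp add: jen.pmap_smult hom_smult hom_carrier)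
 next
  fix g assume g: "g : F r"
  have gh: "(jen_class P r g :: ('p, 'k) jen_elt) : jen_homogeneous P r" by (rule class_hom[OF r g])
  have "ppow S (jen_class P r g) : carrier Jen" by (rule jen.pmap_closed[OF hom_carrier[OF gh]])
  hence "ppow S (jen_class P r g) : jen_homogeneous P (CHAR('k) * r)"
   using r p class_hom'[of "CHAR('k) * r"] by (simp add: ppow_class[OF r g])
  thus "jen_class P r g : ?Z" using gh by simp
 qed (auto simp: hom_iff)
 thus ?thesis by simp
qed

lemma wel_carrier: "i : {1..num S} ==> wel S i : carrier Jen"
 using wel_homogeneous by (blast intro: hom_carrier)

text \<open>Dropping the coefficients at basis elements of another degree leaves every component of
  the sum unchanged; uniqueness of coordinates then makes these coefficients zero.\<close>

lemma coeff_hom: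
 assumes "(\<Oplus>\<^bsub>Jen\<^esub>k\<in>{1..num S}. c k *.[Jen] wel S k) : jen_homogeneous P m" "i : {1..num S}" "c i ~= 0"
 shows "wdeg S i = m"
proof (rule ccontr)
 assume ne: "wdeg S i ~= m"
 let ?v = "\<Oplus>\<^bsub>Jen\<^esub>k\<in>{1..num S}. c k *.[Jen] wel S k"
 define c' where "c' k = (if wdeg S k = m then c k else 0)" for k
 let ?v' = "\<Oplus>\<^bsub>Jen\<^esub>k\<in>{1..num S}. c' k *.[Jen] wel S k"
 have vc: "?v : carrier Jen" "?v' : carrier Jen" using wel_carrier jenD(2) by (auto intro!: jen.M.finsum_closed)
 have "?v = ?v'"
 proof (rule comp_ext[OF vc])
  fix t :: nat assume t: "t >= 1"
  have "\<exists>f. comp (wel S k) t f & (t ~= wdeg S k --> f = 0)" if "k : {1..num S}" for k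
   using comp_ex[OF wel_carrier[OF that] t] wel_homogeneous[OF that] t by (auto simp: hom_iff)
  then obtain f where f: "!!k. k : {1..num S} ==> comp (wel S k) t (f k) & (t ~= wdeg S k --> f k = 0)" by metis
  have 1: "comp ?v t (SUM k:{1..num S}. scl (c k) (f k))" using f wel_carrier by (intro comp_sum t) auto
  have 2: "comp ?v' t (SUM k:{1..num S}. scl (c' k) (f k))" using f wel_carrier by (intro comp_sum t) auto
  show "\<exists>f. comp ?v t f & comp ?v' t f"
  proof (cases "t = m")
   case True
   have "(SUM k:{1..num S}. scl (c k) (f k)) = (SUM k:{1..num S}. scl (c' k) (f k))"
    using f True by (intro sum.cong) (auto simp: c'_def)
   thus ?thesis using 1 2 by auto
  next
   case False
   have "(SUM k:{1..num S}. scl (c' k) (f k)) = 0"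
    using f False by (intro sum.neutral) (auto simp: c'_def)
   moreover have "comp ?v t 0" using assms(1) t False by (simp add: hom_iff)
   ultimately show ?thesis using 2 by auto
  qed
 qed
 have e: "(\<Oplus>\<^bsub>Jen\<^esub>k\<in>{1..num S}. restrict d {1..num S} k *.[Jen] wel S k) = (\<Oplus>\<^bsub>Jen\<^esub>k\<in>{1..num S}. d k *.[Jen] wel S k)" for d
  using wel_carrier jenD(2) by (intro jen.M.finsum_cong') auto
 obtain d where "!!c. c : {1..num S} \<rightarrow>\<^sub>E UNIV & ?v = (\<Oplus>\<^bsub>Jen\<^esub>k\<in>{1..num S}. c k *.[Jen] wel S k) ==> c = d"
  using wel_basis[OF vc(1)] by (elim ex1E) blast
 from this[of "restrict c {1..num S}"] this[of "restrict c' {1..num S}"]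
 have "restrict c {1..num S} = restrict c' {1..num S}"
  unfolding e using \<open>?v = ?v'\<close> by simp
 hence "restrict c {1..num S} i = restrict c' {1..num S} i" by simp
 hence "c i = c' i" using assms(2) by simp
 thus False using assms(3) ne by (simp add: c'_def)
qed

text \<open>Homogeneity of the bracket in terms of coefficients. It is the reason why replacing two
  letters by a letter of their bracket preserves the weight of a word while shortening it.\<close>

lemma cLie_deg: "[|i : {1..num S}; j : {1..num S}; k : {1..num S}; cLie S i j k ~= 0|] ==> wdeg S k = wdeg S i + wdeg S j"
 using coeff_hom[of "cLie S i j" "wdeg S i + wdeg S j" k] lie_hom[OF wel_homogeneous wel_homogeneous, of i j] wdeg_pos lie_coeffs[of i j]
 by simp

lemma dLie_deg: "[|i : {1..num S}; k : {1..num S}; dLie S i k ~= 0|] ==> wdeg S k = CHAR('k) * wdeg S i"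
 using coeff_hom[of "dLie S i" "CHAR('k) * wdeg S i" k] ppow_hom[OF wel_homogeneous, of i] wdeg_pos ppow_coeffs[of i]
 by simp

section \<open>The Jennings-Quillen map in degree one\<close>

lemma wlift_J: "i : {1..num S} ==> wlift S i : J (wdeg S i)"
 using wlift_represents[of i] by (simp add: jq_representatives_def kP_def[symmetric] kP.rad_pow_augpow)

lemma wlift_carrier: "i : {1..num S} ==> wlift S i : Pc"
 using wlift_J kP.augpow_carrier by blast

text \<open>The Jennings-Quillen map in degree one on formal combinations of cosets. It depends on
  the chosen coset representatives, but modulo J^2 neither on these nor, by \<open>jq1_rels\<close>,
  on the tensor relations.\<close>

definition jq1 :: "('p set => 'k) => 'p => 'k" where
 "jq1 f = (SUM C:carrier (V 1). scl (f C) (kP.dl (SOME g. g : C)))"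

lemma V1_rep:
 assumes "C : carrier (V 1)" "c : C"
 shows "c : carrier P" "kP.dl (SOME g. g : C) - kP.dl c : J 2"
proof -
 obtain g where g: "g : carrier P" "C = F (Suc 1) #>\<^bsub>P\<^esub> g" using assms(1) F_1 by (auto simp: V_carrier)
 show "c : carrier P" using coset_dl[OF g(1)] assms(2) g(2) by blast
 have "(SOME g. g : C) : C" using assms(2) by (rule someI)
 hence "kP.dl (SOME g. g : C) - kP.dl g : J (Suc 1)" "kP.dl c - kP.dl g : J (Suc 1)"
  using coset_dl[OF g(1)] assms(2) g(2) by blast+
 hence "(kP.dl (SOME g. g : C) - kP.dl g) - (kP.dl c - kP.dl g) : J (Suc 1)"
  by (rule fv.subspace_diff[OF kP.augpow_sub])
 thus "kP.dl (SOME g. g : C) - kP.dl c : J 2" by (simp add: numeral_2_eq_2)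
qed

lemma jq1_delta: "C : carrier (V 1) ==> jq1 (delta C) = kP.dl (SOME g. g : C)"
proof -
 assume C: "C : carrier (V 1)"
 have "jq1 (delta C) = (SUM D:carrier (V 1). if D = C then kP.dl (SOME g. g : C) else 0)"
  unfolding jq1_def by (intro sum.cong) (auto simp: delta_apply)
 thus ?thesis using C V_finite by simp
qed

lemma jq1_linear: "jq1 (f + g) = jq1 f + jq1 g" "jq1 (scl c f) = scl c (jq1 f)" "jq1 (f - g) = jq1 f - jq1 g"
 by (simp_all add: jq1_def pointwise fv.scale_left_distrib fv.scale_left_diff_distrib sum.distrib sum_subtractf fv.scale_sum_right)

lemma jq1_mult:
 assumes "C : carrier (V 1)" "D : carrier (V 1)"
 shows "jq1 (delta (C *[V 1] D)) - jq1 (delta C) - jq1 (delta D) : J 2"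
proof -
 interpret V: group "V 1" by (rule V_group)
 obtain g h where g: "g : carrier P" "C = F (Suc 1) #>\<^bsub>P\<^esub> g" and h: "h : carrier P" "D = F (Suc 1) #>\<^bsub>P\<^esub> h"
  using assms F_1 by (auto simp: V_carrier)
 have self: "g : C" "h : D" using g h F_subgroup by (auto intro: kP.rcos_self)
 have "g *[P] h : C *[V 1] D" using self by (auto simp: jlayer_def FactGroup_def set_mult_def)
 hence 1: "kP.dl (SOME x. x : C *[V 1] D) - kP.dl (g *[P] h) : J 2"
  by (rule V1_rep(2)[OF V.m_closed[OF assms]])
 have 2: "kP.dl (SOME x. x : C) - kP.dl g : J 2" "kP.dl (SOME x. x : D) - kP.dl h : J 2"
  using V1_rep(2) assms self by auto
 have "kP.dl g \<star> kP.dl h : J (Suc 0 + Suc 0)"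
  using kP.dl_aug g(1) h(1) by (intro kP.augpow_mul) (simp_all add: kP.augpow_1)
 hence 3: "kP.dl g \<star> kP.dl h : J 2" by (simp add: numeral_2_eq_2)
 let ?x = "kP.dl (SOME x. x : C *[V 1] D)" and ?y = "kP.dl (SOME x. x : C)" and ?z = "kP.dl (SOME x. x : D)"
 have "(?x - kP.dl (g *[P] h)) - (?y - kP.dl g) - (?z - kP.dl h) + kP.dl g \<star> kP.dl h : J 2"
  by (intro fv.subspace_add[OF kP.augpow_sub] fv.subspace_diff[OF kP.augpow_sub] 1 2 3)
 moreover have "?x - ?y - ?z = (?x - kP.dl (g *[P] h)) - (?y - kP.dl g) - (?z - kP.dl h) + kP.dl g \<star> kP.dl h"
  unfolding dl_mult[OF g(1) h(1)] by (simp add: algebra_simps)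
 ultimately have "?x - ?y - ?z : J 2" by (simp only:)
 thus ?thesis unfolding jq1_delta[OF V.m_closed[OF assms]] jq1_delta[OF assms(1)] jq1_delta[OF assms(2)] .
qed

lemma jq1_pow:
 assumes "C : carrier (V 1)"
 shows "jq1 (delta (C [^]\<^bsub>V 1\<^esub> (a::nat))) - scl (of_nat a) (jq1 (delta C)) : J 2"
proof (induction a)
 case 0
 interpret V: group "V 1" by (rule V_group)
 have "jq1 (delta (#1[V 1] *[V 1] #1[V 1])) - jq1 (delta #1[V 1]) - jq1 (delta #1[V 1]) : J 2"
  by (rule jq1_mult) (rule V.one_closed)+
 hence "- (jq1 (delta #1[V 1]) - jq1 (delta #1[V 1]) - jq1 (delta #1[V 1])) : J 2"
  unfolding V.l_one[OF V.one_closed] by (rule fv.subspace_neg[OF kP.augpow_sub])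
 thus ?case by simp
next
 case (Suc a)
 interpret V: group "V 1" by (rule V_group)
 have "(jq1 (delta (C [^]\<^bsub>V 1\<^esub> a *[V 1] C)) - jq1 (delta (C [^]\<^bsub>V 1\<^esub> a)) - jq1 (delta C))
  + (jq1 (delta (C [^]\<^bsub>V 1\<^esub> a)) - scl (of_nat a) (jq1 (delta C))) : J 2"
  by (intro fv.subspace_add[OF kP.augpow_sub] jq1_mult Suc assms V.nat_pow_closed)
 thus ?case by (simp add: fv.scale_left_distrib algebra_simps)
qed

lemma jq1_rels: "f : tensor_rels (V 1) ==> jq1 f : J 2"
 unfolding tensor_rels_span[OF V_monoid]
proof (induction rule: fv.span_induct_alt)
 case base
 have "jq1 0 = 0" using jq1_linear(2)[of 0 0] by simp
 thus ?case by (simp add: fv.subspace_0[OF kP.augpow_sub])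
next
 case (step c x y)
 have "jq1 x : J 2" using step(1) jq1_mult jq1_pow unfolding tensor_gens_def by (auto simp: jq1_linear)
 thus ?case using step(2)
  by (simp add: jq1_linear fv.subspace_add[OF kP.augpow_sub] fv.subspace_scale[OF kP.augpow_sub])
qed

text \<open>\<open>jq_representatives\<close> allows any choice \<open>s\<close> of coset
  representatives. Exchanging it for the choice made in \<open>jq1\<close> changes the sum by an
  element of J^2.\<close>

lemma wlift_jq1:
 assumes i: "i : {1..num S}" "wdeg S i = 1"
 shows "\<exists>f. comp (wel S i) 1 f & wlift S i - jq1 f : J 2"
proof -
 obtain f s where f: "f : wel S i 1" and s: "ALL C:carrier (V 1). s C : C"
  and d: "(%x. wlift S i x - (SUM C:carrier (V 1). f C * (delta (s C) x - delta #1[P] x))) : J 2"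
  using wlift_represents[OF i(1)] i(2)
  by (auto simp: jq_representatives_def kP_def[symmetric] kP.rad_pow_augpow numeral_2_eq_2)
 have e: "(%x. wlift S i x - (SUM C:carrier (V 1). f C * (delta (s C) x - delta #1[P] x)))
  = wlift S i - (SUM C:carrier (V 1). scl (f C) (kP.dl (s C)))"
  by (simp add: fun_eq_iff pointwise sum_apply kP.dl_def)
 have "(SUM C:carrier (V 1). scl (f C) (kP.dl (s C))) - jq1 f = - (SUM C:carrier (V 1). scl (f C) (kP.dl (SOME g. g : C) - kP.dl (s C)))"
  by (simp add: jq1_def fv.scale_right_diff_distrib sum_subtractf)
 also have "... : J 2"
  using s V1_rep(2) by (intro fv.subspace_neg fv.subspace_sum fv.subspace_scale kP.augpow_sub) auto
 finally have "(wlift S i - (SUM C:carrier (V 1). scl (f C) (kP.dl (s C))))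
  + ((SUM C:carrier (V 1). scl (f C) (kP.dl (s C))) - jq1 f) : J 2"
  using d unfolding e by (intro fv.subspace_add[OF kP.augpow_sub])
 moreover obtain f0 where f0: "comp (wel S i) 1 f0" using comp_ex[OF wel_carrier[OF i(1)], of 1] by auto
 hence "comp (wel S i) 1 f"
  using f tensor_elt_eq[OF V_monoid, of 1 f f0] by (simp add: comp_def tensor_elt_mem)
 ultimately show ?thesis by auto
qed

text \<open>Expand the class of \<open>g\<close> in the basis of the \<open>wel S i\<close> and read
  off the component of degree one: basis elements of other degrees contribute 0 there, those of
  degree one give their lifts. Modulo J^2 this expresses g - 1, and such elements span the
  augmentation ideal.\<close>

lemma aug_degree_one:
 assumes "x : J 1"
 shows "x : fv.span (wlift S ` {i : {1..num S}. wdeg S i = 1} \<union> J 2)"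
proof -
 let ?B = "wlift S ` {i : {1..num S}. wdeg S i = 1} \<union> J 2"
 have "kP.dl g : fv.span ?B" if g: "g : carrier P" for g
 proof -
  have g1: "g : F 1" using g F_1 by simp
  let ?v = "jen_class P 1 g :: ('p, 'k) jen_elt"
  have vc: "?v : carrier Jen" using class_hom[OF _ g1] by (auto intro: hom_carrier)
  obtain c where c: "?v = (\<Oplus>\<^bsub>Jen\<^esub>i\<in>{1..num S}. c i *.[Jen] wel S i)" using wel_basis[OF vc] by blast
  have "\<exists>f. comp (wel S i) 1 f & (if wdeg S i = 1 then wlift S i - jq1 f : J 2 else f = 0)" if "i : {1..num S}" for i
  proof (cases "wdeg S i = 1")
   case False
   hence "comp (wel S i) 1 0" using wel_homogeneous[OF that] by (simp add: hom_iff)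
   thus ?thesis using False by auto
  qed (use wlift_jq1[OF that] in auto)
  then obtain f where f: "!!i. i : {1..num S} ==> comp (wel S i) 1 (f i)"
   "!!i. i : {1..num S} ==> if wdeg S i = 1 then wlift S i - jq1 (f i) : J 2 else f i = 0" by metis
  have "comp ?v 1 (SUM i:{1..num S}. scl (c i) (f i))"
   unfolding c using f wel_carrier by (intro comp_sum) auto
  moreover have "comp ?v 1 (delta (F (Suc 1) #>\<^bsub>P\<^esub> g))" using class_comp[of 1 g] by simp
  ultimately have "delta (F (Suc 1) #>\<^bsub>P\<^esub> g) - (SUM i:{1..num S}. scl (c i) (f i)) : tensor_rels (V 1)"
   unfolding comp_def by (simp only: tensor_elt_eq[OF V_monoid, symmetric])
  from jq1_rels[OF this] have 1: "jq1 (delta (F (Suc 1) #>\<^bsub>P\<^esub> g)) - (SUM i:{1..num S}. scl (c i) (jq1 (f i))) : J 2"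
  proof -
   have "jq1 (SUM i:I. scl (c i) (f i)) = (SUM i:I. scl (c i) (jq1 (f i)))" for I
    using sum_comp_morphism[of jq1 "%i. scl (c i) (f i)" I] jq1_linear(2)[of 0]
    by (simp add: jq1_linear o_def)
   thus ?thesis using jq1_rels[OF \<open>delta _ - _ : tensor_rels (V 1)\<close>] by (simp add: jq1_linear)
  qed
  have C: "F (Suc 1) #>\<^bsub>P\<^esub> g : carrier (V 1)" using g1 by (auto simp: V_carrier)
  have gC: "g : F (Suc 1) #>\<^bsub>P\<^esub> g" using g F_subgroup by (auto intro: kP.rcos_self)
  have 2: "jq1 (delta (F (Suc 1) #>\<^bsub>P\<^esub> g)) - kP.dl g : J 2" using V1_rep(2)[OF C gC] by (simp only: jq1_delta[OF C])
  have 3: "scl (c i) (jq1 (f i)) : fv.span ?B" if i: "i : {1..num S}" for i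
  proof (cases "wdeg S i = 1")
   case True
   hence "wlift S i - jq1 (f i) : J 2" using f(2)[OF i] by simp
   hence "wlift S i - (wlift S i - jq1 (f i)) : fv.span ?B"
    using i True by (intro fv.span_diff fv.span_base) auto
   thus ?thesis by (simp add: fv.span_scale)
  next
   case False
   hence "f i = 0" using f(2)[OF i] by simp
   hence "jq1 (f i) = 0" using jq1_linear(2)[of 0 "0"] by simp
   thus ?thesis by (simp add: fv.span_zero)
  qed
  have J2: "y : J 2 ==> y : fv.span ?B" for y by (rule fv.span_base) blast
  have "(SUM i:{1..num S}. scl (c i) (jq1 (f i))) : fv.span ?B" using 3 by (rule fv.span_sum)
  from fv.span_add[OF fv.span_diff[OF J2[OF 1] J2[OF 2]] this] show ?thesis by simp
 qed
 hence "(SUM g:carrier P. scl (x g) (kP.dl g)) : fv.span ?B" by (rule span_sumI)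
 moreover have "x = (SUM g:carrier P. scl (x g) (kP.dl g))"
  using kP.aug_span assms by (simp add: kP.augpow_1[symmetric])
 ultimately show ?thesis by simp
qed

end

section \<open>The basis of PBW monomials\<close>

context block_setting
begin

definition wt :: "nat list => nat" where
 "wt xs = sum_list (map (wdeg S) xs)"

lemma wt_simps [simp]: "wt [] = 0" "wt (x # xs) = wdeg S x + wt xs" "wt (xs @ ys) = wt xs + wt ys"
 by (auto simp: wt_def)

lemma wt_replicate [simp]: "wt (replicate n i) = n * wdeg S i"
 by (induction n) auto

lemma wt_mset: "mset xs = mset ys ==> wt xs = wt ys"
 unfolding wt_def by (metis mset_map sum_mset_sum_list)

abbreviation LT where "LT \<equiv> {1..num S}"

lemma wmon_Nil: "wmon S [] = #1[kP S]"
 by (simp add: wmon_def)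

lemma wmon_Cons: "wmon S (i # xs) = wlift S i \<star> wmon S xs"
 by (simp add: wmon_def)

lemma wmon_J: "set xs <= LT ==> wmon S xs : J (wt xs)"
proof (induction xs)
 case Nil
 show ?case by (simp add: wmon_Nil kP.augpow_0 kP.closed)
next
 case (Cons i xs)
 have "wlift S i \<star> wmon S xs : J (wdeg S i + wt xs)"
  using Cons by (intro kP.augpow_mul wlift_J) auto
 thus ?case by (simp add: wmon_Cons)
qed

lemma wmon_carrier: "set xs <= LT ==> wmon S xs : Pc"
 using wmon_J kP.augpow_carrier by blast

lemma wmon_append: "set ys <= LT ==> wmon S (xs @ ys) = wmon S xs \<star> wmon S ys"
 using wmon_carrier[of ys] by (induction xs) (auto simp: wmon_Nil wmon_Cons kP.one_l kP.assoc)

lemma wmon_single: "i : LT ==> wmon S [i] = wlift S i"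
 by (simp add: wmon_Nil wmon_Cons kP.one_r wlift_carrier)

definition D1 :: "nat set" where
 "D1 = {i : LT. wdeg S i = 1}"

text \<open>Each factor from J^1 is a combination of lifts of degree one up to an element of J^2,
  and a single factor in J^2 already moves the product into the next power. For m = 0 the only word
  is empty, and subtracting the augmentation leaves an element of J^1.\<close>

lemma J_words:
 "x : J m ==> x : fv.span (wmon S ` {is. set is <= D1 & length is = m} \<union> J (Suc m))"
proof (induction m arbitrary: x)
 case 0
 let ?B = "wmon S ` {is. set is <= D1 & length is = 0} \<union> J (Suc 0)"
 define c where "c = (SUM g:carrier P. x g)"
 have x: "x : Pc" using 0 by (simp add: kP.augpow_0)
 have "x - scl c #1[kP S] : kP.aug"
 proof -
  have "x - scl c #1[kP S] : Pc" using x by (intro kP.closed)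
  thus ?thesis
   by (simp add: kP.aug_def sum_subtractf pointwise c_def sum_distrib_left[symmetric] kP.one_delta kP.sum_delta)
 qed
 hence "x - scl c #1[kP S] : fv.span ?B" by (intro fv.span_base) (simp add: kP.augpow_1)
 moreover have "scl c #1[kP S] : fv.span ?B" by (intro fv.span_scale fv.span_base UnI1 image_eqI[of _ _ "[]"]) (simp_all add: wmon_Nil)
 ultimately show ?case using fv.span_add by fastforce
next
 case (Suc m)
 let ?B = "wmon S ` {is. set is <= D1 & length is = Suc m} \<union> J (Suc (Suc m))"
 from Suc.prems show ?case
 proof (induction rule: kP.augpow_Suc_induct)
  case (prod i j)
  have "i : J 1" using prod(1) by (simp add: kP.augpow_1)
  hence "i : fv.span (wlift S ` D1 \<union> J 2)" unfolding D1_def by (rule aug_degree_one)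
  moreover have "j : fv.span (wmon S ` {is. set is <= D1 & length is = m} \<union> J (Suc m))" by (rule Suc.IH[OF prod(2)])
  ultimately show ?case
  proof (rule kP.span_mul)
   fix b c assume b: "b : wlift S ` D1 \<union> J 2" and c: "c : wmon S ` {is. set is <= D1 & length is = m} \<union> J (Suc m)"
   have c': "c : J m" using c wmon_J kP.augpow_decr
   proof -
    have "wmon S is : J m" if "set is <= D1" "length is = m" for "is"
    proof -
     have "wt is = length is" using that(1) by (induction "is") (auto simp: D1_def)
     moreover have "set is <= LT" using that(1) by (auto simp: D1_def)
     ultimately show ?thesis using wmon_J[of "is"] that(2) by simp
    qed
    thus ?thesis using c subsetD[OF kP.augpow_decr] by auto
   qed
   have b': "b : J 1"
   proof -
    have "wlift S i : J 1" if "i : D1" for i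
    proof -
     have i: "i : LT" "wdeg S i = 1" using that by (auto simp: D1_def)
     show ?thesis using wlift_J[OF i(1)] unfolding i(2) .
    qed
    moreover have "J 2 <= J 1" by (rule kP.augpow_mono) simp
    ultimately show ?thesis using b by blast
   qed
   show "b \<star> c : fv.span ?B"
   proof (cases "b : J 2 \<or> c : J (Suc m)")
    case True
    hence "b \<star> c : J (2 + m) \<or> b \<star> c : J (1 + Suc m)" using b' c' kP.augpow_mul by blast
    hence "b \<star> c : J (Suc (Suc m))" by simp
    thus ?thesis by (intro fv.span_base) simp
   next
    case False
    then obtain a "is" where "b = wlift S a" "a : D1" "c = wmon S is" "set is <= D1" "length is = m" using b c by blast
    hence "b \<star> c = wmon S (a # is)" "set (a # is) <= D1" "length (a # is) = Suc m" by (auto simp: wmon_Cons)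
    thus ?thesis by (intro fv.span_base) blast
   qed
  qed simp
 next
  case (sum x y)
  thus ?case by (rule fv.span_add)
 qed
qed

lemma finsum_kP: "(!!i. i : I ==> f i : Pc) ==> (\<Oplus>\<^bsub>kP S\<^esub>i\<in>I. f i) = (SUM i:I. f i)"
 by (rule kP.finsum_A) auto

lemma PBW_letters: "xs : PBW S ==> set xs <= LT"
 by (simp add: PBW_def)

lemma wmon_PBW: "xs : PBW S ==> wmon S xs : Pc"
 by (rule wmon_carrier[OF PBW_letters])

lemma yComm_eq: "yComm S i j = (SUM xs:PBW S. scl (cErr S i j xs) (wmon S xs))"
 unfolding yComm_def by (subst finsum_kP) (auto simp: kP.smult_A intro!: kP.closed wmon_PBW)

lemma yPow_eq: "yPow S i = (SUM xs:PBW S. scl (dErr S i xs) (wmon S xs))"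
 unfolding yPow_def by (subst finsum_kP) (auto simp: kP.smult_A intro!: kP.closed wmon_PBW)

lemma yComm_J: "i : LT ==> j : LT ==> yComm S i j : J (Suc (wdeg S i + wdeg S j))"
 using yComm_deep by (simp add: kP.rad_pow_augpow)

lemma yPow_J: "i : LT ==> yPow S i : J (Suc (CHAR('k) * wdeg S i))"
 using yPow_deep by (simp add: kP.rad_pow_augpow)

lemma comm_eq:
 assumes "i : LT" "j : LT"
 shows "wlift S i \<star> wlift S j - wlift S j \<star> wlift S i = (SUM k:LT. scl (cLie S i j k) (wlift S k)) + yComm S i j"
proof -
 have "(\<Oplus>\<^bsub>kP S\<^esub>k\<in>LT. cLie S i j k *.[kP S] wlift S k) = (SUM k:LT. scl (cLie S i j k) (wlift S k))"
  by (subst finsum_kP) (auto simp: kP.smult_A kP.closed wlift_carrier)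
 thus ?thesis using wlift_comm[OF assms] assms
  by (simp add: kP.minus_A kP.closed wlift_carrier kP.add_A)
qed

lemma pow_wmon: "i : LT ==> wlift S i [^]\<^bsub>kP S\<^esub> (n::nat) = wmon S (replicate n i)"
proof (induction n)
 case 0
 interpret ring "kP S" by (rule kP.ring_A)
 show ?case by (simp add: wmon_Nil)
next
 case (Suc n)
 interpret ring "kP S" by (rule kP.ring_A)
 have "wlift S i [^]\<^bsub>kP S\<^esub> Suc n = wmon S (replicate n i) \<star> wmon S [i]" using Suc by (simp add: wmon_single)
 also have "... = wmon S (replicate n i @ [i])" using Suc.prems by (simp add: wmon_append)
 also have "replicate n i @ [i] = replicate (Suc n) i" by (simp add: replicate_append_same)
 finally show ?case .
qed

lemma pow_eq:
 assumes "i : LT"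
 shows "wmon S (replicate CHAR('k) i) = (SUM k:LT. scl (dLie S i k) (wlift S k)) + yPow S i"
proof -
 have "(\<Oplus>\<^bsub>kP S\<^esub>k\<in>LT. dLie S i k *.[kP S] wlift S k) = (SUM k:LT. scl (dLie S i k) (wlift S k))"
  by (subst finsum_kP) (auto simp: kP.smult_A kP.closed wlift_carrier)
 thus ?thesis using wlift_pow[OF assms] assms by (simp add: pow_wmon kP.add_A)
qed

lemma char_ge2: "CHAR('k) >= 2"
 using prime_char by (rule prime_ge_2_nat)

text \<open>The Lie and p-power terms have the weight of the letters they replace, by
  \<open>cLie_deg\<close> and \<open>dLie_deg\<close>, and are shorter, so \<open>straighten\<close>
  has them by induction; the terms \<open>yComm\<close> and \<open>yPow\<close> fall into the next
  power of the radical.\<close>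

lemma wmon_straighten:
 assumes "set xs <= LT" "wt xs = m"
 shows "wmon S xs : fv.span (wmon S ` {ys : PBW S. wt ys = m} \<union> J (Suc m))"
proof -
 let ?B = "wmon S ` {ys : PBW S. wt ys = m} \<union> J (Suc m)"
 define Q where "Q ys \<longleftrightarrow> set ys <= LT & wt ys = m" for ys
 have JB: "x : J (Suc m) ==> x : fv.span ?B" for x by (rule fv.span_base) blast
 show ?thesis
 proof (rule straighten[where U = "fv.span ?B" and Q = Q and p = "CHAR('k)" and wd = "wmon S"])
  show "Q xs" using assms by (simp add: Q_def)
  show "Q ys ==> mset ys = mset zs ==> Q zs" for ys zs
   using wt_mset[of ys zs] by (auto simp: Q_def dest: mset_eq_setD)
 next
  fix u i j v assume q: "Q (u @ [j, i] @ v)" and ij: "i < j"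
   and short: "!!ys. Q ys ==> length ys < length (u @ [j, i] @ v) ==> wmon S ys : fv.span ?B"
  have l: "set u <= LT" "set v <= LT" "i : LT" "j : LT" using q by (auto simp: Q_def)
  have w: "wt u + (wdeg S i + wdeg S j) + wt v = m" using q by (simp add: Q_def)
  have 1: "wmon S (u @ [k] @ v) : fv.span ?B" if "k : LT" "cLie S i j k ~= 0" for k
   using that l w cLie_deg[OF l(3,4) that] by (intro short) (auto simp: Q_def)
  have "wmon S u \<star> yComm S i j \<star> wmon S v : J (wt u + Suc (wdeg S i + wdeg S j) + wt v)"
   using l by (intro kP.augpow_mul wmon_J yComm_J)
  hence 2: "wmon S u \<star> (yComm S i j \<star> wmon S v) : fv.span ?B" using w by (intro JB) (simp add: kP.assoc)
  have "wmon S (u @ [i, j] @ v) - wmon S (u @ [j, i] @ v)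
   = wmon S u \<star> ((wlift S i \<star> wlift S j - wlift S j \<star> wlift S i) \<star> wmon S v)"
   using l by (simp add: wmon_append wmon_Cons kP.diff_l kP.diff_r kP.assoc)
  also have "... = (SUM k:LT. scl (cLie S i j k) (wmon S (u @ [k] @ v))) + wmon S u \<star> (yComm S i j \<star> wmon S v)"
   unfolding comm_eq[OF l(3,4)] using l by (simp add: wmon_append wmon_Cons kP.distribs)
  also have "... : fv.span ?B"
  proof (rule fv.span_add[OF fv.span_sum 2])
   show "scl (cLie S i j k) (wmon S (u @ [k] @ v)) : fv.span ?B" if "k : LT" for k
    using 1[OF that] by (cases "cLie S i j k = 0") (auto intro: fv.span_scale fv.span_zero)
  qed
  finally have "- (wmon S (u @ [i, j] @ v) - wmon S (u @ [j, i] @ v)) : fv.span ?B" by (rule fv.span_neg)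
  hence "wmon S (u @ [j, i] @ v) - scl 1 (wmon S (u @ [i, j] @ v)) : fv.span ?B" by simp
  thus "\<exists>q. wmon S (u @ [j, i] @ v) - scl q (wmon S (u @ [i, j] @ v)) : fv.span ?B" ..
 next
  fix u i v assume q: "Q (u @ replicate CHAR('k) i @ v)"
   and short: "!!ys. Q ys ==> length ys < length (u @ replicate CHAR('k) i @ v) ==> wmon S ys : fv.span ?B"
  have l: "set u <= LT" "set v <= LT" "i : LT" using q char_ge2 by (auto simp: Q_def)
  have w: "wt u + CHAR('k) * wdeg S i + wt v = m" using q by (simp add: Q_def)
  have 1: "wmon S (u @ [k] @ v) : fv.span ?B" if "k : LT" "dLie S i k ~= 0" for k
   using that l w dLie_deg[OF l(3) that] char_ge2 by (intro short) (auto simp: Q_def)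
  have "wmon S u \<star> yPow S i \<star> wmon S v : J (wt u + Suc (CHAR('k) * wdeg S i) + wt v)"
   using l by (intro kP.augpow_mul wmon_J yPow_J)
  hence 2: "wmon S u \<star> (yPow S i \<star> wmon S v) : fv.span ?B" using w by (intro JB) (simp add: kP.assoc)
  have "wmon S (u @ replicate CHAR('k) i @ v) = wmon S u \<star> (wmon S (replicate CHAR('k) i) \<star> wmon S v)"
   using l by (subst wmon_append) (auto simp: wmon_append)
  also have "... = (SUM k:LT. scl (dLie S i k) (wmon S (u @ [k] @ v))) + wmon S u \<star> (yPow S i \<star> wmon S v)"
   unfolding pow_eq[OF l(3)] using l by (simp add: wmon_append wmon_Cons kP.distribs)
  also have "... : fv.span ?B"
  proof (rule fv.span_add[OF fv.span_sum 2])
   show "scl (dLie S i k) (wmon S (u @ [k] @ v)) : fv.span ?B" if "k : LT" for k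
    using 1[OF that] by (cases "dLie S i k = 0") (auto intro: fv.span_scale fv.span_zero)
  qed
  finally show "wmon S (u @ replicate CHAR('k) i @ v) : fv.span ?B" .
 next
  fix ys assume y: "Q ys" "sorted ys" "!!i. count_list ys i < CHAR('k)"
  have "count_list ys i <= CHAR('k) - 1" for i using y(3)[of i] by linarith
  hence "ys : PBW S" "wt ys = m" using y(1,2) by (simp_all add: Q_def PBW_def)
  thus "wmon S ys : fv.span ?B" by (intro fv.span_base) blast
 qed simp
qed

lemma J_top: "J (rad_length (kP S)) = {0}"
 by (rule kP.rad_length_zero)

text \<open>Spanning modulo the next power becomes spanning, because the powers of the radical reach
  zero. The induction runs downwards from the radical length.\<close>

lemma descend:
 assumes "!!m x. x : J m ==> x : fv.span (B m \<union> J (Suc m))"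
 shows "x : J m ==> x : fv.span (\<Union>r\<in>{m..}. B r)"
proof -
 let ?s = "rad_length (kP S)"
 have "x : J (?s - i) ==> x : fv.span (\<Union>r\<in>{?s - i..}. B r)" for i x
 proof (induction i arbitrary: x)
  case 0
  thus ?case using J_top by (simp add: fv.span_zero)
 next
  case (Suc i)
  show ?case
  proof (cases "?s - i")
   case 0
   thus ?thesis using Suc by simp
  next
   case (Suc r)
   hence r: "?s - Suc i = r" by simp
   have "B r \<union> J (Suc r) <= fv.span (\<Union>t\<in>{r..}. B t)"
   proof
    fix y assume "y : B r \<union> J (Suc r)"
    thus "y : fv.span (\<Union>t\<in>{r..}. B t)"
    proof
     assume "y : B r" thus ?thesis by (intro fv.span_base) auto
    next
     assume "y : J (Suc r)"
     hence "y : fv.span (\<Union>t\<in>{Suc r..}. B t)" using Suc.IH[of y] Suc by simp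
     moreover have "(\<Union>t\<in>{Suc r..}. B t) <= (\<Union>t\<in>{r..}. B t)" by (intro UN_mono) auto
     ultimately show ?thesis using fv.span_mono by blast
    qed
   qed
   hence "fv.span (B r \<union> J (Suc r)) <= fv.span (\<Union>t\<in>{r..}. B t)" by (rule fv.span_minimal) simp
   thus ?thesis using assms[of x r] Suc.prems r by auto
  qed
 qed
 note 1 = this
 assume x: "x : J m"
 show "x : fv.span (\<Union>r\<in>{m..}. B r)"
 proof (cases "m <= ?s")
  case True
  thus ?thesis using 1[of x "?s - m"] x by simp
 next
  case False
  hence "x = 0" using x J_top kP.augpow_mono[of ?s m] by auto
  thus ?thesis by (simp add: fv.span_zero)
 qed
qed

lemma J_span_PBW: "x : J m ==> x : fv.span (wmon S ` {ys : PBW S. wt ys >= m})"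
proof -
 assume x: "x : J m"
 have "x : fv.span (\<Union>r\<in>{m..}. wmon S ` {ys : PBW S. wt ys = r})"
 proof (rule descend[OF _ x])
  fix m x assume "x : J m"
  hence "x : fv.span (wmon S ` {is. set is <= D1 & length is = m} \<union> J (Suc m))" by (rule J_words)
  moreover have "wmon S ` {is. set is <= D1 & length is = m} \<union> J (Suc m) <= fv.span (wmon S ` {ys : PBW S. wt ys = m} \<union> J (Suc m))"
  proof -
   have "wmon S is : fv.span (wmon S ` {ys : PBW S. wt ys = m} \<union> J (Suc m))" if "set is <= D1" "length is = m" for "is"
   proof (rule wmon_straighten)
    show "set is <= LT" using that(1) by (auto simp: D1_def)
    show "wt is = m" unfolding that(2)[symmetric] using that(1) by (induction "is") (auto simp: D1_def)
   qed
   thus ?thesis by (auto intro: fv.span_base)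
  qed
  ultimately show "x : fv.span (wmon S ` {ys : PBW S. wt ys = m} \<union> J (Suc m))"
   using fv.span_minimal[OF _ fv.subspace_span] by blast
 qed
 moreover have "(\<Union>r\<in>{m..}. wmon S ` {ys : PBW S. wt ys = r}) = wmon S ` {ys : PBW S. wt ys >= m}" by auto
 ultimately show ?thesis by simp
qed

lemma J1_span_words: "x : J 1 ==> x : fv.span (wmon S ` {is. set is <= D1 & is ~= []})"
proof -
 assume x: "x : J 1"
 have "x : fv.span (\<Union>r\<in>{1..}. wmon S ` {is. set is <= D1 & length is = r})"
  by (rule descend[OF J_words x])
 moreover have "(\<Union>r\<in>{1..}. wmon S ` {is. set is <= D1 & length is = r}) = wmon S ` {is. set is <= D1 & is ~= []}"
 proof
  show "wmon S ` {is. set is <= D1 & is ~= []} <= (\<Union>r\<in>{1..}. wmon S ` {is. set is <= D1 & length is = r})"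
  proof clarify
   fix "is" :: "nat list" assume "set is <= D1" "is ~= []"
   moreover from this have "length is : {1..}" by (cases "is") auto
   ultimately show "wmon S is : (\<Union>r\<in>{1..}. wmon S ` {is. set is <= D1 & length is = r})" by blast
  qed
 qed (auto simp: Suc_le_eq)
 ultimately show ?thesis by simp
qed

lemma PBW_count_less: "xs : PBW S ==> count_list xs i < CHAR('k)"
proof -
 assume "xs : PBW S"
 hence "count_list xs i <= CHAR('k) - 1" by (simp add: PBW_def)
 thus ?thesis using char_ge2 by linarith
qed

text \<open>A sorted word is determined by how often each letter occurs, and each count is below
  p.\<close>

lemma PBW_count:
 "finite (PBW S)" "card (PBW S) <= CHAR('k) ^ num S"
proof -
 let ?f = "%xs. \<lambda>i\<in>LT. count_list xs i"
 have inj: "inj_on ?f (PBW S)"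
 proof (rule inj_onI)
  fix xs ys assume xs: "xs : PBW S" and ys: "ys : PBW S" and e: "?f xs = ?f ys"
  have "count_list xs i = count_list ys i" for i
  proof (cases "i : LT")
   case True
   thus ?thesis using fun_cong[OF e, of i] by simp
  next
   case False
   hence "i \<notin> set xs" "i \<notin> set ys" using PBW_letters xs ys by blast+
   thus ?thesis by (simp add: count_list_0_iff)
  qed
  hence "mset xs = mset ys" by (intro multiset_eqI) (simp add: count_mset)
  thus "xs = ys" using xs ys properties_for_sort[of ys xs] properties_for_sort[of xs xs] by (simp add: PBW_def)
 qed
 have sub: "?f ` PBW S <= LT \<rightarrow>\<^sub>E {..<CHAR('k)}"
  using PBW_count_less by auto
 have fin: "finite (LT \<rightarrow>\<^sub>E {..<CHAR('k)})" by (intro finite_PiE) auto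
 show "finite (PBW S)" using finite_imageD[OF finite_subset[OF sub fin] inj] .
 have "card (PBW S) = card (?f ` PBW S)" using inj by (simp add: card_image)
 also have "... <= card (LT \<rightarrow>\<^sub>E {..<CHAR('k)})" by (rule card_mono[OF fin sub])
 also have "... = CHAR('k) ^ num S" by (simp add: card_funcsetE)
 finally show "card (PBW S) <= CHAR('k) ^ num S" .
qed

lemma PBW_independent: "inj_on (wmon S) (PBW S)" "fv.independent (wmon S ` PBW S)"
proof -
 have span: "Pc <= fv.span (wmon S ` PBW S)"
  using J_span_PBW[of _ 0] by (auto simp: kP.augpow_0)
 have D: "fv.independent (delta ` carrier P :: ('p => 'k) set)"
 proof (rule fv.independent_if_scalars_zero)
  show "finite (delta ` carrier P :: ('p => 'k) set)" using finite_P by simp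
  fix f :: "('p => 'k) => 'k" and x :: "'p => 'k" assume s: "(SUM x:delta ` carrier P. scl (f x) x) = 0" and x: "x : delta ` carrier P"
  then obtain g where g: "g : carrier P" "x = delta g" by blast
  have inj: "inj_on (delta :: 'p => 'p => 'k) (carrier P)"
   by (rule inj_onI) (metis delta_apply zero_neq_one)
  have "0 = (SUM h:carrier P. scl (f (delta h)) (delta h)) g"
  proof -
   have "(SUM x:delta ` carrier P. scl (f x) x) = (SUM h:carrier P. scl (f (delta h)) (delta h))"
    by (rule sum.reindex_cong[OF inj]) (rule refl)+
   thus ?thesis using s by (simp add: zero_fun_apply)
  qed
  also have "... = (SUM h:carrier P. if h = g then f (delta g) else 0)"
   unfolding sum_apply by (intro sum.cong) (auto simp: delta_apply pointwise)
  also have "... = f x" using g finite_P by simp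
  finally show "f x = 0" by simp
 qed
 have injd: "inj_on (delta :: 'p => 'p => 'k) (carrier P)"
  by (rule inj_onI) (metis delta_apply zero_neq_one)
 have cardD: "card (delta ` carrier P :: ('p => 'k) set) = CHAR('k) ^ num S"
  using injd P_order by (simp add: card_image Coset.order_def)
 \<comment> \<open>A maximal independent set \<open>B\<close> of monomials still spans. In the chain
   p^n <= |B| <= number of monomials <= number of sorted words <= p^n everything is equal, which
   gives injectivity of \<open>wmon S\<close> along with independence.\<close>
 obtain B where B: "B <= wmon S ` PBW S" "fv.independent B" "fv.span B = fv.span (wmon S ` PBW S)"
  using fv.maximal_independent_subset[of "wmon S ` PBW S"] fv.span_minimal[OF _ fv.subspace_span]
   fv.span_mono by (metis subset_antisym)
 have finB: "finite B" using B(1) PBW_count(1) by (meson finite_imageI finite_subset)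
 have "card (delta ` carrier P :: ('p => 'k) set) <= card B"
 proof -
  have "delta ` carrier P <= fv.span B" using span kP.delta_in B(3) by blast
  thus ?thesis using fv.independent_span_bound[OF finB D] by blast
 qed
 hence c: "CHAR('k) ^ num S <= card B" using cardD by simp
 have c2: "card B <= card (wmon S ` PBW S)" using B(1) PBW_count(1) by (intro card_mono) auto
 have c3: "card (wmon S ` PBW S) <= card (PBW S)" using PBW_count(1) by (rule card_image_le)
 have e: "card (wmon S ` PBW S) = card (PBW S)" "card B = card (wmon S ` PBW S)"
  using c c2 c3 PBW_count(2) by auto
 show "inj_on (wmon S) (PBW S)" using e(1) PBW_count(1) by (simp add: eq_card_imp_inj_on)
 have "B = wmon S ` PBW S" using B(1) e(2) PBW_count(1) by (intro card_subset_eq) auto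
 thus "fv.independent (wmon S ` PBW S)" using B(2) by simp
qed

lemma PBW_zero:
 assumes "(SUM xs:PBW S. scl (c xs) (wmon S xs)) = 0" "xs : PBW S"
 shows "c xs = 0"
proof -
 let ?d = "%x. c (the_inv_into (PBW S) (wmon S) x)"
 have "(SUM x:wmon S ` PBW S. scl (?d x) x) = (SUM xs:PBW S. scl (c xs) (wmon S xs))"
  unfolding sum.reindex[OF PBW_independent(1)] o_def
  by (intro sum.cong refl) (simp add: the_inv_into_f_f[OF PBW_independent(1)])
 hence "?d (wmon S xs) = 0"
  using fv.independentD[OF PBW_independent(2), of "wmon S ` PBW S" ?d "wmon S xs"] assms PBW_count(1) by auto
 thus ?thesis using assms(2) by (simp add: the_inv_into_f_f[OF PBW_independent(1)])
qed

lemma PBW_expand: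
 assumes "x : J m"
 shows "\<exists>c. x = (SUM xs:PBW S. scl (c xs) (wmon S xs)) & (\<forall>xs. wt xs < m --> c xs = 0)"
proof -
 let ?Q = "{ys : PBW S. wt ys >= m}"
 have fin: "finite (wmon S ` ?Q)" using PBW_count(1) by simp
 have inj: "inj_on (wmon S) ?Q" using PBW_independent(1) by (rule inj_on_subset) auto
 obtain d where "x = (SUM y:wmon S ` ?Q. scl (d y) y)"
  using J_span_PBW[OF assms] fv.span_finite[OF fin] by auto
 also have "... = (SUM ys:?Q. scl (d (wmon S ys)) (wmon S ys))" by (rule sum.reindex_cong[OF inj]) (rule refl)+
 also have "... = (SUM ys:PBW S. scl (if wt ys >= m then d (wmon S ys) else 0) (wmon S ys))"
  using PBW_count(1) by (intro sum.mono_neutral_cong_left) auto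
 finally show ?thesis by (intro exI[of _ "%ys. if wt ys >= m then d (wmon S ys) else 0"]) auto
qed

text \<open>An element of J^m also has an expansion into words of weight at least m, and expansions
  are unique. This converts the depth of \<open>yComm\<close> and \<open>yPow\<close> into a strict
  lower bound for the weight of each word in the error terms, so that straightening ends.\<close>

lemma PBW_deep:
 assumes "(SUM xs:PBW S. scl (c xs) (wmon S xs)) : J m" "xs : PBW S" "c xs ~= 0"
 shows "m <= wt xs"
proof (rule ccontr)
 assume n: "\<not> m <= wt xs"
 obtain d where d: "(SUM xs:PBW S. scl (c xs) (wmon S xs)) = (SUM xs:PBW S. scl (d xs) (wmon S xs))" "\<forall>xs. wt xs < m --> d xs = 0"
  using PBW_expand[OF assms(1)] by blast
 have "(SUM xs:PBW S. scl (c xs - d xs) (wmon S xs)) = 0"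
  using d(1) by (simp add: fv.scale_left_diff_distrib sum_subtractf)
 hence "c xs - d xs = 0" using assms(2) by (rule PBW_zero)
 thus False using d(2) n assms(3) by simp
qed

lemma cErr_wt: "[|i : LT; j : LT; xs : PBW S; cErr S i j xs ~= 0|] ==> wdeg S i + wdeg S j < wt xs"
 using PBW_deep[of "cErr S i j" "Suc (wdeg S i + wdeg S j)" xs] yComm_J[of i j] by (simp add: yComm_eq)

lemma dErr_wt: "[|i : LT; xs : PBW S; dErr S i xs ~= 0|] ==> CHAR('k) * wdeg S i < wt xs"
 using PBW_deep[of "dErr S i" "Suc (CHAR('k) * wdeg S i)" xs] yPow_J[of i] by (simp add: yPow_eq)

end

section \<open>Characters of the group H\<close>

context block_setting
begin

sublocale H: group "grpH S"
 by (rule H_group)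

abbreviation H where "H \<equiv> grpH S"
abbreviation C where "C \<equiv> centH S"
abbreviation Hc where "Hc \<equiv> carrier (grpH S)"
abbreviation Gc where "Gc \<equiv> carrier (kG S)"
abbreviation Ec where "Ec \<equiv> carrier (kGe S)"
abbreviation Qc where "Qc \<equiv> carrier (kQ S)"
abbreviation Ir where "Ir \<equiv> IrrZ S"

lemma sub_C: "subgroup C H"
proof (rule subgroup.intro)
 show "C <= Hc" "#1[H] : C" by (auto simp: centH_def)
 fix x y assume x: "x : C" and y: "y : C"
 have "x *[H] y *[H] h = h *[H] (x *[H] y)" if "h : Hc" for h
 proof -
  have c: "x : Hc" "y : Hc" "x *[H] h = h *[H] x" "y *[H] h = h *[H] y"
   using x y that by (simp_all add: centH_def)
  have "x *[H] y *[H] h = x *[H] h *[H] y" using c(1,2,4) that by (simp add: H.m_assoc)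
  also have "... = h *[H] x *[H] y" by (simp only: c(3))
  finally show ?thesis using c(1,2) that by (simp add: H.m_assoc)
 qed
 hence "ALL h:Hc. x *[H] y *[H] h = h *[H] (x *[H] y)" by blast
 moreover have xH: "x : Hc" "y : Hc" using x y unfolding centH_def by blast+
 ultimately show "x *[H] y : C" unfolding centH_def using H.m_closed by blast
 have "inv[H] x *[H] h = h *[H] inv[H] x" if h: "h : Hc" for h
 proof -
  have x': "x : Hc" "x *[H] h = h *[H] x" using x h by (auto simp: centH_def)
  have "h = inv[H] x *[H] (x *[H] h)" using h x'(1) by (simp flip: H.m_assoc)
  also have "... = inv[H] x *[H] h *[H] x" unfolding x'(2) using h x'(1) by (simp add: H.m_assoc)
  finally have "h *[H] inv[H] x = inv[H] x *[H] h *[H] x *[H] inv[H] x" by simp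
  thus ?thesis using h x'(1) by (simp add: H.m_assoc)
 qed
 hence "ALL h:Hc. inv[H] x *[H] h = h *[H] inv[H] x" by blast
 thus "inv[H] x : C" unfolding centH_def using H.inv_closed xH(1) by blast
qed

lemma C_carrier: "x : C ==> x : Hc"
 using subgroup.mem_carrier[OF sub_C] .

lemma C_comm: "x : C ==> h : Hc ==> x *[H] h = h *[H] x"
 by (simp add: centH_def)

lemma C_fin: "finite C"
 using H_finite C_carrier by (meson finite_subset subsetI)

lemma sub_autL: "group (grpL S)"
 unfolding grpL_def
 using subgroup.subgroup_is_group[OF L_subgroup group.AutoGroup[OF P_group]] by simp

sublocale L: group "grpL S"
 by (rule sub_autL)

lemma act_hom: "group_hom H (grpL S) (actH S)"
 using H_onto_L by (auto intro!: group_hom.intro H_group sub_autL simp: group_hom_axioms_def epi_def)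

sublocale act: group_hom H "grpL S" "actH S"
 by (rule act_hom)

lemma sub_Z: "subgroup (subZ S) H"
 unfolding subZ_def by (rule act.subgroup_kernel)

lemma Z_carrier: "x : subZ S ==> x : Hc"
 using subgroup.mem_carrier[OF sub_Z] .

lemma Z_C: "x : subZ S ==> x : C"
 using Z_central by blast

lemma commutator_Z: "g : Hc ==> h : Hc ==> commutator H g h : subZ S"
 unfolding Z_derived derived_def commutator_def by (intro generate.incl) blast

lemma lchar_H: "\<psi> : HomHZ S ==> lchar H (Hc) \<psi>"
 using lchar_hom[of \<psi> "Hc" H] by (simp add: HomHZ_def)

lemma HomHZ_Z: "\<psi> : HomHZ S ==> z : subZ S ==> \<psi> z = 1"
 by (simp add: HomHZ_def)

lemma lchar_C: "ph : Ir ==> lchar H C ph"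
 using lchar_hom[of ph C H] by (simp add: IrrZ_def)

lemma IrrZ_Z: "ph : Ir ==> z : subZ S ==> ph z = chi S z"
 by (simp add: IrrZ_def)

lemma lchar_Z: "lchar H (subZ S) (chi S)"
 using chi_hom by (simp add: lchar_hom)

lemma IrrZ_ext: "ph : Ir ==> ph : extensional C"
 by (simp add: IrrZ_def)

lemma IrrZI:
 "lchar H C ph ==> ph : extensional C ==> (!!z. z : subZ S ==> ph z = chi S z) ==> ph : Ir"
 by (simp add: IrrZ_def lchar_hom)

lemma psi_lchar: "i : LT ==> lchar H (Hc) (psi S i)"
 by (rule lchar_H[OF psi_hom])

lemma psi_mult: "i : LT ==> g : Hc ==> h : Hc ==> psi S i (g *[H] h) = psi S i g * psi S i h"
 by (rule lchar_mult[OF psi_lchar])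

lemma psi_nz: "i : LT ==> g : Hc ==> psi S i g ~= 0"
 by (rule lchar_nz[OF psi_lchar])

lemma psi_inv: "i : LT ==> g : Hc ==> psi S i (inv[H] g) = inverse (psi S i g)"
 by (rule H.lchar_inv[OF psi_lchar H.subgroup_self])

lemma psi_one: "i : LT ==> psi S i #1[H] = 1"
 by (rule H.lchar_one[OF psi_lchar]) auto

text \<open>The values are roots of unity of order dividing |C|, and these are the roots of one
  nonzero polynomial.\<close>

lemma finite_IrrZ: "finite (Ir)"
proof -
 have C0: "card C > 0" using C_fin subgroup.one_closed[OF sub_C] by (auto simp: card_gt_0_iff)
 interpret CG: group "H\<lparr>carrier := C\<rparr>" by (rule subgroup.subgroup_is_group[OF sub_C H_group])
 let ?R = "{x :: 'k. x ^ card C = 1}"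
 have "finite ?R"
 proof -
  have "coeff (monom 1 (card C) :: 'k poly) (card C) ~= coeff 1 (card C)" using C0 by simp
  hence "monom 1 (card C) - 1 ~= (0 :: 'k poly)" by (metis eq_iff_diff_eq_0)
  thus ?thesis using poly_roots_finite[of "monom 1 (card C) - 1 :: 'k poly"] by (simp add: poly_monom)
 qed
 hence "finite (C \<rightarrow>\<^sub>E ?R)" using C_fin by (intro finite_PiE) auto
 moreover have "Ir <= C \<rightarrow>\<^sub>E ?R"
 proof
  fix ph assume ph: "ph : Ir"
  have "ph x ^ card C = 1" if x: "x : C" for x
  proof -
   have "x [^]\<^bsub>H\<lparr>carrier := C\<rparr>\<^esub> Coset.order (H\<lparr>carrier := C\<rparr>) = #1[H]" using CG.pow_order_eq_1[of x] x by simp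
   hence "x [^]\<^bsub>H\<^esub> card C = #1[H]" using H.nat_pow_consistent[of x "card C" C] by (simp add: Coset.order_def)
   thus ?thesis
    using H.lchar_pow(2)[OF lchar_C[OF ph] sub_C x, of "card C"] H.lchar_one[OF lchar_C[OF ph] subgroup.one_closed[OF sub_C]]
    by simp
  qed
  thus "ph : C \<rightarrow>\<^sub>E ?R" using IrrZ_ext[OF ph] by (auto simp: PiE_def)
 qed
 ultimately show ?thesis by (rule finite_subset[rotated])
qed

lemma tw_IrrZ: "ph : Ir ==> \<psi> : HomHZ S ==> tw S ph \<psi> : Ir"
proof (rule IrrZI)
 assume ph: "ph : Ir" and \<psi>: "\<psi> : HomHZ S"
 show "lchar H C (tw S ph \<psi>)"
  using lchar_C[OF ph] lchar_subset[OF lchar_H[OF \<psi>], of C] subgroup.subset[OF sub_C] subgroup.m_closed[OF sub_C]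
  by (simp add: lchar_def tw_def)
 show "tw S ph \<psi> : extensional C" by (simp add: tw_def)
 show "tw S ph \<psi> z = chi S z" if "z : subZ S" for z
  using that Z_C ph \<psi> by (simp add: tw_def IrrZ_Z HomHZ_Z)
qed

lemma tw_psi: "ph : Ir ==> i : LT ==> tw S ph (psi S i) : Ir"
 by (rule tw_IrrZ[OF _ psi_hom])

text \<open>Conjugation by \<open>h\<close> multiplies the monomial \<open>xs\<close> by this
  scalar; restricted to the centre it is the shift of the vertex that \<open>tws\<close> performs
  along the word.\<close>

definition Psi :: "nat list => 'h => 'k" where
 "Psi xs h = (\<Prod>i\<leftarrow>xs. psi S i h)"

lemma Psi_simps [simp]: "Psi [] h = 1" "Psi (i # xs) h = psi S i h * Psi xs h" "Psi (xs @ ys) h = Psi xs h * Psi ys h"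
 by (simp_all add: Psi_def)

lemma Psi_lchar: "set xs <= LT ==> lchar H (Hc) (Psi xs)"
proof (induction xs)
 case (Cons i xs)
 thus ?case using psi_lchar[of i] by (simp add: lchar_def)
qed (simp add: lchar_def)

lemma tws_simps [simp]: "tws S ph [] = ph" "tws S ph (i # xs) = tw S (tws S ph xs) (psi S i)"
 "tws S ph (xs @ ys) = tws S (tws S ph ys) xs"
 by (simp_all add: tws_def)

lemma tws_IrrZ: "ph : Ir ==> set xs <= LT ==> tws S ph xs : Ir"
 by (induction xs) (auto simp: tw_psi)

lemma tws_apply: "ph : Ir ==> h : C ==> tws S ph xs h = ph h * Psi xs h"
 by (induction xs) (auto simp: tw_def)

lemma tws_eqI:
 assumes "ph : Ir" "set xs <= LT" "set ys <= LT" "!!h. h : C ==> Psi xs h = Psi ys h"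
 shows "tws S ph xs = tws S ph ys"
 using tws_IrrZ[OF assms(1,2), THEN IrrZ_ext] tws_IrrZ[OF assms(1,3), THEN IrrZ_ext]
 by (rule extensionalityI) (simp add: tws_apply[OF assms(1)] assms(4))

lemma tw_swap: "tw S (tw S ph \<psi>) \<psi>' = tw S (tw S ph \<psi>') \<psi>"
 by (auto simp: tw_def)

end

section \<open>Path algebras\<close>

text \<open>A closed form of \<open>awlast\<close>, in which the end of a concatenation is
  immediate.\<close>

definition end_of :: "('v, 'e) pre_digraph => 'v => 'e list => 'v" where
 "end_of Q u es = (if es = [] then u else head Q (last es))"

lemma awlast_end: "pre_digraph.awlast Q u es = end_of Q u es"
proof -
 have "pre_digraph.awalk_verts Q u es ~= []" for u es
  by (induction es arbitrary: u) (auto simp: pre_digraph.awalk_verts.simps)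
 thus ?thesis by (induction es arbitrary: u) (auto simp: pre_digraph.awalk_verts.simps end_of_def)
qed

lemma end_of_append: "end_of Q u (xs @ ys) = end_of Q (end_of Q u xs) ys"
 by (auto simp: end_of_def)

lemma supp_sum: "finite {x. f x ~= 0} ==> f = (SUM x:{x. f x ~= 0}. scl (f x) (delta x))" for f :: "'x => 'k::field"
 by (rule supp_expand) auto

lemma span_image_finite:
 fixes f :: "'i => 'x => 'k::field"
 assumes "finite I" "x : fv.span (f ` I)"
 shows "\<exists>c. x = (SUM i:I. scl (c i) (f i))"
 using assms(2)
proof (induction rule: fv.span_induct_alt)
 case base
 show ?case by (intro exI[of _ "%_. 0"]) simp
next
 case (step a b y)
 then obtain i c where i: "i : I" "b = f i" "y = (SUM i:I. scl (c i) (f i))" by blast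
 have "scl a b = (SUM j:I. if j = i then scl a (f i) else 0)" using i assms(1) by simp
 hence "scl a b + y = (SUM j:I. scl (c j + (if j = i then a else 0)) (f j))"
  unfolding i(3) by (simp add: sum.distrib[symmetric] fv.scale_left_distrib add.commute if_distrib cong: if_cong)
   (intro sum.cong refl, auto simp: fv.scale_left_distrib)
 thus ?case by (rule exI[of _ "%j. c j + (if j = i then a else 0)"])
qed

context
 fixes Q :: "('v, 'e) pre_digraph" and A :: "('k::field, 'v \<times> 'e list => 'k) module"
 assumes A: "A = path_algebra Q" and fin: "finite (verts Q)"
begin

lemma path_mult: "(f *[A] g) (u, es) = (\<Sum>m\<le>length es. f (end_of Q u (take m es), drop m es) * g (u, take m es))"
 by (simp add: A path_algebra_def awlast_end)

lemma path_ops: "ring.add A = (+)" "ring.zero A = 0" "module.smult A = scl" "carrier A = carrier (free_mod (paths Q))"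
 by (simp_all add: A path_algebra_def)

lemma path_one: "#1[A] = (SUM v:verts Q. delta (v, []))"
proof
 fix x :: "'v \<times> 'e list"
 obtain u es where x: "x = (u, es)" by (cases x)
 have "(SUM v:verts Q. delta (v, [])) x = (SUM v:verts Q. if v = u then (if es = [] then 1 else 0) else (0::'k))"
  unfolding sum_apply x by (intro sum.cong) (auto simp: delta_apply)
 also have "... = #1[A] x" using fin by (simp add: A path_algebra_def x)
 finally show "#1[A] x = (SUM v:verts Q. delta (v, [])) x" by simp
qed

lemma path_mul_delta:
 "delta (v, bs) *[A] delta (u, as) = (if v = end_of Q u as then delta (u, as @ bs) else 0)"
proof
 fix x :: "'v \<times> 'e list"
 obtain w es where x: "x = (w, es)" by (cases x)
 have "(delta (v, bs) *[A] delta (u, as)) (w, es) =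
  (\<Sum>m\<le>length es. if m = length as then (if w = u & es = as @ bs & v = end_of Q u as then 1 else 0) else (0::'k))"
  unfolding path_mult
 proof (intro sum.cong refl)
  fix m assume "m : {..length es}"
  hence "length (take m es) = m" by simp
  hence e: "take m es = as & drop m es = bs \<longleftrightarrow> m = length as & es = as @ bs"
   by (metis append_eq_conv_conj append_take_drop_id)
  show "delta (v, bs) (end_of Q w (take m es), drop m es) * delta (u, as) (w, take m es) =
   (if m = length as then (if w = u & es = as @ bs & v = end_of Q u as then 1 else 0) else (0::'k))"
   using e by (cases "take m es = as"; cases "drop m es = bs"; cases "w = u") (auto simp: delta_apply)
 qed
 also have "... = (if v = end_of Q u as then delta (u, as @ bs) else 0) x"
  by (auto simp: x delta_apply pointwise)
 finally show "(delta (v, bs) *[A] delta (u, as)) x = (if v = end_of Q u as then delta (u, as @ bs) else 0) x"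
  by (simp add: x)
qed

text \<open>Both sides sum over the two places a <= b at which a path is cut into three
  pieces.\<close>

lemma path_assoc: "(f *[A] g) *[A] h = f *[A] (g *[A] h)"
proof
 fix x :: "'v \<times> 'e list"
 obtain u es where x: "x = (u, es)" by (cases x)
 let ?t = "%a b. f (end_of Q u (take b es), drop b es) * g (end_of Q u (take a es), drop a (take b es)) * h (u, take a es)"
 have "((f *[A] g) *[A] h) (u, es) = (\<Sum>a\<le>length es. \<Sum>b\<le>length es - a. ?t a (a + b))"
  unfolding path_mult
 proof (rule sum.cong[OF refl])
  fix a assume a: "a : {..length es}"
  have "end_of Q (end_of Q u (take a es)) (take b (drop a es)) = end_of Q u (take (a + b) es)" for b
   by (simp add: end_of_append[symmetric] take_add)
  moreover have "take b (drop a es) = drop a (take (a + b) es)" "drop b (drop a es) = drop (a + b) es" for b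
   by (simp_all add: take_drop add.commute)
  ultimately show "(\<Sum>m\<le>length (drop a es). f (end_of Q (end_of Q u (take a es)) (take m (drop a es)), drop m (drop a es)) *
    g (end_of Q u (take a es), take m (drop a es))) * h (u, take a es) = (\<Sum>b\<le>length es - a. ?t a (a + b))"
   by (simp add: sum_distrib_right)
 qed
 also have "... = (\<Sum>a\<le>length es. SUM b:{a..length es}. ?t a b)"
 proof (rule sum.cong[OF refl])
  fix a assume a: "a : {..length es}"
  show "(\<Sum>b\<le>length es - a. ?t a (a + b)) = (SUM b:{a..length es}. ?t a b)"
   by (rule sum.reindex_bij_witness[of _ "%b. b - a" "%b. a + b"]) (use a in auto)
 qed
 also have "... = (\<Sum>(a, b)\<in>{(a, b). a <= b & b <= length es}. ?t a b)"
  by (subst sum.Sigma) (auto intro!: sum.cong)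
 also have "... = (\<Sum>(b, a)\<in>{(b, a). a <= b & b <= length es}. ?t a b)"
  by (rule sum.reindex_bij_witness[of _ "%(b, a). (a, b)" "%(a, b). (b, a)"]) auto
 also have "... = (\<Sum>b\<le>length es. \<Sum>a\<le>b. ?t a b)"
  by (subst sum.Sigma) (auto intro!: sum.cong)
 also have "... = (f *[A] (g *[A] h)) (u, es)"
  unfolding path_mult
  by (rule sum.cong[OF refl]) (auto simp: sum_distrib_left min_def mult.assoc intro!: sum.cong)
 finally show "((f *[A] g) *[A] h) x = (f *[A] (g *[A] h)) x" by (simp add: x)
qed

lemma path_pmul: "pmul (monoid.mult A)"
proof
 fix f g h :: "'v \<times> 'e list => 'k" and c
 show "(f + g) *[A] h = f *[A] h + g *[A] h" "h *[A] (f + g) = h *[A] f + h *[A] g"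
  "scl c f *[A] g = scl c (f *[A] g)" "f *[A] scl c g = scl c (f *[A] g)"
  by (auto simp: fun_eq_iff path_mult pointwise algebra_simps sum.distrib sum_distrib_left)
 show "f *[A] g *[A] h = f *[A] (g *[A] h)" by (rule path_assoc)
qed

lemma carrier_span_paths: "carrier A = fv.span (delta ` paths Q)"
proof
 show "carrier A <= fv.span (delta ` paths Q)"
 proof
  fix f assume "f : carrier A"
  hence "finite {x. f x ~= 0}" "{x. f x ~= 0} <= paths Q" by (simp_all add: path_ops free_mod_def)
  thus "f : fv.span (delta ` paths Q)"
   by (subst supp_sum) (auto intro!: span_sumI intro: fv.span_base)
 qed
 show "fv.span (delta ` paths Q) <= carrier A"
  unfolding path_ops by (rule fv.span_minimal[OF _ free_mod_sub]) (auto intro: delta_free_mod)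
qed

lemma path_closed_delta:
 assumes "(v, bs) : paths Q" "(u, as) : paths Q" "v = end_of Q u as"
 shows "(u, as @ bs) : paths Q"
proof -
 have cas: "pre_digraph.cas Q u (as @ bs) w" if "pre_digraph.cas Q u as v'" "pre_digraph.cas Q v' bs w" for u v' w
  using that by (induction as arbitrary: u) (auto simp: pre_digraph.cas.simps)
 have e: "pre_digraph.cas Q u as v' ==> v' = end_of Q u as" for u v'
  by (induction as arbitrary: u) (auto simp: pre_digraph.cas.simps end_of_def split: if_splits)
 show ?thesis using assms cas e unfolding paths_def pre_digraph.awalk_def by fastforce
qed

lemma path_fun_alg:
 assumes "!!a. a : arcs Q ==> head Q a : verts Q"
 shows "fun_alg A"
proof -
 interpret pmul "monoid.mult A" by (rule path_pmul)
 have start: "(u, es) : paths Q ==> u : verts Q & end_of Q u es : verts Q" for u es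
  using assms by (auto simp: paths_def pre_digraph.awalk_def end_of_def dest: last_in_set)
 show ?thesis
 proof
  show "ring.add A = (+)" "ring.zero A = 0" "module.smult A = scl" by (rule path_ops)+
  show sub: "fv.subspace (carrier A)" unfolding path_ops by (rule free_mod_sub)
  show "x *[A] y : carrier A" if "x : carrier A" "y : carrier A" for x y
  proof (rule span_mul[OF that[unfolded carrier_span_paths] sub])
   fix b c :: "'v \<times> 'e list => 'k" assume "b : delta ` paths Q" "c : delta ` paths Q"
   then obtain v bs u as where "b = delta (v, bs)" "c = delta (u, as)" "(v, bs) : paths Q" "(u, as) : paths Q" by auto
   thus "b *[A] c : carrier A"
    using path_closed_delta[of v bs u as] sub
    by (auto simp: path_mul_delta carrier_span_paths fv.span_zero intro: fv.span_base)
  qed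
  show "#1[A] : carrier A"
   unfolding path_one path_ops
   by (intro fv.subspace_sum free_mod_sub delta_free_mod) (auto simp: paths_def pre_digraph.awalk_def pre_digraph.cas.simps)
  have 1: "#1[A] *[A] delta x = delta x" "delta x *[A] #1[A] = delta x" if "x : paths Q" for x :: "'v \<times> 'e list"
  proof -
   obtain u es where x: "x = (u, es)" by (cases x)
   have "(SUM v:verts Q. delta (v, []) *[A] delta x) = (SUM v:verts Q. if v = end_of Q u es then delta x else (0 :: 'v \<times> 'e list => 'k))"
    by (intro sum.cong) (auto simp: x path_mul_delta)
   also have "... = delta x" using start[of u es] fin that x by simp
   finally show "#1[A] *[A] delta x = delta x" by (simp add: path_one sum_l)
   have "(SUM v:verts Q. delta x *[A] delta (v, [])) = (SUM v:verts Q. if v = u then delta x else (0 :: 'v \<times> 'e list => 'k))"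
    by (intro sum.cong) (auto simp: x path_mul_delta end_of_def)
   also have "... = delta x" using start[of u es] fin that x by simp
   finally show "delta x *[A] #1[A] = delta x" by (simp add: path_one sum_r)
  qed
  fix x assume x: "x : carrier A"
  show "#1[A] *[A] x = x" using x unfolding carrier_span_paths
  proof (induction rule: fv.span_induct_alt)
   case (step c x y)
   thus ?case using 1 by (auto simp: distribs)
  qed simp
  show "x *[A] #1[A] = x" using x unfolding carrier_span_paths
  proof (induction rule: fv.span_induct_alt)
   case (step c x y)
   thus ?case using 1 by (auto simp: distribs)
  qed simp
 qed
qed

end

section \<open>Presentations by quivers\<close>

context block_setting
begin

abbreviation Q where "Q \<equiv> quiv S"

lemma quiv_simps [simp]: "verts Q = Ir" "arcs Q = Ir \<times> D1" "tail Q = fst"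
 "head Q a = tw S (fst a) (psi S (snd a))"
 by (simp_all add: quiv_def D1_def)

lemma D1_letters: "i : D1 ==> i : LT"
 by (simp add: D1_def)

lemma kQ_alg: "fun_alg (kQ S)"
 by (rule path_fun_alg[OF kQ_def]) (auto simp: finite_IrrZ intro!: tw_psi D1_letters)

sublocale kQ: fun_alg "kQ S"
 by (rule kQ_alg)

text \<open>Words are read right to left like products of arrows, while a path lists its arrows in
  order of travel; so the first letter of the word gives the last arrow.\<close>

primrec pth :: "('h => 'k) => nat list => (('h => 'k) \<times> nat) list" where
 "pth ph [] = []"
| "pth ph (i # is) = pth ph is @ [(tws S ph is, i)]"

lemma pth_append: "pth ph (xs @ ys) = pth ph ys @ pth (tws S ph ys) xs"
 by (induction xs) auto

lemma length_pth [simp]: "length (pth ph is) = length is"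
 by (induction "is") auto

lemma cas_append:
 "pre_digraph.cas Q u (as @ bs) w \<longleftrightarrow> (\<exists>v. pre_digraph.cas Q u as v & pre_digraph.cas Q v bs w)"
 by (induction as arbitrary: u) (auto simp: pre_digraph.cas.simps)

lemma cas_pth: "pre_digraph.cas Q ph (pth ph is) (tws S ph is)"
 by (induction "is") (auto simp: cas_append pre_digraph.cas.simps)

lemma pth_arcs: "ph : Ir ==> set is <= D1 ==> set (pth ph is) <= Ir \<times> D1"
 by (induction "is") (auto intro!: tws_IrrZ dest: D1_letters)

lemma awalk_pth: "ph : Ir ==> set is <= D1 ==> pre_digraph.awalk Q ph (pth ph is) (tws S ph is)"
 using pth_arcs cas_pth by (simp add: pre_digraph.awalk_def)

text \<open>Each arrow is determined by its tail and its label, so a path amounts to a start vertex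
  and a word in the letters of degree one.\<close>

lemma awalk_is_pth:
 "pre_digraph.awalk Q ph es v ==> \<exists>is. es = pth ph is & set is <= D1 & v = tws S ph is"
proof (induction es arbitrary: v rule: rev_induct)
 case Nil
 thus ?case by (intro exI[of _ "[]"]) (auto simp: pre_digraph.awalk_def pre_digraph.cas.simps)
next
 case (snoc e es)
 then obtain w where w: "pre_digraph.awalk Q ph es w" "e : Ir \<times> D1" "w = fst e" "v = tw S (fst e) (psi S (snd e))"
  by (auto simp: pre_digraph.awalk_def cas_append pre_digraph.cas.simps)
 then obtain "is" where "es = pth ph is" "set is <= D1" "w = tws S ph is" using snoc.IH by blast
 thus ?case using w by (intro exI[of _ "snd e # is"]) auto
qed

lemma paths_eq: "paths Q = {(ph, pth ph is) | ph is. ph : Ir & set is <= D1}"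
proof -
 have "x : paths Q \<longleftrightarrow> (\<exists>ph is. x = (ph, pth ph is) & ph : Ir & set is <= D1)" for x
 proof
  assume "x : paths Q"
  then obtain ph es v where x: "x = (ph, es)" "pre_digraph.awalk Q ph es v" by (auto simp: paths_def)
  moreover have "ph : Ir" using x(2) by (simp add: pre_digraph.awalk_def)
  ultimately show "\<exists>ph is. x = (ph, pth ph is) & ph : Ir & set is <= D1" using awalk_is_pth by blast
 next
  assume "\<exists>ph is. x = (ph, pth ph is) & ph : Ir & set is <= D1"
  thus "x : paths Q" using awalk_pth unfolding paths_def by blast
 qed
 thus ?thesis by blast
qed

lemma end_pth: "ph : Ir ==> end_of Q ph (pth ph is) = tws S ph is"
 by (cases "is") (simp_all add: end_of_def)

lemma kQ_mul_pth:
 "ph : Ir ==> delta (ze, pth ze js) *[kQ S] delta (ph, pth ph is) =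
  (if ze = tws S ph is then delta (ph, pth ph (js @ is)) else 0)"
 by (auto simp: path_mul_delta[OF kQ_def finite_IrrZ[folded quiv_simps(1)]] end_pth pth_append)

lemma kQ_one: "#1[kQ S] = (SUM ph:Ir. vertex ph)"
 using path_one[OF kQ_def finite_IrrZ[folded quiv_simps(1)]] by (simp add: vertex_def)

lemma kQ_span: "Qc = fv.span (delta ` paths Q)"
 by (rule carrier_span_paths[OF kQ_def finite_IrrZ[folded quiv_simps(1)]])

lemma kQ_carrier: "f : Qc \<longleftrightarrow> finite {x. f x ~= 0} & {x. f x ~= 0} <= paths Q"
 by (simp add: path_ops(4)[OF kQ_def finite_IrrZ[folded quiv_simps(1)]] free_mod_def)

lemma delta_in_kQ: "ph : Ir ==> set is <= D1 ==> delta (ph, pth ph is) : Qc"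
 unfolding kQ_span by (rule fv.span_base) (auto simp: paths_eq)

end

text \<open>The setting shared by \<open>kG S\<close>, \<open>frakA S\<close>, \<open>kPM S\<close>
  and the path algebra itself: orthogonal vertex idempotents and elements leading from [ph] to
  [ph psi_i]. The sum of the idempotents is left open, since in \<open>kG S\<close> it is
  \<open>eZ\<close>.\<close>

locale word_system = block_setting S + A: fun_alg A
 for S :: "('p, 'h, 'k::alg_closed_field) block_data" and A :: "('k, 'a => 'k) module" +
 fixes E :: "('h => 'k) => 'a => 'k" and U :: "nat => ('h => 'k) => 'a => 'k"
 assumes E_in: "ph : Ir ==> E ph : carrier A"
  and E_orth: "ph : Ir ==> ze : Ir ==> E ph *[A] E ze = (if ph = ze then E ph else 0)"
  and U_in: "i : LT ==> ph : Ir ==> U i ph : carrier A"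
  and E_U: "i : LT ==> ph : Ir ==> E (tw S ph (psi S i)) *[A] U i ph = U i ph"
  and U_E: "i : LT ==> ph : Ir ==> U i ph *[A] E ph = U i ph"
begin

abbreviation uA where "uA \<equiv> uword S A E U"

lemma uA_in: "ph : Ir ==> set is <= LT ==> uA ph is : carrier A"
 by (induction "is") (auto intro!: E_in A.mul_closed U_in tws_IrrZ)

lemma E_uA: "ph : Ir ==> set is <= LT ==> E (tws S ph is) *[A] uA ph is = uA ph is"
 by (cases "is") (auto simp: E_orth E_U tws_IrrZ simp flip: A.assoc)

lemma uA_E: "ph : Ir ==> set is <= LT ==> uA ph is *[A] E ph = uA ph is"
 by (induction "is") (auto simp: E_orth A.assoc)

lemma uA_mult:
 assumes "ze : Ir" "ph : Ir" "set js <= LT" "set is <= LT"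
 shows "uA ze js *[A] uA ph is = (if ze = tws S ph is then uA ph (js @ is) else 0)"
proof (cases "ze = tws S ph is")
 case True
 have "uA (tws S ph is) js *[A] uA ph is = uA ph (js @ is)" using assms(3)
  by (induction js) (auto simp: E_uA[OF assms(2,4)] A.assoc)
 thus ?thesis using True by simp
next
 case False
 have "uA ze js *[A] uA ph is = (uA ze js *[A] E ze) *[A] (E (tws S ph is) *[A] uA ph is)" using assms by (simp add: uA_E E_uA)
 also have "... = uA ze js *[A] (E ze *[A] E (tws S ph is)) *[A] uA ph is" by (simp only: A.assoc)
 finally show ?thesis using False assms by (simp add: E_orth tws_IrrZ)
qed

end

text \<open>The subspace \<open>N\<close> only serves to separate the vertices from the words of positive length;
  it keeps constant terms out of the expressions of the \<open>U\<^bsub>i,\<phi>\<^esub>\<close> in terms of the arrows.\<close>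

locale quiver_presentation = word_system S A E U
 for S :: "('p, 'h, 'k::alg_closed_field) block_data" and A :: "('k, 'a => 'k) module"
  and E :: "('h => 'k) => 'a => 'k" and U :: "nat => ('h => 'k) => 'a => 'k" +
 fixes q :: "('h, 'k) rel_scalars" and N :: "('a => 'k) set"
 assumes E_one: "(SUM ph:Ir. E ph) = #1[A]"
  and rel_comm: "i : LT ==> j : LT ==> ph : Ir ==>
   U j (tw S ph (psi S i)) *[A] U i ph - scl (sSwap q i j ph) (U i (tw S ph (psi S j)) *[A] U j ph)
   + ((SUM k:LT. scl (cLie S i j k * sLie q i j k ph) (U k ph))
    + (SUM xs:PBW S. scl (sErr q i j xs ph * cErr S i j xs) (uword S A E U ph xs))) = 0"
  and rel_pow: "i : LT ==> ph : Ir ==>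
   uword S A E U ph (replicate CHAR('k) i) =
    (SUM k:LT. scl (dLie S i k * sPow q i k ph) (U k ph))
    + (SUM xs:PBW S. scl (sPowErr q i xs ph * dErr S i xs) (uword S A E U ph xs))"
  and basis_span: "x : carrier A ==> x : fv.span {uword S A E U ph xs | ph xs. ph : Ir & xs : PBW S}"
  and basis_indep: "(SUM ph:Ir. SUM xs:PBW S. scl (c ph xs) (uword S A E U ph xs)) = 0 ==>
   ph : Ir ==> xs : PBW S ==> c ph xs = 0"
  and long_words: "ph : Ir ==> set xs <= D1 ==> rad_length (kP S) <= length xs ==> uword S A E U ph xs = 0"
  and N_sub: "fv.subspace N"
  and N_words: "ph : Ir ==> set xs <= LT ==> xs ~= [] ==> uword S A E U ph xs : N"
  and N_E: "ph : Ir ==> E ph \<notin> N"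
  and generated: "k : LT ==> ph : Ir ==>
   U k ph : fv.span (uword S A E U ph ` {is. set is <= D1 & is ~= [] & tws S ph is = tw S ph (psi S k)})"
begin

abbreviation arr where "arr a \<equiv> U (snd a) (fst a)"

definition val where
 "val x = foldl (%a e. arr e *[A] a) (E (fst x)) (snd x)"

lemma val_pth: "val (ph, pth ph is) = uA ph is"
 by (induction "is") (auto simp: val_def)

definition ev where "ev f = path_eval A E arr f"

lemma path_val: "x : paths Q ==> val x : carrier A"
 unfolding paths_eq using val_pth uA_in D1_letters by fastforce

lemma ev_sum:
 assumes "finite Y" "{x. f x ~= 0} <= Y" "Y <= paths Q"
 shows "ev f = (SUM x:Y. scl (f x) (val x))"
proof -
 have "ev f = (SUM x:{x. f x ~= 0}. scl (f x) (val x))"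
  unfolding ev_def path_eval_def val_def[symmetric] A.smult_A
  by (rule A.finsum_A) (use assms path_val A.closed in blast)
 also have "... = (SUM x:Y. scl (f x) (val x))" using assms by (intro sum.mono_neutral_left) auto
 finally show ?thesis .
qed

lemma ev_add:
 assumes "f : Qc" "g : Qc" shows "ev (f + g) = ev f + ev g"
proof -
 let ?Y = "{x. f x ~= 0} \<union> {x. g x ~= 0}"
 have Y: "finite ?Y" "?Y <= paths Q" using assms unfolding kQ_carrier by auto
 have "{x. (f + g) x ~= 0} <= ?Y" by (auto simp: pointwise)
 thus ?thesis
  using ev_sum[OF Y(1) _ Y(2), of f] ev_sum[OF Y(1) _ Y(2), of g] ev_sum[OF Y(1) _ Y(2), of "f + g"]
  by (simp add: pointwise fv.scale_left_distrib sum.distrib)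
qed

lemma ev_scl:
 assumes "f : Qc" shows "ev (scl c f) = scl c (ev f)"
proof -
 let ?Y = "{x. f x ~= 0}"
 have Y: "finite ?Y" "?Y <= paths Q" using assms unfolding kQ_carrier by auto
 have "{x. scl c f x ~= 0} <= ?Y" by (auto simp: pointwise)
 thus ?thesis
  using ev_sum[OF Y(1) _ Y(2), of f] ev_sum[OF Y(1) _ Y(2), of "scl c f"]
  by (simp add: pointwise fv.scale_sum_right)
qed

lemma ev_zero [simp]: "ev 0 = 0"
 using ev_sum[of "{}" 0] by (simp add: zero_fun_apply)

lemma ev_delta: "ph : Ir ==> set is <= D1 ==> ev (delta (ph, pth ph is)) = uA ph is"
proof -
 assume a: "ph : Ir" "set is <= D1"
 hence "(ph, pth ph is) : paths Q" unfolding paths_eq by blast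
 thus ?thesis
  using ev_sum[of "{(ph, pth ph is)}" "delta (ph, pth ph is)"] by (auto simp: delta_apply val_pth split: if_splits)
qed

lemma ev_sums: "finite I ==> (!!i. i : I ==> f i : Qc) ==> ev (SUM i:I. f i) = (SUM i:I. ev (f i))"
 by (induction rule: finite_induct) (auto simp: ev_add kQ.closed)

lemma ev_mult:
 assumes "f : Qc" "g : Qc" shows "ev (f *[kQ S] g) = ev f *[A] ev g"
proof -
 have D: "D1 <= LT" by (auto simp: D1_def)
 have 1: "ev (delta x *[kQ S] delta y) = ev (delta x) *[A] ev (delta y)" if xyp: "x : paths Q" "y : paths Q" for x y
 proof -
  obtain ze js ph "is" where xy: "x = (ze, pth ze js)" "y = (ph, pth ph is)" "ze : Ir" "ph : Ir" "set js <= D1" "set is <= D1"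
   using xyp unfolding paths_eq by blast
  have l: "set js <= LT" "set is <= LT" using xy D by auto
  have u: "uA ze js *[A] uA ph is = (if ze = tws S ph is then uA ph (js @ is) else 0)" by (rule uA_mult[OF xy(3,4) l])
  show ?thesis unfolding xy(1,2) kQ_mul_pth[OF xy(4)]
   using xy(3-6) u by (auto simp: ev_delta)
 qed
 have dk: "delta x : Qc" if "x : paths Q" for x unfolding kQ_span using that by (intro fv.span_base) simp
 have 2: "ev (delta x *[kQ S] g) = ev (delta x) *[A] ev g" if x: "x : paths Q" for x
 proof -
  have "g : fv.span (delta ` paths Q)" using assms(2) by (simp add: kQ_span)
  hence "g : Qc & ev (delta x *[kQ S] g) = ev (delta x) *[A] ev g"
  proof (induction rule: fv.span_induct_alt)
   case base
   show ?case using kQ.closed(5) by simp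
  next
   case (step c b z)
   then obtain y where y: "b = delta y" "y : paths Q" by blast
   show ?case using step(2) 1[OF x y(2)] y dk[OF x] dk[OF y(2)]
    by (simp add: kQ.distribs A.distribs ev_add ev_scl kQ.closed)
  qed
  thus ?thesis by simp
 qed
 have "f : fv.span (delta ` paths Q)" using assms(1) by (simp add: kQ_span)
 hence "f : Qc & ev (f *[kQ S] g) = ev f *[A] ev g"
 proof (induction rule: fv.span_induct_alt)
  case base
  show ?case using kQ.closed(5) by simp
 next
  case (step c b z)
  then obtain y where y: "b = delta y" "y : paths Q" by blast
  show ?case using step(2) 2[OF y(2)] y dk[OF y(2)] assms(2)
   by (simp add: kQ.distribs A.distribs ev_add ev_scl kQ.closed)
 qed
 thus ?thesis by simp
qed

lemma ev_diff: "f : Qc ==> g : Qc ==> ev (f - g) = ev f - ev g"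
 using ev_add[of f "scl (- 1) g"] ev_scl[of g "- 1"] by (simp add: kQ.closed)

lemma ev_in: "f : Qc ==> ev f : carrier A"
proof -
 assume f: "f : Qc"
 have "ev f = (SUM x:{x. f x ~= 0}. scl (f x) (val x))" by (rule ev_sum) (use f in \<open>auto simp: kQ_carrier\<close>)
 thus ?thesis using f path_val by (auto simp: kQ_carrier intro!: A.closed)
qed

lemma ev_vertex: "ph : Ir ==> ev (vertex ph) = E ph"
 using ev_delta[of ph "[]"] by (simp add: vertex_def)

lemma ev_one: "ev #1[kQ S] = #1[A]"
proof -
 have "vertex ph : Qc" if "ph : Ir" for ph using delta_in_kQ[of ph "[]"] that by (simp add: vertex_def)
 thus ?thesis by (simp add: kQ_one ev_sums finite_IrrZ ev_vertex E_one)
qed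

end

section \<open>Long paths and expressions of the generators in the arrows\<close>

context block_setting
begin

lemma vertex_orth: "ph : Ir ==> ze : Ir ==> vertex ph *[kQ S] vertex ze = (if ph = ze then vertex ph else 0)"
 using kQ_mul_pth[of ze ph "[]" "[]"] by (simp add: vertex_def)

lemma vertex_in: "ph : Ir ==> vertex ph : Qc"
 using delta_in_kQ[of ph "[]"] by (simp add: vertex_def)

text \<open>The n-th power of the arrow ideal. Being a subspace it also holds products of
  expressions such as \<open>W\<close>, which are sums of paths of various lengths.\<close>

definition long_paths :: "nat => ('h, 'k) path_elt set" where
 "long_paths n = fv.span {delta (ph, pth ph is) | ph is. ph : Ir & set is <= D1 & n <= length is}"

lemma long_paths_mult: "x : long_paths m ==> y : long_paths n ==> x *[kQ S] y : long_paths (m + n)"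
 unfolding long_paths_def
proof (rule kQ.span_mul)
 let ?D = "%n. {delta (ph, pth ph is) | ph is. ph : Ir & set is <= D1 & n <= length is} :: ('h, 'k) path_elt set"
 fix b c assume "b : ?D m" "c : ?D n"
 then obtain ze js ph "is" where d: "b = delta (ze, pth ze js)" "set js <= D1" "m <= length js"
  "c = delta (ph, pth ph is)" "ph : Ir" "set is <= D1" "n <= length is" by blast
 show "b *[kQ S] c : fv.span (?D (m + n))"
 proof (cases "ze = tws S ph is")
  case True
  hence "b *[kQ S] c = delta (ph, pth ph (js @ is))" using d by (simp add: kQ_mul_pth)
  moreover have "set (js @ is) <= D1" "m + n <= length (js @ is)" using d by auto
  ultimately show ?thesis using d(5) by (intro fv.span_base) blast
 next
  case False
  thus ?thesis using d by (simp add: kQ_mul_pth fv.span_zero)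
 qed
qed auto

end

locale arrow_expression = quiver_presentation S A E U q N
 for S :: "('p, 'h, 'k::alg_closed_field) block_data" and A :: "('k, 'a => 'k) module"
  and E :: "('h => 'k) => 'a => 'k" and U :: "nat => ('h => 'k) => 'a => 'k"
  and q :: "('h, 'k) rel_scalars" and N :: "('a => 'k) set" +
 fixes W :: "nat => ('h => 'k) => ('h, 'k) path_elt"
 assumes W: "arrow_expressions S A E U W"
begin

lemma W_in: "i : LT ==> ph : Ir ==> W i ph : Qc"
 and W_supp: "i : LT ==> ph : Ir ==> W i ph x ~= 0 ==>
  \<exists>is. x = (ph, pth ph is) & set is <= D1 & tws S ph is = tw S ph (psi S i)"
 and W_ev: "i : LT ==> ph : Ir ==> ev (W i ph) = U i ph"
 and W_arrow: "i : LT ==> ph : Ir ==> wdeg S i = 1 ==> W i ph = arrow i ph"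
proof -
 assume i: "i : LT" "ph : Ir"
 have w: "W i ph : Qc &
  (\<forall>u es. W i ph (u, es) ~= 0 --> u = ph & pre_digraph.awalk (quiv S) ph es (tw S ph (psi S i))) &
  path_eval A E (%a. U (snd a) (fst a)) (W i ph) = U i ph & (wdeg S i = 1 --> W i ph = arrow i ph)"
  using W i unfolding arrow_expressions_def by blast
 show "W i ph : Qc" "ev (W i ph) = U i ph" using w by (simp_all add: ev_def)
 show "W i ph = arrow i ph" if "wdeg S i = 1" using w that by simp
 assume "W i ph x ~= 0"
 moreover obtain u es where x: "x = (u, es)" by (cases x)
 ultimately have u: "u = ph" "pre_digraph.awalk (quiv S) ph es (tw S ph (psi S i))" using w by blast+
 obtain "is" where "es = pth ph is" "set is <= D1" "tw S ph (psi S i) = tws S ph is" using awalk_is_pth[OF u(2)] by blast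
 thus "\<exists>is. x = (ph, pth ph is) & set is <= D1 & tws S ph is = tw S ph (psi S i)" using x u(1) by auto
qed

lemma D1_sub: "D1 <= LT"
 using D1_letters by blast

text \<open>When \<open>psi S i\<close> is trivial on the centre, the start and end vertex of
  \<open>W i ph\<close> coincide and a multiple of the trivial path is formally allowed. Its value
  would be a multiple of \<open>E ph\<close>, but it is also the difference of \<open>U i ph\<close>
  and the value of the nonconstant rest, both in \<open>N\<close>.\<close>

lemma W_nonconst:
 assumes i: "i : LT" "ph : Ir" shows "W i ph (ph, []) = 0"
proof (rule ccontr)
 assume c: "W i ph (ph, []) ~= 0"
 define c where "c = W i ph (ph, [])"
 define f where "f = W i ph - scl c (vertex ph)"
 have f: "f : Qc" unfolding f_def using W_in[OF i] vertex_in[OF i(2)] by (intro kQ.closed)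
 have fx: "\<exists>is. x = (ph, pth ph is) & set is <= D1 & is ~= []" if "f x ~= 0" for x
 proof (cases "x = (ph, [])")
  case True
  hence "f x = 0" by (simp add: f_def c_def vertex_def delta_apply pointwise)
  thus ?thesis using that by simp
 next
  case False
  hence "W i ph x ~= 0" using that by (simp add: f_def vertex_def delta_apply pointwise)
  then obtain "is" where "x = (ph, pth ph is)" "set is <= D1" using W_supp[OF i] by blast
  thus ?thesis using False by (intro exI[of _ "is"]) auto
 qed
 have "ev f = (SUM x:{x. f x ~= 0}. scl (f x) (val x))"
  by (rule ev_sum) (use f in \<open>auto simp: kQ_carrier\<close>)
 also have "... : N"
 proof (intro fv.subspace_sum[OF N_sub] fv.subspace_scale[OF N_sub])
  fix x assume "x : {x. f x ~= 0}"
  then obtain "is" where "x = (ph, pth ph is)" "set is <= D1" "is ~= []" using fx by blast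
  thus "val x : N" using N_words[of ph "is"] i(2) D1_sub by (auto simp: val_pth)
 qed
 finally have "ev f : N" .
 moreover have "U i ph : N" using N_words[of ph "[i]"] U_E[OF i] i by simp
 moreover have "W i ph = f + scl c (vertex ph)" by (simp add: f_def)
 hence "U i ph = ev f + scl c (E ph)"
  using W_ev[OF i] f vertex_in[OF i(2)] by (simp add: ev_add ev_scl ev_vertex i(2) kQ.closed)
 ultimately have "scl c (E ph) : N" using fv.subspace_diff[OF N_sub, of "U i ph" "ev f"] by simp
 hence "scl (inverse c) (scl c (E ph)) : N" by (rule fv.subspace_scale[OF N_sub])
 hence "E ph : N" using c by (simp add: c_def)
 thus False using N_E[OF i(2)] by simp
qed

lemma W_span:
 assumes i: "i : LT" "ph : Ir"
 shows "W i ph : fv.span {delta (ph, pth ph is) | is. set is <= D1 & is ~= [] & tws S ph is = tw S ph (psi S i)}"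
proof -
 let ?B = "{delta (ph, pth ph is) | is. set is <= D1 & is ~= [] & tws S ph is = tw S ph (psi S i)} :: ('h, 'k) path_elt set"
 have f: "finite {x. W i ph x ~= 0}" using W_in[OF i] by (simp add: kQ_carrier)
 have "W i ph = (SUM x:{x. W i ph x ~= 0}. scl (W i ph x) (delta x))" by (rule supp_sum[OF f])
 also have "... : fv.span ?B"
 proof (rule span_sumI, rule fv.span_base)
  fix x assume "x : {x. W i ph x ~= 0}"
  hence x: "W i ph x ~= 0" by simp
  then obtain "is" where "is": "x = (ph, pth ph is)" "set is <= D1" "tws S ph is = tw S ph (psi S i)" using W_supp[OF i] by blast
  moreover have "is ~= []" using x W_nonconst[OF i] "is"(1) by auto
  ultimately show "delta x : ?B" by blast
 qed
 finally show ?thesis .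
qed

lemma W_long: "i : LT ==> ph : Ir ==> W i ph : long_paths 1"
proof -
 assume i: "i : LT" "ph : Ir"
 have "{delta (ph, pth ph is) | is. set is <= D1 & is ~= [] & tws S ph is = tw S ph (psi S i)} \<subseteq>
  {delta (ph, pth ph is) | ph is. ph : Ir & set is <= D1 & 1 <= length is}"
  using i by (force simp: Suc_le_eq)
 thus ?thesis using W_span[OF i] fv.span_mono unfolding long_paths_def by blast
qed

sublocale w: word_system S "kQ S" vertex W
proof
 fix ph assume ph: "ph : Ir"
 show "vertex ph : Qc" by (rule vertex_in[OF ph])
 show "vertex ph *[kQ S] vertex ze = (if ph = ze then vertex ph else 0)" if "ze : Ir" for ze
  by (rule vertex_orth[OF ph that])
 fix i assume i: "i : LT"
 show "W i ph : Qc" by (rule W_in[OF i ph])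
 have e: "vertex (tw S ph (psi S i)) *[kQ S] delta (ph, pth ph is) = (delta (ph, pth ph is) :: ('h, 'k) path_elt)"
  "delta (ph, pth ph is) *[kQ S] vertex ph = (delta (ph, pth ph is) :: ('h, 'k) path_elt)"
  if "tws S ph is = tw S ph (psi S i)" for "is"
  using kQ_mul_pth[of ph "tw S ph (psi S i)" "[]" "is"] kQ_mul_pth[of ph ph "is" "[]"] ph that by (simp_all add: vertex_def)
 show "vertex (tw S ph (psi S i)) *[kQ S] W i ph = W i ph" using W_span[OF i ph]
 proof (induction rule: fv.span_induct_alt)
  case (step c x y)
  thus ?case using e(1) by (auto simp: kQ.distribs)
 qed simp
 show "W i ph *[kQ S] vertex ph = W i ph" using W_span[OF i ph]
 proof (induction rule: fv.span_induct_alt)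
  case (step c x y)
  thus ?case using e(2) by (auto simp: kQ.distribs)
 qed simp
qed

abbreviation uW where "uW \<equiv> uword S (kQ S) vertex W"

lemma uW_long: "ph : Ir ==> set xs <= LT ==> uW ph xs : long_paths (length xs)"
proof (induction xs)
 case Nil
 have "vertex ph = delta (ph, pth ph [])" by (simp add: vertex_def)
 moreover have "delta (ph, pth ph []) : long_paths 0"
  unfolding long_paths_def using Nil(1) by (intro fv.span_base) (auto intro!: exI[of _ "[]"])
 ultimately show ?case by simp
next
 case (Cons i xs)
 hence "W i (tws S ph xs) *[kQ S] uW ph xs : long_paths (1 + length xs)"
  by (intro long_paths_mult W_long tws_IrrZ) auto
 thus ?case by simp
qed

lemma ev_uW: "ph : Ir ==> set xs <= LT ==> ev (uW ph xs) = uA ph xs"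
proof (induction xs)
 case Nil
 thus ?case by (simp add: ev_vertex)
next
 case (Cons i xs)
 hence "W i (tws S ph xs) : Qc" "uW ph xs : Qc"
  using W_in[of i "tws S ph xs"] w.uA_in[of ph xs] tws_IrrZ[of ph xs] by simp_all
 thus ?case using Cons W_ev[of i "tws S ph xs"] tws_IrrZ[of ph xs] by (simp add: ev_mult)
qed

lemma uW_D1: "ph : Ir ==> set is <= D1 ==> uW ph is = delta (ph, pth ph is)"
proof (induction "is")
 case Nil
 thus ?case by (simp add: vertex_def)
next
 case (Cons i "is")
 hence i: "i : LT" "wdeg S i = 1" "tws S ph is : Ir"
  using tws_IrrZ[of ph "is"] D1_sub by (auto simp: D1_def)
 have "delta (tws S ph is, pth (tws S ph is) [i]) *[kQ S] delta (ph, pth ph is) = (delta (ph, pth ph ([i] @ is)) :: ('h, 'k) path_elt)"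
  using Cons.prems by (subst kQ_mul_pth) simp_all
 thus ?case using Cons W_arrow[OF i(1,3,2)] by (simp add: arrow_def)
qed

definition rI where "rI = rel_ideal S q W"

interpretation kQr: ring "kQ S"
 by (rule kQ.ring_A)

definition rgens where
 "rgens = {comm_rel S q W i j ph | i j ph. i : LT & j : LT & ph : Ir} \<union>
   {pow_rel S q W i ph | i ph. i : LT & ph : Ir} \<union>
   {delta x | x. x : paths (quiv S) & rad_length (kP S) <= length (snd x)}"

lemma rI_eq: "rI = Idl\<^bsub>kQ S\<^esub> rgens"
 by (simp only: rI_def rel_ideal_def rgens_def)

lemma kQ_finsum: "(!!i. i : I ==> f i : Qc) ==> (\<Oplus>\<^bsub>kQ S\<^esub>i\<in>I. f i) = (SUM i:I. f i)"
 by (rule kQ.finsum_A) auto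

lemma uW_PBW: "ph : Ir ==> xs : PBW S ==> uW ph xs : Qc"
 by (rule w.uA_in[OF _ PBW_letters])

lemma rel_sums:
 assumes "ph : Ir"
 shows "(\<Oplus>\<^bsub>kQ S\<^esub>k\<in>LT. c k *.[kQ S] W k ph) = (SUM k:LT. scl (c k) (W k ph))"
  "(\<Oplus>\<^bsub>kQ S\<^esub>xs\<in>PBW S. d xs *.[kQ S] uW ph xs) = (SUM xs:PBW S. scl (d xs) (uW ph xs))"
  "(SUM k:LT. scl (c k) (W k ph)) : Qc"
  "(SUM xs:PBW S. scl (d xs) (uW ph xs)) : Qc"
  "ev (SUM k:LT. scl (c k) (W k ph)) = (SUM k:LT. scl (c k) (U k ph))"
  "ev (SUM xs:PBW S. scl (d xs) (uW ph xs)) = (SUM xs:PBW S. scl (d xs) (uA ph xs))"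
proof -
 show "(\<Oplus>\<^bsub>kQ S\<^esub>k\<in>LT. c k *.[kQ S] W k ph) = (SUM k:LT. scl (c k) (W k ph))"
  unfolding kQ.smult_A using W_in assms by (intro kQ_finsum kQ.closed)
 show "(\<Oplus>\<^bsub>kQ S\<^esub>xs\<in>PBW S. d xs *.[kQ S] uW ph xs) = (SUM xs:PBW S. scl (d xs) (uW ph xs))"
  unfolding kQ.smult_A using uW_PBW assms by (intro kQ_finsum kQ.closed)
 show "(SUM k:LT. scl (c k) (W k ph)) : Qc" using W_in assms by (intro kQ.closed)
 show "(SUM xs:PBW S. scl (d xs) (uW ph xs)) : Qc" using uW_PBW assms by (intro kQ.closed)
 show "ev (SUM k:LT. scl (c k) (W k ph)) = (SUM k:LT. scl (c k) (U k ph))"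
 proof -
  have "ev (SUM k:LT. scl (c k) (W k ph)) = (SUM k:LT. ev (scl (c k) (W k ph)))"
   using W_in assms by (intro ev_sums kQ.closed) auto
  also have "... = (SUM k:LT. scl (c k) (U k ph))"
   by (rule sum.cong[OF refl]) (simp only: ev_scl W_in assms W_ev)
  finally show ?thesis .
 qed
 have "ev (SUM xs:PBW S. scl (d xs) (uW ph xs)) = (SUM xs:PBW S. ev (scl (d xs) (uW ph xs)))"
  using PBW_count(1) uW_PBW assms by (intro ev_sums kQ.closed)
 also have "... = (SUM xs:PBW S. scl (d xs) (uA ph xs))"
  by (intro sum.cong refl) (simp only: ev_scl uW_PBW assms ev_uW[OF assms PBW_letters])
 finally show "ev (SUM xs:PBW S. scl (d xs) (uW ph xs)) = (SUM xs:PBW S. scl (d xs) (uA ph xs))" .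
qed

lemma comm_rel_eq:
 assumes ij: "i : LT" "j : LT" "ph : Ir"
 shows "comm_rel S q W i j ph = uW ph [j, i] - scl (sSwap q i j ph) (uW ph [i, j])
  + ((SUM k:LT. scl (cLie S i j k * sLie q i j k ph) (W k ph))
   + (SUM xs:PBW S. scl (sErr q i j xs ph * cErr S i j xs) (uW ph xs)))"
  "comm_rel S q W i j ph : Qc" "ev (comm_rel S q W i j ph) = 0"
proof -
 have u: "uW ph [j, i] : Qc" "uW ph [i, j] : Qc"
  by (rule w.uA_in; use ij in simp)+
 have e: "W j (tw S ph (psi S i)) *[kQ S] W i ph = uW ph [j, i]" "W i (tw S ph (psi S j)) *[kQ S] W j ph = uW ph [i, j]"
  using ij w.U_E by simp_all
 show 1: "comm_rel S q W i j ph = uW ph [j, i] - scl (sSwap q i j ph) (uW ph [i, j])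
  + ((SUM k:LT. scl (cLie S i j k * sLie q i j k ph) (W k ph))
   + (SUM xs:PBW S. scl (sErr q i j xs ph * cErr S i j xs) (uW ph xs)))"
  unfolding comm_rel_def e rel_sums(1,2)[OF ij(3)]
  unfolding kQ.add_A kQ.smult_A kQ.minus_A[OF kQ.closed(4)[OF u(2)]] by (rule refl)
 show "comm_rel S q W i j ph : Qc"
  unfolding 1 by (intro kQ.closed u rel_sums(3,4) ij(3)) (auto intro: W_in uW_PBW ij(3))
 have "ev (uW ph [j, i]) = uA ph [j, i]" "ev (uW ph [i, j]) = uA ph [i, j]"
  by (rule ev_uW; use ij in simp)+
 hence "ev (comm_rel S q W i j ph) = uA ph [j, i] - scl (sSwap q i j ph) (uA ph [i, j])
  + ((SUM k:LT. scl (cLie S i j k * sLie q i j k ph) (U k ph))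
   + (SUM xs:PBW S. scl (sErr q i j xs ph * cErr S i j xs) (uA ph xs)))"
  unfolding 1 using u rel_sums(3-6)[OF ij(3)] by (simp only: ev_add ev_diff ev_scl kQ.closed)
 also have "... = 0" using rel_comm[OF ij] ij U_E by simp
 finally show "ev (comm_rel S q W i j ph) = 0" .
qed

lemma pow_rel_eq:
 assumes ij: "i : LT" "ph : Ir"
 shows "pow_rel S q W i ph = uW ph (replicate CHAR('k) i) -
  ((SUM k:LT. scl (dLie S i k * sPow q i k ph) (W k ph))
   + (SUM xs:PBW S. scl (sPowErr q i xs ph * dErr S i xs) (uW ph xs)))"
  "pow_rel S q W i ph : Qc" "ev (pow_rel S q W i ph) = 0"
proof -
 have l: "set (replicate CHAR('k) i) <= LT" using ij(1) by auto
 have u: "uW ph (replicate CHAR('k) i) : Qc" by (rule w.uA_in[OF ij(2) l])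
 let ?r = "(SUM k:LT. scl (dLie S i k * sPow q i k ph) (W k ph))
   + (SUM xs:PBW S. scl (sPowErr q i xs ph * dErr S i xs) (uW ph xs))"
 have r: "?r : Qc" by (intro kQ.closed(3) rel_sums(3,4) ij(2))
 show 1: "pow_rel S q W i ph = uW ph (replicate CHAR('k) i) - ?r"
  unfolding pow_rel_def rel_sums(1,2)[OF ij(2)] kQ.add_A by (rule kQ.minus_A[OF r])
 show "pow_rel S q W i ph : Qc" unfolding 1 by (intro kQ.closed u r)
 have "ev (pow_rel S q W i ph) = ev (uW ph (replicate CHAR('k) i)) - ev ?r"
  unfolding 1 by (rule ev_diff[OF u r])
 also have "ev ?r = uA ph (replicate CHAR('k) i)"
  unfolding rel_pow[OF ij] using rel_sums(3-6)[OF ij(2)] by (simp only: ev_add)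
 also have "ev (uW ph (replicate CHAR('k) i)) = uA ph (replicate CHAR('k) i)" by (rule ev_uW[OF ij(2) l])
 finally show "ev (pow_rel S q W i ph) = 0" by simp
qed

lemma rgens_carrier: "rgens <= Qc"
proof -
 have "delta x : Qc" if "x : paths Q" for x unfolding kQ_span using that by (intro fv.span_base) simp
 thus ?thesis unfolding rgens_def using comm_rel_eq(2) pow_rel_eq(2) by blast
qed

lemma rI_ideal: "ideal rI (kQ S)"
 unfolding rI_eq by (rule kQr.genideal_ideal[OF rgens_carrier])

lemma rgens_rI: "rgens <= rI"
 unfolding rI_eq by (rule kQr.genideal_self[OF rgens_carrier])

lemma ev_ring_hom: "ring_hom_ring (kQ S) A ev"
proof -
 have "ev : ring_hom (kQ S) A"
  by (rule ring_hom_memI) (simp_all add: ev_in ev_mult ev_add ev_one kQ.add_A A.add_A)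
 thus ?thesis using kQ.ring_A A.ring_A by (simp add: ring_hom_ring_def ring_hom_ring_axioms_def)
qed

lemma ker_ev: "a_kernel (kQ S) A ev = {f : Qc. ev f = 0}"
 by (simp add: a_kernel_def' A.zero_A)

lemma rI_ker: "rI <= a_kernel (kQ S) A ev"
 unfolding rI_eq
proof (rule kQr.genideal_minimal)
 show "ideal (a_kernel (kQ S) A ev) (kQ S)" by (rule ring_hom_ring.kernel_is_ideal[OF ev_ring_hom])
 show "rgens <= a_kernel (kQ S) A ev"
 proof
  fix x assume x: "x : rgens"
  consider i j ph where "x = comm_rel S q W i j ph" "i : LT" "j : LT" "ph : Ir"
   | i ph where "x = pow_rel S q W i ph" "i : LT" "ph : Ir"
   | ph "is" where "x = delta (ph, pth ph is)" "ph : Ir" "set is <= D1" "rad_length (kP S) <= length is"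
   using x unfolding rgens_def paths_eq by fastforce
  thus "x : a_kernel (kQ S) A ev"
  proof cases
   case 1
   thus ?thesis using comm_rel_eq(2,3) by (simp add: ker_ev)
  next
   case 2
   thus ?thesis using pow_rel_eq(2,3) by (simp add: ker_ev)
  next
   case 3
   thus ?thesis by (simp add: ker_ev delta_in_kQ ev_delta long_words)
  qed
 qed
qed

lemma rI_sub: "fv.subspace rI"
proof -
 interpret ideal rI "kQ S" by (rule rI_ideal)
 show ?thesis
  unfolding fv.subspace_def
 proof (intro conjI ballI allI)
  show "0 : rI" using zero_closed by (simp add: kQ.zero_A)
  show "x + y : rI" if "x : rI" "y : rI" for x y using a_closed[OF that] by (simp add: kQ.add_A)
  show "scl c x : rI" if "x : rI" for c x
  proof -
   have xk: "x : Qc" using that by (rule a_Hcarr)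
   have "scl c #1[kQ S] *[kQ S] x : rI" by (rule I_l_closed[OF that]) (intro kQ.closed)
   thus ?thesis using xk by (simp add: kQ.distribs kQ.one_l)
  qed
 qed
qed

lemma rI_mult: "x : rI ==> u : Qc ==> v : Qc ==> u *[kQ S] (x *[kQ S] v) : rI"
 using ideal.I_l_closed[OF rI_ideal] ideal.I_r_closed[OF rI_ideal] by blast

end

text \<open>\<open>quot_alg\<close> is the factor ring together with a scalar multiplication, so the
  homomorphism theorem for rings applies.\<close>

lemma ring_iso_quot: "ring_iso (quot_alg A I) B = ring_iso (A Quot I) B"
 by (simp add: ring_iso_def ring_hom_def quot_alg_def FactRing_def)

section \<open>Straightening modulo the relations, and the kernel of the evaluation\<close>

context arrow_expression
begin

lemma long_paths_rI: "x : long_paths (rad_length (kP S)) ==> x : rI"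
proof -
 have "{delta (ph, pth ph is) | ph is. ph : Ir & set is <= D1 & rad_length (kP S) <= length is} <= rgens"
  unfolding rgens_def paths_eq by fastforce
 hence "long_paths (rad_length (kP S)) <= rI"
  unfolding long_paths_def using rgens_rI rI_sub by (intro fv.span_minimal) auto
 thus "x : long_paths (rad_length (kP S)) ==> x : rI" by blast
qed

lemma long_paths_mono: "m <= n ==> long_paths n <= long_paths m"
 unfolding long_paths_def by (rule fv.span_mono) fastforce

text \<open>The sum of all degrees bounds the weight of one letter, so a heavier word has at least
  as many letters as the radical length and is killed by the relations on long paths.\<close>

definition maxwt where "maxwt = rad_length (kP S) * (SUM k:LT. wdeg S k)"

lemma heavy_word:
 assumes "ph : Ir" "set xs <= LT" "maxwt < wt xs" shows "uW ph xs : rI"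
proof -
 let ?D = "SUM k:LT. wdeg S k"
 have "wdeg S k <= ?D" if "k : LT" for k by (rule member_le_sum[OF that]) auto
 hence "wt xs <= length xs * ?D" using assms(2) by (induction xs) (auto intro: add_mono)
 hence "rad_length (kP S) * ?D < length xs * ?D" using assms(3) unfolding maxwt_def by linarith
 hence "rad_length (kP S) <= length xs" by (metis mult_less_cancel2 nat_less_le)
 thus ?thesis using uW_long[OF assms(1,2)] long_paths_mono long_paths_rI by blast
qed

definition PB where "PB = (%(ph, xs). uW ph xs) ` (Ir \<times> PBW S)"

text \<open>Places a relation at the vertex reached by \<open>v\<close> between the words
  \<open>u\<close> and \<open>v\<close>. Terms of the relation whose end vertex does not match the
  start of \<open>u\<close> give zero, which lies in every span.\<close>

lemma uW_sandwich:
 assumes "ph : Ir" "ze : Ir" "set u <= LT" "set ys <= LT" "set v <= LT"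
 shows "uW ze u *[kQ S] (uW (tws S ph v) ys *[kQ S] uW ph v) =
  (if ze = tws S ph (ys @ v) then uW ph (u @ ys @ v) else 0)"
proof -
 have y: "set (ys @ v) <= LT" using assms by auto
 show ?thesis
  using w.uA_mult[OF tws_IrrZ[OF assms(1,5)] assms(1,4,5)] w.uA_mult[OF assms(2,1,3) y] by simp
qed

lemma W_uW: "k : LT ==> ph : Ir ==> W k ph = uW ph [k]"
 using w.U_E by simp

text \<open>Straightening a word changes it by shorter words of the same weight and by words of larger
  weight. Words of large weight lie in the ideal, as all paths in a word are at least as long as the
  word itself.\<close>

lemma straight_word:
 assumes ph: "ph : Ir" shows "set xs <= LT ==> uW ph xs : fv.span (PB \<union> rI)"
proof (induction "Suc maxwt - wt xs" arbitrary: xs rule: less_induct)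
 case less
 let ?T = "fv.span (PB \<union> rI)"
 have rT: "x : rI ==> x : ?T" for x by (rule fv.span_base) blast
 show ?case
 proof (cases "maxwt < wt xs")
  case True
  thus ?thesis using heavy_word[OF ph less.prems] rT by blast
 next
  case False
  hence heavy: "uW ph ys : ?T" if "set ys <= LT" "wt xs < wt ys" for ys
   using less.hyps[of ys] that by simp
  define Q where "Q ys \<longleftrightarrow> set ys <= LT & wt ys = wt xs" for ys
  show ?thesis
  proof (rule straighten[where U = ?T and Q = Q and p = "CHAR('k)" and wd = "uW ph"])
   show "Q xs" using less.prems by (simp add: Q_def)
   show "Q ys ==> mset ys = mset zs ==> Q zs" for ys zs
    using wt_mset[of ys zs] by (auto simp: Q_def dest: mset_eq_setD)
  next
   fix u i j v assume q: "Q (u @ [j, i] @ v)" and ij: "i < j"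
    and short: "!!ys. Q ys ==> length ys < length (u @ [j, i] @ v) ==> uW ph ys : ?T"
   have l: "set u <= LT" "set v <= LT" "i : LT" "j : LT" using q by (auto simp: Q_def)
   have wt: "wt u + (wdeg S i + wdeg S j) + wt v = wt xs" using q by (simp add: Q_def)
   \<comment> \<open>Letters are read right to left: the factor to be rewritten starts at the vertex
     \<open>et\<close> reached by \<open>v\<close> and ends at \<open>ze\<close>, where
     \<open>u\<close> takes over.\<close>
   define et where "et = tws S ph v"
   define ze where "ze = tws S ph ([j, i] @ v)"
   have li: "set [j, i] <= LT" "set [i, j] <= LT" "set ([j, i] @ v) <= LT" using l by auto
   have etze: "et : Ir" "ze : Ir" unfolding et_def ze_def using tws_IrrZ[OF ph] l(2) li(3) by blast+
   have ze': "ze = tws S ph ([i, j] @ v)" by (simp add: ze_def tw_swap)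
   define M where "M y = uW ze u *[kQ S] (y *[kQ S] uW ph v)" for y
   have uv: "uW ze u : Qc" "uW ph v : Qc" using w.uA_in etze ph l by blast+
   have Msw: "M (uW et ys) = (if ze = tws S ph (ys @ v) then uW ph (u @ ys @ v) else 0)" if "set ys <= LT" for ys
    unfolding M_def et_def by (rule uW_sandwich[OF ph etze(2) l(1) that l(2)])
   have M: "M (uW et [j, i]) = uW ph (u @ [j, i] @ v)" "M (uW et [i, j]) = uW ph (u @ [i, j] @ v)"
    unfolding Msw[OF li(1)] Msw[OF li(2)] using ze' by (simp_all add: ze_def)
   let ?r = "comm_rel S q W i j et"
   have "?r : rI" using rgens_rI l(3,4) etze(1) unfolding rgens_def by blast
   hence Mr: "M ?r : ?T" unfolding M_def by (intro rT rI_mult uv)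
   have Mk: "scl (cLie S i j k * a) (M (W k et)) : ?T" if k: "k : LT" for k a
   proof (cases "cLie S i j k = 0")
    case False
    have kl: "set [k] <= LT" using k by simp
    have "uW ph (u @ [k] @ v) : ?T"
     using k l wt cLie_deg[OF l(3,4) k False] by (intro short) (auto simp: Q_def)
    hence "M (W k et) : ?T" unfolding W_uW[OF k etze(1)] Msw[OF kl] by (simp add: fv.span_zero)
    thus ?thesis by (rule fv.span_scale)
   qed (simp add: fv.span_zero)
   have Mx: "scl (a * cErr S i j ys) (M (uW et ys)) : ?T" if y: "ys : PBW S" for ys a
   proof (cases "cErr S i j ys = 0")
    case False
    have "uW ph (u @ ys @ v) : ?T"
     using PBW_letters[OF y] l wt cErr_wt[OF l(3,4) y False] by (intro heavy) auto
    hence "M (uW et ys) : ?T" unfolding Msw[OF PBW_letters[OF y]] by (simp add: fv.span_zero)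
    thus ?thesis by (rule fv.span_scale)
   qed (simp add: fv.span_zero)
   let ?s = "(SUM k:LT. scl (cLie S i j k * sLie q i j k et) (M (W k et)))
    + (SUM xs:PBW S. scl (sErr q i j xs et * cErr S i j xs) (M (uW et xs)))"
   have "M ?r = uW ph (u @ [j, i] @ v) - scl (sSwap q i j et) (uW ph (u @ [i, j] @ v)) + ?s"
    unfolding comm_rel_eq(1)[OF l(3,4) etze(1)] M[symmetric] unfolding M_def by (simp only: kQ.distribs)
   hence e: "uW ph (u @ [j, i] @ v) - scl (sSwap q i j et) (uW ph (u @ [i, j] @ v)) = M ?r - ?s" by simp
   have "M ?r - ?s : ?T"
   proof (rule fv.span_diff[OF Mr fv.span_add[OF fv.span_sum fv.span_sum]])
    show "scl (cLie S i j k * sLie q i j k et) (M (W k et)) : ?T" if "k : LT" for k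
     by (rule Mk[OF that])
    show "scl (sErr q i j ys et * cErr S i j ys) (M (uW et ys)) : ?T" if "ys : PBW S" for ys
     by (rule Mx[OF that])
   qed
   thus "\<exists>q. uW ph (u @ [j, i] @ v) - scl q (uW ph (u @ [i, j] @ v)) : ?T" unfolding e[symmetric] by blast
  next
   fix u i v assume q: "Q (u @ replicate CHAR('k) i @ v)"
    and short: "!!ys. Q ys ==> length ys < length (u @ replicate CHAR('k) i @ v) ==> uW ph ys : ?T"
   have l: "set u <= LT" "set v <= LT" "i : LT" using q char_ge2 by (auto simp: Q_def)
   have wt: "wt u + CHAR('k) * wdeg S i + wt v = wt xs" using q by (simp add: Q_def)
   have li: "set (replicate CHAR('k) i) <= LT" "set (replicate CHAR('k) i @ v) <= LT" using l by auto
   define et where "et = tws S ph v"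
   define ze where "ze = tws S ph (replicate CHAR('k) i @ v)"
   have etze: "et : Ir" "ze : Ir" unfolding et_def ze_def using tws_IrrZ[OF ph] l(2) li(2) by blast+
   define M where "M y = uW ze u *[kQ S] (y *[kQ S] uW ph v)" for y
   have uv: "uW ze u : Qc" "uW ph v : Qc" using w.uA_in etze ph l by blast+
   have Msw: "M (uW et ys) = (if ze = tws S ph (ys @ v) then uW ph (u @ ys @ v) else 0)" if "set ys <= LT" for ys
    unfolding M_def et_def by (rule uW_sandwich[OF ph etze(2) l(1) that l(2)])
   have M: "M (uW et (replicate CHAR('k) i)) = uW ph (u @ replicate CHAR('k) i @ v)"
    unfolding Msw[OF li(1)] by (simp add: ze_def)
   let ?r = "pow_rel S q W i et"
   have "?r : rI" using rgens_rI l(3) etze(1) unfolding rgens_def by blast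
   hence Mr: "M ?r : ?T" unfolding M_def by (intro rT rI_mult uv)
   have Mk: "scl (dLie S i k * a) (M (W k et)) : ?T" if k: "k : LT" for k a
   proof (cases "dLie S i k = 0")
    case False
    have kl: "set [k] <= LT" using k by simp
    have "uW ph (u @ [k] @ v) : ?T"
     using k l wt dLie_deg[OF l(3) k False] char_ge2 by (intro short) (auto simp: Q_def)
    hence "M (W k et) : ?T" unfolding W_uW[OF k etze(1)] Msw[OF kl] by (simp add: fv.span_zero)
    thus ?thesis by (rule fv.span_scale)
   qed (simp add: fv.span_zero)
   have Mx: "scl (a * dErr S i ys) (M (uW et ys)) : ?T" if y: "ys : PBW S" for ys a
   proof (cases "dErr S i ys = 0")
    case False
    have "uW ph (u @ ys @ v) : ?T"
     using PBW_letters[OF y] l wt dErr_wt[OF l(3) y False] by (intro heavy) auto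
    hence "M (uW et ys) : ?T" unfolding Msw[OF PBW_letters[OF y]] by (simp add: fv.span_zero)
    thus ?thesis by (rule fv.span_scale)
   qed (simp add: fv.span_zero)
   let ?s = "(SUM k:LT. scl (dLie S i k * sPow q i k et) (M (W k et)))
    + (SUM xs:PBW S. scl (sPowErr q i xs et * dErr S i xs) (M (uW et xs)))"
   have "M ?r = uW ph (u @ replicate CHAR('k) i @ v) - ?s"
    unfolding pow_rel_eq(1)[OF l(3) etze(1)] M[symmetric] unfolding M_def by (simp only: kQ.distribs)
   hence e: "uW ph (u @ replicate CHAR('k) i @ v) = M ?r + ?s" by simp
   show "uW ph (u @ replicate CHAR('k) i @ v) : ?T"
    unfolding e
   proof (rule fv.span_add[OF Mr fv.span_add[OF fv.span_sum fv.span_sum]])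
    show "scl (dLie S i k * sPow q i k et) (M (W k et)) : ?T" if "k : LT" for k
     by (rule Mk[OF that])
    show "scl (sPowErr q i ys et * dErr S i ys) (M (uW et ys)) : ?T" if "ys : PBW S" for ys
     by (rule Mx[OF that])
   qed
  next
   fix ys assume y: "Q ys" "sorted ys" "!!i. count_list ys i < CHAR('k)"
   have "count_list ys i <= CHAR('k) - 1" for i using y(3)[of i] by linarith
   hence "ys : PBW S" using y(1,2) by (simp add: Q_def PBW_def)
   hence "uW ph ys : PB" using ph unfolding PB_def by force
   thus "uW ph ys : ?T" by (intro fv.span_base) blast
  qed simp
 qed
qed

lemma kQ_straight: "Qc <= fv.span (PB \<union> rI)"
 unfolding kQ_span paths_eq
proof (rule fv.span_minimal)
 show "delta ` {(ph, pth ph is) | ph is. ph : Ir & set is <= D1} <= fv.span (PB \<union> rI)"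
 proof clarify
  fix ph "is" assume "ph : Ir" "set is <= D1"
  moreover from this have "set is <= LT" using D1_sub by blast
  ultimately show "delta (ph, pth ph is) : fv.span (PB \<union> rI)"
   using straight_word[of ph "is"] uW_D1[of ph "is"] by simp
 qed
qed simp

text \<open>By \<open>kQ_straight\<close> an element of the kernel is, up to \<open>rI\<close>, a
  combination of PBW words; its value in \<open>A\<close> is zero, and \<open>basis_indep\<close>
  makes all coefficients vanish.\<close>

lemma ker_rI: "a_kernel (kQ S) A ev = rI"
proof
 show "rI <= a_kernel (kQ S) A ev" by (rule rI_ker)
 show "a_kernel (kQ S) A ev <= rI"
 proof
  fix f assume "f : a_kernel (kQ S) A ev"
  hence f: "f : Qc" "ev f = 0" by (simp_all add: ker_ev)
  then obtain a r where ar: "a : fv.span PB" "r : fv.span rI" "f = a + r"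
   using kQ_straight by (auto simp: fv.span_Un)
  have r: "r : rI" using ar(2) rI_sub by (simp add: fv.span_eq_iff[THEN iffD2])
  hence r': "r : Qc" "ev r = 0" using rI_ker by (auto simp: ker_ev)
  have fin: "finite (Ir \<times> PBW S)" using finite_IrrZ PBW_count(1) by simp
  obtain c where c: "a = (SUM v:Ir \<times> PBW S. scl (c v) ((%(ph, xs). uW ph xs) v))"
   using span_image_finite[OF fin ar(1)[unfolded PB_def]] by blast
  have uin: "scl (c v) ((%(ph, xs). uW ph xs) v) : Qc" if "v : Ir \<times> PBW S" for v
   using that uW_PBW by (cases v) (simp add: kQ.closed(4))
  have a: "a : Qc" unfolding c by (rule kQ.closed(7)) (rule uin)
  have "0 = ev a" using f(2) r' a unfolding ar(3) by (simp add: ev_add)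
  also have "... = (SUM v:Ir \<times> PBW S. ev (scl (c v) ((%(ph, xs). uW ph xs) v)))"
   unfolding c by (rule ev_sums[OF fin uin])
  also have "... = (SUM v:Ir \<times> PBW S. scl (c v) ((%(ph, xs). uA ph xs) v))"
  proof (rule sum.cong[OF refl])
   fix v assume "v : Ir \<times> PBW S"
   then obtain ph xs where v: "v = (ph, xs)" "ph : Ir" "xs : PBW S" by blast
   show "ev (scl (c v) ((%(ph, xs). uW ph xs) v)) = scl (c v) ((%(ph, xs). uA ph xs) v)"
    using ev_scl[OF uW_PBW[OF v(2,3)]] ev_uW[OF v(2) PBW_letters[OF v(3)]] by (simp add: v(1))
  qed
  also have "... = (SUM ph:Ir. SUM xs:PBW S. scl (c (ph, xs)) (uA ph xs))"
   by (simp add: sum.cartesian_product case_prod_beta)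
  finally have "c (ph, xs) = 0" if "ph : Ir" "xs : PBW S" for ph xs
   using basis_indep[of "%ph xs. c (ph, xs)"] that by simp
  hence "a = 0" unfolding c by (intro sum.neutral) auto
  thus "f : rI" using r ar(3) by simp
 qed
qed

lemma ev_surj: "ev ` Qc = carrier A"
proof
 show "ev ` Qc <= carrier A" using ev_in by blast
 show "carrier A <= ev ` Qc"
 proof
  fix x assume "x : carrier A"
  hence "x : fv.span {uA ph xs | ph xs. ph : Ir & xs : PBW S}" by (rule basis_span)
  thus "x : ev ` Qc"
  proof (induction rule: fv.span_induct_alt)
   case base
   show ?case using ev_zero kQ.closed(5) by force
  next
   case (step c x y)
   then obtain ph xs f where f: "x = uA ph xs" "ph : Ir" "xs : PBW S" "f : Qc" "y = ev f" by blast
   hence "scl c x + y = ev (scl c (uW ph xs) + f)" "scl c (uW ph xs) + f : Qc"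
    using uW_PBW[OF f(2,3)] ev_uW[OF f(2) PBW_letters[OF f(3)]]
    by (simp_all add: ev_add ev_scl kQ.closed)
   thus ?case by blast
  qed
 qed
qed

lemma Psi_iso:
 "EX \<Psi>:alg_iso (quot_alg (kQ S) (rel_ideal S q W)) A.
  (ALL f:Qc. \<Psi> (rel_ideal S q W +>\<^bsub>kQ S\<^esub> f) = ev f)"
proof -
 interpret h: ring_hom_ring "kQ S" A ev by (rule ev_ring_hom)
 interpret rI: ideal rI "kQ S" by (rule rI_ideal)
 let ?g = "%T. the_elem (ev ` T)"
 have iso: "?g : ring_iso (quot_alg (kQ S) rI) A"
  unfolding ring_iso_quot ker_rI[symmetric] by (rule h.FactRing_iso_set[OF ev_surj])
 have co: "rI +>\<^bsub>kQ S\<^esub> f = (%x. x + f) ` rI" for f by (auto simp: a_r_coset_def' kQ.add_A)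
 have val: "?g (rI +>\<^bsub>kQ S\<^esub> f) = ev f" if f: "f : Qc" for f
 proof -
  have "ev (x + f) = ev f" if "x : rI" for x
   using that f rI_ker by (auto simp: ker_ev ev_add)
  hence "ev ` (rI +>\<^bsub>kQ S\<^esub> f) = {ev f}" unfolding co image_image using fv.subspace_0[OF rI_sub] by force
  thus ?thesis by simp
 qed
 have "?g (c *.[quot_alg (kQ S) rI] T) = c *.[A] ?g T" if T: "T : carrier (quot_alg (kQ S) rI)" for c T
 proof -
  obtain f where f: "f : Qc" "T = rI +>\<^bsub>kQ S\<^esub> f"
   using T by (auto simp: quot_alg_def A_RCOSETS_def' )
  \<comment> \<open>Scalars act on a coset through the union over its elements; every element of
    \<open>T\<close> yields the same coset, so the union collapses.\<close>
  have "rI +>\<^bsub>kQ S\<^esub> scl c y = rI +>\<^bsub>kQ S\<^esub> scl c f" if yT: "y : T" for y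
  proof -
   obtain x where x: "x : rI" "y = x + f" using yT f(2) by (auto simp: co)
   hence y: "scl c y = scl c x + scl c f" by (simp add: fv.scale_right_distrib)
   have sx: "scl c x : rI" using x(1) by (rule fv.subspace_scale[OF rI_sub])
   show ?thesis
   proof
    show "rI +>\<^bsub>kQ S\<^esub> scl c y <= rI +>\<^bsub>kQ S\<^esub> scl c f"
    proof
     fix t assume "t : rI +>\<^bsub>kQ S\<^esub> scl c y"
     then obtain a where "a : rI" "t = (a + scl c x) + scl c f" by (auto simp: co y add.assoc)
     thus "t : rI +>\<^bsub>kQ S\<^esub> scl c f" using fv.subspace_add[OF rI_sub _ sx] by (auto simp: co)
    qed
    show "rI +>\<^bsub>kQ S\<^esub> scl c f <= rI +>\<^bsub>kQ S\<^esub> scl c y"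
    proof
     fix t assume "t : rI +>\<^bsub>kQ S\<^esub> scl c f"
     then obtain a where a: "a : rI" "t = a + scl c f" by (auto simp: co)
     hence "t = (a - scl c x) + scl c y" by (simp add: y)
     thus "t : rI +>\<^bsub>kQ S\<^esub> scl c y" using fv.subspace_diff[OF rI_sub a(1) sx] by (auto simp: co)
    qed
   qed
  qed
  moreover have "T ~= {}" unfolding f(2) co using fv.subspace_0[OF rI_sub] by blast
  ultimately have "c *.[quot_alg (kQ S) rI] T = rI +>\<^bsub>kQ S\<^esub> scl c f"
   by (auto simp: quot_alg_def kQ.smult_A)
  thus ?thesis using f val[of f] val[of "scl c f"] by (simp add: kQ.closed ev_scl A.smult_A)
 qed
 hence g: "?g : alg_iso (quot_alg (kQ S) rI) A" using iso by (simp add: alg_iso_def)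
 show ?thesis unfolding rI_def[symmetric] by (intro bexI[OF _ g] ballI val)
qed

end

section \<open>Existence of expressions, and the presentation\<close>

context quiver_presentation
begin

lemma expression_exists:
 assumes "k : LT" "ph : Ir"
 shows "\<exists>f. f : Qc & (\<forall>x. f x ~= 0 --> (\<exists>is. x = (ph, pth ph is) & set is <= D1 & tws S ph is = tw S ph (psi S k)))
  & ev f = U k ph"
 using generated[OF assms]
proof (induction rule: fv.span_induct_alt)
 case base
 show ?case
 proof (intro exI conjI)
  show "0 : Qc" "ev 0 = 0" by (rule kQ.closed(5), rule ev_zero)
 qed (simp add: zero_fun_apply)
next
 case (step c x y)
 then obtain "is" f where i: "x = uA ph is" "set is <= D1" "tws S ph is = tw S ph (psi S k)" and f: "f : Qc"
  "\<forall>x. f x ~= 0 --> (\<exists>is. x = (ph, pth ph is) & set is <= D1 & tws S ph is = tw S ph (psi S k))" "ev f = y" by blast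
 let ?f = "scl c (delta (ph, pth ph is)) + f"
 have d: "delta (ph, pth ph is) : Qc" by (rule delta_in_kQ[OF assms(2) i(2)])
 have "\<exists>is. x = (ph, pth ph is) & set is <= D1 & tws S ph is = tw S ph (psi S k)" if "?f x ~= 0" for x
 proof (cases "x = (ph, pth ph is)")
  case False
  hence "f x ~= 0" using that by (simp add: pointwise delta_apply)
  thus ?thesis using f(2) by blast
 qed (use i in blast)
 moreover have "ev ?f = scl c x + y" using d f(1,3) i assms(2) by (simp add: ev_add ev_scl ev_delta kQ.closed)
 moreover have "?f : Qc" using d f(1) by (intro kQ.closed)
 ultimately show ?case by (intro exI[of _ ?f]) blast
qed

lemma arrow_expressions_exist: "\<exists>W. arrow_expressions S A E U W"
proof -
 have "\<exists>f. f : Qc & (\<forall>u es. f (u, es) ~= 0 --> u = ph & pre_digraph.awalk (quiv S) ph es (tw S ph (psi S k)))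
  & ev f = U k ph & (wdeg S k = 1 --> f = arrow k ph)" if k: "k : LT" "ph : Ir" for k ph
 proof (cases "wdeg S k = 1")
  case True
  hence D: "set [k] <= D1" using k by (simp add: D1_def)
  have "pre_digraph.awalk (quiv S) ph [(ph, k)] (tw S ph (psi S k))" using awalk_pth[OF k(2) D] by simp
  moreover have "ev (arrow k ph) = U k ph" using ev_delta[OF k(2) D] k U_E by (simp add: arrow_def)
  moreover have "arrow k ph : Qc" using delta_in_kQ[OF k(2) D] by (simp add: arrow_def)
  ultimately show ?thesis by (intro exI[of _ "arrow k ph"]) (auto simp: arrow_def delta_apply split: if_splits)
 next
  case False
  obtain f where f: "f : Qc" "\<forall>x. f x ~= 0 --> (\<exists>is. x = (ph, pth ph is) & set is <= D1 & tws S ph is = tw S ph (psi S k))"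
   "ev f = U k ph" using expression_exists[OF k] by blast
  have "u = ph & pre_digraph.awalk (quiv S) ph es (tw S ph (psi S k))" if ue: "f (u, es) ~= 0" for u es
  proof -
   obtain "is" where "(u, es) = (ph, pth ph is)" "set is <= D1" "tws S ph is = tw S ph (psi S k)" using f(2) ue by blast
   thus ?thesis using awalk_pth[OF k(2), of "is"] by simp
  qed
  thus ?thesis using f False by (intro exI[of _ f]) blast
 qed
 then obtain W where W: "!!k ph. k : LT ==> ph : Ir ==> W k ph : Qc &
  (\<forall>u es. W k ph (u, es) ~= 0 --> u = ph & pre_digraph.awalk (quiv S) ph es (tw S ph (psi S k)))
  & ev (W k ph) = U k ph & (wdeg S k = 1 --> W k ph = arrow k ph)" by metis
 have "arrow_expressions S A E U W"
  unfolding arrow_expressions_def using W unfolding ev_def by blast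
 thus ?thesis by blast
qed

theorem presented: "presented_by S q A E U"
 unfolding presented_by_def
proof (intro conjI allI impI)
 show "\<exists>W. arrow_expressions S A E U W" by (rule arrow_expressions_exist)
 fix W assume W: "arrow_expressions S A E U W"
 interpret arrow_expression S A E U q N W by unfold_locales (rule W)
 obtain \<Psi> where \<Psi>: "\<Psi> : alg_iso (quot_alg (kQ S) (rel_ideal S q W)) A"
  "!!f. f : Qc ==> \<Psi> (rel_ideal S q W +>\<^bsub>kQ S\<^esub> f) = ev f" using Psi_iso by blast
 have "\<Psi> (rel_ideal S q W +>\<^bsub>kQ S\<^esub> vertex ph) = E ph" if "ph : Ir" for ph
  using \<Psi>(2)[OF vertex_in[OF that]] ev_vertex[OF that] by simp
 moreover have "\<Psi> (rel_ideal S q W +>\<^bsub>kQ S\<^esub> arrow i ph) = U i ph" if "ph : Ir" "i : LT" "wdeg S i = 1" for i ph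
  using \<Psi>(2)[OF W_in[OF that(2,1)]] W_ev[OF that(2,1)] W_arrow[OF that(2,1,3)] by simp
 ultimately show "EX \<Psi>:alg_iso (quot_alg (kQ S) (rel_ideal S q W)) A.
     (ALL ph:Ir. \<Psi> (rel_ideal S q W +>\<^bsub>kQ S\<^esub> vertex ph) = E ph) &
     (ALL ph:Ir. ALL i:LT. wdeg S i = 1 --> \<Psi> (rel_ideal S q W +>\<^bsub>kQ S\<^esub> arrow i ph) = U i ph)"
  using \<Psi>(1) by blast
qed

end

section \<open>Group algebras of semidirect products\<close>

text \<open>Used for the complements \<open>H\<close>, Z(H)/Z and \<open>L\<close>. An element of kP
  is embedded by \<open>emb\<close>, an element of the complement by \<open>br\<close>, and every
  element is a sum of products of the two kinds.\<close>

locale semi = P: group P + K: group K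
 for P :: "('a, 'm) monoid_scheme" and K :: "('b, 'n) monoid_scheme" +
 fixes th :: "'b => 'a => 'a" and RP :: "('k::field, 'a => 'k) module" and R :: "('k, 'a \<times> 'b => 'k) module"
 assumes finP: "finite (carrier P)" and finK: "finite (carrier K)"
  and act_in: "u : carrier K ==> x : carrier P ==> th u x : carrier P"
  and act_mult: "u : carrier K ==> x : carrier P ==> y : carrier P ==> th u (x *[P] y) = th u x *[P] th u y"
  and act_comp: "u : carrier K ==> v : carrier K ==> x : carrier P ==> th (u *[K] v) x = th u (th v x)"
  and act_one: "x : carrier P ==> th #1[K] x = x"
  and RP_def: "RP = group_algebra P" and R_def: "R = group_algebra (semidirect P K th)"
begin

abbreviation T where "T \<equiv> semidirect P K th"

lemma act_1: "u : carrier K ==> th u #1[P] = #1[P]"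
proof -
 assume u: "u : carrier K"
 have "th u #1[P] *[P] th u #1[P] = th u #1[P]" using act_mult[OF u, of "#1[P]" "#1[P]"] by simp
 thus ?thesis using act_in[OF u, of "#1[P]"] by (simp add: P.l_cancel_one)
qed

lemma group_T: "group T"
proof (rule groupI)
 show "x *[T] y *[T] z = x *[T] (y *[T] z)" if "x : carrier T" "y : carrier T" "z : carrier T" for x y z
  using that by (auto simp: semidirect_def P.m_assoc K.m_assoc act_mult act_in act_comp)
 show "EX y:carrier T. y *[T] x = #1[T]" if xT: "x : carrier T" for x
 proof -
  obtain a u where x: "x = (a, u)" "a : carrier P" "u : carrier K" using xT by (auto simp: semidirect_def)
  thus ?thesis
   by (intro bexI[of _ "(inv[P] (th (inv[K] u) a), inv[K] u)"]) (auto simp: semidirect_def act_in)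
 qed
qed (auto simp: semidirect_def act_in act_one)

sublocale RP: group_alg P RP
 using P.group_axioms finP RP_def by (simp add: group_alg_def group_alg_axioms_def)

sublocale R: group_alg T R
 using group_T finP finK R_def by (simp add: group_alg_def group_alg_axioms_def semidirect_def)

abbreviation mulR (infixl \<open>@@\<close> 70) where "x @@ y \<equiv> x *[R] y"
abbreviation br :: "'b => 'a \<times> 'b => 'k" where "br h \<equiv> delta (#1[P], h)"
abbreviation emb :: "('a => 'k) => 'a \<times> 'b => 'k" where "emb \<equiv> embP K"

lemma br_in: "h : carrier K ==> br h : carrier R"
 by (rule R.delta_in) (simp add: semidirect_def)

lemma br_mult: "g : carrier K ==> h : carrier K ==> br g @@ br h = br (g *[K] h)"
 by (subst R.mul_delta) (simp_all add: semidirect_def act_1)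

lemma one_br: "#1[R] = br #1[K]"
 unfolding R.one_delta by (simp add: semidirect_def)

lemma br_mult2: "g : carrier K ==> h : carrier K ==> br g @@ (br h @@ x) = br (g *[K] h) @@ x"
 by (simp add: br_mult flip: R.assoc)

lemma emb_delta: "emb (delta x) = delta (x, #1[K])"
 by (auto simp: embP_def delta_def fun_eq_iff)

lemma emb_add: "emb (f + g) = emb f + emb g"
 and emb_scl: "emb (scl c f) = scl c (emb f)"
 and emb_0: "emb 0 = 0"
 and emb_diff: "emb (f - g) = emb f - emb g"
 by (auto simp: embP_def fun_eq_iff pointwise)

lemma emb_sum: "emb (SUM i:I. f i) = (SUM i:I. emb (f i))"
 using sum_comp_morphism[of emb f I] by (simp add: emb_0 emb_add o_def)

lemma emb_delta_br: "x : carrier P ==> h : carrier K ==> emb (delta x) @@ br h = delta (x, h)"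
 unfolding emb_delta by (subst R.mul_delta) (simp_all add: semidirect_def act_one)

lemma emb_in: "f : carrier RP ==> emb f : carrier R"
 unfolding R.carrier_kT RP.carrier_kT by (auto simp: embP_def semidirect_def split: if_splits)

lemma emb_mult: assumes "f : carrier RP" "g : carrier RP" shows "emb (f *[RP] g) = emb f @@ emb g"
proof -
 have d: "emb (delta x *[RP] delta y) = emb (delta x) @@ emb (delta y)" if "x : carrier P" "y : carrier P" for x y
  using that by (simp add: RP.mul_delta emb_delta) (subst R.mul_delta, simp_all add: semidirect_def act_one)
 have f: "f : fv.span (delta ` carrier P)" and g: "g : fv.span (delta ` carrier P)" using assms RP.carrier_span by auto
 have 1: "emb (delta x *[RP] g) = emb (delta x) @@ emb g" if x: "x : carrier P" for x
  using g
 proof (induction rule: fv.span_induct_alt)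
  case (step c b y)
  thus ?case using d[OF x] by (auto simp: RP.distribs R.distribs emb_add emb_scl)
 qed (simp add: emb_0)
 show ?thesis using f
 proof (induction rule: fv.span_induct_alt)
  case (step c b y)
  thus ?case using 1 by (auto simp: RP.distribs R.distribs emb_add emb_scl)
 qed (simp add: emb_0)
qed

lemma emb_one: "emb #1[RP] = #1[R]"
 by (simp add: RP.one_delta emb_delta one_br)

definition tr :: "('a => 'a) => ('a => 'k) => 'a => 'k" where
 "tr si f = (SUM x:carrier P. scl (f x) (delta (si x)))"

lemma br_emb:
 assumes u: "u : carrier K" and f: "f : carrier RP"
 shows "br u @@ emb f = emb (tr (th u) f) @@ br u"
proof -
 have "br u @@ emb (delta x) = emb (delta (th u x)) @@ br u" if x: "x : carrier P" for x
  using u x by (simp add: emb_delta_br act_in) (unfold emb_delta, subst R.mul_delta, simp_all add: semidirect_def act_in)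
 hence "br u @@ emb (SUM x:carrier P. scl (f x) (delta x)) = emb (tr (th u) f) @@ br u"
  by (simp add: tr_def emb_sum emb_scl R.distribs)
 thus ?thesis unfolding RP.expand[OF f, symmetric] .
qed

lemma emb_br_apply:
 assumes "f : carrier RP" "h : carrier K"
 shows "(emb f @@ br h) (x, u) = (if u = h then f x else 0)"
proof -
 have "emb f @@ br h = (SUM y:carrier P. scl (f y) (delta (y, h)))"
  using assms by (subst RP.expand[OF assms(1)]) (simp add: emb_sum emb_scl R.distribs emb_delta_br)
 hence "(emb f @@ br h) (x, u) = (SUM y:carrier P. scl (f y) (delta (y, h)) (x, u))" by (simp only: sum_apply)
 also have "... = (SUM y:carrier P. if y = x then (if u = h then f x else 0) else 0)"
  by (intro sum.cong refl) (auto simp: pointwise delta_apply)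
 also have "... = (if u = h then f x else 0)" using assms(1) finP by (auto simp: RP.carrier_kT)
 finally show ?thesis .
qed

lemma emb_inj: "emb f = emb g ==> f = g"
proof
 fix x assume "emb f = emb g"
 hence "emb f (x, #1[K]) = emb g (x, #1[K])" by simp
 thus "f x = g x" by (simp add: embP_def)
qed

lemma R_expand:
 assumes "y : carrier R"
 shows "y = (SUM h:carrier K. emb (%x. y (x, h)) @@ br h)" "h : carrier K ==> (%x. y (x, h)) : carrier RP"
proof -
 have c: "(%x. y (x, h)) : carrier RP" for h
  using assms unfolding R.carrier_kT RP.carrier_kT by (auto simp: semidirect_def)
 thus "h : carrier K ==> (%x. y (x, h)) : carrier RP" by simp
 show "y = (SUM h:carrier K. emb (%x. y (x, h)) @@ br h)"
 proof
  fix v :: "'a \<times> 'b"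
  obtain x u where v: "v = (x, u)" by (cases v)
  have "(SUM h:carrier K. emb (%x. y (x, h)) @@ br h) v = (SUM h:carrier K. if h = u then y (x, u) else 0)"
   unfolding sum_apply v using c by (intro sum.cong) (auto simp: emb_br_apply)
  also have "... = y v" using assms finK by (auto simp: v R.carrier_kT semidirect_def)
  finally show "y v = (SUM h:carrier K. emb (%x. y (x, h)) @@ br h) v" by simp
 qed
qed

end

text \<open>Two cases share this: \<open>K\<close> is \<open>H\<close>, with \<open>N\<close> its
  centre and the characters ph themselves; or \<open>K\<close> is Z(H)/Z, with \<open>N\<close> all
  of it and the characters ph / phi0. In both, the idempotents of the characters of \<open>N\<close>
  are the vertices and the lifts are eigenvectors for \<open>K\<close>.\<close>

locale semi_words = block_setting S + semi "grpP S" K th "kP S" R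
 for S :: "('p, 'h, 'k::alg_closed_field) block_data" and K :: "('b, 'n) monoid_scheme"
  and th :: "'b => 'p => 'p" and R :: "('k, 'p \<times> 'b => 'k) module" +
 fixes N :: "'b set" and nu :: "('h => 'k) => 'b => 'k" and psiK :: "nat => 'b => 'k"
 assumes N_sub: "subgroup N K" and N_central: "n : N ==> h : carrier K ==> n *[K] h = h *[K] n"
  and N_card: "of_nat (card N) ~= (0 :: 'k)"
  and nu_char: "ph : Ir ==> lchar K N (nu ph)"
  and nu_inj: "ph : Ir ==> ze : Ir ==> ph ~= ze ==> EX n:N. nu ph n ~= nu ze n"
  and nu_tw: "ph : Ir ==> i : LT ==> n : N ==> nu (tw S ph (psi S i)) n = nu ph n * psiK i n"
  and psiK_char: "i : LT ==> lchar K (carrier K) (psiK i)"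
  and eigen: "i : LT ==> h : carrier K ==>
   delta (#1[grpP S], h) *[R] embP K (wlift S i) = scl (psiK i h) (embP K (wlift S i) *[R] delta (#1[grpP S], h))"
begin

lemma N_in: "n : N ==> n : carrier K"
 using subgroup.mem_carrier[OF N_sub] .

lemma N_fin: "finite N"
 using finK N_in by (meson finite_subset subsetI)

definition EK :: "('h => 'k) => 'p \<times> 'b => 'k" where
 "EK ph = char_idem P K N (nu ph)"

lemma EK_eq: "EK ph = scl (inverse (of_nat (card N))) (SUM h:N. scl (nu ph (inv[K] h)) (br h))"
 by (auto simp: EK_def char_idem_def fun_eq_iff pointwise sum_apply)

lemma EK_in: "EK ph : carrier R"
 unfolding EK_eq by (intro R.closed br_in N_in)

lemma EK_br: assumes "h : carrier K" shows "EK ph @@ br h = br h @@ EK ph"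
proof -
 have "br n @@ br h = br h @@ br n" if "n : N" for n
  using br_mult[OF N_in[OF that] assms] br_mult[OF assms N_in[OF that]] N_central[OF that assms] by simp
 thus ?thesis unfolding EK_eq by (simp add: R.distribs)
qed

lemma br_EK:
 assumes ph: "ph : Ir" and n: "n : N"
 shows "br n @@ EK ph = scl (nu ph n) (EK ph)"
proof -
 have "(SUM h:N. scl (nu ph (inv[K] h)) (br (n *[K] h))) = (SUM h:N. scl (nu ph n * nu ph (inv[K] h)) (br h))"
 proof (rule sum.reindex_bij_witness[of _ "%h. inv[K] n *[K] h" "%h. n *[K] h"])
  fix h assume h: "h : N"
  note c = N_in[OF n] N_in[OF h]
  show "inv[K] n *[K] (n *[K] h) = h" "n *[K] (inv[K] n *[K] h) = h" using c by (simp_all flip: K.m_assoc)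
  show "n *[K] h : N" "inv[K] n *[K] h : N" using n h subgroup.m_closed[OF N_sub] subgroup.m_inv_closed[OF N_sub] by blast+
  have "nu ph (inv[K] (n *[K] h)) = inverse (nu ph n) * nu ph (inv[K] h)"
   using K.lchar_inv[OF nu_char[OF ph] N_sub subgroup.m_closed[OF N_sub n h]] K.lchar_inv[OF nu_char[OF ph] N_sub h]
    lchar_mult[OF nu_char[OF ph] n h] by simp
  thus "scl (nu ph n * nu ph (inv[K] (n *[K] h))) (br (n *[K] h)) = scl (nu ph (inv[K] h)) (br (n *[K] h))"
   using lchar_nz[OF nu_char[OF ph] n] by simp
 qed
 also have "... = scl (nu ph n) (SUM h:N. scl (nu ph (inv[K] h)) (br h))" by (simp add: fv.scale_sum_right)
 finally have e: "(SUM h:N. scl (nu ph (inv[K] h)) (br (n *[K] h))) = scl (nu ph n) (SUM h:N. scl (nu ph (inv[K] h)) (br h))" .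
 have "br n @@ EK ph = scl (inverse (of_nat (card N))) (SUM h:N. scl (nu ph (inv[K] h)) (br (n *[K] h)))"
  unfolding EK_eq R.distribs using br_mult[OF N_in[OF n] N_in] by simp
 thus ?thesis unfolding e EK_eq by (simp add: mult.commute)
qed

lemma EK_orth:
 assumes ph: "ph : Ir" and ze: "ze : Ir"
 shows "EK ph @@ EK ze = (if ph = ze then EK ph else 0)"
proof -
 have "EK ph @@ EK ze = scl (inverse (of_nat (card N))) (SUM h:N. scl (nu ph (inv[K] h) * nu ze h) (EK ze))"
  by (subst (1) EK_eq) (simp add: R.distribs br_EK[OF ze])
 also have "... = scl (inverse (of_nat (card N)) * (SUM h:N. nu ph (inv[K] h) * nu ze h)) (EK ze)"
  by (simp only: fv.scale_sum_left[symmetric] fv.scale_scale)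
 also have "(SUM h:N. nu ph (inv[K] h) * nu ze h) = (if ph = ze then of_nat (card N) else 0)"
 proof (cases "ph = ze")
  case True
  have "nu ph (inv[K] h) * nu ze h = 1" if "h : N" for h
   using K.lchar_inv[OF nu_char[OF ph] N_sub that] lchar_nz[OF nu_char[OF ph] that] True by simp
  thus ?thesis using True by simp
 next
  case False
  then obtain n where n: "n : N" "nu ph n ~= nu ze n" using nu_inj ph ze by blast
  have l: "lchar K N (%h. inverse (nu ph h) * nu ze h)" using nu_char[OF ph] nu_char[OF ze] by (simp add: lchar_def)
  have "inverse (nu ph n) * nu ze n ~= 1" using n lchar_nz[OF nu_char[OF ph] n(1)] by (simp add: field_simps)
  hence "(SUM h:N. inverse (nu ph h) * nu ze h) = 0" by (rule K.sum_lchar[OF N_sub l n(1)])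
  moreover have "(SUM h:N. nu ph (inv[K] h) * nu ze h) = (SUM h:N. inverse (nu ph h) * nu ze h)"
   using K.lchar_inv[OF nu_char[OF ph] N_sub] by simp
  ultimately show ?thesis using False by simp
 qed
 finally show ?thesis using N_card by auto
qed

lemma wl_in: "i : LT ==> emb (wlift S i) : carrier R"
 by (rule emb_in[OF wlift_carrier])

lemma wl_EK:
 assumes ph: "ph : Ir" and i: "i : LT"
 shows "emb (wlift S i) @@ EK ph = EK (tw S ph (psi S i)) @@ emb (wlift S i)"
proof -
 have e: "scl (nu ph (inv[K] h)) (emb (wlift S i) @@ br h) = scl (nu (tw S ph (psi S i)) (inv[K] h)) (br h @@ emb (wlift S i))"
  if h: "h : N" for h
 proof -
  have h': "inv[K] h : N" using h by (rule subgroup.m_inv_closed[OF N_sub])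
  have "psiK i (inv[K] h) * psiK i h = 1"
   using K.lchar_inv[OF psiK_char[OF i] K.subgroup_self N_in[OF h]] lchar_nz[OF psiK_char[OF i] N_in[OF h]] by simp
  thus ?thesis by (simp add: nu_tw[OF ph i h'] eigen[OF i N_in[OF h]] mult.assoc)
 qed
 show ?thesis
  unfolding EK_eq using e by (simp add: R.distribs cong: sum.cong)
qed

definition PsiK where "PsiK xs h = (\<Prod>i\<leftarrow>xs. psiK i h)"

lemma PsiK_simps [simp]: "PsiK [] h = 1" "PsiK (i # xs) h = psiK i h * PsiK xs h"
 by (simp_all add: PsiK_def)

lemma PsiK_nz: "set xs <= LT ==> h : carrier K ==> PsiK xs h ~= 0"
 by (induction xs) (auto simp: lchar_nz[OF psiK_char])

lemma wm_in: "set xs <= LT ==> emb (wmon S xs) : carrier R"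
 by (rule emb_in[OF wmon_carrier])

lemma emb_wmon_Cons: "i : LT ==> set xs <= LT ==> emb (wmon S (i # xs)) = emb (wlift S i) @@ emb (wmon S xs)"
 by (simp only: wmon_Cons emb_mult[OF wlift_carrier wmon_carrier])

lemma br_wm:
 assumes h: "h : carrier K"
 shows "set xs <= LT ==> br h @@ emb (wmon S xs) = scl (PsiK xs h) (emb (wmon S xs) @@ br h)"
proof (induction xs)
 case Nil
 show ?case using h by (simp add: wmon_Nil emb_one R.one_l R.one_r br_in)
next
 case (Cons i xs)
 hence l: "i : LT" "set xs <= LT" by auto
 have "br h @@ emb (wmon S (i # xs)) = (br h @@ emb (wlift S i)) @@ emb (wmon S xs)"
  unfolding emb_wmon_Cons[OF l] by (simp only: R.assoc)
 also have "... = scl (psiK i h) (emb (wlift S i) @@ (br h @@ emb (wmon S xs)))"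
  unfolding eigen[OF l(1) h] by (simp only: R.distribs R.assoc)
 also have "... = scl (PsiK (i # xs) h) (emb (wmon S (i # xs)) @@ br h)"
  unfolding Cons.IH[OF l(2)] emb_wmon_Cons[OF l] by (simp add: R.distribs R.assoc)
 finally show ?case .
qed

lemma wm_br:
 assumes h: "h : carrier K" and xs: "set xs <= LT"
 shows "emb (wmon S xs) @@ br h = scl (inverse (PsiK xs h)) (br h @@ emb (wmon S xs))"
 using PsiK_nz[OF xs h] by (simp add: br_wm[OF h xs])

lemma wm_EK:
 assumes ph: "ph : Ir"
 shows "set xs <= LT ==> emb (wmon S xs) @@ EK ph = EK (tws S ph xs) @@ emb (wmon S xs)"
proof (induction xs)
 case Nil
 show ?case by (simp add: wmon_Nil emb_one R.one_l R.one_r EK_in)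
next
 case (Cons i xs)
 hence l: "i : LT" "set xs <= LT" by auto
 have "emb (wmon S (i # xs)) @@ EK ph = emb (wlift S i) @@ (EK (tws S ph xs) @@ emb (wmon S xs))"
  unfolding emb_wmon_Cons[OF l] R.assoc Cons.IH[OF l(2)] ..
 also have "... = (emb (wlift S i) @@ EK (tws S ph xs)) @@ emb (wmon S xs)" by (simp only: R.assoc)
 also have "... = EK (tws S ph (i # xs)) @@ emb (wmon S (i # xs))"
  unfolding wl_EK[OF tws_IrrZ[OF ph l(2)] l(1)] emb_wmon_Cons[OF l] by (simp only: R.assoc tws_simps)
 finally show ?case .
qed

lemma emb_EK_apply:
 assumes f: "f : Pc" and g: "g : carrier K" and u: "u : carrier K"
 shows "(emb f @@ (br g @@ EK ph)) (x, u) =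
  f x * (if inv[K] g *[K] u : N then inverse (of_nat (card N)) * nu ph (inv[K] (inv[K] g *[K] u)) else 0)"
proof -
 have "emb f @@ (br g @@ EK ph) = scl (inverse (of_nat (card N))) (SUM h:N. scl (nu ph (inv[K] h)) (emb f @@ br (g *[K] h)))"
  unfolding EK_eq using g N_in by (simp add: R.distribs br_mult cong: sum.cong)
 hence "(emb f @@ (br g @@ EK ph)) (x, u) = inverse (of_nat (card N)) *
  (SUM h:N. nu ph (inv[K] h) * (if u = g *[K] h then f x else 0))"
  using f g N_in by (simp add: pointwise sum_apply emb_br_apply cong: sum.cong)
 also have "(SUM h:N. nu ph (inv[K] h) * (if u = g *[K] h then f x else 0)) =
  (SUM h:N. if h = inv[K] g *[K] u then nu ph (inv[K] (inv[K] g *[K] u)) * f x else 0)"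
 proof (intro sum.cong refl)
  fix h assume h: "h : N"
  have "u = g *[K] h \<longleftrightarrow> h = inv[K] g *[K] u" using g u N_in[OF h] by (metis K.inv_solve_left)
  thus "nu ph (inv[K] h) * (if u = g *[K] h then f x else 0) =
   (if h = inv[K] g *[K] u then nu ph (inv[K] (inv[K] g *[K] u)) * f x else 0)" by auto
 qed
 also have "... = (if inv[K] g *[K] u : N then nu ph (inv[K] (inv[K] g *[K] u)) * f x else 0)"
  using N_fin by simp
 finally show ?thesis by (simp add: ac_simps)
qed

text \<open>Multiplication by \<open>EK ze\<close> on the right isolates one vertex. The component
  at the group element \<open>\<gamma> ze ys\<close> is then a linear relation between PBW monomials
  in kP, in which \<open>ys\<close> has the coefficient \<open>c ze ys\<close> divided by
  |N|.\<close>

lemma words_independent: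
 fixes \<gamma> :: "('h => 'k) => nat list => 'b" and c :: "('h => 'k) => nat list => 'k"
 assumes \<gamma>: "!!ph xs. ph : Ir ==> xs : PBW S ==> \<gamma> ph xs : carrier K"
  and s: "(SUM ph:Ir. SUM xs:PBW S. scl (c ph xs) (emb (wmon S xs) @@ (br (\<gamma> ph xs) @@ EK ph))) = 0"
  and ze: "ze : Ir" and ys: "ys : PBW S"
 shows "c ze ys = 0"
proof -
 let ?u = "\<gamma> ze ys"
 let ?v = "%xs. if inv[K] (\<gamma> ze xs) *[K] ?u : N then inverse (of_nat (card N)) * nu ze (inv[K] (inv[K] (\<gamma> ze xs) *[K] ?u)) else 0"
 have "0 = (SUM ph:Ir. SUM xs:PBW S. scl (c ph xs) (emb (wmon S xs) @@ (br (\<gamma> ph xs) @@ EK ph))) @@ EK ze" unfolding s by simp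
 also have "... = (SUM ph:Ir. if ph = ze then (SUM xs:PBW S. scl (c ze xs) (emb (wmon S xs) @@ (br (\<gamma> ze xs) @@ EK ze))) else 0)"
  unfolding R.sum_l
  by (intro sum.cong refl) (auto simp: R.distribs R.assoc EK_orth[OF _ ze])
 also have "... = (SUM xs:PBW S. scl (c ze xs) (emb (wmon S xs) @@ (br (\<gamma> ze xs) @@ EK ze)))"
  using ze finite_IrrZ by simp
 finally have 0: "(SUM xs:PBW S. scl (c ze xs) (emb (wmon S xs) @@ (br (\<gamma> ze xs) @@ EK ze))) = 0" by simp
 have "(SUM xs:PBW S. scl (c ze xs * ?v xs) (wmon S xs)) = 0"
 proof
  fix x
  have "(SUM xs:PBW S. scl (c ze xs * ?v xs) (wmon S xs)) x =
   (SUM xs:PBW S. scl (c ze xs) (emb (wmon S xs) @@ (br (\<gamma> ze xs) @@ EK ze))) (x, ?u)"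
   unfolding sum_apply
  proof (rule sum.cong[OF refl])
   fix xs assume xs: "xs : PBW S"
   show "scl (c ze xs * ?v xs) (wmon S xs) x = scl (c ze xs) (emb (wmon S xs) @@ (br (\<gamma> ze xs) @@ EK ze)) (x, ?u)"
    unfolding scl_apply emb_EK_apply[OF wmon_PBW[OF xs] \<gamma>[OF ze xs] \<gamma>[OF ze ys]] by (simp only: ac_simps)
  qed
  thus "(SUM xs:PBW S. scl (c ze xs * ?v xs) (wmon S xs)) x = 0 x" unfolding 0 by (simp only: zero_fun_apply)
 qed
 hence "c ze ys * ?v ys = 0" using ys by (rule PBW_zero)
 moreover have "?v ys ~= 0"
 proof -
  have "inv[K] ?u *[K] ?u = #1[K]" using \<gamma>[OF ze ys] by simp
  thus ?thesis
   using N_card subgroup.one_closed[OF N_sub] K.lchar_one[OF nu_char[OF ze] subgroup.one_closed[OF N_sub]] by simp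
 qed
 ultimately show ?thesis by simp
qed

text \<open>Within \<open>carrier R\<close> this is the kernel of the map to kK induced by the
  augmentation of kP. It contains every nonempty word and no vertex idempotent, which is what
  \<open>quiver_presentation\<close> asks of \<open>N\<close>.\<close>

definition NN :: "('p \<times> 'b => 'k) set" where
 "NN = {f. ALL h:carrier K. (SUM x:carrier P. f (x, h)) = 0}"

lemma NN_sub: "fv.subspace NN"
 unfolding fv.subspace_def NN_def by (auto simp: pointwise sum.distrib sum_distrib_left[symmetric])

lemma NN_words:
 assumes g: "g : carrier K" and xs: "set xs <= LT"
 shows "xs ~= [] ==> emb (wmon S xs) @@ (br g @@ EK ph) : NN"
  "ph : Ir ==> EK ph \<notin> NN"
proof -
 have e: "(SUM x:carrier P. (emb f @@ (br g @@ EK ph)) (x, u)) = (SUM x:carrier P. f x) *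
  (if inv[K] g *[K] u : N then inverse (of_nat (card N)) * nu ph (inv[K] (inv[K] g *[K] u)) else 0)"
  if "f : Pc" "g : carrier K" "u : carrier K" for f g u ph
  unfolding emb_EK_apply[OF that] by (simp only: sum_distrib_right)
 show "emb (wmon S xs) @@ (br g @@ EK ph) : NN" if ne: "xs ~= []"
 proof -
  obtain i ys where i: "xs = i # ys" using ne by (cases xs) auto
  hence "1 <= wt xs" using xs wdeg_pos[of i] by simp
  hence "wmon S xs : J 1" using wmon_J[OF xs] kP.augpow_mono[of 1 "wt xs"] by blast
  hence "(SUM x:carrier P. wmon S xs x) = 0" by (simp add: kP.augpow_1 kP.aug_def)
  thus ?thesis using e[OF wmon_carrier[OF xs] g] by (simp add: NN_def)
 qed
 assume ph: "ph : Ir"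
 have "EK ph = emb #1[kP S] @@ (br #1[K] @@ EK ph)"
  by (simp add: emb_one R.one_l EK_in flip: one_br)
 hence "(SUM x:carrier P. EK ph (x, #1[K])) = (SUM x:carrier P. #1[kP S] x) * inverse (of_nat (card N))"
  using e[OF kP.one_closed K.one_closed K.one_closed, of ph] subgroup.one_closed[OF N_sub]
   K.lchar_one[OF nu_char[OF ph] subgroup.one_closed[OF N_sub]] by simp
 also have "(SUM x:carrier P. #1[kP S] x) = (1 :: 'k)" by (simp add: kP.one_delta kP.sum_delta)
 finally show "EK ph \<notin> NN" using N_card K.one_closed unfolding NN_def by fastforce
qed

end

section \<open>The quantum relations\<close>

context block_setting
begin

lemma autL_auto: "si : autL S ==> si : hom (grpP S) (grpP S) & si : Bij (carrier (grpP S))"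
 using subgroup.subset[OF L_subgroup] by (auto simp: AutoGroup_def auto_def)

lemma act_autL: "h : Hc ==> actH S h : autL S"
 using act.hom_closed[of h] by (simp add: grpL_def)

lemma act_semi: "semi (grpP S) H (actH S) (kP S) (kG S)"
proof (intro semi.intro semi_axioms.intro P_group H_group finite_P H_finite)
 fix u v x y assume u: "u : Hc" and x: "x : carrier P"
 show "actH S u x : carrier P" using autL_auto[OF act_autL[OF u]] x by (auto simp: hom_def)
 show "actH S u (x *[P] y) = actH S u x *[P] actH S u y" if "y : carrier P"
  using autL_auto[OF act_autL[OF u]] x that by (auto simp: hom_def)
 show "actH S (u *[H] v) x = actH S u (actH S v x)" if v: "v : Hc"
  using act.hom_mult[OF u v] autL_auto[OF act_autL[OF u]] autL_auto[OF act_autL[OF v]] x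
  by (simp add: grpL_def AutoGroup_def BijGroup_def compose_def)
next
 fix x assume x: "x : carrier P"
 show "actH S #1[H] x = x" using act.hom_one x by (simp add: grpL_def AutoGroup_def BijGroup_def)
qed (simp_all add: kP_def kG_def)

sublocale G: semi "grpP S" "grpH S" "actH S" "kP S" "kG S"
 by (rule act_semi)

abbreviation mulG (infixl \<open>@@\<close> 70) where "x @@ y \<equiv> x *[kG S] y"

lemma card_nz: "subgroup B H ==> of_nat (card B) ~= (0 :: 'k)"
proof -
 assume B: "subgroup B H"
 hence "card B dvd Coset.order H" using H.lagrange[OF B] by (metis dvd_triv_right)
 hence "coprime (card B) CHAR('k)" using H_p' by (meson coprime_divisors dvd_refl)
 hence "\<not> CHAR('k) dvd card B" using prime_char by (metis coprime_absorb_right not_prime_unit)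
 thus ?thesis by (simp add: of_nat_eq_0_iff_char_dvd)
qed

lemma wl_eigen:
 assumes i: "i : LT" and h: "h : Hc"
 shows "G.br h @@ G.emb (wlift S i) = scl (psi S i h) (G.emb (wlift S i) @@ G.br h)"
proof -
 have "G.br h @@ G.emb (wlift S i) = G.br h @@ G.emb (wlift S i) @@ (G.br (inv[H] h) @@ G.br h)"
  using h i by (simp add: G.br_mult G.one_br[symmetric] G.R.one_r G.R.closed G.br_in G.emb_in wlift_carrier)
 also have "... = (G.br h @@ G.emb (wlift S i) @@ G.br (inv[H] h)) @@ G.br h" by (simp only: G.R.assoc)
 also have "... = scl (psi S i h) (G.emb (wlift S i)) @@ G.br h"
  using wlift_eigen[OF i h] by (simp add: G.R.smult_A)
 finally show ?thesis by (simp add: G.R.distribs)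
qed

sublocale GW: semi_words S "grpH S" "actH S" "kG S" "centH S" "%ph. ph" "psi S"
proof (intro semi_words.intro semi_words_axioms.intro block_setting_axioms act_semi)
 show "subgroup C H" by (rule sub_C)
 show "n *[H] h = h *[H] n" if "n : C" "h : Hc" for n h using that by (rule C_comm)
 show "of_nat (card C) ~= (0 :: 'k)" by (rule card_nz[OF sub_C])
 fix ph assume ph: "ph : Ir"
 show "lchar H C ph" by (rule lchar_C[OF ph])
 show "EX n:C. ph n ~= ze n" if ze: "ze : Ir" "ph ~= ze" for ze
  using extensionalityI[OF IrrZ_ext[OF ph] IrrZ_ext[OF ze(1)]] ze(2) by blast
 show "tw S ph (psi S i) n = ph n * psi S i n" if "n : C" for i n using that by (simp add: tw_def)
next
 fix i assume i: "i : LT"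
 show "lchar H (Hc) (psi S i)" by (rule psi_lchar[OF i])
 show "G.br h @@ G.emb (wlift S i) = scl (psi S i h) (G.emb (wlift S i) @@ G.br h)" if "h : Hc" for h
  by (rule wl_eigen[OF i that])
qed

lemma ePhi_EK: "ePhi S ph = GW.EK ph"
 by (simp add: ePhi_def GW.EK_def)

lemma PsiK_Psi: "GW.PsiK = Psi"
 by (simp add: fun_eq_iff GW.PsiK_def Psi_def)

text \<open>Compare coefficients in the eigenvalue equation: PBW monomials are themselves
  eigenvectors, and independence leaves only those whose eigenvalue is \<open>m\<close>.\<close>

lemma expansion_eigen:
 assumes L: "L = (SUM xs:PBW S. scl (a xs) (wmon S xs))" and h: "h : Hc"
  and e: "G.br h @@ G.emb L = scl m (G.emb L @@ G.br h)" and xs: "xs : PBW S" "a xs ~= 0"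
 shows "Psi xs h = m"
proof -
 have b: "G.br h @@ G.emb (wmon S xs) = scl (Psi xs h) (G.emb (wmon S xs) @@ G.br h)" if "xs : PBW S" for xs
  using GW.br_wm[OF h PBW_letters[OF that]] by (simp only: PsiK_Psi)
 have "G.emb (SUM xs:PBW S. scl (a xs * Psi xs h) (wmon S xs)) @@ G.br h = G.br h @@ G.emb L"
  unfolding L using b by (simp add: G.emb_sum G.emb_scl G.R.distribs)
 also have "... = G.emb (scl m L) @@ G.br h" unfolding e by (simp add: G.emb_scl G.R.distribs)
 finally have c: "G.emb (SUM xs:PBW S. scl (a xs * Psi xs h) (wmon S xs)) @@ G.br h = G.emb (scl m L) @@ G.br h" .
 have k: "(SUM xs:PBW S. scl (a xs * Psi xs h) (wmon S xs)) : Pc" "scl m L : Pc"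
  unfolding L by (intro kP.closed wmon_PBW; assumption)+
 have "(SUM xs:PBW S. scl (a xs * Psi xs h) (wmon S xs)) = scl m L"
 proof
  fix x
  show "(SUM xs:PBW S. scl (a xs * Psi xs h) (wmon S xs)) x = scl m L x"
   using G.emb_br_apply[OF k(1) h, of x h] G.emb_br_apply[OF k(2) h, of x h] c by simp
 qed
 also have "... = (SUM xs:PBW S. scl (a xs * m) (wmon S xs))" unfolding L by (simp add: fv.scale_sum_right mult.commute)
 finally have "(SUM xs:PBW S. scl (a xs * Psi xs h - a xs * m) (wmon S xs)) = 0"
  by (simp add: fv.scale_left_diff_distrib sum_subtractf)
 hence "a xs * Psi xs h - a xs * m = 0" using xs(1) by (rule PBW_zero)
 thus ?thesis using xs(2) by simp
qed

lemma single_PBW: "k : LT ==> [k] : PBW S"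
 using char_ge2 by (auto simp: PBW_def)

text \<open>The two sums share the words of one letter, so a coefficient could in principle cancel.
  Weights exclude this: the first sum has weight \<open>w\<close> throughout, the second exceeds
  it.\<close>

lemma eigen_terms:
 assumes L: "L = (SUM k:LT. scl (c k) (wlift S k)) + (SUM xs:PBW S. scl (d xs) (wmon S xs))"
  and c: "!!k. k : LT ==> c k ~= 0 ==> wdeg S k = w"
  and d: "!!xs. xs : PBW S ==> d xs ~= 0 ==> w < wt xs"
  and h: "h : Hc" and e: "G.br h @@ G.emb L = scl m (G.emb L @@ G.br h)"
 shows "k : LT ==> c k ~= 0 ==> psi S k h = m" "xs : PBW S ==> d xs ~= 0 ==> Psi xs h = m"
proof -
 \<comment> \<open>The first sum rewritten over PBW words: \<open>b\<close> is supported on words of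
   one letter.\<close>
 define b where "b xs = (SUM k:LT. if xs = [k] then c k else 0)" for xs
 have "(SUM xs:PBW S. scl (b xs) (wmon S xs)) = (SUM xs:PBW S. SUM k:LT. if xs = [k] then scl (c k) (wmon S [k]) else 0)"
  unfolding b_def fv.scale_sum_left by (intro sum.cong refl) auto
 also have "... = (SUM k:LT. SUM xs:PBW S. if xs = [k] then scl (c k) (wmon S [k]) else 0)" by (rule sum.swap)
 also have "... = (SUM k:LT. scl (c k) (wlift S k))"
 proof (rule sum.cong[OF refl])
  fix k assume k: "k : LT"
  show "(SUM xs:PBW S. if xs = [k] then scl (c k) (wmon S [k]) else 0) = scl (c k) (wlift S k)"
   using PBW_count(1) single_PBW[OF k] wmon_single[OF k] by simp
 qed
 finally have "L = (SUM xs:PBW S. scl (b xs + d xs) (wmon S xs))"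
  unfolding L by (simp add: fv.scale_left_distrib sum.distrib)
 note 1 = expansion_eigen[OF this h e]
 have bs: "b [k] = c k" if "k : LT" for k
 proof -
  have "b [k] = (SUM k':LT. if k' = k then c k else 0)" unfolding b_def by (intro sum.cong) auto
  thus ?thesis using that by simp
 qed
 show "psi S k h = m" if k: "k : LT" "c k ~= 0"
 proof -
  have "d [k] = 0" using d[OF single_PBW[OF k(1)]] c[OF k] by (cases "d [k] = 0") auto
  thus ?thesis using 1[OF single_PBW[OF k(1)]] bs[OF k(1)] k(2) by simp
 qed
 show "Psi xs h = m" if xs: "xs : PBW S" "d xs ~= 0"
 proof -
  have "b xs = 0" unfolding b_def
  proof (rule sum.neutral, rule ballI)
   fix k assume k: "k : LT"
   have "c k = 0" if "xs = [k]"
   proof (rule ccontr)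
    assume "c k ~= 0"
    from c[OF k this] d[OF xs] show False by (simp add: that)
   qed
   thus "(if xs = [k] then c k else 0) = 0" by simp
  qed
  thus ?thesis using 1[OF xs(1)] xs(2) by simp
 qed
qed

text \<open>The lifts are eigenvectors, hence so is their commutator, and every word in its
  expansion shares the eigenvalue. That is what makes the group elements in the scalars
  central.\<close>

lemma comm_psi:
 assumes ij: "i : LT" "j : LT" and h: "h : Hc"
 shows "k : LT ==> cLie S i j k ~= 0 ==> psi S k h = Psi [j, i] h"
  "xs : PBW S ==> cErr S i j xs ~= 0 ==> Psi xs h = Psi [j, i] h"
proof -
 have L: "wmon S [i, j] - wmon S [j, i] = (SUM k:LT. scl (cLie S i j k) (wlift S k)) + (SUM xs:PBW S. scl (cErr S i j xs) (wmon S xs))"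
  using comm_eq[OF ij] ij by (simp add: wmon_Cons wmon_Nil kP.one_r wlift_carrier yComm_eq)
 have l: "set [i, j] <= LT" "set [j, i] <= LT" using ij by auto
 have p: "Psi [i, j] h = Psi [j, i] h" by simp
 have e: "G.br h @@ G.emb (wmon S [i, j] - wmon S [j, i]) = scl (Psi [j, i] h) (G.emb (wmon S [i, j] - wmon S [j, i]) @@ G.br h)"
  unfolding G.emb_diff G.R.diff_r G.R.diff_l GW.br_wm[OF h l(1)] GW.br_wm[OF h l(2)] PsiK_Psi p by (simp only: fv.scale_right_diff_distrib)
 show "k : LT ==> cLie S i j k ~= 0 ==> psi S k h = Psi [j, i] h"
  "xs : PBW S ==> cErr S i j xs ~= 0 ==> Psi xs h = Psi [j, i] h"
  using eigen_terms[OF L cLie_deg[OF ij] cErr_wt[OF ij] h e] by blast+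
qed

lemma pow_psi:
 assumes i: "i : LT" and h: "h : Hc"
 shows "k : LT ==> dLie S i k ~= 0 ==> psi S k h = Psi (replicate CHAR('k) i) h"
  "xs : PBW S ==> dErr S i xs ~= 0 ==> Psi xs h = Psi (replicate CHAR('k) i) h"
proof -
 have l: "set (replicate CHAR('k) i) <= LT" using i by auto
 note L = pow_eq[OF i, unfolded yPow_eq]
 show "k : LT ==> dLie S i k ~= 0 ==> psi S k h = Psi (replicate CHAR('k) i) h"
  "xs : PBW S ==> dErr S i xs ~= 0 ==> Psi xs h = Psi (replicate CHAR('k) i) h"
  using eigen_terms[OF L dLie_deg[OF i] dErr_wt[OF i] h GW.br_wm[OF h l, unfolded PsiK_Psi]] by blast+
qed

section \<open>The commutator pairing on H and products of the elements g\<close>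

definition rho :: "'h => 'h => 'k" where
 "rho g h = chi S (commutator H h g)"

lemma commutator_in: "g : Hc ==> h : Hc ==> commutator H g h : Hc"
 by (simp add: commutator_def)

lemma commutator_eq: "g : Hc ==> h : Hc ==> h *[H] g = commutator H h g *[H] (g *[H] h)"
 by (simp add: commutator_def H.m_assoc) (simp flip: H.m_assoc)

text \<open>Commutators lie in Z, which is central, so \<open>H\<close> has class at most two and
  [h, g g'] splits without conjugation.\<close>

lemma commutator_mult_right:
 assumes "h : Hc" "g : Hc" "g' : Hc"
 shows "commutator H h (g *[H] g') = commutator H h g *[H] commutator H h g'"
proof -
 define c where "c = commutator H h g"
 define c' where "c' = commutator H h g'"
 define d where "d = commutator H h (g *[H] g')"
 have c: "c : Hc" "c' : Hc" "d : Hc" unfolding c_def c'_def d_def using assms commutator_in by simp_all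
 have z: "g *[H] c' = c' *[H] g"
  unfolding c'_def using C_comm[OF Z_C[OF commutator_Z[OF assms(1,3)]] assms(2)] by simp
 have "d *[H] ((g *[H] g') *[H] h) = h *[H] (g *[H] g')"
  unfolding d_def using commutator_eq[of "g *[H] g'" h] assms by simp
 also have "... = (h *[H] g) *[H] g'" using assms by (simp add: H.m_assoc)
 also have "... = (c *[H] (g *[H] h)) *[H] g'" unfolding c_def using commutator_eq[of g h] assms by simp
 also have "... = (c *[H] g) *[H] (h *[H] g')" using assms c by (simp add: H.m_assoc)
 also have "... = (c *[H] g) *[H] (c' *[H] (g' *[H] h))" unfolding c'_def using commutator_eq[of g' h] assms by simp
 also have "... = c *[H] (g *[H] c') *[H] (g' *[H] h)" using assms c by (simp add: H.m_assoc)
 also have "... = (c *[H] c') *[H] ((g *[H] g') *[H] h)" unfolding z using assms c by (simp add: H.m_assoc)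
 finally have "d *[H] ((g *[H] g') *[H] h) = (c *[H] c') *[H] ((g *[H] g') *[H] h)" .
 hence "d = c *[H] c'" by (rule H.right_cancel[THEN iffD1, rotated -1]) (use assms c in simp_all)
 thus ?thesis by (simp add: c_def c'_def d_def)
qed

lemma rho_mult:
 assumes "g : Hc" "g' : Hc" "h : Hc"
 shows "rho (g *[H] g') h = rho g h * rho g' h"
 unfolding rho_def commutator_mult_right[OF assms(3,1,2)]
 by (rule lchar_mult[OF lchar_Z]) (rule commutator_Z; use assms in simp)+

lemma rho_one: "h : Hc ==> rho #1[H] h = 1"
 using H.lchar_one[OF lchar_Z subgroup.one_closed[OF sub_Z]] by (simp add: rho_def commutator_def)

lemma rho_nz: "g : Hc ==> h : Hc ==> rho g h ~= 0"
 unfolding rho_def by (rule lchar_nz[OF lchar_Z commutator_Z])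

lemma rho_inv: "g : Hc ==> h : Hc ==> rho (inv[H] g) h = inverse (rho g h)"
 using rho_mult[of g "inv[H] g" h] rho_one[of h] rho_nz[of g h] by (simp add: field_simps)

text \<open>Faithfulness of \<open>chi\<close> on Z turns a trivial value into a trivial
  commutator.\<close>

lemma rho_ker:
 assumes g: "g : Hc" and 1: "!!h. h : Hc ==> rho g h = 1"
 shows "g : C"
proof -
 have "g *[H] h = h *[H] g" if h: "h : Hc" for h
 proof -
  have "chi S (commutator H h g) = chi S #1[H]"
   using 1[OF h] H.lchar_one[OF lchar_Z subgroup.one_closed[OF sub_Z]] by (simp add: rho_def)
  hence "commutator H h g = #1[H]"
   using chi_faithful commutator_Z[OF h g] subgroup.one_closed[OF sub_Z] by (simp add: inj_on_eq_iff)
  thus ?thesis using commutator_eq[OF g h] g h by simp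
 qed
 thus ?thesis using g by (simp add: centH_def)
qed

lemma gi_in: "i : LT ==> ph : Ir ==> gi S i ph : Hc"
 unfolding gi_def by (rule gel_closed[OF psi_hom])

lemma gword_in: "ph : Ir ==> set xs <= LT ==> gword S ph xs : Hc"
proof (induction xs)
 case (Cons i xs)
 thus ?case using gi_in[of i "tws S ph xs"] tws_IrrZ[of ph xs] by simp
qed simp

lemma xi_nz: "ph : Ir ==> h : Hc ==> xi S ph h ~= 0"
 by (rule lchar_nz[OF lchar_H[OF xi_hom]])

lemma rho_gi:
 assumes "i : LT" "ph : Ir" "h : Hc"
 shows "rho (gi S i ph) h = xi S (tw S ph (psi S i)) h / xi S ph h / psi S i h"
 unfolding rho_def gi_def by (rule gel_rho[OF psi_hom[OF assms(1)] assms(2,3)])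

text \<open>The factors xi at the inner vertices of the path cancel, leaving those at its two
  ends.\<close>

lemma rho_gword:
 assumes ph: "ph : Ir" and h: "h : Hc"
 shows "set xs <= LT ==> rho (gword S ph xs) h = xi S (tws S ph xs) h / xi S ph h / Psi xs h"
proof (induction xs)
 case Nil
 show ?case using xi_nz[OF ph h] rho_one[OF h] by simp
next
 case (Cons i xs)
 hence l: "i : LT" "set xs <= LT" by auto
 have t: "tws S ph xs : Ir" by (rule tws_IrrZ[OF ph l(2)])
 show ?case
  using rho_mult[OF gi_in[OF l(1) t] gword_in[OF ph l(2)] h] rho_gi[OF l(1) t h] Cons.IH[OF l(2)]
   xi_nz[OF t h] xi_nz[OF ph h] by simp
qed

lemma gword_central:
 assumes ph: "ph : Ir" and xs: "set xs <= LT" and ys: "set ys <= LT"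
  and e: "!!h. h : Hc ==> Psi xs h = Psi ys h"
 shows "inv[H] (gword S ph xs) *[H] gword S ph ys : C"
proof (rule rho_ker)
 note g = gword_in[OF ph xs] gword_in[OF ph ys]
 show "inv[H] (gword S ph xs) *[H] gword S ph ys : Hc" using g by simp
 have t: "tws S ph xs = tws S ph ys" using C_carrier e by (intro tws_eqI ph xs ys) blast
 fix h assume h: "h : Hc"
 have "rho (gword S ph xs) h = rho (gword S ph ys) h"
  unfolding rho_gword[OF ph h xs] rho_gword[OF ph h ys] t e[OF h] ..
 thus "rho (inv[H] (gword S ph xs) *[H] gword S ph ys) h = 1"
  using rho_mult[of "inv[H] (gword S ph xs)" "gword S ph ys" h] g h rho_nz[OF g(2) h] by (simp add: rho_inv)
qed

abbreviation En where "En \<equiv> ePhi S"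
abbreviation uG where "uG \<equiv> uword S (kG S) (ePhi S) (wPhi S)"

text \<open>The central quotient \<open>z\<close> of the two group words passes the monomial with
  the factor \<open>Psi vs z\<close> and is absorbed by the vertex idempotent with the factor
  \<open>ph z\<close>; these are the factors psi_k(z) phi(z) in the quantum scalars.\<close>

lemma gword_scalar:
 assumes ph: "ph : Ir" and xs: "set xs <= LT" and ys: "set ys <= LT" and vs: "set vs <= LT"
  and e: "!!h. h : Hc ==> Psi xs h = Psi ys h"
 defines "z \<equiv> inv[H] (gword S ph xs) *[H] gword S ph ys"
 shows "G.br (gword S ph ys) @@ (G.emb (wmon S vs) @@ En ph) =
  scl (Psi vs z * ph z) (G.br (gword S ph xs) @@ (G.emb (wmon S vs) @@ En ph))"
proof -
 note g = gword_in[OF ph xs] gword_in[OF ph ys]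
 have z: "z : C" unfolding z_def by (rule gword_central[OF ph xs ys e])
 have "gword S ph ys = gword S ph xs *[H] z" using g by (simp add: z_def flip: H.m_assoc)
 hence "G.br (gword S ph ys) @@ (G.emb (wmon S vs) @@ En ph) =
  G.br (gword S ph xs) @@ ((G.br z @@ G.emb (wmon S vs)) @@ En ph)"
  using g C_carrier[OF z] by (simp add: G.R.assoc G.br_mult2)
 also have "... = scl (Psi vs z) (G.br (gword S ph xs) @@ (G.emb (wmon S vs) @@ (G.br z @@ En ph)))"
  unfolding GW.br_wm[OF C_carrier[OF z] vs] PsiK_Psi by (simp only: G.R.distribs G.R.assoc)
 also have "... = scl (Psi vs z * ph z) (G.br (gword S ph xs) @@ (G.emb (wmon S vs) @@ En ph))"
  using GW.br_EK[OF ph z] by (simp add: ePhi_EK G.R.distribs)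
 finally show ?thesis .
qed

text \<open>The scalar that arises when the group elements in a word are collected on the left.\<close>

primrec KK :: "('h => 'k) => nat list => 'k" where
 "KK ph [] = 1"
| "KK ph (i # is) = KK ph is * inverse (psi S i (gword S ph is))"

lemma KK_nz: "ph : Ir ==> set xs <= LT ==> KK ph xs ~= 0"
 by (induction xs) (auto simp: psi_nz gword_in)

lemma wPhi_eq: "wPhi S i ph = G.br (gi S i ph) @@ (G.emb (wlift S i) @@ En ph)"
 by (simp add: wPhi_def G.R.assoc)

lemma En_in: "En ph : Gc"
 by (simp add: ePhi_EK GW.EK_in)

lemma uG_eq:
 assumes ph: "ph : Ir"
 shows "set xs <= LT ==> uG ph xs = scl (KK ph xs) (G.br (gword S ph xs) @@ (G.emb (wmon S xs) @@ En ph))"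
proof (induction xs)
 case Nil
 show ?case by (simp add: wmon_Nil G.emb_one G.one_br[symmetric] G.R.one_l En_in)
next
 case (Cons i xs)
 hence l: "i : LT" "set xs <= LT" by auto
 let ?ze = "tws S ph xs" and ?g = "gword S ph xs"
 have ze: "?ze : Ir" by (rule tws_IrrZ[OF ph l(2)])
 note g = gi_in[OF l(1) ze] gword_in[OF ph l(2)]
 have E: "En ?ze @@ (G.br ?g @@ (G.emb (wmon S xs) @@ En ph)) = G.br ?g @@ (G.emb (wmon S xs) @@ En ph)"
 proof -
  have "En ?ze @@ (G.br ?g @@ (G.emb (wmon S xs) @@ En ph)) = (En ?ze @@ G.br ?g) @@ (G.emb (wmon S xs) @@ En ph)"
   by (simp only: G.R.assoc)
  also have "... = G.br ?g @@ ((En ?ze @@ G.emb (wmon S xs)) @@ En ph)"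
   unfolding ePhi_EK GW.EK_br[OF g(2)] by (simp only: G.R.assoc)
  also have "... = G.br ?g @@ (G.emb (wmon S xs) @@ (En ph @@ En ph))"
   unfolding ePhi_EK GW.wm_EK[OF ph l(2), symmetric] by (simp only: G.R.assoc)
  finally show ?thesis by (simp add: ePhi_EK GW.EK_orth[OF ph ph])
 qed
 have "uG ph (i # xs) = scl (KK ph xs) (G.br (gi S i ?ze) @@ (G.emb (wlift S i) @@ (G.br ?g @@ (G.emb (wmon S xs) @@ En ph))))"
 proof -
  have "uG ph (i # xs) = wPhi S i ?ze @@ uG ph xs" by simp
  also have "... = scl (KK ph xs) (G.br (gi S i ?ze) @@ (G.emb (wlift S i) @@ (En ?ze @@ (G.br ?g @@ (G.emb (wmon S xs) @@ En ph)))))"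
   unfolding wPhi_eq[of i ?ze] Cons.IH[OF l(2)] by (simp only: G.R.distribs G.R.assoc)
  finally show ?thesis unfolding E .
 qed
 also have "G.emb (wlift S i) @@ (G.br ?g @@ (G.emb (wmon S xs) @@ En ph)) =
   scl (inverse (psi S i ?g)) (G.br ?g @@ (G.emb (wmon S (i # xs)) @@ En ph))"
 proof -
  have "scl (psi S i ?g) (G.emb (wlift S i) @@ (G.br ?g @@ (G.emb (wmon S xs) @@ En ph))) =
   (G.br ?g @@ G.emb (wlift S i)) @@ (G.emb (wmon S xs) @@ En ph)"
   unfolding wl_eigen[OF l(1) g(2)] by (simp only: G.R.distribs G.R.assoc)
  also have "... = G.br ?g @@ (G.emb (wmon S (i # xs)) @@ En ph)"
   unfolding GW.emb_wmon_Cons[OF l] by (simp only: G.R.assoc)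
  finally have "scl (inverse (psi S i ?g)) (scl (psi S i ?g) (G.emb (wlift S i) @@ (G.br ?g @@ (G.emb (wmon S xs) @@ En ph)))) =
    scl (inverse (psi S i ?g)) (G.br ?g @@ (G.emb (wmon S (i # xs)) @@ En ph))" by (rule arg_cong)
  thus ?thesis using psi_nz[OF l(1) g(2)] by simp
 qed
 finally show ?case using g by (simp add: G.R.distribs G.br_mult2)
qed

lemma uG_wm:
 assumes ph: "ph : Ir" and xs: "set xs <= LT"
 shows "G.br (gword S ph xs) @@ (G.emb (wmon S xs) @@ En ph) = scl (inverse (KK ph xs)) (uG ph xs)"
 using KK_nz[OF ph xs] by (simp add: uG_eq[OF ph xs])

lemma word_scalar:
 assumes ph: "ph : Ir" and xs: "set xs <= LT" and ys: "set ys <= LT"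
  and e: "!!h. h : Hc ==> Psi xs h = Psi ys h"
 defines "z \<equiv> inv[H] (gword S ph xs) *[H] gword S ph ys"
 shows "G.br (gword S ph ys) @@ (G.emb (wmon S xs) @@ En ph) = scl (Psi xs z * ph z * inverse (KK ph xs)) (uG ph xs)"
  "Psi xs z * ph z * inverse (KK ph xs) ~= 0"
proof -
 show "G.br (gword S ph ys) @@ (G.emb (wmon S xs) @@ En ph) = scl (Psi xs z * ph z * inverse (KK ph xs)) (uG ph xs)"
  using gword_scalar[OF ph xs ys xs e] uG_wm[OF ph xs] by (simp add: z_def)
 have z: "z : C" unfolding z_def by (rule gword_central[OF ph xs ys e])
 show "Psi xs z * ph z * inverse (KK ph xs) ~= 0"
  using KK_nz[OF ph xs] lchar_nz[OF lchar_C[OF ph] z] lchar_nz[OF Psi_lchar[OF xs] C_carrier[OF z]] by simp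
qed

lemma uG_independent:
 assumes s: "(SUM ph:Ir. SUM xs:PBW S. scl (c ph xs) (uG ph xs)) = 0" and ze: "ze : Ir" and ys: "ys : PBW S"
 shows "c ze ys = 0"
proof -
 have e: "scl (c ph xs) (uG ph xs) = scl (c ph xs * KK ph xs * Psi xs (gword S ph xs))
   (G.emb (wmon S xs) @@ (G.br (gword S ph xs) @@ GW.EK ph))" if ph: "ph : Ir" and xs: "xs : PBW S" for ph xs
 proof -
  have "G.br (gword S ph xs) @@ (G.emb (wmon S xs) @@ En ph) =
   scl (Psi xs (gword S ph xs)) (G.emb (wmon S xs) @@ (G.br (gword S ph xs) @@ GW.EK ph))"
   using GW.br_wm[OF gword_in[OF ph PBW_letters[OF xs]] PBW_letters[OF xs]]
   by (simp add: PsiK_Psi ePhi_EK G.R.distribs flip: G.R.assoc)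
  thus ?thesis unfolding uG_eq[OF ph PBW_letters[OF xs]] by simp
 qed
 have "(SUM ph:Ir. SUM xs:PBW S. scl (c ph xs * KK ph xs * Psi xs (gword S ph xs))
   (G.emb (wmon S xs) @@ (G.br (gword S ph xs) @@ GW.EK ph))) = 0"
  using s e by simp
 from GW.words_independent[OF _ this ze ys] gword_in PBW_letters
 have "c ze ys * KK ze ys * Psi ys (gword S ze ys) = 0" by blast
 thus ?thesis
  using KK_nz[OF ze PBW_letters[OF ys]] lchar_nz[OF Psi_lchar[OF PBW_letters[OF ys]] gword_in[OF ze PBW_letters[OF ys]]] by simp
qed

lemma uG_nz: "ph : Ir ==> xs : PBW S ==> uG ph xs ~= 0"
proof
 assume ph: "ph : Ir" and xs: "xs : PBW S" and 0: "uG ph xs = 0"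
 have "(SUM ze:Ir. SUM ys:PBW S. scl (if ze = ph & ys = xs then 1 else 0) (uG ze ys)) = 0"
  by (intro sum.neutral ballI) (auto simp: 0)
 from uG_independent[OF this ph xs] show False by simp
qed

text \<open>The scalar exists by \<open>word_scalar\<close>, and it is unique because a PBW word,
  belonging to an independent family, is nonzero.\<close>

lemma qWord_eq:
 assumes ph: "ph : Ir" and xs: "xs : PBW S" and ys: "set ys <= LT"
  and e: "!!h. h : Hc ==> Psi xs h = Psi ys h"
 shows "G.br (gword S ph ys) @@ (G.emb (wmon S xs) @@ En ph) = scl (qWord S ys xs ph) (uG ph xs)"
proof -
 let ?P = "%q. q ~= 0 & G.br (gword S ph ys) @@ G.emb (wmon S xs) @@ En ph = scl q (uG ph xs)"
 have "\<exists>q. ?P q" using word_scalar[OF ph PBW_letters[OF xs] ys e] unfolding G.R.assoc by blast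
 moreover have "q = q'" if "?P q" "?P q'" for q q'
  using that uG_nz[OF ph xs] by (metis fv.scale_right_imp_eq)
 ultimately have "\<exists>!q. ?P q" by blast
 hence "?P (THE q. ?P q)" by (rule theI')
 thus ?thesis unfolding qWord_def G.R.smult_A G.R.assoc by blast
qed

end

lemma uword_cong: "monoid.mult A = monoid.mult B ==> uword S A E U ph xs = uword S B E U ph xs"
 by (induction xs) auto

section \<open>The relations of kP, carried over to the generators\<close>

context block_setting
begin

lemma wPhi_in: "i : LT ==> ph : Ir ==> wPhi S i ph : Gc"
 unfolding wPhi_eq by (intro G.R.closed(1) G.br_in gi_in En_in GW.wl_in)

lemma wPhi_E: "ph : Ir ==> wPhi S i ph @@ En ph = wPhi S i ph"
 unfolding wPhi_eq by (simp add: G.R.assoc ePhi_EK GW.EK_orth)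

lemma E_wPhi:
 assumes i: "i : LT" and ph: "ph : Ir"
 shows "En (tw S ph (psi S i)) @@ wPhi S i ph = wPhi S i ph"
proof -
 have "En (tw S ph (psi S i)) @@ wPhi S i ph = (En (tw S ph (psi S i)) @@ G.br (gi S i ph)) @@ (G.emb (wlift S i) @@ En ph)"
  unfolding wPhi_eq by (simp only: G.R.assoc)
 also have "... = G.br (gi S i ph) @@ ((En (tw S ph (psi S i)) @@ G.emb (wlift S i)) @@ En ph)"
  unfolding ePhi_EK GW.EK_br[OF gi_in[OF i ph]] by (simp only: G.R.assoc)
 also have "... = G.br (gi S i ph) @@ (G.emb (wlift S i) @@ (En ph @@ En ph))"
  unfolding ePhi_EK GW.wl_EK[OF ph i, symmetric] by (simp only: G.R.assoc)
 finally show ?thesis unfolding wPhi_eq by (simp add: ePhi_EK GW.EK_orth ph)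
qed

sublocale GS: word_system S "kG S" "ePhi S" "wPhi S"
proof
 show "En ph @@ En ze = (if ph = ze then En ph else 0)" if "ph : Ir" "ze : Ir" for ph ze
  unfolding ePhi_EK by (rule GW.EK_orth[OF that])
qed (simp_all only: En_in wPhi_in wPhi_E E_wPhi)

lemma KK_single: "i : LT ==> KK ph [i] = 1"
 by (simp add: psi_one)

lemma gword_single: "i : LT ==> ph : Ir ==> gword S ph [i] = gi S i ph"
 using gi_in[of i ph] by simp

lemma uG_single: "ph : Ir ==> uG ph [i] = wPhi S i ph"
 by (simp add: wPhi_E)

text \<open>Multiplying an identity of kP by a group word on the left and a vertex idempotent on the
  right turns each term into a generator or a word, with the scalar of \<open>word_scalar\<close>.
  Equal eigenvalues are known for terms with nonzero coefficient, so zero coefficients are split off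
  first.\<close>

lemma quantum_terms:
 assumes ys: "set ys <= LT" and ph: "ph : Ir"
  and cp: "!!k h. k : LT ==> c k ~= 0 ==> h : Hc ==> psi S k h = Psi ys h"
  and dp: "!!xs h. xs : PBW S ==> d xs ~= 0 ==> h : Hc ==> Psi xs h = Psi ys h"
 shows "G.br (gword S ph ys) @@ (G.emb ((SUM k:LT. scl (c k) (wlift S k)) + (SUM xs:PBW S. scl (d xs) (wmon S xs))) @@ En ph) =
  (SUM k:LT. scl (c k * (psi S k (inv[H] (gi S k ph) *[H] gword S ph ys) * ph (inv[H] (gi S k ph) *[H] gword S ph ys))) (wPhi S k ph)) +
  (SUM xs:PBW S. scl (d xs * qWord S ys xs ph) (uG ph xs))"
proof -
 have k: "scl (c k) (G.br (gword S ph ys) @@ (G.emb (wlift S k) @@ En ph)) =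
   scl (c k * (psi S k (inv[H] (gi S k ph) *[H] gword S ph ys) * ph (inv[H] (gi S k ph) *[H] gword S ph ys))) (wPhi S k ph)"
  if k: "k : LT" for k
 proof (cases "c k = 0")
  case False
  have l: "set [k] <= LT" using k by simp
  have e: "Psi [k] h = Psi ys h" if "h : Hc" for h using cp[OF k False that] by simp
  show ?thesis
   using word_scalar(1)[OF ph l ys e] uG_single[OF ph] KK_single[OF k] gword_single[OF k ph]
   by (simp only: wmon_single[OF k] Psi_simps mult_1_right inverse_1 fv.scale_scale)
 qed simp
 have x: "scl (d xs) (G.br (gword S ph ys) @@ (G.emb (wmon S xs) @@ En ph)) = scl (d xs * qWord S ys xs ph) (uG ph xs)"
  if xs: "xs : PBW S" for xs
 proof (cases "d xs = 0")
  case False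
  thus ?thesis using qWord_eq[OF ph xs ys dp[OF xs False]] by simp
 qed simp
 show ?thesis
  unfolding G.emb_add G.emb_sum G.emb_scl G.R.distribs using k x by simp
qed

text \<open>The commutator [w_i, w_j] is multiplied by g_j g_i on the left, so that w_j w_i has its
  own group word and w_i w_j acquires \<open>zSwap\<close>. The factor \<open>?m\<close> is
  \<open>KK\<close> of the word [j, i]; it normalises the leading term to coefficient 1.\<close>

lemma quantum_comm:
 assumes i: "i : LT" and j: "j : LT" and ph: "ph : Ir"
 shows "wPhi S j (tw S ph (psi S i)) @@ wPhi S i ph - scl (qSwap S i j ph) (wPhi S i (tw S ph (psi S j)) @@ wPhi S j ph)
  + ((SUM k:LT. scl (cLie S i j k * qLie S i j k ph) (wPhi S k ph))
   + (SUM xs:PBW S. scl (inverse (psi S j (gi S i ph)) * qWord S [j, i] xs ph * cErr S i j xs) (uG ph xs))) = 0"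
proof -
 have l: "set [j, i] <= LT" "set [i, j] <= LT" using i j by auto
 let ?m = "inverse (psi S j (gi S i ph))"
 let ?B = "%v. G.br (gword S ph [j, i]) @@ (G.emb v @@ En ph)"
 have u: "uG ph [j, i] = wPhi S j (tw S ph (psi S i)) @@ wPhi S i ph" "uG ph [i, j] = wPhi S i (tw S ph (psi S j)) @@ wPhi S j ph"
  using wPhi_E[OF ph] by simp_all
 have K: "KK ph [j, i] = ?m" "KK ph [i, j] = inverse (psi S i (gi S j ph))"
  using gi_in[OF i ph] gi_in[OF j ph] psi_one[OF i] psi_one[OF j] by simp_all
 have 1: "scl ?m (?B (wmon S [j, i])) = uG ph [j, i]" unfolding uG_eq[OF ph l(1)] K(1) ..
 have g: "gi S i ph : Hc" "gi S j ph : Hc" using gi_in i j ph by blast+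
 have z: "zSwap S i j ph : Hc"
  unfolding zSwap_def using gword_in[OF ph l(1)] gword_in[OF ph l(2)] by (intro H.m_closed H.inv_closed)
 have 2: "scl ?m (?B (wmon S [i, j])) = scl (qSwap S i j ph) (uG ph [i, j])"
 proof -
  have "Psi [i, j] h = Psi [j, i] h" for h by simp
  from word_scalar(1)[OF ph l(2) l(1) this]
  have "?B (wmon S [i, j]) = scl (Psi [i, j] (zSwap S i j ph) * ph (zSwap S i j ph) * psi S i (gi S j ph)) (uG ph [i, j])"
   unfolding zSwap_def[symmetric] K(2) inverse_inverse_eq .
  thus ?thesis
   unfolding qSwap_def using g z by (simp add: psi_mult[OF i] psi_mult[OF j] psi_inv[OF j] ac_simps)
 qed
 have L: "wmon S [i, j] - wmon S [j, i] = (SUM k:LT. scl (cLie S i j k) (wlift S k)) + (SUM xs:PBW S. scl (cErr S i j xs) (wmon S xs))"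
  using comm_eq[OF i j] i j by (simp add: wmon_Cons wmon_Nil kP.one_r wlift_carrier yComm_eq)
 have "?B (wmon S [i, j]) - ?B (wmon S [j, i]) = ?B (wmon S [i, j] - wmon S [j, i])"
  by (simp only: G.emb_diff G.R.diff_l G.R.diff_r)
 also have "... = (SUM k:LT. scl (cLie S i j k * (psi S k (zLie S i j k ph) * ph (zLie S i j k ph))) (wPhi S k ph)) +
  (SUM xs:PBW S. scl (cErr S i j xs * qWord S [j, i] xs ph) (uG ph xs))"
  unfolding L zLie_def by (rule quantum_terms[OF l(1) ph comm_psi(1)[OF i j] comm_psi(2)[OF i j]])
 finally have "scl ?m (?B (wmon S [i, j])) - scl ?m (?B (wmon S [j, i])) =
  scl ?m ((SUM k:LT. scl (cLie S i j k * (psi S k (zLie S i j k ph) * ph (zLie S i j k ph))) (wPhi S k ph)) +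
  (SUM xs:PBW S. scl (cErr S i j xs * qWord S [j, i] xs ph) (uG ph xs)))"
  by (simp only: fv.scale_right_diff_distrib[symmetric])
 also have "... = (SUM k:LT. scl (cLie S i j k * qLie S i j k ph) (wPhi S k ph))
   + (SUM xs:PBW S. scl (inverse (psi S j (gi S i ph)) * qWord S [j, i] xs ph * cErr S i j xs) (uG ph xs))"
  unfolding fv.scale_right_distrib fv.scale_sum_right fv.scale_scale qLie_def
  by (intro arg_cong2[where f = "(+)"] sum.cong refl) (simp_all only: ac_simps)
 finally show ?thesis unfolding 1 2 u by (simp add: algebra_simps)
qed

lemma gword_replicate_psi:
 assumes i: "i : LT" and ph: "ph : Ir"
 shows "psi S i (gword S ph (replicate n i)) = (\<Prod>a<n. psi S i (gi S i (tws S ph (replicate a i))))"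
proof (induction n)
 case 0
 show ?case using psi_one[OF i] by simp
next
 case (Suc n)
 have l: "set (replicate n i) <= LT" using i by auto
 show ?case
  using Suc psi_mult[OF i gi_in[OF i tws_IrrZ[OF ph l]] gword_in[OF ph l]] by (simp add: mult.commute)
qed

text \<open>The element g at the a-th vertex has to pass the n - a letters to its left; for n = p -
  1 these are the exponents in \<open>kappa\<close>.\<close>

lemma KK_replicate:
 assumes i: "i : LT" and ph: "ph : Ir"
 shows "KK ph (replicate (Suc n) i) = (\<Prod>a<n. inverse (psi S i (gi S i (tws S ph (replicate a i)))) ^ (n - a))"
proof (induction n)
 case 0
 show ?case using psi_one[OF i] by simp
next
 case (Suc n)
 let ?x = "%a. inverse (psi S i (gi S i (tws S ph (replicate a i))))"
 have "KK ph (replicate (Suc (Suc n)) i) = KK ph (replicate (Suc n) i) * inverse (psi S i (gword S ph (replicate (Suc n) i)))" by simp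
 also have "inverse (psi S i (gword S ph (replicate (Suc n) i))) = (\<Prod>a<Suc n. ?x a)"
  unfolding gword_replicate_psi[OF i ph] by (rule prod_inversef[unfolded o_def, symmetric])
 also have "KK ph (replicate (Suc n) i) = (\<Prod>a<Suc n. ?x a ^ (n - a))" unfolding Suc by simp
 also have "(\<Prod>a<Suc n. ?x a ^ (n - a)) * (\<Prod>a<Suc n. ?x a) = (\<Prod>a<Suc n. ?x a ^ (Suc n - a))"
  unfolding prod.distrib[symmetric] by (intro prod.cong refl) (simp add: Suc_diff_le)
 finally show ?case .
qed

lemma KK_kappa:
 assumes i: "i : LT" and ph: "ph : Ir"
 shows "KK ph (replicate CHAR('k) i) = kappa S i ph"
proof -
 have "CHAR('k) = Suc (CHAR('k) - 1)" using char_ge2 by simp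
 thus ?thesis using KK_replicate[OF i ph, of "CHAR('k) - 1"] by (simp add: kappa_def)
qed

lemma quantum_pow:
 assumes i: "i : LT" and ph: "ph : Ir"
 shows "uG ph (replicate CHAR('k) i) =
  (SUM k:LT. scl (dLie S i k * qPow S i k ph) (wPhi S k ph))
  + (SUM xs:PBW S. scl (kappa S i ph * qWord S (replicate CHAR('k) i) xs ph * dErr S i xs) (uG ph xs))"
proof -
 have l: "set (replicate CHAR('k) i) <= LT" using i by auto
 have "uG ph (replicate CHAR('k) i) = scl (kappa S i ph) (G.br (gword S ph (replicate CHAR('k) i)) @@
  (G.emb ((SUM k:LT. scl (dLie S i k) (wlift S k)) + (SUM xs:PBW S. scl (dErr S i xs) (wmon S xs))) @@ En ph))"
  unfolding uG_eq[OF ph l] KK_kappa[OF i ph] pow_eq[OF i] yPow_eq ..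
 also have "... = scl (kappa S i ph) ((SUM k:LT. scl (dLie S i k * (psi S k (zPow S i k ph) * ph (zPow S i k ph))) (wPhi S k ph)) +
  (SUM xs:PBW S. scl (dErr S i xs * qWord S (replicate CHAR('k) i) xs ph) (uG ph xs)))"
  unfolding zPow_def by (subst quantum_terms[OF l ph pow_psi(1)[OF i] pow_psi(2)[OF i]]) auto
 also have "... = (SUM k:LT. scl (dLie S i k * qPow S i k ph) (wPhi S k ph))
  + (SUM xs:PBW S. scl (kappa S i ph * qWord S (replicate CHAR('k) i) xs ph * dErr S i xs) (uG ph xs))"
  unfolding fv.scale_right_distrib fv.scale_sum_right fv.scale_scale qPow_def
  by (intro arg_cong2[where f = "(+)"] sum.cong refl) (simp_all only: ac_simps)
 finally show ?thesis .
qed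

text \<open>Averaging over \<open>H\<close> projects to the eigenspace of \<open>\<psi>\<^sub>k\<close>, and so removes the words with
  another eigenvalue.\<close>

lemma wlift_words:
 assumes k: "k : LT"
 shows "wlift S k : fv.span (wmon S ` {is. set is <= D1 & is ~= [] & (ALL h:Hc. Psi is h = psi S k h)})"
proof -
 let ?W = "wmon S ` {is. set is <= D1 & is ~= []}"
 let ?W' = "wmon S ` {is. set is <= D1 & is ~= [] & (ALL h:Hc. Psi is h = psi S k h)}"
 define av where "av x = (SUM h:Hc. scl (inverse (psi S k h)) (G.br h @@ (G.emb x @@ G.br (inv[H] h))))" for x
 have D: "D1 <= LT" by (auto simp: D1_def)
 have m: "av (wmon S xs) = scl (SUM h:Hc. inverse (psi S k h) * Psi xs h) (G.emb (wmon S xs))"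
  if xs: "set xs <= LT" for xs
 proof -
  have "G.br h @@ (G.emb (wmon S xs) @@ G.br (inv[H] h)) = scl (Psi xs h) (G.emb (wmon S xs))" if h: "h : Hc" for h
  proof -
   have "G.br h @@ (G.emb (wmon S xs) @@ G.br (inv[H] h)) = (G.br h @@ G.emb (wmon S xs)) @@ G.br (inv[H] h)" by (simp only: G.R.assoc)
   also have "... = scl (Psi xs h) (G.emb (wmon S xs) @@ (G.br h @@ G.br (inv[H] h)))"
    unfolding GW.br_wm[OF h xs] PsiK_Psi by (simp only: G.R.distribs G.R.assoc)
   finally show ?thesis using h by (simp add: G.br_mult G.one_br[symmetric] G.R.one_r GW.wm_in[OF xs])
  qed
  thus ?thesis by (simp add: av_def fv.scale_sum_left)
 qed
 have lin: "av (scl c x + y) = scl c (av x) + av y" for c x y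
  unfolding av_def G.emb_add G.emb_scl G.R.distribs
  by (simp add: fv.scale_right_distrib sum.distrib fv.scale_sum_right mult.commute)
 have "wlift S k : J 1" using wlift_J[OF k] kP.augpow_mono[OF wdeg_pos[OF k]] by blast
 hence "wlift S k : fv.span ?W" by (rule J1_span_words)
 hence "av (wlift S k) : G.emb ` fv.span ?W'"
 proof (induction rule: fv.span_induct_alt)
  case base
  have "av 0 = 0" by (simp add: av_def G.emb_0)
  thus ?case using G.emb_0 fv.span_zero by force
 next
  case (step c x y)
  then obtain xs t where x: "x = wmon S xs" "set xs <= D1" "xs ~= []" and t: "av y = G.emb t" "t : fv.span ?W'" by blast
  have xl: "set xs <= LT" using x(2) D by blast
  have "EX t':fv.span ?W'. av x = G.emb t'"
  proof (cases "ALL h:Hc. Psi xs h = psi S k h")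
   case True
   hence "wmon S xs : ?W'" using x by blast
   thus ?thesis
    using m[OF xl] unfolding x(1) by (intro bexI[of _ "scl (SUM h:Hc. inverse (psi S k h) * Psi xs h) (wmon S xs)"])
     (auto simp: G.emb_scl intro: fv.span_scale fv.span_base)
  next
   case False
   then obtain h0 where h0: "h0 : Hc" "Psi xs h0 ~= psi S k h0" by blast
   have l: "lchar H (Hc) (%h. inverse (psi S k h) * Psi xs h)"
    using psi_lchar[OF k] Psi_lchar[OF xl] by (simp add: lchar_def)
   have "inverse (psi S k h0) * Psi xs h0 ~= 1" using h0 psi_nz[OF k h0(1)] by (simp add: field_simps)
   hence "(SUM h:Hc. inverse (psi S k h) * Psi xs h) = 0" by (rule H.sum_lchar[OF H.subgroup_self l h0(1)])
   thus ?thesis using m[OF xl] x(1) fv.span_zero G.emb_0 by (intro bexI[of _ 0]) auto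
  qed
  then obtain t' where t': "t' : fv.span ?W'" "av x = G.emb t'" by blast
  have "av (scl c x + y) = G.emb (scl c t' + t)" unfolding lin t'(2) t(1) by (simp add: G.emb_add G.emb_scl)
  thus ?case using t'(1) t(2) by (auto intro!: imageI fv.span_add fv.span_scale)
 qed
 then obtain t where t: "t : fv.span ?W'" "av (wlift S k) = G.emb t" by blast
 have kl: "set [k] <= LT" using k by simp
 have "(SUM h:Hc. inverse (psi S k h) * Psi [k] h) = (SUM h:Hc. 1 :: 'k)"
  by (rule sum.cong[OF refl]) (simp add: psi_nz[OF k])
 hence "G.emb (scl (of_nat (card (Hc))) (wlift S k)) = G.emb t"
  using m[OF kl] t(2) by (simp add: wmon_single[OF k] G.emb_scl del: Psi_simps)
 hence "scl (of_nat (card (Hc))) (wlift S k) = t" by (rule G.emb_inj)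
 hence "wlift S k = scl (inverse (of_nat (card (Hc)))) t"
  using card_nz[OF H.subgroup_self] by auto
 thus ?thesis using t(1) fv.span_scale by simp
qed

lemma wmon_long: "set is <= D1 ==> rad_length (kP S) <= length is ==> wmon S is = 0"
proof -
 assume a: "set is <= D1" "rad_length (kP S) <= length is"
 have "wt is = length is" using a(1) by (induction "is") (auto simp: D1_def)
 moreover have "set is <= LT" using a(1) by (auto simp: D1_def)
 ultimately have "wmon S is : J (length is)" using wmon_J[of "is"] by simp
 thus ?thesis using kP.augpow_mono[OF a(2)] J_top by blast
qed

subsection \<open>The algebra generated by the arrows\<close>

definition SA where "SA = fv.span {uG ph xs | ph xs. ph : Ir & xs : PBW S}"

text \<open>The word is straightened in kP instead of kG: its monomial is expanded in PBW monomials,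
  those with nonzero coefficient have the same eigenvalue, and for them the same group word gives a
  multiple of the PBW word \<open>uG ph xs\<close>. This is what closes the span under
  products.\<close>

lemma uG_SA:
 assumes ph: "ph : Ir" and ys: "set ys <= LT" shows "uG ph ys : SA"
proof -
 have "wmon S ys : J 0" using wmon_carrier[OF ys] by (simp add: kP.augpow_0)
 then obtain a where a: "wmon S ys = (SUM xs:PBW S. scl (a xs) (wmon S xs))" using PBW_expand by blast
 have p: "Psi xs h = Psi ys h" if "xs : PBW S" "a xs ~= 0" "h : Hc" for xs h
  using expansion_eigen[OF a that(3) GW.br_wm[OF that(3) ys, unfolded PsiK_Psi] that(1,2)] .
 have "scl (a xs) (G.br (gword S ph ys) @@ (G.emb (wmon S xs) @@ En ph)) : SA" if xs: "xs : PBW S" for xs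
 proof (cases "a xs = 0")
  case False
  have "uG ph xs : SA" unfolding SA_def using ph xs by (intro fv.span_base) blast
  moreover obtain q where q: "G.br (gword S ph ys) @@ (G.emb (wmon S xs) @@ En ph) = scl q (uG ph xs)"
   by (rule that[OF word_scalar(1)[OF ph PBW_letters[OF xs] ys p[OF xs False]]])
  ultimately show ?thesis
   unfolding q SA_def by (intro fv.span_scale)
 qed (simp add: SA_def fv.span_zero)
 hence 1: "(SUM xs:PBW S. scl (a xs) (G.br (gword S ph ys) @@ (G.emb (wmon S xs) @@ En ph))) : SA"
  unfolding SA_def by (rule fv.span_sum)
 have "uG ph ys = scl (KK ph ys) (G.br (gword S ph ys) @@ (G.emb (wmon S ys) @@ En ph))" by (rule uG_eq[OF ph ys])
 also have "G.br (gword S ph ys) @@ (G.emb (wmon S ys) @@ En ph) =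
   (SUM xs:PBW S. scl (a xs) (G.br (gword S ph ys) @@ (G.emb (wmon S xs) @@ En ph)))"
  by (subst a) (simp only: G.emb_sum G.emb_scl G.R.distribs)
 finally show ?thesis using 1 fv.span_scale unfolding SA_def by simp
qed

lemma SA_mult: "x : SA ==> y : SA ==> x @@ y : SA"
 unfolding SA_def
proof (rule G.R.span_mul, assumption, assumption)
 fix b c assume "b : {uG ph xs | ph xs. ph : Ir & xs : PBW S}" "c : {uG ph xs | ph xs. ph : Ir & xs : PBW S}"
 then obtain ze xs ph ys where b: "b = uG ze xs" "ze : Ir" "xs : PBW S" and c: "c = uG ph ys" "ph : Ir" "ys : PBW S" by blast
 have "set (xs @ ys) <= LT" using PBW_letters[OF b(3)] PBW_letters[OF c(3)] by simp
 hence "uG ph (xs @ ys) : SA" by (rule uG_SA[OF c(2)])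
 thus "b @@ c : fv.span {uG ph xs | ph xs. ph : Ir & xs : PBW S}"
  using GS.uA_mult[OF b(2) c(2) PBW_letters[OF b(3)] PBW_letters[OF c(3)]] b(1) c(1)
  by (auto simp: SA_def fv.span_zero)
qed simp

end

section \<open>The sum of the vertex idempotents, and the algebra of PBW words\<close>

context block_setting
begin

definition eZ where "eZ = char_idem (grpP S) (grpH S) (subZ S) (chi S)"

lemma eZ_eq: "eZ = scl (inverse (of_nat (card (subZ S)))) (SUM h:subZ S. scl (chi S (inv[H] h)) (G.br h))"
 by (auto simp: eZ_def char_idem_def fun_eq_iff pointwise sum_apply)

lemma Nil_PBW: "[] : PBW S"
 by (simp add: PBW_def)

lemma En_nz: "ph : Ir ==> En ph ~= 0"
 using uG_nz[OF _ Nil_PBW, of ph] by simp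

lemma br_En: "ph : Ir ==> z : C ==> G.br z @@ En ph = scl (ph z) (En ph)"
 unfolding ePhi_EK by (rule GW.br_EK)

lemma En_br: "h : Hc ==> En ph @@ G.br h = G.br h @@ En ph"
 unfolding ePhi_EK by (rule GW.EK_br)

lemma En_orth: "ph : Ir ==> ze : Ir ==> En ph @@ En ze = (if ph = ze then En ph else 0)"
 by (rule GS.E_orth)

lemma eZ_En: assumes ph: "ph : Ir" shows "eZ @@ En ph = En ph"
proof -
 have "eZ @@ En ph = scl (inverse (of_nat (card (subZ S))) * (SUM h:subZ S. 1)) (En ph)"
 proof -
  have "scl (chi S (inv[H] h)) (G.br h @@ En ph) = scl 1 (En ph)" if h: "h : subZ S" for h
   using br_En[OF ph Z_C[OF h]] IrrZ_Z[OF ph h] H.lchar_inv[OF lchar_Z sub_Z h] lchar_nz[OF lchar_Z h] by simp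
  hence "(SUM h:subZ S. scl (chi S (inv[H] h)) (G.br h @@ En ph)) = (SUM h:subZ S. scl 1 (En ph))" by (rule sum.cong[OF refl])
  thus ?thesis unfolding eZ_eq G.R.distribs by (simp only: fv.scale_sum_left[symmetric] fv.scale_scale)
 qed
 thus ?thesis using card_nz[OF sub_Z] by simp
qed

text \<open>A character of Z(H) that is trivial on Z but not at \<open>x\<close> exists by
  \<open>lchar_separates\<close>. Multiplying by it permutes \<open>IrrZ\<close> and scales the sum
  by its value at \<open>x\<close>, which is not 1.\<close>

lemma sum_IrrZ_zero:
 assumes x: "x : C" "x \<notin> subZ S" shows "(SUM ph:Ir. ph x) = 0"
proof -
 interpret CG: group "H\<lparr>carrier := C\<rparr>" by (rule subgroup.subgroup_is_group[OF sub_C H_group])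
 have "\<exists>l'. lchar (H\<lparr>carrier := C\<rparr>) (carrier (H\<lparr>carrier := C\<rparr>)) l' & (ALL b:subZ S. l' b = (1 :: 'k)) & l' x ~= 1"
 proof (rule CG.lchar_separates)
  show "finite (carrier (H\<lparr>carrier := C\<rparr>))" using C_fin by simp
  show "a *[H\<lparr>carrier := C\<rparr>] b = b *[H\<lparr>carrier := C\<rparr>] a" if "a : carrier (H\<lparr>carrier := C\<rparr>)" "b : carrier (H\<lparr>carrier := C\<rparr>)" for a b
   using C_comm[of a b] C_carrier[of b] that by simp
  show "of_nat (Coset.order (H\<lparr>carrier := C\<rparr>)) ~= (0 :: 'k)" using card_nz[OF sub_C] by (simp add: Coset.order_def)
  show "subgroup (subZ S) (H\<lparr>carrier := C\<rparr>)" by (rule H.subgroup_incl[OF sub_Z sub_C Z_central])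
  show "lchar (H\<lparr>carrier := C\<rparr>) (carrier (H\<lparr>carrier := C\<rparr>)) (%_. 1 :: 'k)" by (simp add: lchar_def)
 qed (use x in simp_all)
 then obtain l where l: "lchar H C l" "!!b. b : subZ S ==> l b = (1 :: 'k)" "l x ~= 1" by (auto simp: lchar_def)
 define t where "t ph = (\<lambda>h\<in>C. ph h * l h)" for ph
 have t_in: "t ph : Ir" if ph: "ph : Ir" for ph
 proof (rule IrrZI)
  show "lchar H C (t ph)"
   using lchar_C[OF ph] l(1) subgroup.m_closed[OF sub_C] by (simp add: lchar_def t_def)
  show "t ph : extensional C" by (simp add: t_def)
  show "t ph z = chi S z" if "z : subZ S" for z using that Z_C IrrZ_Z[OF ph] l(2) by (simp add: t_def)
 qed
 have "inj_on t (Ir)"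
 proof (rule inj_onI)
  fix ph ze assume ph: "ph : Ir" "ze : Ir" and e: "t ph = t ze"
  show "ph = ze"
  proof (rule extensionalityI[OF IrrZ_ext[OF ph(1)] IrrZ_ext[OF ph(2)]])
   fix h assume h: "h : C"
   hence "ph h * l h = ze h * l h" using arg_cong[OF e, of "%f. f h"] by (simp add: t_def)
   thus "ph h = ze h" using lchar_nz[OF l(1) h] by simp
  qed
 qed
 hence "bij_betw t (Ir) (Ir)"
  using endo_inj_surj[OF finite_IrrZ, of t] t_in by (auto simp: bij_betw_def)
 hence "(SUM ph:Ir. ph x) = (SUM ph:Ir. t ph x)" by (rule sum.reindex_bij_betw[symmetric])
 also have "... = (SUM ph:Ir. ph x) * l x" using x(1) by (simp add: t_def sum_distrib_right)
 finally have "(SUM ph:Ir. ph x) * (1 - l x) = 0" by (simp add: algebra_simps)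
 thus ?thesis using l(3) by simp
qed

text \<open>In the double sum the coefficients outside Z vanish, so the sum is a multiple of
  \<open>eZ\<close>. Both act as the identity on the vertex idempotent of \<open>phi0\<close>, which
  fixes the factor as 1.\<close>

lemma sum_En: "(SUM ph:Ir. En ph) = eZ"
proof -
 let ?f = "SUM ph:Ir. En ph"
 have fE: "?f @@ En ph = En ph" if "ph : Ir" for ph
  using finite_IrrZ that by (simp add: G.R.sum_l En_orth)
 have "?f = scl (inverse (of_nat (card C))) (SUM ph:Ir. SUM h:C. scl (ph (inv[H] h)) (G.br h))"
  unfolding ePhi_EK GW.EK_eq by (simp only: fv.scale_sum_right)
 also have "(SUM ph:Ir. SUM h:C. scl (ph (inv[H] h)) (G.br h)) = (SUM h:C. scl (SUM ph:Ir. ph (inv[H] h)) (G.br h))"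
  by (subst sum.swap) (simp only: fv.scale_sum_left)
 also have "... = (SUM h:subZ S. scl (SUM ph:Ir. ph (inv[H] h)) (G.br h))"
 proof (rule sum.mono_neutral_right[OF C_fin Z_central], rule ballI)
  fix h assume h: "h : C - subZ S"
  have "inv[H] h \<notin> subZ S"
  proof
   assume "inv[H] h : subZ S"
   hence "inv[H] (inv[H] h) : subZ S" by (rule subgroup.m_inv_closed[OF sub_Z])
   thus False using h C_carrier by simp
  qed
  hence "(SUM ph:Ir. ph (inv[H] h)) = 0"
   using h subgroup.m_inv_closed[OF sub_C] by (intro sum_IrrZ_zero) auto
  thus "scl (SUM ph:Ir. ph (inv[H] h)) (G.br h) = 0" by simp
 qed
 also have "... = scl (of_nat (card (Ir))) (SUM h:subZ S. scl (chi S (inv[H] h)) (G.br h))"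
 proof -
  have "(SUM ph:Ir. ph (inv[H] h)) = of_nat (card (Ir)) * chi S (inv[H] h)" if h: "h : subZ S" for h
  proof -
   have "(SUM ph:Ir. ph (inv[H] h)) = (SUM ph:Ir. chi S (inv[H] h))"
    by (rule sum.cong[OF refl]) (rule IrrZ_Z[OF _ subgroup.m_inv_closed[OF sub_Z h]])
   thus ?thesis by simp
  qed
  thus ?thesis by (simp add: fv.scale_sum_right)
 qed
 also have "(SUM h:subZ S. scl (chi S (inv[H] h)) (G.br h)) = scl (of_nat (card (subZ S))) eZ"
  unfolding eZ_eq using card_nz[OF sub_Z] by simp
 finally obtain c where c: "?f = scl c eZ" by (simp only: fv.scale_scale)
 have "scl c (En (phi0 S)) = scl 1 (En (phi0 S))"
  using fE[OF phi0] eZ_En[OF phi0] unfolding c by (simp add: G.R.distribs)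
 hence "c = 1" using En_nz[OF phi0] by (metis fv.scale_right_imp_eq)
 thus ?thesis using c by simp
qed

lemma En_eZ: "ph : Ir ==> En ph @@ eZ = En ph"
 unfolding sum_En[symmetric] using finite_IrrZ by (simp add: G.R.sum_r En_orth)

lemma eZ_in: "eZ : Gc"
 unfolding sum_En[symmetric] by (intro G.R.closed En_in)

lemma eZ_idem: "eZ @@ eZ = eZ"
proof -
 have "eZ @@ (SUM ph:Ir. En ph) = (SUM ph:Ir. En ph)" by (simp add: G.R.sum_r eZ_En)
 thus ?thesis by (simp add: sum_En)
qed

lemma eZ_nz: "eZ ~= 0"
 using eZ_En[OF phi0] En_nz[OF phi0] by auto

lemma kGe_eq: "kGe S = corner_alg (kG S) eZ"
 by (simp add: kGe_def eZ_def)

lemma kGe_simps [simp]: "monoid.mult (kGe S) = monoid.mult (kG S)" "#1[kGe S] = eZ"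
 by (simp_all add: kGe_eq corner_alg_def)

sublocale Ge: fun_alg "kGe S"
 unfolding kGe_eq by (rule G.R.corner_fun_alg[OF eZ_in eZ_idem])

lemma kGe_carrier: "x : Ec \<longleftrightarrow> x : Gc & eZ @@ x = x & x @@ eZ = x"
 unfolding kGe_eq by (rule G.R.corner_carrier[OF eZ_in eZ_idem])

lemma uG_kGe:
 assumes ph: "ph : Ir" and xs: "set xs <= LT" shows "uG ph xs : Ec"
proof -
 have "eZ @@ uG ph xs = eZ @@ (En (tws S ph xs) @@ uG ph xs)" by (simp only: GS.E_uA[OF ph xs])
 also have "... = En (tws S ph xs) @@ uG ph xs" using eZ_En[OF tws_IrrZ[OF ph xs]] by (simp flip: G.R.assoc)
 finally have 1: "eZ @@ uG ph xs = uG ph xs" by (simp only: GS.E_uA[OF ph xs])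
 have "uG ph xs @@ eZ = (uG ph xs @@ En ph) @@ eZ" by (simp only: GS.uA_E[OF ph xs])
 also have "... = uG ph xs @@ En ph" by (simp only: G.R.assoc En_eZ[OF ph])
 finally have "uG ph xs @@ eZ = uG ph xs" by (simp only: GS.uA_E[OF ph xs])
 thus ?thesis using 1 GS.uA_in[OF ph xs] by (simp add: kGe_carrier)
qed

lemma SA_sub: "fv.subspace SA"
 by (simp add: SA_def)

lemma SA_kGe: "SA <= Ec"
 unfolding SA_def using uG_kGe PBW_letters by (intro fv.span_minimal[OF _ Ge.sub_A]) blast

lemma En_SA: "ph : Ir ==> En ph : SA"
 using uG_SA[of ph "[]"] by simp

lemma eZ_SA: "eZ : SA"
 unfolding sum_En[symmetric] by (intro fv.subspace_sum[OF SA_sub] En_SA)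

lemma wPhi_SA: "i : LT ==> ph : Ir ==> wPhi S i ph : SA"
 using uG_SA[of ph "[i]"] uG_single[of ph i] by simp

lemma frakA_eq: "frakA S = (kG S)\<lparr>carrier := SA, one := eZ\<rparr>"
proof -
 let ?T = "En ` Ir \<union> {wPhi S i ph | i ph. i : LT & ph : Ir}"
 let ?F = "{B. subring B (kGe S) & (\<forall>c. ALL x:B. c *.[kGe S] x : B) & ?T <= B}"
 interpret ring "kGe S" by (rule Ge.ring_A)
 have "\<Inter>?F = SA"
 proof
  have "subring SA (kGe S)"
  proof (rule subringI[OF SA_kGe])
   show "#1[kGe S] : SA" using eZ_SA by simp
   show "\<ominus>\<^bsub>kGe S\<^esub> h : SA" if "h : SA" for h
    using that SA_kGe fv.subspace_neg[OF SA_sub] by (subst Ge.a_inv_A) auto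
   show "h1 *[kGe S] h2 : SA" if "h1 : SA" "h2 : SA" for h1 h2 using SA_mult[OF that] by simp
   show "h1 +[kGe S] h2 : SA" if "h1 : SA" "h2 : SA" for h1 h2
    using fv.subspace_add[OF SA_sub that] by (simp add: Ge.add_A)
  qed
  moreover have "\<forall>c. ALL x:SA. c *.[kGe S] x : SA" using fv.subspace_scale[OF SA_sub] by (simp add: Ge.smult_A)
  moreover have "?T <= SA" using En_SA wPhi_SA by blast
  ultimately show "\<Inter>?F <= SA" by blast
  show "SA <= \<Inter>?F"
  proof (rule Inter_greatest)
   fix B assume "B : ?F"
   hence B: "subring B (kGe S)" "!!c x. x : B ==> scl c x : B" "?T <= B" by (auto simp: Ge.smult_A)
   have T: "En ph : B" "i : LT ==> wPhi S i ph : B" if "ph : Ir" for i ph using B(3) that by blast+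
   have sub: "fv.subspace B"
    using subringE(2,7)[OF B(1)] B(2) by (simp add: fv.subspace_def Ge.zero_A Ge.add_A)
   have "uG ph xs : B" if ph: "ph : Ir" and xs: "set xs <= LT" for ph xs
    using xs
   proof (induction xs)
    case (Cons i xs)
    hence "wPhi S i (tws S ph xs) : B" "uG ph xs : B" using T(2) tws_IrrZ[OF ph, of xs] by simp_all
    thus ?case using subringE(6)[OF B(1)] by simp
   qed (simp add: T(1) ph)
   thus "SA <= B" unfolding SA_def using PBW_letters by (intro fv.span_minimal[OF _ sub]) blast
  qed
 qed
 thus ?thesis by (simp add: frakA_def gen_subalg_def kGe_eq corner_alg_def)
qed

lemma frakA_simps: "monoid.mult (frakA S) = monoid.mult (kG S)" "#1[frakA S] = eZ" "carrier (frakA S) = SA"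
 by (simp_all add: frakA_eq)

lemma uG_frakA: "uword S (frakA S) (ePhi S) (wPhi S) ph xs = uG ph xs"
 by (rule uword_cong[OF frakA_simps(1)])

lemma eZ_SA_l: "x : SA ==> eZ @@ x = x" and eZ_SA_r: "x : SA ==> x @@ eZ = x"
 using SA_kGe kGe_carrier by blast+

lemma frakA_alg: "fun_alg (frakA S)"
 unfolding frakA_eq
 by (rule G.R.sub_algebra[OF SA_sub _ eZ_SA SA_mult eZ_SA_l eZ_SA_r]) (use SA_kGe kGe_carrier in blast)

text \<open>By \<open>wlift_words\<close> the lift is a combination of words with its own
  eigenvalue; these lead to the same vertex and share the group word up to a central
  element.\<close>

lemma quantum_generated:
 assumes k: "k : LT" and ph: "ph : Ir"
 shows "wPhi S k ph : fv.span (uG ph ` {is. set is <= D1 & is ~= [] & tws S ph is = tw S ph (psi S k)})"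
proof -
 let ?V = "fv.span (uG ph ` {is. set is <= D1 & is ~= [] & tws S ph is = tw S ph (psi S k)})"
 have D: "D1 <= LT" by (auto simp: D1_def)
 have kl: "set [k] <= LT" using k by simp
 have "G.br (gi S k ph) @@ (G.emb (wlift S k) @@ En ph) : ?V"
  using wlift_words[OF k]
 proof (induction rule: fv.span_induct_alt)
  case base
  show ?case by (simp add: G.emb_0 fv.span_zero)
 next
  case (step c x y)
  then obtain xs where x: "x = wmon S xs" "set xs <= D1" "xs ~= []" "ALL h:Hc. Psi xs h = psi S k h" by blast
  have l: "set xs <= LT" using x(2) D by blast
  have e: "Psi xs h = Psi [k] h" if "h : Hc" for h using x(4) that by simp
  have "tws S ph xs = tws S ph [k]" using e C_carrier by (intro tws_eqI ph l kl) blast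
  hence "uG ph xs : ?V" using x by (intro fv.span_base) auto
  moreover obtain q where "G.br (gword S ph [k]) @@ (G.emb (wmon S xs) @@ En ph) = scl q (uG ph xs)"
   by (rule that[OF word_scalar(1)[OF ph l kl e]])
  ultimately have "G.br (gi S k ph) @@ (G.emb x @@ En ph) : ?V"
   unfolding gword_single[OF k ph] x(1) by (simp add: fv.span_scale)
  thus ?case using step(2) by (simp add: G.emb_add G.emb_scl G.R.distribs fv.span_add fv.span_scale)
 qed
 thus ?thesis by (simp only: wPhi_eq)
qed

theorem quantum_presentation: "presented_by S (quantum_scalars S) (frakA S) (ePhi S) (wPhi S)"
proof -
 interpret A: fun_alg "frakA S" by (rule frakA_alg)
 interpret W: word_system S "frakA S" "ePhi S" "wPhi S"
  by unfold_locales (simp_all only: frakA_simps En_SA wPhi_SA En_orth E_wPhi wPhi_E)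
 interpret quiver_presentation S "frakA S" "ePhi S" "wPhi S" "quantum_scalars S" "GW.NN"
 proof unfold_locales
  show "(SUM ph:Ir. En ph) = #1[frakA S]" by (simp only: sum_En frakA_simps)
  show "fv.subspace GW.NN" by (rule GW.NN_sub)
  fix ph assume ph: "ph : Ir"
  show "En ph \<notin> GW.NN" unfolding ePhi_EK by (rule GW.NN_words(2)[OF H.one_closed _ ph, of "[]"]) simp
  show "uword S (frakA S) (ePhi S) (wPhi S) ph xs : GW.NN" if xs: "set xs <= LT" "xs ~= []" for xs
  proof -
   have "G.br (gword S ph xs) @@ (G.emb (wmon S xs) @@ En ph) =
    scl (Psi xs (gword S ph xs)) (G.emb (wmon S xs) @@ (G.br (gword S ph xs) @@ GW.EK ph))"
    using GW.br_wm[OF gword_in[OF ph xs(1)] xs(1)] by (simp add: PsiK_Psi ePhi_EK G.R.distribs flip: G.R.assoc)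
   thus ?thesis
    unfolding uG_frakA uG_eq[OF ph xs(1)]
    using GW.NN_words(1)[OF gword_in[OF ph xs(1)] xs(1,2)] fv.subspace_scale[OF GW.NN_sub] by simp
  qed
  show "uword S (frakA S) (ePhi S) (wPhi S) ph xs = 0" if xs: "set xs <= D1" "rad_length (kP S) <= length xs" for xs
  proof -
   have "set xs <= LT" using xs(1) by (auto simp: D1_def)
   thus ?thesis unfolding uG_frakA by (simp add: uG_eq[OF ph] wmon_long[OF xs] G.emb_0)
  qed
  fix i assume i: "i : LT"
  show "wPhi S i ph : fv.span (uword S (frakA S) (ePhi S) (wPhi S) ph ` {is. set is <= D1 & is ~= [] & tws S ph is = tw S ph (psi S i)})"
   unfolding uG_frakA by (rule quantum_generated[OF i ph])
  show "uword S (frakA S) (ePhi S) (wPhi S) ph (replicate CHAR('k) i) =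
    (SUM k:LT. scl (dLie S i k * sPow (quantum_scalars S) i k ph) (wPhi S k ph))
    + (SUM xs:PBW S. scl (sPowErr (quantum_scalars S) i xs ph * dErr S i xs) (uword S (frakA S) (ePhi S) (wPhi S) ph xs))"
   unfolding uG_frakA quantum_scalars_def rel_scalars.simps by (rule quantum_pow[OF i ph])
  fix j assume j: "j : LT"
  show "wPhi S j (tw S ph (psi S i)) *[frakA S] wPhi S i ph -
    scl (sSwap (quantum_scalars S) i j ph) (wPhi S i (tw S ph (psi S j)) *[frakA S] wPhi S j ph) +
   ((SUM k:LT. scl (cLie S i j k * sLie (quantum_scalars S) i j k ph) (wPhi S k ph))
    + (SUM xs:PBW S. scl (sErr (quantum_scalars S) i j xs ph * cErr S i j xs) (uword S (frakA S) (ePhi S) (wPhi S) ph xs))) = 0"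
   unfolding uG_frakA frakA_simps quantum_scalars_def rel_scalars.simps by (rule quantum_comm[OF i j ph])
 next
  fix x assume "x : carrier (frakA S)"
  thus "x : fv.span {uword S (frakA S) (ePhi S) (wPhi S) ph xs | ph xs. ph : Ir & xs : PBW S}"
   unfolding uG_frakA frakA_simps SA_def .
 next
  fix c ph xs assume "(SUM ph:Ir. SUM xs:PBW S. scl (c ph xs) (uword S (frakA S) (ePhi S) (wPhi S) ph xs)) = 0"
   and "ph : Ir" "xs : PBW S"
  thus "c ph xs = 0" unfolding uG_frakA by (rule uG_independent)
 qed
 show ?thesis by (rule presented)
qed

end

section \<open>The basic idempotent\<close>

context block_setting
begin

text \<open>This defines a homomorphism on \<open>H\<close>. It commutes with the generators: the choice of
  \<open>g\<^bsub>i,\<phi>\<^esub>\<close> makes its commutators with \<open>H\<close> compensate the change of \<open>\<xi>\<close> along an arrow.\<close>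

definition DD :: "'h => 'p \<times> 'h => 'k" where
 "DD h = (SUM ph:Ir. scl (inverse (xi S ph h)) (G.br h @@ En ph))"

lemma DD_in: "h : Hc ==> DD h : Gc"
 unfolding DD_def by (intro G.R.closed G.br_in En_in)

lemma DD_E: "h : Hc ==> ph : Ir ==> DD h @@ En ph = scl (inverse (xi S ph h)) (G.br h @@ En ph)"
proof -
 assume h: "h : Hc" and ph: "ph : Ir"
 have "DD h @@ En ph = (SUM ze:Ir. if ze = ph then scl (inverse (xi S ph h)) (G.br h @@ En ph) else 0)"
  unfolding DD_def G.R.distribs by (intro sum.cong refl) (auto simp: G.R.assoc En_orth ph)
 thus ?thesis using ph finite_IrrZ by simp
qed

lemma E_DD: "h : Hc ==> ph : Ir ==> En ph @@ DD h = scl (inverse (xi S ph h)) (G.br h @@ En ph)"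
proof -
 assume h: "h : Hc" and ph: "ph : Ir"
 have e: "En ph @@ (G.br h @@ En ze) = G.br h @@ (En ph @@ En ze)" for ze
  using En_br[OF h, of ph] by (simp flip: G.R.assoc)
 have "En ph @@ DD h = (SUM ze:Ir. if ze = ph then scl (inverse (xi S ph h)) (G.br h @@ En ph) else 0)"
  unfolding DD_def G.R.distribs e by (intro sum.cong refl) (auto simp: En_orth ph)
 thus ?thesis using ph finite_IrrZ by simp
qed

lemma DD_mult: "g : Hc ==> h : Hc ==> DD g @@ DD h = DD (g *[H] h)"
proof -
 assume g: "g : Hc" and h: "h : Hc"
 have "scl (inverse (xi S ph h)) (DD g @@ (G.br h @@ En ph)) = scl (inverse (xi S ph (g *[H] h))) (G.br (g *[H] h) @@ En ph)"
  if ph: "ph : Ir" for ph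
 proof -
  have "DD g @@ (G.br h @@ En ph) = (DD g @@ En ph) @@ G.br h" by (simp add: G.R.assoc En_br[OF h])
  also have "... = scl (inverse (xi S ph g)) (G.br (g *[H] h) @@ En ph)"
   unfolding DD_E[OF g ph] using g h by (simp add: G.R.distribs G.R.assoc En_br G.br_mult2)
  finally show ?thesis using lchar_mult[OF lchar_H[OF xi_hom[OF ph]] g h] by (simp add: mult.commute)
 qed
 thus ?thesis unfolding DD_def[of h] DD_def[of "g *[H] h"] G.R.distribs by simp
qed

text \<open>On the vertex idempotent of \<open>ph\<close> the element \<open>z\<close> acts by
  \<open>ph z\<close>, and xi removes the factor ph / phi0, so all vertices see the same scalar. The
  span of the \<open>DD h\<close> is therefore an image of a twisted group algebra of
  H/Z(H).\<close>

lemma DD_central: "z : C ==> DD z = scl (phi0 S z) eZ"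
proof -
 assume z: "z : C"
 have "scl (inverse (xi S ph z)) (G.br z @@ En ph) = scl (phi0 S z) (En ph)" if ph: "ph : Ir" for ph
  using br_En[OF ph z] xi_restrict[OF ph z] lchar_nz[OF lchar_C[OF ph] z] by simp
 thus ?thesis unfolding DD_def sum_En[symmetric] by (simp add: fv.scale_sum_right)
qed

lemma DD_one: "DD #1[H] = eZ"
 using DD_central[OF subgroup.one_closed[OF sub_C]] H.lchar_one[OF lchar_C[OF phi0] subgroup.one_closed[OF sub_C]] by simp

lemma DD_eZ: "h : Hc ==> DD h @@ eZ = DD h" "h : Hc ==> eZ @@ DD h = DD h"
 using DD_mult[of h "#1[H]"] DD_mult[of "#1[H]" h] by (simp_all add: DD_one)

lemma Z_uG:
 assumes ph: "ph : Ir" and xs: "set xs <= LT" and z: "z : subZ S"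
 shows "G.br z @@ uG ph xs = scl (chi S z) (uG ph xs)"
proof -
 have "G.br z @@ uG ph xs = (G.br z @@ En (tws S ph xs)) @@ uG ph xs" by (simp only: GS.E_uA[OF ph xs] G.R.assoc)
 also have "... = scl (chi S z) (En (tws S ph xs) @@ uG ph xs)"
  unfolding br_En[OF tws_IrrZ[OF ph xs] Z_C[OF z]] IrrZ_Z[OF tws_IrrZ[OF ph xs] z] by (simp only: G.R.distribs)
 finally show ?thesis by (simp only: GS.E_uA[OF ph xs])
qed

text \<open>Passing \<open>h\<close> through the group word costs chi of a commutator, passing it
  through the monomial costs \<open>Psi xs h\<close>; by \<open>rho_gword\<close> the product is the
  quotient of the xi at the two ends of the path.\<close>

lemma br_uG:
 assumes ph: "ph : Ir" and xs: "set xs <= LT" and h: "h : Hc"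
 shows "G.br h @@ uG ph xs = scl (xi S (tws S ph xs) h / xi S ph h) (uG ph xs @@ G.br h)"
proof -
 let ?g = "gword S ph xs"
 have g: "?g : Hc" by (rule gword_in[OF ph xs])
 define c where "c = commutator H h ?g"
 have c: "c : subZ S" unfolding c_def by (rule commutator_Z[OF h g])
 let ?w = "G.br ?g @@ (G.emb (wmon S xs) @@ En ph)"
 have "G.br h @@ ?w = G.br (c *[H] (?g *[H] h)) @@ (G.emb (wmon S xs) @@ En ph)"
  unfolding c_def commutator_eq[OF g h, symmetric] using g h by (simp add: G.br_mult2)
 also have "... = G.br c @@ (G.br ?g @@ ((G.br h @@ G.emb (wmon S xs)) @@ En ph))"
  using g h Z_carrier[OF c] by (simp add: G.R.assoc G.br_mult2 H.m_assoc)
 also have "... = scl (Psi xs h) (G.br c @@ (?w @@ G.br h))"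
  unfolding GW.br_wm[OF h xs] PsiK_Psi by (simp add: G.R.distribs G.R.assoc En_br[OF h])
 finally have "scl (KK ph xs) (G.br h @@ ?w) = scl (Psi xs h) (G.br c @@ uG ph xs @@ G.br h)"
  unfolding uG_eq[OF ph xs] by (simp add: G.R.distribs G.R.assoc mult.commute)
 also have "... = scl (Psi xs h * rho ?g h) (uG ph xs @@ G.br h)"
  unfolding Z_uG[OF ph xs c] by (simp add: G.R.distribs rho_def c_def)
 also have "Psi xs h * rho ?g h = xi S (tws S ph xs) h / xi S ph h"
  using lchar_nz[OF Psi_lchar[OF xs] h] by (simp add: rho_gword[OF ph h xs])
 finally show ?thesis unfolding uG_eq[OF ph xs] by (simp add: G.R.distribs)
qed

lemma DD_uG:
 assumes ph: "ph : Ir" and xs: "set xs <= LT" and h: "h : Hc"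
 shows "DD h @@ uG ph xs = scl (inverse (xi S (tws S ph xs) h)) (G.br h @@ uG ph xs)"
  "DD h @@ uG ph xs = uG ph xs @@ DD h"
proof -
 note t = tws_IrrZ[OF ph xs]
 have "DD h @@ uG ph xs = (DD h @@ En (tws S ph xs)) @@ uG ph xs" by (simp only: GS.E_uA[OF ph xs] G.R.assoc)
 also have "... = scl (inverse (xi S (tws S ph xs) h)) (G.br h @@ (En (tws S ph xs) @@ uG ph xs))"
  unfolding DD_E[OF h t] by (simp only: G.R.distribs G.R.assoc)
 finally show 1: "DD h @@ uG ph xs = scl (inverse (xi S (tws S ph xs) h)) (G.br h @@ uG ph xs)"
  by (simp only: GS.E_uA[OF ph xs])
 have "uG ph xs @@ DD h = uG ph xs @@ (En ph @@ DD h)" by (simp add: GS.uA_E[OF ph xs] flip: G.R.assoc)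
 also have "... = scl (inverse (xi S ph h)) (uG ph xs @@ En ph @@ G.br h)"
  unfolding E_DD[OF h ph] by (simp add: G.R.distribs G.R.assoc En_br[OF h])
 also have "... = scl (inverse (xi S ph h)) (uG ph xs @@ G.br h)" by (simp only: GS.uA_E[OF ph xs])
 finally show "DD h @@ uG ph xs = uG ph xs @@ DD h"
  unfolding 1 br_uG[OF ph xs h] using xi_nz[OF t h] by (simp add: field_simps)
qed

lemma DD_SA: "h : Hc ==> c : SA ==> DD h @@ c = c @@ DD h"
proof -
 assume h: "h : Hc" and "c : SA"
 hence "c : fv.span {uG ph xs | ph xs. ph : Ir & xs : PBW S}" by (simp add: SA_def)
 thus ?thesis
 proof (induction rule: fv.span_induct_alt)
  case (step a x y)
  then obtain ph xs where "x = uG ph xs" "ph : Ir" "xs : PBW S" by blast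
  thus ?case using step(2) DD_uG(2)[OF _ PBW_letters h] by (simp add: G.R.distribs)
 qed simp
qed

text \<open>Together with \<open>DD_SA\<close> this makes kGe an image of the tensor product of the
  span of the \<open>DD h\<close> with \<open>SA\<close>, so that computations at \<open>eps\<close>
  reduce to the \<open>DD h\<close>.\<close>

lemma kGe_span: "Ec <= fv.span {DD h @@ uG ph xs | h ph xs. h : Hc & ph : Ir & xs : PBW S}"
proof
 let ?V = "fv.span {DD h @@ uG ph xs | h ph xs. h : Hc & ph : Ir & xs : PBW S}"
 fix x assume "x : Ec"
 hence x: "x : Gc" "x @@ eZ = x" by (simp_all add: kGe_carrier)
 have w: "G.emb (wmon S xs) @@ G.br h @@ En ph : ?V" if ph: "ph : Ir" and xs: "xs : PBW S" and h: "h : Hc" for ph xs h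
 proof -
  note l = PBW_letters[OF xs]
  let ?g = "gword S ph xs"
  have g: "?g : Hc" by (rule gword_in[OF ph l])
  \<comment> \<open>Splitting off the group word of \<open>xs\<close> leaves a factor h' on the
    left, and in front of a word \<open>G.br h'\<close> is a multiple of
    \<open>DD h'\<close>.\<close>
  define h' where "h' = h *[H] inv[H] ?g"
  have h': "h' : Hc" "h = h' *[H] ?g" using g h by (simp_all add: h'_def H.m_assoc)
  have "G.br h @@ G.emb (wmon S xs) @@ En ph = G.br h' @@ (G.br ?g @@ (G.emb (wmon S xs) @@ En ph))"
   using g h' by (simp add: G.R.assoc G.br_mult2)
  also have "... = scl (inverse (KK ph xs)) (G.br h' @@ uG ph xs)"
   unfolding uG_wm[OF ph l] by (simp only: G.R.distribs)
  also have "G.br h' @@ uG ph xs = scl (xi S (tws S ph xs) h') (DD h' @@ uG ph xs)"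
   unfolding DD_uG(1)[OF ph l h'(1)] using xi_nz[OF tws_IrrZ[OF ph l] h'(1)] by simp
  finally have e: "G.br h @@ G.emb (wmon S xs) @@ En ph =
   scl (inverse (KK ph xs)) (scl (xi S (tws S ph xs) h') (DD h' @@ uG ph xs))" .
  have "DD h' @@ uG ph xs : ?V" using ph xs h'(1) by (intro fv.span_base) blast
  hence "G.br h @@ G.emb (wmon S xs) @@ En ph : ?V" unfolding e by (intro fv.span_scale)
  thus ?thesis unfolding GW.wm_br[OF h l] by (simp add: G.R.distribs fv.span_scale)
 qed
 have e: "G.emb f @@ G.br h @@ En ph : ?V" if ph: "ph : Ir" and f: "f : Pc" and h: "h : Hc" for ph f h
 proof -
  have "f : J 0" using f by (simp add: kP.augpow_0)
  then obtain a where a: "f = (SUM xs:PBW S. scl (a xs) (wmon S xs))" using PBW_expand by blast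
  show ?thesis unfolding a G.emb_sum G.emb_scl G.R.distribs using w[OF ph _ h] by (intro fv.span_sum fv.span_scale)
 qed
 have "x = (SUM ph:Ir. x @@ En ph)" using x(2) unfolding sum_En[symmetric] by (simp only: G.R.sum_r)
 also have "... : ?V"
 proof (rule fv.span_sum)
  fix ph assume ph: "ph : Ir"
  have "x @@ En ph = (SUM h:Hc. G.emb (%y. x (y, h)) @@ G.br h @@ En ph)"
   by (subst G.R_expand(1)[OF x(1)]) (simp only: G.R.sum_l)
  also have "... : ?V" by (rule fv.span_sum) (rule e[OF ph G.R_expand(2)[OF x(1)]])
  finally show "x @@ En ph : ?V" .
 qed
 finally show "x : ?V" .
qed

text \<open>The products of J^r(kP) with kH. They form a multiplicative filtration of kG that ends
  in zero, and \<open>NJ 1\<close> provides the nil ideal for \<open>basic_setI\<close>.\<close>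

definition NJ :: "nat => ('p \<times> 'h => 'k) set" where
 "NJ r = fv.span {G.emb f @@ G.br h | f h. f : J r & h : Hc}"

lemma NJ_mult: "x : NJ r ==> y : NJ t ==> x @@ y : NJ (r + t)"
 unfolding NJ_def
proof (rule G.R.span_mul, assumption, assumption)
 let ?N = "%r. {G.emb f @@ G.br h | f h. f : J r & h : Hc}"
 fix b c assume "b : ?N r" "c : ?N t"
 then obtain f h f' h' where b: "b = G.emb f @@ G.br h" "f : J r" "h : Hc"
  and c: "c = G.emb f' @@ G.br h'" "f' : J t" "h' : Hc" by blast
 have fk: "f : Pc" using b(2) kP.augpow_carrier by blast
 have "b @@ c = G.emb f @@ (G.br h @@ G.emb f' @@ G.br h')" by (simp add: b(1) c(1) G.R.assoc)
 also have "... : fv.span (?N (r + t))"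
  using J_span_PBW[OF c(2)]
 proof (induction rule: fv.span_induct_alt)
  case base
  show ?case by (simp add: G.emb_0 fv.span_zero)
 next
  case (step a x y)
  then obtain xs where x: "x = wmon S xs" "xs : PBW S" "t <= wt xs" by blast
  have xJ: "x : J t" using wmon_J[OF PBW_letters[OF x(2)]] kP.augpow_mono[OF x(3)] x(1) by blast
  have xk: "x : Pc" using xJ kP.augpow_carrier by blast
  have "G.emb f @@ (G.br h @@ G.emb x @@ G.br h') = scl (Psi xs h) (G.emb (f \<star> x) @@ G.br (h *[H] h'))"
   unfolding x(1) GW.br_wm[OF b(3) PBW_letters[OF x(2)]] PsiK_Psi
   using b(3) c(3) G.emb_mult[OF fk xk] by (simp add: G.R.distribs G.R.assoc G.br_mult x(1))
  moreover have "f \<star> x : J (r + t)" by (rule kP.augpow_mul[OF b(2) xJ])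
  hence "G.emb (f \<star> x) @@ G.br (h *[H] h') : fv.span (?N (r + t))"
   using b(3) c(3) by (intro fv.span_base) blast
  ultimately have "G.emb f @@ (G.br h @@ G.emb x @@ G.br h') : fv.span (?N (r + t))" by (simp add: fv.span_scale)
  thus ?case using step(2)
   by (simp add: G.emb_add G.emb_scl G.R.distribs fv.span_add fv.span_scale)
 qed
 finally show "b @@ c : fv.span (?N (r + t))" .
qed simp

lemma NJ_0: "Gc <= NJ 0"
proof
 fix x assume x: "x : Gc"
 have "G.emb (%y. x (y, h)) @@ G.br h : NJ 0" if h: "h : Hc" for h
  unfolding NJ_def using G.R_expand(2)[OF x h] h by (intro fv.span_base) (auto simp: kP.augpow_0)
 thus "x : NJ 0" by (subst G.R_expand(1)[OF x]) (auto simp: NJ_def intro: fv.span_sum)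
qed

lemma NJ_top: "NJ (rad_length (kP S)) = {0}"
proof -
 have "{G.emb f @@ G.br h | f h. f : J (rad_length (kP S)) & h : Hc} <= {0}"
  by (auto simp: J_top G.emb_0)
 hence "NJ (rad_length (kP S)) <= {0}" unfolding NJ_def by (rule fv.span_minimal) (simp add: fv.subspace_def)
 thus ?thesis using fv.span_zero unfolding NJ_def by blast
qed

lemma NJ_sub: "fv.subspace (NJ r)"
 by (simp add: NJ_def)

lemma uG_NJ:
 assumes ph: "ph : Ir" and xs: "set xs <= LT" "xs ~= []" shows "uG ph xs : NJ 1"
proof -
 obtain i ys where i: "xs = i # ys" using xs(2) by (cases xs) auto
 hence "1 <= wt xs" using xs wdeg_pos[of i] by simp
 hence w: "wmon S xs : J 1" using wmon_J[OF xs(1)] kP.augpow_mono[of 1 "wt xs"] by blast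
 have g: "gword S ph xs : Hc" by (rule gword_in[OF ph xs(1)])
 have "G.emb (wmon S xs) @@ G.br (gword S ph xs) : NJ 1" unfolding NJ_def using w g by (intro fv.span_base) blast
 moreover have "En ph : NJ 0" using NJ_0 En_in by blast
 ultimately have "G.emb (wmon S xs) @@ G.br (gword S ph xs) @@ En ph : NJ (1 + 0)" by (rule NJ_mult)
 moreover have "uG ph xs = scl (KK ph xs * Psi xs (gword S ph xs)) (G.emb (wmon S xs) @@ G.br (gword S ph xs) @@ En ph)"
  unfolding uG_eq[OF ph xs(1)] using GW.br_wm[OF g xs(1)] by (simp add: PsiK_Psi G.R.distribs flip: G.R.assoc)
 ultimately show ?thesis using fv.subspace_scale[OF NJ_sub] by simp
qed

end

section \<open>A maximal isotropic subgroup and the Morita equivalence\<close>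

context block_setting
begin

text \<open>Representatives of the left cosets of \<open>A\<close>, numbered because
  \<open>mat_alg\<close> is indexed by numbers. The last clause, for functions into the algebra,
  splits sums over \<open>H\<close> into cosets.\<close>

lemma transversal:
 assumes A: "subgroup A H"
 shows "\<exists>(m::nat) ta. (\<forall>l<m. ta l : Hc) & (\<forall>l<m. \<forall>l'<m. inv[H] (ta l) *[H] ta l' : A --> l = l') &
  (\<forall>f :: 'h => 'p \<times> 'h => 'k. (SUM h:Hc. f h) = (\<Sum>l<m. SUM a:A. f (ta l *[H] a)))"
proof -
 note Ac = subgroup.mem_carrier[OF A] and Am = subgroup.m_closed[OF A] and Ai = subgroup.m_inv_closed[OF A]
 define cl where "cl h = {y : Hc. inv[H] h *[H] y : A}" for h
 define r where "r h = (SOME y. y : cl h)" for h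
 have self: "h : cl h" if "h : Hc" for h using that subgroup.one_closed[OF A] by (simp add: cl_def)
 have rcl: "r h : cl h" if "h : Hc" for h unfolding r_def using self[OF that] by (rule someI)
 have rin: "r h : Hc" "inv[H] h *[H] r h : A" if "h : Hc" for h using rcl[OF that] by (auto simp: cl_def)
 have sub: "cl h' <= cl h" if h: "h : Hc" "h' : Hc" "inv[H] h *[H] h' : A" for h h'
 proof
  fix y assume "y : cl h'"
  hence y: "y : Hc" "inv[H] h' *[H] y : A" by (auto simp: cl_def)
  have "(inv[H] h *[H] h') *[H] (inv[H] h' *[H] y) : A" using h(3) y(2) by (rule Am)
  moreover have "(inv[H] h *[H] h') *[H] (inv[H] h' *[H] y) = inv[H] h *[H] y"
   using h y by (metis H.inv_closed H.l_one H.m_assoc H.m_closed H.r_inv)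
  ultimately show "y : cl h" using h y by (simp add: cl_def)
 qed
 have cleq: "cl h = cl h'" if h: "h : Hc" "h' : Hc" "inv[H] h *[H] h' : A" for h h'
 proof -
  have "inv[H] (inv[H] h *[H] h') : A" using h(3) by (rule Ai)
  hence "inv[H] h' *[H] h : A" using h by (simp add: H.inv_mult_group)
  thus ?thesis using sub[OF h] sub[OF h(2,1)] by blast
 qed
 have req: "r h = r h'" if "h : Hc" "h' : Hc" "inv[H] h *[H] h' : A" for h h'
  using cleq[OF that] by (simp add: r_def)
 define T where "T = r ` Hc"
 have T: "ta : Hc" "r ta = ta" if ta: "ta : T" for ta
 proof -
  obtain h where h: "h : Hc" "ta = r h" using ta by (auto simp: T_def)
  show "ta : Hc" using rin(1)[OF h(1)] h(2) by simp
  show "r ta = ta" using req[OF h(1) rin[OF h(1)]] h(2) by simp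
 qed
 have finT: "finite T" using H_finite by (simp add: T_def)
 have rt: "r (ta *[H] a) = ta" if "ta : T" "a : A" for ta a
 proof -
  have "inv[H] ta *[H] (ta *[H] a) : A" using T(1)[OF that(1)] Ac[OF that(2)] that(2) by (simp flip: H.m_assoc)
  thus ?thesis using req[of ta "ta *[H] a"] T[OF that(1)] Ac[OF that(2)] by simp
 qed
 have su: "(SUM h:Hc. f h) = (SUM ta:T. SUM a:A. f (ta *[H] a))" for f :: "'h => 'p \<times> 'h => 'k"
 proof -
  have "(SUM h:Hc. f h) = (SUM v:T \<times> A. f (fst v *[H] snd v))"
  proof (rule sum.reindex_bij_witness[of _ "%v. fst v *[H] snd v" "%h. (r h, inv[H] (r h) *[H] h)"])
   fix h assume h: "h : Hc"
   have "inv[H] (inv[H] h *[H] r h) : A" using rin(2)[OF h] by (rule Ai)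
   hence "inv[H] (r h) *[H] h : A" using h rin(1)[OF h] by (simp add: H.inv_mult_group)
   thus "(r h, inv[H] (r h) *[H] h) : T \<times> A" using h by (simp add: T_def)
   show e: "fst (r h, inv[H] (r h) *[H] h) *[H] snd (r h, inv[H] (r h) *[H] h) = h"
    using h rin(1)[OF h] by (simp flip: H.m_assoc)
   thus "f (fst (r h, inv[H] (r h) *[H] h) *[H] snd (r h, inv[H] (r h) *[H] h)) = f h" by (rule arg_cong)
  next
   fix v assume "v : T \<times> A"
   then obtain ta a where v: "v = (ta, a)" "ta : T" "a : A" by blast
   show "(r (fst v *[H] snd v), inv[H] (r (fst v *[H] snd v)) *[H] (fst v *[H] snd v)) = v"
    using rt[OF v(2,3)] T(1)[OF v(2)] Ac[OF v(3)] by (simp add: v(1) flip: H.m_assoc)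
   show "fst v *[H] snd v : Hc" using T(1)[OF v(2)] Ac[OF v(3)] by (simp add: v(1))
  qed
  thus ?thesis by (simp add: sum.cartesian_product case_prod_beta)
 qed
 obtain ta where ta: "bij_betw ta {..<card T} T"
  using ex_bij_betw_nat_finite[OF finT] by (auto simp: atLeast0LessThan)
 have taT: "ta l : T" if "l < card T" for l using ta that by (auto simp: bij_betw_def)
 have c1: "\<forall>i<card T. ta i : Hc" using T(1)[OF taT] by blast
 have c2: "\<forall>i<card T. \<forall>j<card T. inv[H] (ta i) *[H] ta j : A --> i = j"
 proof (intro allI impI)
  fix i j assume ij: "i < card T" "j < card T" "inv[H] (ta i) *[H] ta j : A"
  have "ta i = ta j" using req[OF T(1)[OF taT[OF ij(1)]] T(1)[OF taT[OF ij(2)]] ij(3)] T(2)[OF taT[OF ij(1)]] T(2)[OF taT[OF ij(2)]] by simp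
  thus "i = j" using ta ij(1,2) by (auto simp: bij_betw_def inj_on_def)
 qed
 have c3: "\<forall>f :: 'h => 'p \<times> 'h => 'k. (SUM h:Hc. f h) = (\<Sum>i<card T. SUM a:A. f (ta i *[H] a))"
  unfolding su by (intro allI sum.reindex_bij_betw[OF ta, symmetric])
 show ?thesis by (intro exI conjI) (rule c1, rule c2, rule c3)
qed

lemma rho_swap: "g : Hc ==> h : Hc ==> rho g h = inverse (rho h g)"
proof -
 assume g: "g : Hc" and h: "h : Hc"
 define c where "c = commutator H h g"
 define c' where "c' = commutator H g h"
 have c: "c : subZ S" "c' : subZ S" unfolding c_def c'_def using commutator_Z g h by simp_all
 note cH = c[THEN Z_carrier]
 have e: "h *[H] g = c *[H] (g *[H] h)" "g *[H] h = c' *[H] (h *[H] g)"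
  unfolding c_def c'_def using commutator_eq g h by blast+
 have "h *[H] g = c *[H] (c' *[H] (h *[H] g))" by (subst e(1)) (subst e(2), rule refl)
 also have "... = (c *[H] c') *[H] (h *[H] g)" using cH g h by (simp add: H.m_assoc)
 finally have "c *[H] c' = #1[H]" using cH g h H.r_cancel_one'[of "h *[H] g" "c *[H] c'"] by simp
 hence "chi S c * chi S c' = 1"
  using lchar_mult[OF lchar_Z c] H.lchar_one[OF lchar_Z subgroup.one_closed[OF sub_Z]] by simp
 thus ?thesis unfolding rho_def c_def[symmetric] c'_def[symmetric]
  using inverse_unique[of "chi S c'" "chi S c"] by (simp add: mult.commute)
qed

text \<open>A maximal extension of \<open>\<phi>\<^sub>0\<close> is a maximal isotropic subgroup for the commutator form
  on \<open>H/Z(H)\<close>.\<close>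

context
 fixes A :: "'h set" and l :: "'h => 'k"
 assumes A: "subgroup A H" and CA: "C <= A" and l: "lchar H A l"
  and lC: "!!z. z : C ==> l z = phi0 S z"
  and max: "!!h. h : Hc ==> (!!a. a : A ==> a *[H] h = h *[H] a) ==> h : A"
begin

lemma A_H: "a : A ==> a : Hc"
 using subgroup.mem_carrier[OF A] .

lemma A_fin: "finite A"
 using H_finite A_H by (meson finite_subset subsetI)

text \<open>The idempotent of the linear character \<open>l\<close>, with \<open>DD a\<close> in the
  role of group elements. As \<open>l\<close> extends \<open>phi0\<close>, the summands in one coset
  of the centre agree by \<open>DD_central\<close> instead of cancelling.\<close>

definition eps where
 "eps = scl (inverse (of_nat (card A))) (SUM a:A. scl (l (inv[H] a)) (DD a))"

lemma eps_in: "eps : Gc"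
 unfolding eps_def by (intro G.R.closed DD_in A_H)

lemma eps_eZ: "eZ @@ eps = eps" "eps @@ eZ = eps"
 unfolding eps_def G.R.distribs using DD_eZ A_H by simp_all

lemma l_inv: "a : A ==> l (inv[H] a) = inverse (l a)"
 by (rule H.lchar_inv[OF l A])

lemma DD_eps: assumes b: "b : A" shows "DD b @@ eps = scl (l b) eps" "eps @@ DD b = scl (l b) eps"
proof -
 note cl = subgroup.m_closed[OF A] subgroup.m_inv_closed[OF A]
 have 1: "(SUM a:A. scl (l (inv[H] a)) (DD (b *[H] a))) = (SUM a:A. scl (l b * l (inv[H] a)) (DD a))"
 proof (rule sum.reindex_bij_witness[of _ "%a. inv[H] b *[H] a" "%a. b *[H] a"])
  fix a assume a: "a : A"
  note c = A_H[OF b] A_H[OF a]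
  show "inv[H] b *[H] (b *[H] a) = a" "b *[H] (inv[H] b *[H] a) = a" using c by (simp_all flip: H.m_assoc)
  show "b *[H] a : A" "inv[H] b *[H] a : A" using a b cl by blast+
  show "scl (l b * l (inv[H] (b *[H] a))) (DD (b *[H] a)) = scl (l (inv[H] a)) (DD (b *[H] a))"
   using l_inv[OF a] l_inv[OF cl(1)[OF b a]] lchar_mult[OF l b a] lchar_nz[OF l b] by simp
 qed
 have 2: "(SUM a:A. scl (l (inv[H] a)) (DD (a *[H] b))) = (SUM a:A. scl (l b * l (inv[H] a)) (DD a))"
 proof (rule sum.reindex_bij_witness[of _ "%a. a *[H] inv[H] b" "%a. a *[H] b"])
  fix a assume a: "a : A"
  note c = A_H[OF b] A_H[OF a]
  show "a *[H] b *[H] inv[H] b = a" "a *[H] inv[H] b *[H] b = a" using c by (simp_all add: H.m_assoc)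
  show "a *[H] b : A" "a *[H] inv[H] b : A" using a b cl by blast+
  show "scl (l b * l (inv[H] (a *[H] b))) (DD (a *[H] b)) = scl (l (inv[H] a)) (DD (a *[H] b))"
   using l_inv[OF a] l_inv[OF cl(1)[OF a b]] lchar_mult[OF l a b] lchar_nz[OF l b] by simp
 qed
 have m: "DD b @@ DD a = DD (b *[H] a)" "DD a @@ DD b = DD (a *[H] b)" if "a : A" for a
  using DD_mult A_H that b by blast+
 have "DD b @@ eps = scl (inverse (of_nat (card A))) (SUM a:A. scl (l (inv[H] a)) (DD (b *[H] a)))"
  unfolding eps_def G.R.distribs using m(1) by simp
 thus "DD b @@ eps = scl (l b) eps"
  unfolding 1 eps_def by (simp add: fv.scale_sum_right mult.left_commute)
 have "eps @@ DD b = scl (inverse (of_nat (card A))) (SUM a:A. scl (l (inv[H] a)) (DD (a *[H] b)))"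
  unfolding eps_def G.R.distribs using m(2) by simp
 thus "eps @@ DD b = scl (l b) eps"
  unfolding 2 eps_def by (simp add: fv.scale_sum_right mult.left_commute)
qed

lemma eps_idem: "eps @@ eps = eps"
proof -
 have "scl (l (inv[H] a)) (DD a @@ eps) = eps" if "a : A" for a
  using DD_eps(1)[OF that] l_inv[OF that] lchar_nz[OF l that] by simp
 hence "eps @@ eps = scl (inverse (of_nat (card A))) (SUM a:A. eps)"
  by (subst (1) eps_def) (simp add: G.R.distribs)
 also have "(SUM a:A. eps) = scl (of_nat (card A)) eps"
  using fv.scale_sum_left[of "%_. 1" A eps] by simp
 finally show ?thesis using card_nz[OF A] by simp
qed

text \<open>Maximality provides \<open>a\<close> in \<open>A\<close> that does not commute with
  \<open>h\<close>. Between two copies of \<open>eps\<close> the elements DD(a h) and DD(h a) have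
  the same value, since \<open>DD a\<close> acts as \<open>l a\<close> from either side, but they
  differ by the factor chi(c), which is not 1.\<close>

lemma eps_off:
 assumes h: "h : Hc" "h \<notin> A" shows "eps @@ (DD h @@ eps) = 0"
proof -
 obtain a where a: "a : A" "a *[H] h ~= h *[H] a" using max[OF h(1)] h(2) by blast
 note aH = A_H[OF a(1)]
 define c where "c = commutator H a h"
 have c: "c : subZ S" unfolding c_def by (rule commutator_Z[OF aH h(1)])
 have e: "a *[H] h = c *[H] (h *[H] a)" unfolding c_def by (rule commutator_eq[OF h(1) aH])
 have c1: "chi S c ~= 1"
 proof
  assume "chi S c = 1"
  hence "chi S c = chi S #1[H]" using H.lchar_one[OF lchar_Z subgroup.one_closed[OF sub_Z]] by simp
  hence "c = #1[H]" using chi_faithful c subgroup.one_closed[OF sub_Z] by (simp add: inj_on_eq_iff)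
  thus False using e a(2) aH h(1) by simp
 qed
 have "DD (a *[H] h) = scl (chi S c) (DD (h *[H] a))"
 proof -
  have "DD (a *[H] h) = DD c @@ DD (h *[H] a)" unfolding e using DD_mult[OF Z_carrier[OF c]] h(1) aH by simp
  thus ?thesis
   unfolding DD_central[OF Z_C[OF c]] IrrZ_Z[OF phi0 c] using DD_eZ(2) h(1) aH by (simp add: G.R.distribs)
 qed
 hence s: "eps @@ (DD (a *[H] h) @@ eps) = scl (chi S c) (eps @@ (DD (h *[H] a) @@ eps))" by (simp add: G.R.distribs)
 have "eps @@ (DD (a *[H] h) @@ eps) = (eps @@ DD a) @@ (DD h @@ eps)" by (simp only: DD_mult[OF aH h(1), symmetric] G.R.assoc)
 hence s1: "eps @@ (DD (a *[H] h) @@ eps) = scl (l a) (eps @@ (DD h @@ eps))" by (simp add: DD_eps(2)[OF a(1)] G.R.distribs)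
 have "eps @@ (DD (h *[H] a) @@ eps) = eps @@ (DD h @@ (DD a @@ eps))" by (simp only: DD_mult[OF h(1) aH, symmetric] G.R.assoc)
 hence s2: "eps @@ (DD (h *[H] a) @@ eps) = scl (l a) (eps @@ (DD h @@ eps))" by (simp add: DD_eps(1)[OF a(1)] G.R.distribs)
 have "scl (l a) (eps @@ (DD h @@ eps)) = scl (chi S c * l a) (eps @@ (DD h @@ eps))" using s unfolding s1 s2 by simp
 thus ?thesis using c1 lchar_nz[OF l a(1)] by (metis fv.scale_cancel_right mult_cancel_right1)
qed

text \<open>Conjugation by \<open>DD h\<close> multiplies \<open>DD a\<close> by
  \<open>rho a h\<close>. Summed over \<open>h\<close> this vanishes unless \<open>a\<close> is
  central, and each central \<open>a\<close> contributes |H| times \<open>eZ\<close>; division by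
  |A| gives the constant |H| |C| / |A|.\<close>

lemma eps_average:
 "(SUM h:Hc. DD h @@ (eps @@ DD (inv[H] h))) =
  scl (inverse (of_nat (card A)) * (of_nat (card (Hc)) * of_nat (card C))) eZ"
proof -
 have d: "DD h @@ (DD a @@ DD (inv[H] h)) = scl (rho a h) (DD a)" if h: "h : Hc" and a: "a : Hc" for h a
 proof -
  define c where "c = commutator H h a"
  have c: "c : subZ S" unfolding c_def by (rule commutator_Z[OF h a])
  have "DD h @@ (DD a @@ DD (inv[H] h)) = DD ((h *[H] a) *[H] inv[H] h)" using h a by (simp add: DD_mult H.m_assoc)
  also have "(h *[H] a) *[H] inv[H] h = c *[H] a"
   unfolding c_def commutator_eq[OF a h] using h a commutator_in[OF h a] by (simp add: H.m_assoc)
  also have "DD (c *[H] a) = scl (chi S c) (DD a)"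
   using DD_mult[OF Z_carrier[OF c] a] DD_eZ(2)[OF a]
   unfolding DD_central[OF Z_C[OF c]] IrrZ_Z[OF phi0 c] by (simp add: G.R.distribs)
  finally show ?thesis by (simp add: rho_def c_def)
 qed
 have r: "(SUM h:Hc. rho a h) = (if a : C then of_nat (card (Hc)) else 0)" if a: "a : Hc" for a
 proof (cases "a : C")
  case True
  have "rho a h = 1" if h: "h : Hc" for h
   using C_comm[OF True h] h a H.lchar_one[OF lchar_Z subgroup.one_closed[OF sub_Z]]
   by (simp add: rho_def commutator_def flip: C_comm[OF True h]) (simp add: H.m_assoc)
  thus ?thesis using True by simp
 next
  case False
  then obtain h0 where h0: "h0 : Hc" "rho a h0 ~= 1" using rho_ker[OF a] by blast
  have "lchar H (Hc) (%h. inverse (rho h a))" using rho_nz a rho_mult[OF _ _ a] by (simp add: lchar_def)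
  hence "(SUM h:Hc. inverse (rho h a)) = 0"
   by (rule H.sum_lchar[OF H.subgroup_self _ h0(1)]) (use rho_swap[OF a h0(1)] h0(2) in simp)
  thus ?thesis using False rho_swap[OF a] by simp
 qed
 have "(SUM h:Hc. DD h @@ (eps @@ DD (inv[H] h))) =
  scl (inverse (of_nat (card A))) (SUM h:Hc. SUM a:A. scl (l (inv[H] a)) (scl (rho a h) (DD a)))"
  unfolding eps_def G.R.distribs using d A_H by (simp add: fv.scale_sum_right)
 also have "(SUM h:Hc. SUM a:A. scl (l (inv[H] a)) (scl (rho a h) (DD a))) =
  (SUM a:A. scl (l (inv[H] a) * (SUM h:Hc. rho a h)) (DD a))"
  by (subst sum.swap) (simp add: fv.scale_sum_left sum_distrib_left)
 also have "... = (SUM a:C. scl (l (inv[H] a) * (SUM h:Hc. rho a h)) (DD a))"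
  by (rule sum.mono_neutral_right[OF A_fin CA]) (use r A_H in auto)
 also have "... = (SUM a:C. scl (of_nat (card (Hc))) eZ)"
 proof (rule sum.cong[OF refl])
  fix a assume a: "a : C"
  hence aA: "a : A" using CA by blast
  show "scl (l (inv[H] a) * (SUM h:Hc. rho a h)) (DD a) = scl (of_nat (card (Hc))) eZ"
   using r[OF A_H[OF aA]] a DD_central[OF a] l_inv[OF aA] lC[OF a] lchar_nz[OF l aA] by (simp add: field_simps)
 qed
 also have "... = scl (of_nat (card (Hc)) * of_nat (card C)) eZ"
  using fv.scale_sum_left[of "%_. of_nat (card (Hc))" C eZ] by (simp add: mult.commute)
 finally show ?thesis by simp
qed

lemma eps_comm: "c : SA ==> eps @@ c = c @@ eps"
 unfolding eps_def using DD_SA A_H by (simp add: G.R.distribs)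

lemma eps_kGe: "eps : Ec"
 using eps_in eps_eZ by (simp add: kGe_carrier)

lemma DD_kGe: "h : Hc ==> DD h : Ec"
 using DD_in DD_eZ by (simp add: kGe_carrier)

lemma average_nz: "inverse (of_nat (card A)) * (of_nat (card (Hc)) * of_nat (card C)) ~= (0 :: 'k)"
 using card_nz[OF A] card_nz[OF sub_C] card_nz[OF H.subgroup_self] by simp

text \<open>As \<open>c\<close> commutes with all \<open>DD h\<close>, it annihilates every
  conjugate of \<open>eps\<close> and so their sum, a nonzero multiple of the identity of
  kGe.\<close>

lemma eps_inj:
 assumes c: "c : SA" and 0: "c @@ eps = 0" shows "c = 0"
proof -
 let ?k = "inverse (of_nat (card A)) * (of_nat (card (Hc)) * of_nat (card C)) :: 'k"
 have "c @@ (DD h @@ (eps @@ DD (inv[H] h))) = 0" if h: "h : Hc" for h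
 proof -
  have "c @@ (DD h @@ (eps @@ DD (inv[H] h))) = (c @@ DD h) @@ (eps @@ DD (inv[H] h))" by (simp only: G.R.assoc)
  also have "... = DD h @@ ((c @@ eps) @@ DD (inv[H] h))" unfolding DD_SA[OF h c, symmetric] by (simp only: G.R.assoc)
  finally show ?thesis by (simp add: 0)
 qed
 hence "c @@ (SUM h:Hc. DD h @@ (eps @@ DD (inv[H] h))) = 0" by (simp add: G.R.sum_r)
 hence "scl ?k c = 0" unfolding eps_average by (simp add: G.R.distribs eZ_SA_r[OF c])
 thus ?thesis using average_nz by (metis fv.scale_eq_0_iff)
qed

text \<open>On the spanning elements of \<open>kGe_span\<close> the part in \<open>SA\<close> moves
  out, and eps (DD h) eps is \<open>l h\<close> times \<open>eps\<close> for \<open>h\<close> in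
  \<open>A\<close> and zero otherwise.\<close>

lemma eps_corner:
 assumes "x : Ec" shows "EX c:SA. eps @@ (x @@ eps) = c @@ eps"
proof -
 have "x : fv.span {DD h @@ uG ph xs | h ph xs. h : Hc & ph : Ir & xs : PBW S}"
  using assms kGe_span by blast
 thus ?thesis
 proof (induction rule: fv.span_induct_alt)
  case base
  show ?case using fv.subspace_0[OF SA_sub] by (intro bexI[of _ 0]) simp_all
 next
  case (step a x y)
  then obtain h ph xs d where x: "x = DD h @@ uG ph xs" "h : Hc" "ph : Ir" "xs : PBW S"
   and d: "d : SA" "eps @@ (y @@ eps) = d @@ eps" by blast
  have u: "uG ph xs : SA" using uG_SA[OF x(3) PBW_letters[OF x(4)]] .
  have e: "eps @@ (x @@ eps) = (eps @@ (DD h @@ eps)) @@ uG ph xs"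
   unfolding x(1) by (simp add: G.R.assoc eps_comm[OF u])
  have "\<exists>c. eps @@ (x @@ eps) = scl c (uG ph xs) @@ eps"
  proof (cases "h : A")
   case True
   have "eps @@ (x @@ eps) = scl (l h) (uG ph xs) @@ eps"
    unfolding e DD_eps(1)[OF True] by (simp add: G.R.distribs eps_idem eps_comm[OF u])
   thus ?thesis by blast
  next
   case False
   hence "eps @@ (x @@ eps) = scl 0 (uG ph xs) @@ eps" unfolding e eps_off[OF x(2) False] by simp
   thus ?thesis by blast
  qed
  then obtain c where c: "eps @@ (x @@ eps) = scl c (uG ph xs) @@ eps" by blast
  have "eps @@ ((scl a x + y) @@ eps) = (scl a (scl c (uG ph xs)) + d) @@ eps"
   using c d(2) by (simp add: G.R.distribs)
  moreover have "scl a (scl c (uG ph xs)) + d : SA"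
   by (intro fv.subspace_add[OF SA_sub] fv.subspace_scale[OF SA_sub] u d(1))
  ultimately show ?case by blast
 qed
qed

lemma Ge_corner: "x : carrier (corner_alg (kGe S) eps) \<longleftrightarrow> x : Ec & eps @@ x = x & x @@ eps = x"
 using Ge.corner_carrier[OF eps_kGe] eps_idem by simp

lemma frakA_corner: "alg_isomorphic (frakA S) (corner_alg (kGe S) eps)"
proof -
 interpret Af: fun_alg "frakA S" by (rule frakA_alg)
 interpret Ce: fun_alg "corner_alg (kGe S) eps" using Ge.corner_fun_alg[OF eps_kGe] eps_idem by simp
 let ?f = "%c. c @@ eps"
 have inj: "inj_on ?f SA"
 proof (rule inj_onI)
  fix c d assume cd: "c : SA" "d : SA" "c @@ eps = d @@ eps"
  have "c - d : SA" "(c - d) @@ eps = 0" using cd fv.subspace_diff[OF SA_sub cd(1,2)] by (simp_all add: G.R.distribs)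
  hence "c - d = 0" by (rule eps_inj)
  thus "c = d" by simp
 qed
 have into: "c @@ eps : carrier (corner_alg (kGe S) eps)" if c: "c : SA" for c
 proof -
  have "c @@ eps : Ec" using Ge.mul_closed[of c eps] SA_kGe c eps_kGe by auto
  moreover have "eps @@ (c @@ eps) = c @@ eps"
  proof -
   have "eps @@ (c @@ eps) = (eps @@ c) @@ eps" by (simp only: G.R.assoc)
   thus ?thesis by (simp add: eps_comm[OF c] G.R.assoc eps_idem)
  qed
  ultimately show ?thesis by (simp add: Ge_corner G.R.assoc eps_idem)
 qed
 have surj: "?f ` SA = carrier (corner_alg (kGe S) eps)"
 proof
  show "?f ` SA <= carrier (corner_alg (kGe S) eps)" using into by blast
  show "carrier (corner_alg (kGe S) eps) <= ?f ` SA"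
  proof
   fix x assume "x : carrier (corner_alg (kGe S) eps)"
   hence x: "x : Ec" "eps @@ x = x" "x @@ eps = x" by (simp_all add: Ge_corner)
   thus "x : ?f ` SA" using eps_corner[OF x(1)] by auto
  qed
 qed
 have bij: "bij_betw ?f SA (carrier (corner_alg (kGe S) eps))" using inj surj by (simp add: bij_betw_def)
 have "?f : alg_iso (frakA S) (corner_alg (kGe S) eps)"
 proof (rule alg_isoI[where g = "the_inv_into SA ?f"])
  show "the_inv_into SA ?f y : carrier (frakA S)" if "y : carrier (corner_alg (kGe S) eps)" for y
   using the_inv_into_into[OF inj, of y SA] that surj by (simp add: frakA_simps)
  show "the_inv_into SA ?f (?f x) = x" if "x : carrier (frakA S)" for x
   using the_inv_into_f_f[OF inj] that by (simp add: frakA_simps)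
  show "?f (the_inv_into SA ?f y) = y" if "y : carrier (corner_alg (kGe S) eps)" for y
   using f_the_inv_into_f[OF inj, of y] that surj by simp
  fix x assume x: "x : carrier (frakA S)"
  hence xS: "x : SA" by (simp add: frakA_simps)
  show "?f x : carrier (corner_alg (kGe S) eps)" by (rule into[OF xS])
  show "?f (c *.[frakA S] x) = c *.[corner_alg (kGe S) eps] ?f x" for c
   by (simp add: Af.smult_A Ce.smult_A G.R.distribs)
  fix y assume y: "y : carrier (frakA S)"
  hence yS: "y : SA" by (simp add: frakA_simps)
  show "?f (x +[frakA S] y) = ?f x +[corner_alg (kGe S) eps] ?f y"
   by (simp add: Af.add_A Ce.add_A G.R.distribs)
  have "?f x *[corner_alg (kGe S) eps] ?f y = x @@ (eps @@ (y @@ eps))" by (simp add: corner_alg_def G.R.assoc)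
  also have "... = x @@ (y @@ (eps @@ eps))" by (simp add: eps_comm[OF yS] flip: G.R.assoc)
  finally show "?f (x *[frakA S] y) = ?f x *[corner_alg (kGe S) eps] ?f y" by (simp add: frakA_simps eps_idem G.R.assoc)
 next
  show "?f #1[frakA S] = #1[corner_alg (kGe S) eps]" by (simp add: frakA_simps eps_eZ) (simp add: corner_alg_def)
 qed
 thus ?thesis by (auto simp: alg_isomorphic_def)
qed

text \<open>By \<open>eps_corner\<close> the element may be taken from \<open>SA\<close>. There a
  nonempty word lies in \<open>NJ 1\<close>, and an empty word is a vertex idempotent, which leaves
  a scalar if the two ends agree.\<close>

lemma eps_En_mult:
 assumes ph: "ph : Ir" and ze: "ze : Ir" and x: "x : Ec"
 shows "\<exists>c. (eps @@ En ph) @@ x @@ (eps @@ En ze) - scl c (if ph = ze then eps @@ En ph else 0) : NJ 1"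
proof -
 obtain d where d: "d : SA" "eps @@ (x @@ eps) = d @@ eps" using eps_corner[OF x] by blast
 note E = eps_comm[OF En_SA[OF ph]] eps_comm[OF En_SA[OF ze]]
 have "(eps @@ En ph) @@ x @@ (eps @@ En ze) = En ph @@ ((eps @@ (x @@ eps)) @@ En ze)" by (simp add: E(1) G.R.assoc)
 also have "... = (En ph @@ (d @@ En ze)) @@ eps" unfolding d(2) by (simp add: G.R.assoc E(2))
 finally have e: "(eps @@ En ph) @@ x @@ (eps @@ En ze) = (En ph @@ (d @@ En ze)) @@ eps" .
 have "\<exists>c. (En ph @@ (d @@ En ze)) @@ eps - scl c (if ph = ze then eps @@ En ph else 0) : NJ 1"
  using d(1) unfolding SA_def
 proof (induction rule: fv.span_induct_alt)
  case base
  show ?case using fv.subspace_0[OF NJ_sub] by (intro exI[of _ 0]) simp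
 next
  case (step a u y)
  from step(1) obtain \<xi> ys where u: "u = uG \<xi> ys" "\<xi> : Ir" "ys : PBW S" by blast
  from step(2) obtain c where c: "(En ph @@ (y @@ En ze)) @@ eps - scl c (if ph = ze then eps @@ En ph else 0) : NJ 1" ..
  have "\<exists>b. (En ph @@ (u @@ En ze)) @@ eps - scl b (if ph = ze then eps @@ En ph else 0) : NJ 1"
  proof (cases "ys = []")
   case True
   have "(En ph @@ (u @@ En ze)) @@ eps = scl (if \<xi> = ph then 1 else 0) (if ph = ze then eps @@ En ph else 0)"
    using u True ph ze E by (simp add: En_orth)
   thus ?thesis using fv.subspace_0[OF NJ_sub] by (intro exI[of _ "if \<xi> = ph then 1 else 0"]) simp
  next
   case False
   have "u : NJ 1" unfolding u(1) by (rule uG_NJ[OF u(2) PBW_letters[OF u(3)] False])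
   moreover have "En ph : NJ 0" "En ze : NJ 0" "eps : NJ 0" using NJ_0 En_in eps_in by blast+
   ultimately have "(En ph @@ (u @@ En ze)) @@ eps : NJ (0 + (1 + 0) + 0)" by (intro NJ_mult)
   thus ?thesis by (intro exI[of _ 0]) simp
  qed
  then obtain b where b: "(En ph @@ (u @@ En ze)) @@ eps - scl b (if ph = ze then eps @@ En ph else 0) : NJ 1" by blast
  have "(En ph @@ ((scl a u + y) @@ En ze)) @@ eps - scl (a * b + c) (if ph = ze then eps @@ En ph else 0) =
   scl a ((En ph @@ (u @@ En ze)) @@ eps - scl b (if ph = ze then eps @@ En ph else 0)) +
   ((En ph @@ (y @@ En ze)) @@ eps - scl c (if ph = ze then eps @@ En ph else 0))"
   by (simp add: G.R.distribs fv.scale_left_distrib fv.scale_right_diff_distrib)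
  thus ?case using fv.subspace_add[OF NJ_sub fv.subspace_scale[OF NJ_sub b] c] by (intro exI[of _ "a * b + c"]) simp
 qed
 thus ?thesis unfolding e .
qed

lemma sum_eps_En: "(SUM ph:Ir. eps @@ En ph) = eps"
 using eps_eZ(2) unfolding sum_En[symmetric] by (simp only: G.R.sum_r)

text \<open>The conjugates of \<open>eps\<close> by a transversal of \<open>A\<close> are orthogonal
  by \<open>eps_off\<close> and sum to the identity of kGe, so they yield matrix units. The
  primitive idempotents are the products of \<open>eps\<close> with the vertex idempotents, to which
  \<open>basic_setI\<close> applies with the ideal \<open>NJ 1\<close> inside kGe.\<close>

theorem morita:
 "\<exists>I m. basic_set (kGe S) I & (\<Oplus>\<^bsub>kGe S\<^esub>i\<in>I. i) = eps & m >= 1 &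
  alg_isomorphic (kGe S) (mat_alg m (corner_alg (kGe S) eps))"
proof -
 from transversal[OF A] obtain m :: nat and ta where tr:
  "(\<forall>l<m. ta l : Hc) & (\<forall>l<m. \<forall>l'<m. inv[H] (ta l) *[H] ta l' : A --> l = l') &
  (\<forall>f :: 'h => 'p \<times> 'h => 'k. (SUM h:Hc. f h) = (\<Sum>l<m. SUM a:A. f (ta l *[H] a)))"
  by (elim exE)
 note ta1 = tr[THEN conjunct1] and ta2 = tr[THEN conjunct2, THEN conjunct1] and ta3 = tr[THEN conjunct2, THEN conjunct2]
 note ta = ta1[rule_format] ta2[rule_format] and su = ta3[rule_format]
 have st: "eps @@ (DD (inv[H] (ta i)) @@ (DD (ta j) @@ eps)) = (if i = j then eps else 0)" if ij: "i < m" "j < m" for i j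
 proof -
  have "eps @@ (DD (inv[H] (ta i)) @@ (DD (ta j) @@ eps)) = eps @@ (DD (inv[H] (ta i) *[H] ta j) @@ eps)"
   using DD_mult[of "inv[H] (ta i)" "ta j"] ta(1) ij by (simp flip: G.R.assoc)
  also have "... = (if i = j then eps else 0)"
  proof (cases "i = j")
   case True
   thus ?thesis using ta(1)[OF ij(1)] by (simp add: DD_one eps_eZ eps_idem)
  next
   case False
   thus ?thesis using eps_off[of "inv[H] (ta i) *[H] ta j"] ta(1) ta(2)[OF ij] ij by auto
  qed
  finally show ?thesis .
 qed
 define g where "g = (\<Sum>i<m. DD (ta i) @@ (eps @@ DD (inv[H] (ta i))))"
 have "(SUM h:Hc. DD h @@ (eps @@ DD (inv[H] h))) = (\<Sum>i<m. SUM a:A. DD (ta i) @@ (eps @@ DD (inv[H] (ta i))))"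
  unfolding su
 proof (intro sum.cong refl)
  fix i a assume i: "i : {..<m}" and a: "a : A"
  have t: "ta i : Hc" using ta(1) i by simp
  have "DD (ta i *[H] a) @@ (eps @@ DD (inv[H] (ta i *[H] a))) =
   DD (ta i) @@ (((DD a @@ eps) @@ DD (inv[H] a)) @@ DD (inv[H] (ta i)))"
   using t A_H[OF a] by (simp add: H.inv_mult_group DD_mult[symmetric] G.R.assoc)
  \<comment> \<open>The factors \<open>l a\<close> and l(a^-1) cancel, so all elements of a coset
    contribute the same conjugate.\<close>
  also have "(DD a @@ eps) @@ DD (inv[H] a) = eps"
   using DD_eps(1)[OF a] DD_eps(2)[OF subgroup.m_inv_closed[OF A a]] l_inv[OF a] lchar_nz[OF l a] by (simp add: G.R.distribs)
  finally show "DD (ta i *[H] a) @@ (eps @@ DD (inv[H] (ta i *[H] a))) = DD (ta i) @@ (eps @@ DD (inv[H] (ta i)))" .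
 qed
 also have "... = scl (of_nat (card A)) g"
 proof -
  have "(SUM a:A. y) = scl (of_nat (card A)) y" for y :: "'p \<times> 'h => 'k"
   using fv.scale_sum_left[of "%_. 1" A y] by simp
  thus ?thesis unfolding g_def by (simp add: fv.scale_sum_right)
 qed
 finally have ag: "scl (of_nat (card A)) g = scl (inverse (of_nat (card A)) * (of_nat (card (Hc)) * of_nat (card C))) eZ"
  unfolding eps_average by simp
 \<comment> \<open>In the field this is |H| |C| / |A|^2. It is nonzero and, since \<open>g\<close>
   is idempotent, satisfies c^2 = c; so it must be 1.\<close>
 define c :: 'k where "c = inverse (of_nat (card A)) * (inverse (of_nat (card A)) * (of_nat (card (Hc)) * of_nat (card C))) "
 have c0: "c ~= 0" unfolding c_def using average_nz card_nz[OF A] by simp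
 have "scl (inverse (of_nat (card A))) (scl (of_nat (card A)) g) = scl c eZ" unfolding ag c_def by simp
 hence gc: "g = scl c eZ" using card_nz[OF A] by simp
 have "g @@ g = g"
 proof -
  have "g @@ g = (\<Sum>j<m. \<Sum>i<m. DD (ta i) @@ ((eps @@ (DD (inv[H] (ta i)) @@ (DD (ta j) @@ eps))) @@ DD (inv[H] (ta j))))"
   unfolding g_def G.R.sum_l G.R.sum_r by (simp only: G.R.assoc)
  also have "... = (\<Sum>j<m. \<Sum>i<m. if i = j then DD (ta j) @@ (eps @@ DD (inv[H] (ta j))) else 0)"
   by (intro sum.cong refl) (auto simp: st)
  finally show ?thesis by (simp add: g_def)
 qed
 hence "scl (c * c - c) eZ = 0" unfolding gc by (simp add: G.R.distribs eZ_idem fv.scale_left_diff_distrib)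
 hence "c * c - c = 0" using eZ_nz by (metis fv.scale_eq_0_iff)
 hence "c = 1" using c0 by simp
 hence ts: "(\<Sum>i<m. DD (ta i) @@ (eps @@ DD (inv[H] (ta i)))) = eZ" using gc by (simp add: g_def)
 have m: "m >= 1"
 proof (rule ccontr)
  assume "\<not> m >= 1"
  hence "m = 0" by simp
  thus False using ts eZ_nz by simp
 qed
 have iso: "alg_isomorphic (kGe S) (mat_alg m (corner_alg (kGe S) eps))"
  by (rule Ge.matrix_units_iso[where t = "%i. DD (ta i)" and s = "%i. DD (inv[H] (ta i))"])
   (use eps_kGe eps_idem DD_kGe ta(1) st ts in auto)
 note bs = Ge.basic_setI[where \<Phi> = "Ir" and ep = "%ph. eps @@ En ph" and N = "NJ 1 \<inter> Ec"
   and r = "rad_length (kP S)" and \<Lambda> = "{..<m}" and t = "%i. DD (ta i)" and s = "%i. DD (inv[H] (ta i))", unfolded kGe_simps]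
 have En_kGe: "En ph : Ec" if "ph : Ir" for ph using En_SA[OF that] SA_kGe by blast
 have mk: "x @@ y : Ec" if "x : Ec" "y : Ec" for x y
  using Ge.mul_closed[OF that] by simp
 have N0: "x : NJ 0" if "x : Ec" for x using that NJ_0 by (auto simp: kGe_carrier)
 have e: "eps @@ En ph : Ec" if "ph : Ir" for ph by (rule mk[OF eps_kGe En_kGe[OF that]])
  have h1: "finite (Ir)" by (rule finite_IrrZ)
  have h2: "eps @@ En ph : Ec" if "ph : Ir" for ph by (rule e[OF that])
  have h3: "eps @@ En ph ~= 0" if ph: "ph : Ir" for ph
   using eps_inj[OF En_SA[OF ph]] En_nz[OF ph] eps_comm[OF En_SA[OF ph]] by auto
  have h4: "eps @@ En ph @@ (eps @@ En ze) = (if ph = ze then eps @@ En ph else 0)" if ph: "ph : Ir" and ze: "ze : Ir" for ph ze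
  proof -
   have "eps @@ En ph @@ (eps @@ En ze) = eps @@ ((En ph @@ eps) @@ En ze)" by (simp only: G.R.assoc)
   also have "... = (eps @@ eps) @@ (En ph @@ En ze)" unfolding eps_comm[OF En_SA[OF ph], symmetric] by (simp only: G.R.assoc)
   finally show ?thesis by (simp add: eps_idem En_orth ph ze)
  qed
  have h5: "fv.subspace (NJ 1 \<inter> Ec)" by (rule fv.subspace_inter[OF NJ_sub Ge.sub_A])
  have h6: "NJ 1 \<inter> Ec <= Ec" by blast
  have h7: "x @@ n : NJ 1 \<inter> Ec" "n @@ x : NJ 1 \<inter> Ec"
   if "x : Ec" "n : NJ 1 \<inter> Ec" for x n
   using NJ_mult[OF N0[OF that(1)], of n 1] NJ_mult[of n 1 x 0] N0[OF that(1)] mk that by auto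
  have h8: "((%y. n @@ y) ^^ rad_length (kP S)) x = 0" if n: "n : NJ 1 \<inter> Ec" and x: "x : Ec" for n x
  proof -
   have "((%y. n @@ y) ^^ i) x : NJ i" for i
   proof (induction i)
    case 0
    show ?case using N0[OF x] by simp
   next
    case (Suc i)
    have "n @@ ((%y. n @@ y) ^^ i) x : NJ (1 + i)" using n Suc by (intro NJ_mult) auto
    thus ?case by simp
   qed
   thus ?thesis using NJ_top by blast
  qed
  have h9: "\<exists>c. eps @@ En ph @@ x @@ (eps @@ En ph) - scl c (eps @@ En ph) : NJ 1 \<inter> Ec"
   if ph: "ph : Ir" and x: "x : Ec" for ph x
  proof -
   obtain c where "eps @@ En ph @@ x @@ (eps @@ En ph) - scl c (eps @@ En ph) : NJ 1"
    using eps_En_mult[OF ph ph x] by auto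
   moreover have "eps @@ En ph @@ x @@ (eps @@ En ph) - scl c (eps @@ En ph) : Ec"
    by (rule Ge.closed(6)[OF mk[OF mk[OF e[OF ph] x] e[OF ph]] Ge.closed(4)[OF e[OF ph]]])
   ultimately show ?thesis by blast
  qed
  have h10: "eps @@ En ph @@ x @@ (eps @@ En ze) : NJ 1 \<inter> Ec"
   if ph: "ph : Ir" and ze: "ze : Ir" and ne: "ph ~= ze" and x: "x : Ec" for ph ze x
   using eps_En_mult[OF ph ze x] ne mk[OF mk[OF e[OF ph] x] e[OF ze]] by auto
  have h11: "DD (ta i) : Ec" "DD (inv[H] (ta i)) : Ec" if "i : {..<m}" for i
   using ta(1) that DD_kGe by simp_all
  have "(SUM ph:Ir. DD (ta i) @@ (eps @@ En ph @@ DD (inv[H] (ta i)))) = DD (ta i) @@ (eps @@ DD (inv[H] (ta i)))" for i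
   by (simp only: G.R.sum_r[symmetric] G.R.sum_l[symmetric] sum_En eps_eZ)
  hence h12: "(\<Sum>i<m. SUM ph:Ir. DD (ta i) @@ (eps @@ En ph @@ DD (inv[H] (ta i)))) = eZ" using ts by simp
  note b = bs[OF h1 h2 h3 h4 h5 h6 h7 h8 h9 h10 h11 h12]
 show ?thesis using b iso m sum_eps_En by auto
qed

end

theorem morita_equivalence:
 "\<exists>I m. basic_set (kGe S) I & alg_isomorphic (frakA S) (corner_alg (kGe S) (\<Oplus>\<^bsub>kGe S\<^esub>i\<in>I. i)) & m >= 1 &
  alg_isomorphic (kGe S) (mat_alg m (corner_alg (kGe S) (\<Oplus>\<^bsub>kGe S\<^esub>i\<in>I. i))) &
  k_algebra (corner_alg (kGe S) (\<Oplus>\<^bsub>kGe S\<^esub>i\<in>I. i))"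
proof -
 obtain A l where A: "subgroup A H" "C <= A" "lchar H A l" "ALL b:C. l b = phi0 S b"
  "ALL h:Hc. (ALL a:A. a *[H] h = h *[H] a) --> h : A"
  using H.lchar_maximal[OF H_finite sub_C lchar_C[OF phi0]] by blast
 note a = A(1,2,3) A(4)[rule_format] A(5)[rule_format]
 obtain I m where I: "basic_set (kGe S) I" "(\<Oplus>\<^bsub>kGe S\<^esub>i\<in>I. i) = eps A l" "m >= 1"
  "alg_isomorphic (kGe S) (mat_alg m (corner_alg (kGe S) (eps A l)))" using morita[OF a] by blast
 have "eps A l *[kGe S] eps A l = eps A l" unfolding kGe_simps by (rule eps_idem[OF a])
 from Ge.corner_fun_alg[OF eps_kGe[OF a] this] have "k_algebra (corner_alg (kGe S) (eps A l))"
  by (rule fun_alg.k_algebra_A)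
 thus ?thesis
  using I(1,3,4) frakA_corner[OF a] unfolding I(2)[symmetric] by blast
qed

end

section \<open>The classical case\<close>

context block_setting
begin

abbreviation CC where "CC \<equiv> H\<lparr>carrier := C\<rparr>"
abbreviation M where "M \<equiv> grpM S"

definition co :: "'h => 'h set" where "co c = subZ S #>\<^bsub>CC\<^esub> c"

lemma CC_group: "comm_group CC"
proof -
 interpret CG: group CC by (rule subgroup.subgroup_is_group[OF sub_C H_group])
 show ?thesis using C_comm C_carrier by (intro CG.group_comm_groupI) simp
qed

lemma Z_normal: "subZ S \<lhd> CC"
 by (rule comm_group.subgroup_imp_normal[OF CC_group H.subgroup_incl[OF sub_Z sub_C Z_central]])

lemma M_group: "group M"
 unfolding grpM_def by (rule normal.factorgroup_is_group[OF Z_normal])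

lemma M_carrier: "carrier M = co ` C"
 by (auto simp: grpM_def FactGroup_def RCOSETS_def co_def)

lemma M_mult: "c : C ==> d : C ==> co c *[M] co d = co (c *[H] d)"
 using normal.rcos_sum[OF Z_normal, of c d] by (simp add: grpM_def FactGroup_def co_def)

lemma M_one: "#1[M] = co #1[H]"
 using normal.axioms(1)[OF Z_normal] Z_carrier by (auto simp: grpM_def FactGroup_def co_def r_coset_def)

lemma co_elem: "z : co c ==> EX y:subZ S. z = y *[H] c" and co_self: "c : C ==> c : co c"
 using subgroup.one_closed[OF sub_Z] C_carrier by (auto simp: co_def r_coset_def intro!: bexI[of _ "#1[H]"])

lemma the_elem_co:
 assumes c: "c : C" and f: "!!z. z : subZ S ==> f (z *[H] c) = f c" shows "the_elem (f ` co c) = f c"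
proof -
 have "f ` co c = {f c}" using co_self[OF c] co_elem[of _ c] f by fastforce
 thus ?thesis by simp
qed

lemma co_eq_one: "c : C ==> co c = #1[M] \<longleftrightarrow> c : subZ S"
proof
 assume c: "c : C" and "co c = #1[M]"
 hence "c : #1[M]" using co_self by blast
 thus "c : subZ S" by (simp add: grpM_def FactGroup_def)
next
 assume c: "c : C" and z: "c : subZ S"
 interpret N: normal "subZ S" CC by (rule Z_normal)
 show "co c = #1[M]" using N.rcos_const[OF subgroup.subgroup_is_group[OF sub_C H_group] z] by (simp add: co_def grpM_def FactGroup_def)
qed

text \<open>Values at a coset, well defined because Z acts trivially on P, each
  \<open>psi S i\<close> is trivial on Z, and any two characters in \<open>IrrZ\<close> agree
  there.\<close>

definition actM where "actM T = the_elem (actH S ` T)"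
definition psiM where "psiM i T = the_elem (psi S i ` T)"
definition nuM where "nuM ph T = the_elem ((%h. ph h / phi0 S h) ` T)"

lemma actM_co: "c : C ==> actM (co c) = actH S c"
 unfolding actM_def
proof (rule the_elem_co)
 fix z assume c: "c : C" and z: "z : subZ S"
 have "actH S z = #1[grpL S]" using z by (simp add: subZ_def kernel_def)
 thus "actH S (z *[H] c) = actH S c"
  using act.hom_mult[OF Z_carrier[OF z] C_carrier[OF c]] act.hom_closed[OF C_carrier[OF c]] by simp
qed

lemma psiM_co: "i : LT ==> c : C ==> psiM i (co c) = psi S i c"
 unfolding psiM_def
 by (rule the_elem_co) (simp_all add: psi_mult Z_carrier C_carrier HomHZ_Z psi_hom)

lemma nuM_co: "ph : Ir ==> c : C ==> nuM ph (co c) = ph c / phi0 S c"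
 unfolding nuM_def
proof (rule the_elem_co)
 fix z assume ph: "ph : Ir" and c: "c : C" and z: "z : subZ S"
 show "ph (z *[H] c) / phi0 S (z *[H] c) = ph c / phi0 S c"
  using lchar_mult[OF lchar_C[OF ph] Z_C[OF z] c] lchar_mult[OF lchar_C[OF phi0] Z_C[OF z] c]
   IrrZ_Z[OF ph z] IrrZ_Z[OF phi0 z] lchar_nz[OF lchar_Z z] by simp
qed

lemma C_mult: "c : C ==> d : C ==> c *[H] d : C"
 by (rule subgroup.m_closed[OF sub_C])

lemma tr_act: "i : LT ==> h : Hc ==> G.tr (actH S h) (wlift S i) = scl (psi S i h) (wlift S i)"
proof -
 assume i: "i : LT" and h: "h : Hc"
 have k: "scl (psi S i h) (wlift S i) : Pc" "G.tr (actH S h) (wlift S i) : Pc"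
  unfolding G.tr_def using h by (auto intro!: kP.closed wlift_carrier[OF i] kP.delta_in G.act_in)
 have "G.emb (G.tr (actH S h) (wlift S i)) @@ G.br h = G.emb (scl (psi S i h) (wlift S i)) @@ G.br h"
  using G.br_emb[OF h wlift_carrier[OF i]] wl_eigen[OF i h] by (simp add: G.emb_scl G.R.distribs)
 thus ?thesis using G.emb_br_apply[OF k(1) h] G.emb_br_apply[OF k(2) h] by (metis ext)
qed

lemma semi_M: "semi (grpP S) M actM (kP S) (kPM S)"
proof (intro semi.intro semi_axioms.intro P_group M_group finite_P)
 show "finite (carrier M)" unfolding M_carrier using C_fin by simp
 show "kPM S = group_algebra (semidirect P M actM)" by (simp add: kPM_def actM_def[abs_def])
 fix u x y assume u: "u : carrier M" and x: "x : carrier P"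
 obtain c where c: "c : C" "u = co c" using u by (auto simp: M_carrier)
 note cH = C_carrier[OF c(1)]
 show "actM u x : carrier P" using G.act_in[OF cH x] c by (simp add: actM_co)
 show "actM u (x *[P] y) = actM u x *[P] actM u y" if "y : carrier P"
  using G.act_mult[OF cH x that] c by (simp add: actM_co)
 fix v assume "v : carrier M"
 then obtain d where d: "d : C" "v = co d" by (auto simp: M_carrier)
 show "actM (u *[M] v) x = actM u (actM v x)"
  using G.act_comp[OF cH C_carrier[OF d(1)] x] c d by (simp add: M_mult actM_co C_mult)
next
 fix x assume "x : carrier P"
 thus "actM #1[M] x = x" using G.act_one subgroup.one_closed[OF sub_C] by (simp add: M_one actM_co)
qed (simp add: kP_def)

lemma semi_words_M: "semi_words S M actM (kPM S) (carrier M) nuM psiM"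
proof (intro semi_words.intro semi_words_axioms.intro block_setting_axioms semi_M)
 interpret M: group M by (rule M_group)
 interpret sM: semi "grpP S" M actM "kP S" "kPM S" by (rule semi_M)
 show "subgroup (carrier M) M" by (rule M.subgroup_self)
 show "n *[M] h = h *[M] n" if "n : carrier M" "h : carrier M" for n h
  using that C_comm C_carrier by (auto simp: M_carrier M_mult)
 show "of_nat (card (carrier M)) ~= (0 :: 'k)"
 proof
  assume 0: "of_nat (card (carrier M)) = (0 :: 'k)"
  interpret CG: comm_group CC by (rule CC_group)
  have "card (carrier M) * card (subZ S) = card C"
   using CG.lagrange[OF normal_imp_subgroup[OF Z_normal]] by (simp add: grpM_def FactGroup_def Coset.order_def)
  hence "of_nat (card C) = (0 :: 'k)" using 0 by (metis mult_zero_left of_nat_mult)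
  thus False using card_nz[OF sub_C] by simp
 qed
 fix ph assume ph: "ph : Ir"
 show "lchar M (carrier M) (nuM ph)"
  unfolding lchar_def M_carrier
  using ph phi0 lchar_nz[OF lchar_C] lchar_mult[OF lchar_C] by (auto simp: nuM_co M_mult C_mult)
 show "EX n:carrier M. nuM ph n ~= nuM ze n" if ze: "ze : Ir" "ph ~= ze" for ze
 proof -
  obtain c where c: "c : C" "ph c ~= ze c" using extensionalityI[OF IrrZ_ext[OF ph] IrrZ_ext[OF ze(1)]] ze(2) by blast
  hence "nuM ph (co c) ~= nuM ze (co c)" using lchar_nz[OF lchar_C[OF phi0] c(1)] ph ze(1) by (simp add: nuM_co)
  thus ?thesis using c(1) by (auto simp: M_carrier)
 qed
 show "nuM (tw S ph (psi S i)) n = nuM ph n * psiM i n" if i: "i : LT" and n: "n : carrier M" for i n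
  using n tw_psi[OF ph i] ph i by (auto simp: M_carrier nuM_co psiM_co) (simp add: tw_def)
next
 interpret sM: semi "grpP S" M actM "kP S" "kPM S" by (rule semi_M)
 fix i assume i: "i : LT"
 show "lchar M (carrier M) (psiM i)"
  unfolding lchar_def M_carrier using psi_nz[OF i] psi_mult[OF i] C_carrier i by (auto simp: psiM_co M_mult C_mult)
 fix h assume "h : carrier M"
 then obtain c where c: "c : C" "h = co c" "h : carrier M" by (auto simp: M_carrier)
 have "sM.tr (actM h) (wlift S i) = scl (psiM i h) (wlift S i)"
  using tr_act[OF i C_carrier[OF c(1)]] c i by (simp add: sM.tr_def G.tr_def actM_co psiM_co)
 thus "delta (#1[P], h) *[kPM S] embP M (wlift S i) = scl (psiM i h) (embP M (wlift S i) *[kPM S] delta (#1[P], h))"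
  using sM.br_emb[OF c(3) wlift_carrier[OF i]] by (simp add: sM.emb_scl sM.R.distribs)
qed

end

locale classical_setting = block_setting S for S :: "('p, 'h, 'k::alg_closed_field) block_data"
begin

sublocale MW: semi_words S "grpM S" actM "kPM S" "carrier (grpM S)" nuM psiM
 by (rule semi_words_M)

abbreviation mulM (infixl \<open>*@\<close> 70) where "x *@ y \<equiv> x *[kPM S] y"

lemma ePhiM_EK: "ePhiM S ph = MW.EK ph"
proof -
 have n: "(%C. the_elem ((%h. ph h / phi0 S h) ` C)) = nuM ph" by (simp add: nuM_def fun_eq_iff)
 show ?thesis unfolding ePhiM_def MW.EK_def n ..
qed

abbreviation EM where "EM \<equiv> ePhiM S"
abbreviation UM where "UM \<equiv> wPhiM S"

lemma UM_eq: "UM i ph = MW.emb (wlift S i) *@ EM ph"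
 by (simp add: wPhiM_def)

lemma EM_in: "EM ph : carrier (kPM S)"
 by (simp add: ePhiM_EK MW.EK_in)

lemma EM_orth: "ph : Ir ==> ze : Ir ==> EM ph *@ EM ze = (if ph = ze then EM ph else 0)"
 unfolding ePhiM_EK by (rule MW.EK_orth)

lemma UM_word_system: "word_system S (kPM S) (ePhiM S) (wPhiM S)"
proof unfold_locales
 fix ph assume ph: "ph : Ir"
 show "EM ph : carrier (kPM S)" by (rule EM_in)
 show "EM ph *@ EM ze = (if ph = ze then EM ph else 0)" if "ze : Ir" for ze by (rule EM_orth[OF ph that])
 fix i assume i: "i : LT"
 show "UM i ph : carrier (kPM S)" unfolding UM_eq by (intro MW.R.mul_closed MW.wl_in[OF i] EM_in)
 show "UM i ph *@ EM ph = UM i ph" unfolding UM_eq by (simp add: MW.R.assoc EM_orth ph)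
 have "EM (tw S ph (psi S i)) *@ UM i ph = (EM (tw S ph (psi S i)) *@ MW.emb (wlift S i)) *@ EM ph"
  unfolding UM_eq by (simp only: MW.R.assoc)
 also have "... = MW.emb (wlift S i) *@ (EM ph *@ EM ph)"
  unfolding ePhiM_EK MW.wl_EK[OF ph i, symmetric] by (simp only: MW.R.assoc)
 finally show "EM (tw S ph (psi S i)) *@ UM i ph = UM i ph" unfolding UM_eq by (simp add: EM_orth ph)
qed

abbreviation uM where "uM \<equiv> uword S (kPM S) (ePhiM S) (wPhiM S)"

lemma uM_eq: "ph : Ir ==> set xs <= LT ==> uM ph xs = MW.emb (wmon S xs) *@ EM ph"
proof (induction xs)
 case Nil
 show ?case by (simp add: wmon_Nil MW.emb_one MW.R.one_l EM_in)
next
 case (Cons i xs)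
 hence l: "i : LT" "set xs <= LT" and ph: "ph : Ir" by auto
 have "uM ph (i # xs) = UM i (tws S ph xs) *@ uM ph xs" by simp
 also have "... = MW.emb (wlift S i) *@ ((EM (tws S ph xs) *@ MW.emb (wmon S xs)) *@ EM ph)"
  unfolding UM_eq[of i] Cons.IH[OF ph l(2)] by (simp only: MW.R.assoc)
 also have "... = (MW.emb (wlift S i) *@ MW.emb (wmon S xs)) *@ (EM ph *@ EM ph)"
  unfolding ePhiM_EK MW.wm_EK[OF ph l(2), symmetric] by (simp only: MW.R.assoc)
 finally show ?case by (simp only: EM_orth[OF ph ph] if_True refl MW.emb_wmon_Cons[OF l])
qed

lemma uM_lin:
 assumes ph: "ph : Ir"
 shows "MW.emb ((SUM k:LT. scl (c k) (wlift S k)) + (SUM xs:PBW S. scl (d xs) (wmon S xs))) *@ EM ph =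
  (SUM k:LT. scl (c k) (UM k ph)) + (SUM xs:PBW S. scl (d xs) (uM ph xs))"
proof -
 have "(SUM xs:PBW S. scl (d xs) (uM ph xs)) = (SUM xs:PBW S. scl (d xs) (MW.emb (wmon S xs) *@ EM ph))"
  using uM_eq[OF ph PBW_letters] by simp
 thus ?thesis by (simp add: MW.emb_add MW.emb_sum MW.emb_scl MW.R.distribs UM_eq)
qed

text \<open>As in \<open>sum_En\<close>, the coefficients away from the identity vanish, and the
  action on the vertex idempotent of \<open>phi0\<close> determines the remaining factor. Here the
  sum is the full identity.\<close>

lemma sum_EM: "(SUM ph:Ir. EM ph) = #1[kPM S]"
proof -
 let ?f = "SUM ph:Ir. EM ph"
 have EM0: "EM (phi0 S) ~= 0"
  using MW.NN_words(2)[OF MW.K.one_closed _ phi0, of "[]"] fv.subspace_0[OF MW.NN_sub] by (auto simp: ePhiM_EK)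
 have fE: "?f *@ EM (phi0 S) = EM (phi0 S)"
  using finite_IrrZ phi0 by (simp add: MW.R.sum_l EM_orth)
 have "?f = scl (inverse (of_nat (card (carrier M)))) (SUM ph:Ir. SUM h:carrier M. scl (nuM ph (inv[M] h)) (MW.br h))"
  unfolding ePhiM_EK MW.EK_eq by (simp only: fv.scale_sum_right)
 also have "(SUM ph:Ir. SUM h:carrier M. scl (nuM ph (inv[M] h)) (MW.br h)) =
  (SUM h:carrier M. scl (SUM ph:Ir. nuM ph (inv[M] h)) (MW.br h))"
  by (subst sum.swap) (simp only: fv.scale_sum_left)
 also have "... = (SUM h:{ #1[M]}. scl (SUM ph:Ir. nuM ph (inv[M] h)) (MW.br h))"
 proof (rule sum.mono_neutral_right[OF MW.finK], simp, rule ballI)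
  fix h assume h: "h : carrier M - { #1[M]}"
  hence "inv[M] h : carrier M" "inv[M] h ~= #1[M]" by (simp_all add: MW.K.inv_eq_1_iff)
  then obtain c where c: "c : C" "inv[M] h = co c" "c \<notin> subZ S" using co_eq_one by (auto simp: M_carrier)
  have "(SUM ph:Ir. nuM ph (inv[M] h)) = (SUM ph:Ir. ph c) / phi0 S c"
   unfolding c(2) sum_divide_distrib by (intro sum.cong refl) (simp add: nuM_co c(1))
  thus "scl (SUM ph:Ir. nuM ph (inv[M] h)) (MW.br h) = 0" using sum_IrrZ_zero[OF c(1,3)] by simp
 qed
 finally have "?f = scl (inverse (of_nat (card (carrier M))) * (SUM ph:Ir. nuM ph (inv[M] #1[M]))) #1[kPM S]"
  by (simp only: MW.one_br sum.insert_if[OF finite.emptyI] sum.empty empty_iff if_False add_0_right fv.scale_scale)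
 then obtain c where c: "?f = scl c #1[kPM S]" by (rule that)
 have "scl c (EM (phi0 S)) = scl 1 (EM (phi0 S))"
  using fE unfolding c by (simp add: MW.R.distribs MW.R.one_l EM_in)
 hence "c = 1" using EM0 by (metis fv.scale_right_imp_eq)
 thus ?thesis using c by simp
qed

text \<open>All the elements g are replaced by 1, so a word is its monomial times a vertex
  idempotent, and the identities of kP carry over with every scalar equal to 1.\<close>

theorem classical_presentation: "presented_by S classical_scalars (kPM S) (ePhiM S) (wPhiM S)"
proof -
 interpret W: word_system S "kPM S" "ePhiM S" "wPhiM S" by (rule UM_word_system)
 have emb_br: "MW.emb (wmon S xs) *@ EM ph = MW.emb (wmon S xs) *@ (MW.br #1[M] *@ MW.EK ph)" for xs ph
  by (simp add: ePhiM_EK MW.R.one_l MW.EK_in flip: MW.one_br)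
 have U1: "UM i ph *@ EM ph = UM i ph" if "ph : Ir" for i ph
  unfolding UM_eq using that by (simp add: MW.R.assoc EM_orth)
 interpret quiver_presentation S "kPM S" "ePhiM S" "wPhiM S" classical_scalars "MW.NN"
 proof unfold_locales
  show "(SUM ph:Ir. EM ph) = #1[kPM S]" by (rule sum_EM)
  show "fv.subspace MW.NN" by (rule MW.NN_sub)
  fix ph assume ph: "ph : Ir"
  show "EM ph \<notin> MW.NN" unfolding ePhiM_EK by (rule MW.NN_words(2)[OF MW.K.one_closed _ ph, of "[]"]) simp
  show "uM ph xs : MW.NN" if xs: "set xs <= LT" "xs ~= []" for xs
   unfolding uM_eq[OF ph xs(1)] emb_br by (rule MW.NN_words(1)[OF MW.K.one_closed xs])
  show "uM ph xs = 0" if xs: "set xs <= D1" "rad_length (kP S) <= length xs" for xs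
  proof -
   have "set xs <= LT" using xs(1) by (auto simp: D1_def)
   thus ?thesis by (simp add: uM_eq[OF ph] wmon_long[OF xs] MW.emb_0)
  qed
  fix i assume i: "i : LT"
  have "MW.emb (wlift S i) *@ EM ph : fv.span (uM ph ` {is. set is <= D1 & is ~= [] & tws S ph is = tw S ph (psi S i)})"
   using wlift_words[OF i]
  proof (induction rule: fv.span_induct_alt)
   case base
   show ?case by (simp add: MW.emb_0 fv.span_zero)
  next
   case (step c x y)
   then obtain xs where x: "x = wmon S xs" "set xs <= D1" "xs ~= []" "ALL h:Hc. Psi xs h = psi S i h" by blast
   have l: "set xs <= LT" "set [i] <= LT" using x(2) i by (auto simp: D1_def)
   have "Psi xs h = Psi [i] h" if "h : C" for h using x(4) C_carrier[OF that] by simp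
   hence "tws S ph xs = tws S ph [i]" by (rule tws_eqI[OF ph l])
   hence "uM ph xs : fv.span (uM ph ` {is. set is <= D1 & is ~= [] & tws S ph is = tw S ph (psi S i)})"
    using x by (intro fv.span_base) auto
   thus ?case using step(2) unfolding x(1) uM_eq[OF ph l(1)]
    by (simp add: MW.emb_add MW.emb_scl MW.R.distribs fv.span_add fv.span_scale)
  qed
  thus "UM i ph : fv.span (uM ph ` {is. set is <= D1 & is ~= [] & tws S ph is = tw S ph (psi S i)})"
   by (simp only: UM_eq)
  have r: "set (replicate CHAR('k) i) <= LT" using i by auto
  show "uM ph (replicate CHAR('k) i) =
    (SUM k:LT. scl (dLie S i k * sPow classical_scalars i k ph) (UM k ph))
    + (SUM xs:PBW S. scl (sPowErr classical_scalars i xs ph * dErr S i xs) (uM ph xs))"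
   unfolding uM_eq[OF ph r] pow_eq[OF i] yPow_eq uM_lin[OF ph] by (simp add: classical_scalars_def)
  fix j assume j: "j : LT"
  have l: "set [j, i] <= LT" "set [i, j] <= LT" using i j by auto
  have u: "UM j (tw S ph (psi S i)) *@ UM i ph = uM ph [j, i]" "UM i (tw S ph (psi S j)) *@ UM j ph = uM ph [i, j]"
   using U1[OF ph] by simp_all
  have L: "wmon S [i, j] - wmon S [j, i] = (SUM k:LT. scl (cLie S i j k) (wlift S k)) + (SUM xs:PBW S. scl (cErr S i j xs) (wmon S xs))"
   using comm_eq[OF i j] i j by (simp add: wmon_Cons wmon_Nil kP.one_r wlift_carrier yComm_eq)
  have "uM ph [i, j] - uM ph [j, i] = MW.emb (wmon S [i, j] - wmon S [j, i]) *@ EM ph"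
   unfolding uM_eq[OF ph l(1)] uM_eq[OF ph l(2)] by (simp only: MW.emb_diff MW.R.diff_l)
  also have "... = (SUM k:LT. scl (cLie S i j k) (UM k ph)) + (SUM xs:PBW S. scl (cErr S i j xs) (uM ph xs))"
   unfolding L by (rule uM_lin[OF ph])
  finally have e: "(SUM k:LT. scl (cLie S i j k) (UM k ph)) + (SUM xs:PBW S. scl (cErr S i j xs) (uM ph xs)) = uM ph [i, j] - uM ph [j, i]" ..
  show "UM j (tw S ph (psi S i)) *@ UM i ph -
    scl (sSwap classical_scalars i j ph) (UM i (tw S ph (psi S j)) *@ UM j ph) +
   ((SUM k:LT. scl (cLie S i j k * sLie classical_scalars i j k ph) (UM k ph))
    + (SUM xs:PBW S. scl (sErr classical_scalars i j xs ph * cErr S i j xs) (uM ph xs))) = 0"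
   unfolding u classical_scalars_def rel_scalars.simps mult_1_left mult_1_right e by simp
 next
  fix x assume x: "x : carrier (kPM S)"
  let ?V = "fv.span {uM ph xs | ph xs. ph : Ir & xs : PBW S}"
  have e: "MW.emb f *@ MW.br h *@ EM ph : ?V" if ph: "ph : Ir" and f: "f : Pc" and h: "h : carrier M" for ph f h
  proof -
   have "f : J 0" using f by (simp add: kP.augpow_0)
   then obtain a where a: "f = (SUM xs:PBW S. scl (a xs) (wmon S xs))" using PBW_expand by blast
   have b: "MW.br h *@ EM ph = scl (nuM ph h) (EM ph)" unfolding ePhiM_EK by (rule MW.br_EK[OF ph h])
   have "MW.emb (wmon S xs) *@ EM ph : ?V" if xs: "xs : PBW S" for xs
    unfolding uM_eq[OF ph PBW_letters[OF xs], symmetric] using ph xs by (intro fv.span_base) blast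
   hence "(SUM xs:PBW S. scl (a xs) (MW.emb (wmon S xs) *@ EM ph)) : ?V" by (intro fv.span_sum fv.span_scale)
   moreover have "MW.emb f *@ MW.br h *@ EM ph = scl (nuM ph h) (SUM xs:PBW S. scl (a xs) (MW.emb (wmon S xs) *@ EM ph))"
    unfolding MW.R.assoc b unfolding a MW.emb_sum MW.emb_scl by (simp only: MW.R.distribs)
   ultimately show ?thesis by (simp add: fv.span_scale)
  qed
  have "x = (SUM ph:Ir. x *@ EM ph)" unfolding MW.R.sum_r[symmetric] sum_EM by (simp add: MW.R.one_r x)
  also have "... : ?V"
  proof (rule fv.span_sum)
   fix ph assume ph: "ph : Ir"
   have "x *@ EM ph = (SUM h:carrier M. MW.emb (%y. x (y, h)) *@ MW.br h *@ EM ph)"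
    by (subst MW.R_expand(1)[OF x]) (simp only: MW.R.sum_l)
   also have "... : ?V" by (rule fv.span_sum) (rule e[OF ph MW.R_expand(2)[OF x]])
   finally show "x *@ EM ph : ?V" .
  qed
  finally show "x : ?V" .
 next
  fix c ph xs assume s: "(SUM ph:Ir. SUM xs:PBW S. scl (c ph xs) (uM ph xs)) = 0" and ph: "ph : Ir" and xs: "xs : PBW S"
  have "(SUM ph:Ir. SUM xs:PBW S. scl (c ph xs) (MW.emb (wmon S xs) *@ (MW.br #1[M] *@ MW.EK ph))) =
   (SUM ph:Ir. SUM xs:PBW S. scl (c ph xs) (uM ph xs))"
   by (intro sum.cong refl) (simp add: uM_eq[OF _ PBW_letters] emb_br)
  hence "(SUM ph:Ir. SUM xs:PBW S. scl (c ph xs) (MW.emb (wmon S xs) *@ (MW.br #1[M] *@ MW.EK ph))) = 0" using s by simp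
  from MW.words_independent[OF _ this ph xs] show "c ph xs = 0" by simp
 qed
 show ?thesis by (rule presented)
qed

end

section \<open>The twisted group algebra\<close>

context block_setting
begin

abbreviation LL where "LL \<equiv> grpL S"
abbreviation PL where "PL \<equiv> semidirect P LL (%si. si)"

lemma L_carrier: "carrier LL = autL S"
 by (simp add: grpL_def)

lemma L_from_H: "x : autL S ==> hat S x : Hc" "x : autL S ==> actH S (hat S x) = x"
 using hat_preimage by auto

lemma L_fin: "finite (carrier LL)"
proof -
 have "carrier LL <= actH S ` Hc" using L_from_H by (force simp: L_carrier)
 thus ?thesis using H_finite by (meson finite_imageI finite_subset)
qed

lemma semi_L: "semi P LL (%si. si) (kP S) (group_algebra PL)"
proof (intro semi.intro semi_axioms.intro P_group sub_autL finite_P L_fin)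
 fix u x y assume u: "u : carrier LL" and x: "x : carrier P"
 note h = L_from_H[of u, unfolded L_carrier[symmetric], OF u]
 show "u x : carrier P" using G.act_in[OF h(1) x] h(2) by simp
 show "u (x *[P] y) = u x *[P] u y" if "y : carrier P" using G.act_mult[OF h(1) x that] h(2) by simp
 fix v assume v: "v : carrier LL"
 note h' = L_from_H[of v, unfolded L_carrier[symmetric], OF v]
 show "(u *[LL] v) x = u (v x)"
  using G.act_comp[OF h(1) h'(1) x] act.hom_mult[OF h(1) h'(1)] h(2) h'(2) by simp
next
 fix x assume "x : carrier P"
 thus "#1[LL] x = x" using G.act_one act.hom_one by metis
qed (simp_all add: kP_def)

definition coPL where "coPL = (%(v, w). coc S (snd v, snd w))"

lemma tga_PL: "tga PL coPL"
proof -
 interpret sL: semi P LL "%si. si" "kP S" "group_algebra PL" by (rule semi_L)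
 have c: "coc S : carrier LL \<times> carrier LL \<rightarrow>\<^sub>E carrier kx"
  "!!x y z. x : carrier LL ==> y : carrier LL ==> z : carrier LL ==>
   coc S (x, y) * coc S (x *[LL] y, z) = coc S (x, y *[LL] z) * coc S (y, z)"
  using coc_cocycle by (auto simp: cocycles2_def)
 have nz: "coc S (x, y) ~= 0" if "x : carrier LL" "y : carrier LL" for x y
  using PiE_mem[OF c(1), of "(x, y)"] that by (simp add: ring_of_type_algebra_def)
 show ?thesis
 proof (intro tga.intro tga_axioms.intro sL.group_T)
  show "finite (carrier PL)" using finite_P L_fin by (simp add: semidirect_def)
  fix x y z assume x: "x : carrier PL" and y: "y : carrier PL"
  show "coPL (x, y) ~= 0" using x y nz by (auto simp: coPL_def semidirect_def)
  assume z: "z : carrier PL"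
  show "coPL (x, y) * coPL (x *[PL] y, z) = coPL (x, y *[PL] z) * coPL (y, z)"
   using x y z c(2)[of "snd x" "snd y" "snd z"] by (auto simp: coPL_def semidirect_def)
 qed
qed

sublocale TW: tga PL coPL
 by (rule tga_PL)

lemma k_alpha_eq: "k_alpha_PL S = twisted_group_algebra PL coPL"
 by (simp add: k_alpha_PL_def coPL_def)

lemma delta_eZ: "u : carrier P ==> h : Hc ==> z : subZ S ==>
 delta (u, z *[H] h) @@ eZ = scl (chi S z) (delta (u, h) @@ eZ)"
proof -
 assume u: "u : carrier P" and h: "h : Hc" and z: "z : subZ S"
 have zE: "G.br z @@ eZ = scl (chi S z) eZ"
  unfolding sum_En[symmetric] G.R.sum_r fv.scale_sum_right
  using br_En[OF _ Z_C[OF z]] IrrZ_Z[OF _ z] by simp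
 have "delta (u, h) @@ G.br z = delta (u, h *[H] z)"
  using u h Z_carrier[OF z] G.act_1[OF h] by (subst G.R.mul_delta) (simp_all add: semidirect_def)
 also have "h *[H] z = z *[H] h" using C_comm[OF Z_C[OF z] h] by (rule sym)
 finally have "delta (u, z *[H] h) = delta (u, h) @@ G.br z" by (rule sym)
 thus ?thesis by (simp add: G.R.assoc zE G.R.distribs)
qed

lemma act_Z: "z : subZ S ==> x : carrier P ==> actH S z x = x"
proof -
 assume z: "z : subZ S" and x: "x : carrier P"
 have "actH S z = actH S #1[H]" using z by (simp add: subZ_def kernel_def)
 thus ?thesis using G.act_one[OF x] by simp
qed

lemma eZ_central:
 assumes u: "u : carrier P" and h: "h : Hc" shows "eZ @@ delta (u, h) = delta (u, h) @@ eZ"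
proof -
 have "G.br z @@ delta (u, h) = delta (u, h) @@ G.br z" if z: "z : subZ S" for z
 proof -
  have "G.br z @@ delta (u, h) = delta (u, z *[H] h)"
   using u h Z_carrier[OF z] act_Z[OF z u] by (subst G.R.mul_delta) (simp_all add: semidirect_def)
  moreover have "delta (u, h) @@ G.br z = delta (u, h *[H] z)"
   using u h Z_carrier[OF z] G.act_1[OF h] by (subst G.R.mul_delta) (simp_all add: semidirect_def)
  ultimately show ?thesis using C_comm[OF Z_C[OF z] h] by simp
 qed
 thus ?thesis unfolding eZ_eq by (simp add: G.R.distribs)
qed

text \<open>The counterpart in kGe of the basis element of \<open>v\<close>: the lift chosen by
  \<open>hat\<close>, cut down by the central idempotent of \<open>chi\<close>.\<close>

definition BB :: "'p \<times> ('p => 'p) => 'p \<times> 'h => 'k" where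
 "BB v = delta (fst v, hat S (snd v)) @@ eZ"

text \<open>The lifts satisfy hat x hat y = z hat(xy) with z in Z. Next to \<open>eZ\<close> the
  factor z becomes \<open>chi S z\<close>, and by \<open>coc_chi\<close> this is the value of the
  cocycle.\<close>

lemma BB_mult:
 assumes v: "v : carrier PL" and w: "w : carrier PL"
 shows "BB v @@ BB w = scl (coPL (v, w)) (BB (v *[PL] w))"
proof -
 obtain u x where v': "v = (u, x)" "u : carrier P" "x : autL S" using v by (auto simp: semidirect_def L_carrier)
 obtain t y where w': "w = (t, y)" "t : carrier P" "y : autL S" using w by (auto simp: semidirect_def L_carrier)
 note hx = L_from_H[OF v'(3)] and hy = L_from_H[OF w'(3)]
 have xy: "x *[LL] y : autL S" using L.m_closed[of x y] v'(3) w'(3) by (simp add: L_carrier)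
 note hxy = L_from_H[OF xy]
 define z where "z = hat S x *[H] hat S y *[H] inv[H] hat S (x *[LL] y)"
 have zH: "z : Hc" using hx(1) hy(1) hxy(1) by (simp add: z_def)
 have "actH S z = (x *[LL] y) *[LL] inv[LL] (x *[LL] y)"
  unfolding z_def using hx hy hxy by (simp add: act.hom_mult act.hom_inv)
 also have "... = #1[LL]" using xy by (simp add: L_carrier)
 finally have z: "z : subZ S" using zH by (simp add: subZ_def kernel_def)
 have h: "hat S x *[H] hat S y = z *[H] hat S (x *[LL] y)" using hx(1) hy(1) hxy(1) by (simp add: z_def H.m_assoc)
 have xt: "x t : carrier P" using G.act_in[OF hx(1) w'(2)] hx(2) by simp
 have "BB v @@ BB w = delta (u, hat S x) @@ (delta (t, hat S y) @@ (eZ @@ eZ))"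
  unfolding BB_def v'(1) w'(1) fst_conv snd_conv G.R.assoc
  using eZ_central[OF w'(2) hy(1)] by (simp flip: G.R.assoc)
 also have "... = (delta (u, hat S x) @@ delta (t, hat S y)) @@ eZ" by (simp add: eZ_idem G.R.assoc)
 also have "delta (u, hat S x) @@ delta (t, hat S y) = delta (u *[P] x t, z *[H] hat S (x *[LL] y))"
  using v'(2) w'(2) hx hy h by (subst G.R.mul_delta) (simp_all add: semidirect_def)
 also have "... @@ eZ = scl (chi S z) (delta (u *[P] x t, hat S (x *[LL] y)) @@ eZ)"
  using v'(2) xt hxy(1) z by (intro delta_eZ) auto
 also have "chi S z = coPL (v, w)"
  unfolding z_def using coc_chi[OF v'(3) w'(3)] by (simp add: coPL_def v'(1) w'(1))
 finally show ?thesis by (simp add: BB_def v'(1) w'(1) semidirect_def)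
qed

definition FF :: "('p \<times> ('p => 'p) => 'k) => 'p \<times> 'h => 'k" where
 "FF b = (SUM v:carrier PL. scl (b v) (BB v))"

lemma BB_in: "v : carrier PL ==> BB v : Ec"
proof -
 assume "v : carrier PL"
 hence v: "fst v : carrier P" "hat S (snd v) : Hc" using L_from_H by (auto simp: semidirect_def L_carrier)
 have d: "delta (fst v, hat S (snd v)) : Gc" using v by (intro G.R.delta_in) (simp add: semidirect_def)
 have "eZ @@ BB v = (eZ @@ delta (fst v, hat S (snd v))) @@ eZ" by (simp add: BB_def G.R.assoc)
 also have "... = BB v" unfolding eZ_central[OF v] by (simp add: BB_def G.R.assoc eZ_idem)
 finally show ?thesis using G.R.mul_closed[OF d eZ_in] by (simp add: kGe_carrier BB_def G.R.assoc eZ_idem)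
qed

lemma FF_linear: "FF (f + g) = FF f + FF g" "FF (scl c f) = scl c (FF f)"
 by (simp_all add: FF_def pointwise fv.scale_left_distrib sum.distrib fv.scale_sum_right)

lemma FF_delta: "v : carrier PL ==> FF (delta v) = BB v"
proof -
 assume v: "v : carrier PL"
 have "FF (delta v) = (SUM w:carrier PL. if w = v then BB v else 0)"
  unfolding FF_def by (intro sum.cong refl) (auto simp: delta_apply)
 thus ?thesis using v TW.fin by simp
qed

lemma FF_sum: "FF (SUM i:I. f i) = (SUM i:I. FF (f i))"
proof -
 have "FF 0 = 0" using FF_linear(2)[of 0 0] by simp
 thus ?thesis using sum_comp_morphism[of FF f I] by (simp add: FF_linear(1) o_def)
qed

text \<open>Two chosen lifts in one coset of Z coincide, so evaluation at the lifts is dual to these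
  elements up to 1/|Z|. This makes \<open>FF\<close> injective.\<close>

lemma BB_apply:
 assumes v: "v : carrier PL" and w: "w : carrier PL"
 shows "BB v (fst w, hat S (snd w)) = (if v = w then inverse (of_nat (card (subZ S))) else 0)"
proof -
 obtain u x where v': "v = (u, x)" "u : carrier P" "x : autL S" using v by (auto simp: semidirect_def L_carrier)
 obtain t y where w': "w = (t, y)" "t : carrier P" "y : autL S" using w by (auto simp: semidirect_def L_carrier)
 note hx = L_from_H[OF v'(3)] and hy = L_from_H[OF w'(3)]
 have fZ: "finite (subZ S)" using H_finite Z_carrier by (meson finite_subset subsetI)
 have "BB v = scl (inverse (of_nat (card (subZ S)))) (SUM z:subZ S. scl (chi S (inv[H] z)) (delta (u, hat S x *[H] z)))"
 proof -
  have "delta (u, hat S x) @@ G.br z = delta (u, hat S x *[H] z)" if "z : subZ S" for z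
   using v'(2) hx(1) Z_carrier[OF that] G.act_1[OF hx(1)] by (subst G.R.mul_delta) (simp_all add: semidirect_def)
  thus ?thesis unfolding BB_def v'(1) fst_conv snd_conv eZ_eq by (simp add: G.R.distribs)
 qed
 hence "BB v (t, hat S y) = inverse (of_nat (card (subZ S))) *
  (SUM z:subZ S. chi S (inv[H] z) * delta (u, hat S x *[H] z) (t, hat S y))"
  by (simp add: pointwise sum_apply)
 also have "(SUM z:subZ S. chi S (inv[H] z) * delta (u, hat S x *[H] z) (t, hat S y)) =
  (SUM z:subZ S. if z = #1[H] then (if v = w then 1 else 0) else 0)"
 proof (rule sum.cong[OF refl])
  fix z assume z: "z : subZ S"
  have "hat S y = hat S x *[H] z \<longleftrightarrow> x = y & z = #1[H]"
  proof
   assume e: "hat S y = hat S x *[H] z"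
   have "actH S z = #1[LL]" using z by (simp add: subZ_def kernel_def)
   hence "actH S (hat S x *[H] z) = x"
    using act.hom_mult[OF hx(1) Z_carrier[OF z]] hx(2) v'(3) by (simp add: L_carrier)
   hence xy: "x = y" using hy(2) e by simp
   thus "x = y & z = #1[H]" using e hx(1) Z_carrier[OF z] by simp
  next
   assume "x = y & z = #1[H]"
   thus "hat S y = hat S x *[H] z" using hx(1) by simp
  qed
  thus "chi S (inv[H] z) * delta (u, hat S x *[H] z) (t, hat S y) = (if z = #1[H] then (if v = w then 1 else 0) else 0)"
   using H.lchar_one[OF lchar_Z subgroup.one_closed[OF sub_Z]] by (auto simp: delta_apply v'(1) w'(1))
 qed
 also have "... = (if v = w then 1 else 0)" using fZ subgroup.one_closed[OF sub_Z] by simp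
 finally show ?thesis by (simp add: w'(1))
qed

lemma FF_inj: "inj_on FF (carrier (k_alpha_PL S))"
proof (rule inj_onI)
 fix f g assume f: "f : carrier (k_alpha_PL S)" and g: "g : carrier (k_alpha_PL S)" and e: "FF f = FF g"
 have val: "FF b (fst w, hat S (snd w)) = b w * inverse (of_nat (card (subZ S)))" if w: "w : carrier PL" for b w
 proof -
  have "FF b (fst w, hat S (snd w)) = (SUM v:carrier PL. if v = w then b w * inverse (of_nat (card (subZ S))) else 0)"
   unfolding FF_def sum_apply by (intro sum.cong refl) (auto simp: scl_apply BB_apply w)
  thus ?thesis using w TW.fin by simp
 qed
 show "f = g"
 proof
  fix w
  show "f w = g w"
  proof (cases "w : carrier PL")
   case True
   thus ?thesis using val[OF True, of f] val[OF True, of g] e card_nz[OF sub_Z] by simp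
  next
   case False
   hence "f w = 0" "g w = 0" using f g unfolding k_alpha_eq TW.carrier_kT by blast+
   thus ?thesis by simp
  qed
 qed
qed

lemma FF_mult:
 assumes f: "f : carrier (k_alpha_PL S)" and g: "g : carrier (k_alpha_PL S)"
 shows "FF (f *[k_alpha_PL S] g) = FF f @@ FF g"
proof -
 have "FF (f *[k_alpha_PL S] g) = (SUM v:carrier PL. SUM w:carrier PL. scl (coPL (v, w) * (f v * g w)) (FF (delta (v *[PL] w))))"
  unfolding k_alpha_eq TW.mult_kT FF_sum FF_linear(2) ..
 also have "... = (SUM v:carrier PL. SUM w:carrier PL. scl (f v) (scl (g w) (BB v @@ BB w)))"
  by (intro sum.cong refl) (simp add: BB_mult FF_delta TW.m_closed ac_simps)
 also have "... = (SUM w:carrier PL. SUM v:carrier PL. scl (f v) (scl (g w) (BB v @@ BB w)))" by (rule sum.swap)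
 also have "... = FF f @@ FF g" unfolding FF_def G.R.distribs by (simp add: fv.scale_sum_right ac_simps)
 finally show ?thesis .
qed

text \<open>The lift of 1 may be a nontrivial element z of Z. Then the cocycle at (1, 1) is
  \<open>chi S z\<close>, which cancels the inverse factor in the unit of the twisted group
  algebra.\<close>

lemma FF_one: "FF #1[k_alpha_PL S] = eZ"
proof -
 let ?o = "#1[k_alpha_PL S]"
 have kA: "k_alpha_PL S = twisted_group_algebra PL coPL" by (rule k_alpha_eq)
 have o: "?o = scl (inverse (coPL (#1[PL], #1[PL]))) (delta #1[PL])" unfolding kA by (rule TW.one_kT)
 have "#1[LL] : autL S" using L.one_closed by (simp add: L_carrier)
 note h1 = L_from_H[OF this]
 have z: "hat S #1[LL] : subZ S" using h1 by (simp add: subZ_def kernel_def)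
 have "coc S (#1[LL], #1[LL]) = chi S (hat S #1[LL])"
  using coc_chi[of "#1[LL]" "#1[LL]"] h1(1) L.one_closed by (simp add: L_carrier H.m_assoc)
 moreover have "BB #1[PL] = scl (chi S (hat S #1[LL])) eZ"
  using delta_eZ[of "#1[P]" "#1[H]" "hat S #1[LL]"] z h1(1) kP.one_closed
  by (simp add: BB_def semidirect_def G.one_br[symmetric] G.R.one_l eZ_in monoid.one_closed[OF group.is_monoid[OF P_group]])
 ultimately show ?thesis
  unfolding o FF_linear(2) FF_delta[OF TW.one_closed]
  using lchar_nz[OF lchar_Z z] by (simp add: coPL_def semidirect_def)
qed

lemma FF_surj: "FF ` carrier (k_alpha_PL S) = Ec"
proof
 show "FF ` carrier (k_alpha_PL S) <= Ec"
  unfolding FF_def using BB_in by (auto intro!: Ge.closed)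
 show "Ec <= FF ` carrier (k_alpha_PL S)"
 proof
  fix y assume "y : Ec"
  hence y: "y : Gc" "y @@ eZ = y" by (simp_all add: kGe_carrier)
  have sub: "fv.subspace (FF ` carrier (k_alpha_PL S))"
   unfolding fv.subspace_def
  proof (intro conjI ballI allI)
   have s: "fv.subspace (carrier (k_alpha_PL S))" unfolding k_alpha_eq by (rule TW.kT.sub_A)
   show "0 : FF ` carrier (k_alpha_PL S)"
    using fv.subspace_0[OF s] FF_sum[of "%_. 0" "{}"] by force
   fix a b assume "a : FF ` carrier (k_alpha_PL S)"
   then obtain a' where a: "a = FF a'" "a' : carrier (k_alpha_PL S)" by blast
   show "scl c a : FF ` carrier (k_alpha_PL S)" for c
    unfolding a(1) FF_linear(2)[symmetric] using fv.subspace_scale[OF s a(2)] by (rule imageI)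
   assume "b : FF ` carrier (k_alpha_PL S)"
   then obtain b' where b: "b = FF b'" "b' : carrier (k_alpha_PL S)" by blast
   show "a + b : FF ` carrier (k_alpha_PL S)"
    unfolding a(1) b(1) FF_linear(1)[symmetric] using fv.subspace_add[OF s a(2) b(2)] by (rule imageI)
  qed
  have g: "delta (u, h) @@ eZ : FF ` carrier (k_alpha_PL S)" if u: "u : carrier P" and h: "h : Hc" for u h
  proof -
   define x where "x = actH S h"
   have x: "x : autL S" unfolding x_def by (rule act_autL[OF h])
   note hx = L_from_H[OF x]
   define z where "z = h *[H] inv[H] hat S x"
   have zH: "z : Hc" using h hx(1) by (simp add: z_def)
   have "actH S z = x *[LL] inv[LL] x"
    unfolding z_def using h hx by (simp add: act.hom_mult act.hom_inv x_def)
   hence z: "z : subZ S" using zH x by (simp add: subZ_def kernel_def L_carrier)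
   have "h = z *[H] hat S x" using h hx(1) by (simp add: z_def H.m_assoc)
   hence "delta (u, h) @@ eZ = scl (chi S z) (delta (u, hat S x) @@ eZ)" using delta_eZ[OF u hx(1) z] by simp
   also have "delta (u, hat S x) @@ eZ = FF (delta (u, x))"
    using FF_delta[of "(u, x)"] u x by (simp add: BB_def semidirect_def L_carrier)
   finally have e: "delta (u, h) @@ eZ = scl (chi S z) (FF (delta (u, x)))" .
   have "delta (u, x) : carrier (k_alpha_PL S)" unfolding k_alpha_eq
    using u x by (intro TW.delta_in) (simp add: semidirect_def L_carrier)
   thus ?thesis unfolding e by (intro fv.subspace_scale[OF sub] imageI)
  qed
  have "y = (SUM v:carrier (semidirect P H (actH S)). scl (y v) (delta v @@ eZ))"
  proof -
   have "y @@ eZ = (SUM v:carrier (semidirect P H (actH S)). scl (y v) (delta v)) @@ eZ"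
    by (subst G.R.expand[OF y(1)]) (rule refl)
   thus ?thesis unfolding y(2) by (simp only: G.R.distribs)
  qed
  also have "... : FF ` carrier (k_alpha_PL S)"
   using g by (intro fv.subspace_sum[OF sub] fv.subspace_scale[OF sub]) (auto simp: semidirect_def)
  finally show "y : FF ` carrier (k_alpha_PL S)" .
 qed
qed

lemma k_alpha_alg: "fun_alg (k_alpha_PL S)"
 unfolding k_alpha_eq by (rule TW.kT.fun_alg_axioms)

lemma kGe_k_alpha: "alg_isomorphic (kGe S) (k_alpha_PL S)"
proof -
 interpret K: fun_alg "k_alpha_PL S" by (rule k_alpha_alg)
 have "FF : alg_iso (k_alpha_PL S) (kGe S)"
 proof (rule alg_isoI[where g = "the_inv_into (carrier (k_alpha_PL S)) FF"])
  show "FF x : Ec" if "x : carrier (k_alpha_PL S)" for x using FF_surj that by blast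
  show "the_inv_into (carrier (k_alpha_PL S)) FF y : carrier (k_alpha_PL S)" if "y : Ec" for y
   using the_inv_into_into[OF FF_inj, of y] that FF_surj by blast
  show "the_inv_into (carrier (k_alpha_PL S)) FF (FF x) = x" if "x : carrier (k_alpha_PL S)" for x
   by (rule the_inv_into_f_f[OF FF_inj that])
  show "FF (the_inv_into (carrier (k_alpha_PL S)) FF y) = y" if "y : Ec" for y
   by (rule f_the_inv_into_f[OF FF_inj]) (use that FF_surj in blast)
 qed (simp_all add: FF_mult FF_linear FF_one K.add_A Ge.add_A K.smult_A Ge.smult_A)
 thus ?thesis using alg_isomorphic_sym K.k_algebra_A by (auto simp: alg_isomorphic_def)
qed

end

theorem theorem1p1:
  fixes S :: "('p, 'h, 'k::alg_closed_field) block_data"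
  assumes "block_setting S"
  shows "alg_isomorphic (kGe S) (k_alpha_PL S) \<and>
    basic_algebra_of (frakA S) (k_alpha_PL S) \<and>
    (\<forall>B :: ('k, 'b) module. basic_algebra_of B (k_alpha_PL S) \<longrightarrow>
       alg_isomorphic B (frakA S) \<and> (\<exists>m\<ge>1. alg_isomorphic (k_alpha_PL S) (mat_alg m B))) \<and>
    presented_by S (quantum_scalars S) (frakA S) (ePhi S) (wPhi S) \<and>
    presented_by S classical_scalars (kPM S) (ePhiM S) (wPhiM S)"
proof (intro conjI allI impI)
 interpret block_setting S by fact
 interpret K: fun_alg "k_alpha_PL S" by (rule k_alpha_alg)
 interpret Af: fun_alg "frakA S" by (rule frakA_alg)
 interpret classical_setting S by unfold_locales
 show iso: "alg_isomorphic (kGe S) (k_alpha_PL S)" by (rule kGe_k_alpha)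
 then obtain f where f: "f : alg_iso (kGe S) (k_alpha_PL S)" by (auto simp: alg_isomorphic_def)
 obtain I m where I: "basic_set (kGe S) I" and AI: "alg_isomorphic (frakA S) (corner_alg (kGe S) (\<Oplus>\<^bsub>kGe S\<^esub>i\<in>I. i))"
  and m: "m >= 1" "alg_isomorphic (kGe S) (mat_alg m (corner_alg (kGe S) (\<Oplus>\<^bsub>kGe S\<^esub>i\<in>I. i)))"
  and cA: "k_algebra (corner_alg (kGe S) (\<Oplus>\<^bsub>kGe S\<^esub>i\<in>I. i))"
  using morita_equivalence by blast
 let ?c = "corner_alg (kGe S) (\<Oplus>\<^bsub>kGe S\<^esub>i\<in>I. i)" and ?d = "corner_alg (k_alpha_PL S) (\<Oplus>\<^bsub>k_alpha_PL S\<^esub>i\<in>f ` I. i)"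
 note J = basic_set_iso[OF f Ge.k_algebra_A K.k_algebra_A I]
 have Ad: "alg_isomorphic (frakA S) ?d" by (rule alg_isomorphic_trans[OF AI J(2)])
 show "basic_algebra_of (frakA S) (k_alpha_PL S)"
  unfolding basic_algebra_of_set using Af.k_algebra_A J(1) Ad by blast
 show "presented_by S (quantum_scalars S) (frakA S) (ePhi S) (wPhi S)" by (rule quantum_presentation)
 show "presented_by S classical_scalars (kPM S) (ePhiM S) (wPhiM S)" by (rule classical_presentation)
 fix B :: "('k, 'b) module" assume "basic_algebra_of B (k_alpha_PL S)"
 then obtain I' where B: "k_algebra B" and I': "basic_set (k_alpha_PL S) I'"
  and BI': "alg_isomorphic B (corner_alg (k_alpha_PL S) (\<Oplus>\<^bsub>k_alpha_PL S\<^esub>i\<in>I'. i))"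
  unfolding basic_algebra_of_set by blast
 have Bd: "alg_isomorphic B ?d" by (rule alg_isomorphic_trans[OF BI' K.basic_set_unique[OF I' J(1)]])
 show BA: "alg_isomorphic B (frakA S)"
  by (rule alg_isomorphic_trans[OF Bd alg_isomorphic_sym[OF Ad Af.k_algebra_A]])
 \<comment> \<open>The matrix decomposition is available over the corner \<open>?c\<close> of kGe;
   along this isomorphism \<open>mat_alg_iso\<close> replaces \<open>?c\<close> by
   \<open>B\<close>.\<close>
 have Bc: "alg_isomorphic ?c B"
  by (rule alg_isomorphic_trans[OF alg_isomorphic_sym[OF AI Af.k_algebra_A] alg_isomorphic_sym[OF BA B]])
 then obtain g where g: "g : alg_iso ?c B" by (auto simp: alg_isomorphic_def)
 have "alg_isomorphic (k_alpha_PL S) (mat_alg m B)"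
  by (rule alg_isomorphic_trans[OF alg_isomorphic_trans[OF alg_isomorphic_sym[OF iso Ge.k_algebra_A] m(2)] mat_alg_iso[OF g cA B]])
 thus "\<exists>m\<ge>1. alg_isomorphic (k_alpha_PL S) (mat_alg m B)" using m(1) by blast
qed

end
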